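(* Let $d\in\{2,3\}$, let $Q=\prod_{i=1}^d(0,\ell_i)$ be a rectangle or box, and consider the wave equation $\partial_t^2u=c(\varepsilon t)^2\Delta u+a(\varepsilon t)u^3$ for $x\in Q$, $t\ge0$, with homogeneous Dirichlet boundary conditions $u=0$ on $\partial Q$ and with initial values satisfying $\|\nabla_xu(\cdot,0)\|\le C_0\varepsilon$ and $\|\partial_tu(\cdot,0)\|\le C_0\varepsilon$, where $C_0$ is independent of $\varepsilon$. Fix an integer $N\ge1$ arbitrarily. Then there exist $\varepsilon_N>0$, $\kappa_N>0$ and constants $C_N,C_N'$ such that for all $0<\varepsilon\le\varepsilon_N$ the problem admits a solution $(u(\cdot,t),\partial_tu(\cdot,t))\in H^1_0(Q)\times L_2(Q)$ over times $0\le t\le\kappa_N\varepsilon^{-3+1/N}$, and $$|I(t)-I(0)|\le C_N\varepsilon^3+C_N'\,t\,\varepsilon^{5-1/N}\quad\text{for }0\le t\le\kappa_N\varepsilon^{-3+1/N},$$ where $$I(t)=\frac1{2c(\varepsilon t)}\Bigl(\|\partial_tu(\cdot,t)\|^2+c(\varepsilon t)^2\|\nabla_xu(\cdot,t)\|^2\Bigr),$$ and $C_N,C_N'$ are independent of $\varepsilon\le\varepsilon_N$ and $t\le\kappa_N\varepsilon^{-3+1/N}$.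
   Context: $\|\cdot\|$ is the $L_2(Q)$ or $L_2(Q)^d$ norm. The functions $c,a:[0,\infty)\to\mathbb R$ are smooth and bounded together with all their derivatives, and $c(\tau)\ge c_0>0$ for all $\tau\ge0$. The functions $c$, $a$ do not depend on $\varepsilon$; the (real-valued) initial data may depend on $\varepsilon$. *)

theory Defs
  imports "HOL-Analysis.Analysis"
begin

section \<open>Smooth functions\<close>

text \<open>At the endpoint 0 the derivatives are one-sided.\<close>

definition smooth_bounded_halfline :: "(real \<Rightarrow> real) \<Rightarrow> bool" where
  "smooth_bounded_halfline f \<longleftrightarrow>
     (\<exists>D :: nat \<Rightarrow> real \<Rightarrow> real.
        (\<forall>\<tau>\<ge>0. D 0 \<tau> = f \<tau>) \<and>
        (\<forall>k. \<forall>\<tau>\<ge>0. (D k has_real_derivative D (Suc k) \<tau>) (at \<tau> within {0..})) \<and>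
        (\<forall>k. bounded (D k ` {0..})))"

definition partial_deriv :: "'n::finite \<Rightarrow> (real^'n \<Rightarrow> real) \<Rightarrow> real^'n \<Rightarrow> real" where
  "partial_deriv i f x = frechet_derivative f (at x) (axis i 1)"

primrec C_k :: "nat \<Rightarrow> (real^'n::finite \<Rightarrow> real) \<Rightarrow> bool" where
  "C_k 0 f \<longleftrightarrow> continuous_on UNIV f"
| "C_k (Suc k) f \<longleftrightarrow> (\<forall>x. f differentiable (at x)) \<and> (\<forall>i. C_k k (partial_deriv i f))"

definition test_functions :: "(real^'n::finite) set \<Rightarrow> (real^'n \<Rightarrow> real) set" where
  "test_functions Q =
     {\<phi>. (\<forall>k. C_k k \<phi>) \<and> compact (closure {x. \<phi> x \<noteq> 0}) \<and> closure {x. \<phi> x \<noteq> 0} \<subseteq> Q}"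


section \<open>Lebesgue and Sobolev spaces\<close>

text \<open>
  Elements of the function spaces are represented by functions on the whole space, of which
  only the values on \<open>Q\<close> matter, up to null sets. The type \<open>'b\<close> is
  \<^typ>\<open>real\<close> for functions and \<open>real^'n\<close> for gradients.
\<close>

definition L2_space :: "(real^'n::finite) set \<Rightarrow> (real^'n \<Rightarrow> 'b::euclidean_space) set" where
  "L2_space Q = {f. f \<in> borel_measurable (lebesgue_on Q) \<and>
                    integrable (lebesgue_on Q) (\<lambda>x. (norm (f x))\<^sup>2)}"

definition L2_inner ::
    "(real^'n::finite) set \<Rightarrow> (real^'n \<Rightarrow> 'b::euclidean_space) \<Rightarrow> (real^'n \<Rightarrow> 'b) \<Rightarrow> real" where
  "L2_inner Q f g = (LINT x|lebesgue_on Q. f x \<bullet> g x)"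

definition L2_norm :: "(real^'n::finite) set \<Rightarrow> (real^'n \<Rightarrow> 'b::euclidean_space) \<Rightarrow> real" where
  "L2_norm Q f = sqrt (LINT x|lebesgue_on Q. (norm (f x))\<^sup>2)"

definition is_weak_gradient ::
    "(real^'n::finite) set \<Rightarrow> (real^'n \<Rightarrow> real) \<Rightarrow> (real^'n \<Rightarrow> real^'n) \<Rightarrow> bool" where
  "is_weak_gradient Q f g \<longleftrightarrow>
     (\<forall>\<phi>\<in>test_functions Q. \<forall>i.
        (LINT x|lebesgue_on Q. f x * partial_deriv i \<phi> x) =
        - (LINT x|lebesgue_on Q. g x $ i * \<phi> x))"

definition H1_space :: "(real^'n::finite) set \<Rightarrow> (real^'n \<Rightarrow> real) set" where
  "H1_space Q = {f \<in> L2_space Q. \<exists>g\<in>L2_space Q. is_weak_gradient Q f g}"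

text \<open>The gradient of a function in \<open>H1_space Q\<close> is determined up to null sets.\<close>

definition weak_grad :: "(real^'n::finite) set \<Rightarrow> (real^'n \<Rightarrow> real) \<Rightarrow> real^'n \<Rightarrow> real^'n" where
  "weak_grad Q f = (SOME g. g \<in> L2_space Q \<and> is_weak_gradient Q f g)"

definition H1_norm :: "(real^'n::finite) set \<Rightarrow> (real^'n \<Rightarrow> real) \<Rightarrow> real" where
  "H1_norm Q f = sqrt ((L2_norm Q f)\<^sup>2 + (L2_norm Q (weak_grad Q f))\<^sup>2)"

definition H10_space :: "(real^'n::finite) set \<Rightarrow> (real^'n \<Rightarrow> real) set" where
  "H10_space Q =
     {f \<in> H1_space Q. \<exists>\<phi> :: nat \<Rightarrow> real^'n \<Rightarrow> real. (\<forall>n. \<phi> n \<in> test_functions Q) \<and>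
        (\<lambda>n. H1_norm Q (\<lambda>x. \<phi> n x - f x)) \<longlonglongrightarrow> 0}"


section \<open>The nonlinear wave equation\<close>

text \<open>
  The pair \<open>(u, v)\<close> belongs to \<open>C([0,T], H\<^sup>1\<^sub>0(Q) \<times> L\<^sub>2(Q))\<close>, the function \<open>v\<close> is the time
  derivative of \<open>u\<close> in \<open>L\<^sub>2(Q)\<close>, and the equation for the time derivative of \<open>v\<close> is tested against
  \<open>H\<^sup>1\<^sub>0(Q)\<close>. The Dirichlet condition is the membership of \<open>u t\<close> in \<open>H\<^sup>1\<^sub>0(Q)\<close>. That the
  cube of \<open>u t\<close> is in \<open>L\<^sub>2(Q)\<close> ensures that the integral of the nonlinear term converges;
  in dimension at most 3 it also follows from the Sobolev embedding into \<open>L\<^sub>6(Q)\<close>.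
\<close>

definition wave_solution ::
    "(real^'n::finite) set \<Rightarrow> (real \<Rightarrow> real) \<Rightarrow> (real \<Rightarrow> real) \<Rightarrow> real \<Rightarrow> real
      \<Rightarrow> (real^'n \<Rightarrow> real) \<Rightarrow> (real^'n \<Rightarrow> real)
      \<Rightarrow> (real \<Rightarrow> real^'n \<Rightarrow> real) \<Rightarrow> (real \<Rightarrow> real^'n \<Rightarrow> real) \<Rightarrow> bool" where
  "wave_solution Q c a \<epsilon> T u0 v0 u v \<longleftrightarrow>
     (AE x in lebesgue_on Q. u 0 x = u0 x) \<and>
     (AE x in lebesgue_on Q. v 0 x = v0 x) \<and>
     (\<forall>t\<in>{0..T}.
        u t \<in> H10_space Q \<and> v t \<in> L2_space Q \<and> (\<lambda>x. u t x ^ 3) \<in> L2_space Q \<and>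
        ((\<lambda>s. H1_norm Q (\<lambda>x. u s x - u t x)) \<longlongrightarrow> 0) (at t within {0..T}) \<and>
        ((\<lambda>s. L2_norm Q (\<lambda>x. v s x - v t x)) \<longlongrightarrow> 0) (at t within {0..T}) \<and>
        ((\<lambda>s. L2_norm Q (\<lambda>x. (u s x - u t x) / (s - t) - v t x)) \<longlongrightarrow> 0) (at t within {0..T}) \<and>
        (\<forall>\<phi>\<in>H10_space Q.
           ((\<lambda>s. L2_inner Q (v s) \<phi>) has_real_derivative
              - (c (\<epsilon> * t))\<^sup>2 * L2_inner Q (weak_grad Q (u t)) (weak_grad Q \<phi>)
              + a (\<epsilon> * t) * L2_inner Q (\<lambda>x. u t x ^ 3) \<phi>)
           (at t within {0..T})))"

definition adiabatic_invariant ::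
    "(real^'n::finite) set \<Rightarrow> (real \<Rightarrow> real) \<Rightarrow> real
      \<Rightarrow> (real \<Rightarrow> real^'n \<Rightarrow> real) \<Rightarrow> (real \<Rightarrow> real^'n \<Rightarrow> real) \<Rightarrow> real \<Rightarrow> real" where
  "adiabatic_invariant Q c \<epsilon> u v t =
     1 / (2 * c (\<epsilon> * t)) *
       ((L2_norm Q (v t))\<^sup>2 + (c (\<epsilon> * t))\<^sup>2 * (L2_norm Q (weak_grad Q (u t)))\<^sup>2)"

end

theory Submission
  imports Defs "HOL-Real_Asymp.Real_Asymp"
begin

text \<open>
  A function is represented by its coefficients in the eigenfunctions of the Dirichlet Laplacian,
  which are products of sines. In dimension at most 3 the Sobolev embedding into \<open>L\<^sub>6\<close> makes the
  cube a bounded trilinear map from \<open>H\<^sup>1\<^sub>0\<close> to \<open>L\<^sub>2\<close>. After passing to a rotating frame, which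
  removes the unbounded part of the equation, and truncating the nonlinearity, the equation becomes
  an ordinary differential equation in \<open>\<ell>\<^sub>2\<close> with a globally Lipschitz right-hand side, so that it
  has a global solution.

  On a solution of size \<open>\<epsilon>\<close> the derivative of \<open>I\<close> is of order \<open>\<epsilon>\<^sup>3\<close>. A correction of \<open>I\<close> by
  \<open>O(\<epsilon>\<^sup>3)\<close> lowers this to \<open>O(\<epsilon>\<^sup>5)\<close>. By continuity the solution then remains of size \<open>\<epsilon>\<close>, and
  thus untouched by the truncation, as long as \<open>t \<epsilon>\<^sup>3\<close> is small. This already gives the estimate for all
  \<open>N\<close>, since \<open>\<epsilon>\<^bsup>1/N\<^esup> \<le> 1\<close>.
\<close>

section \<open>Square-summable families\<close>

text \<open>The obstacle is regularity in time. For data of finite energy, \<open>p\<close> and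
  \<open>q\<close> are only continuous in \<open>\<ell>\<^sub>2\<close>; their time derivatives
  exist after division by \<open>\<omega>\<close>, that is, after applying \<open>D\<close>. Hence
  no term may be differentiated by a product rule for \<open>p\<close> and \<open>q\<close>
  themselves. Three devices replace it: the energy is the squared norm of the unknown in the
  rotating frame, which is differentiable; the pairing of \<open>u\<close> with \<open>q\<close> is
  differentiated after moving \<open>D\<close> from one factor to the other; and the symmetry of the
  trilinear map turns a difference of values of \<open>quartic\<close> into a pairing with a
  difference of \<open>D w\<close>.

  The orders come from a simple count: every factor of the solution contributes \<epsilon>, and so
  does every time derivative of a coefficient. The largest correction is \<epsilon> times a
  quadratic term, hence of order 3. What remains in the derivative is \<epsilon> times a quartic
  term and the cube of \<epsilon> times a quadratic term, both of order 5.\<close>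

typedef 'i ell2 = "{f :: 'i \<Rightarrow> real. (\<lambda>i. (f i)\<^sup>2) summable_on UNIV}"
  morphisms coord Abs_ell2
  by (rule exI[of _ "\<lambda>_. 0"]) simp

setup_lifting type_definition_ell2

lemma summable_coord_sq: "(\<lambda>i. (coord x i)\<^sup>2) summable_on UNIV"
  using coord[of x] by simp

lemma ell2_eqI: "(\<And>i. coord x i = coord y i) \<Longrightarrow> x = y"
  by (simp add: coord_inject[symmetric] fun_eq_iff)

lemma summable_on_prod:
  fixes f g :: "'i \<Rightarrow> real"
  assumes "(\<lambda>i. (f i)\<^sup>2) summable_on A" "(\<lambda>i. (g i)\<^sup>2) summable_on A"
  shows "(\<lambda>i. f i * g i) summable_on A"
proof -
  have "(\<lambda>i. norm (f i * g i)) summable_on A"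
  proof (rule summable_on_comparison_test[OF summable_on_add[OF assms]])
    fix i
    have "2 * \<bar>f i\<bar> * \<bar>g i\<bar> \<le> \<bar>f i\<bar>\<^sup>2 + \<bar>g i\<bar>\<^sup>2"
      by (rule sum_squares_bound)
    moreover have "0 \<le> \<bar>f i\<bar> * \<bar>g i\<bar>"
      by simp
    ultimately have "\<bar>f i\<bar> * \<bar>g i\<bar> \<le> (f i)\<^sup>2 + (g i)\<^sup>2"
      unfolding power2_abs by linarith
    then show "norm (f i * g i) \<le> (f i)\<^sup>2 + (g i)\<^sup>2"
      unfolding real_norm_def abs_mult .
  qed simp
  then show ?thesis
    by (rule abs_summable_summable)
qed

lemma summable_on_sum_sq:
  fixes f g :: "'i \<Rightarrow> real"
  assumes "(\<lambda>i. (f i)\<^sup>2) summable_on A" "(\<lambda>i. (g i)\<^sup>2) summable_on A"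
  shows "(\<lambda>i. (f i + g i)\<^sup>2) summable_on A"
proof -
  have "(\<lambda>i. (f i)\<^sup>2 + (g i)\<^sup>2 + 2 * (f i * g i)) summable_on A"
    by (intro summable_on_add assms summable_on_cmult_right summable_on_prod)
  then show ?thesis
    by (simp add: power2_sum mult.assoc)
qed

instantiation ell2 :: (type) real_vector
begin
lift_definition zero_ell2 :: "'a ell2" is "\<lambda>_. 0" by simp
lift_definition plus_ell2 :: "'a ell2 \<Rightarrow> 'a ell2 \<Rightarrow> 'a ell2" is "\<lambda>f g i. f i + g i"
  by (rule summable_on_sum_sq)
lift_definition uminus_ell2 :: "'a ell2 \<Rightarrow> 'a ell2" is "\<lambda>f i. - f i" by simp
lift_definition minus_ell2 :: "'a ell2 \<Rightarrow> 'a ell2 \<Rightarrow> 'a ell2" is "\<lambda>f g i. f i - g i"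
  using summable_on_sum_sq[of _ _ "\<lambda>i. - g i" for g] by fastforce
lift_definition scaleR_ell2 :: "real \<Rightarrow> 'a ell2 \<Rightarrow> 'a ell2" is "\<lambda>c f i. c * f i"
  by (auto simp: power_mult_distrib intro: summable_on_cmult_right)
instance
  by standard (transfer; auto simp: algebra_simps fun_eq_iff)+
end

lemma coord_simps [simp]:
  "coord 0 i = 0"
  "coord (x + y) i = coord x i + coord y i"
  "coord (- x) i = - coord x i"
  "coord (x - y) i = coord x i - coord y i"
  "coord (r *\<^sub>R x) i = r * coord x i"
  by (transfer; simp)+

instantiation ell2 :: (type) real_inner
begin
definition inner_ell2 :: "'a ell2 \<Rightarrow> 'a ell2 \<Rightarrow> real" where
  "inner_ell2 x y = (\<Sum>\<^sub>\<infinity>i. coord x i * coord y i)"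
definition norm_ell2 :: "'a ell2 \<Rightarrow> real" where
  "norm_ell2 x = sqrt (inner x x)"
definition sgn_ell2 :: "'a ell2 \<Rightarrow> 'a ell2" where
  "sgn_ell2 x = x /\<^sub>R norm x"
definition dist_ell2 :: "'a ell2 \<Rightarrow> 'a ell2 \<Rightarrow> real" where
  "dist_ell2 x y = norm (x - y)"
definition uniformity_ell2 :: "('a ell2 \<times> 'a ell2) filter" where
  "uniformity_ell2 = (INF e\<in>{0<..}. principal {(x, y). dist x y < e})"
definition open_ell2 :: "'a ell2 set \<Rightarrow> bool" where
  "open_ell2 U = (\<forall>x\<in>U. eventually (\<lambda>(x', y). x' = x \<longrightarrow> y \<in> U) uniformity)"
instance
proof
  fix x y z :: "'a ell2" and r :: real
  have s: "(\<lambda>i. coord u i * coord v i) summable_on UNIV" for u v :: "'a ell2"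
    by (intro summable_on_prod summable_coord_sq)
  show "inner x y = inner y x"
    by (simp add: inner_ell2_def mult.commute)
  show "inner (x + y) z = inner x z + inner y z"
    by (simp add: inner_ell2_def distrib_right infsum_add s)
  show "inner (r *\<^sub>R x) y = r * inner x y"
    by (simp add: inner_ell2_def mult.assoc infsum_cmult_right')
  show "0 \<le> inner x x"
    by (simp add: inner_ell2_def infsum_nonneg)
  show "inner x x = 0 \<longleftrightarrow> x = 0"
  proof
    assume "inner x x = 0"
    then have "coord x i * coord x i = 0" for i
      using nonneg_infsum_le_0D[OF _ s[of x x], of i] by (auto simp: inner_ell2_def)
    then show "x = 0"
      by (intro ell2_eqI) simp
  qed (simp add: inner_ell2_def)
qed (simp_all add: norm_ell2_def sgn_ell2_def dist_ell2_def uniformity_ell2_def open_ell2_def)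
end

lemma inner_ell2_sums: "((\<lambda>i. coord x i * coord y i) has_sum inner x y) UNIV"
  unfolding inner_ell2_def by (intro has_sum_infsum summable_on_prod summable_coord_sq)

lemma norm_ell2_sq_sums: "((\<lambda>i. (coord x i)\<^sup>2) has_sum (norm x)\<^sup>2) UNIV"
  using inner_ell2_sums[of x x] by (simp add: power2_norm_eq_inner power2_eq_square[of "coord x _"])

lemma sum_coord_sq_le: "finite F \<Longrightarrow> (\<Sum>i\<in>F. (coord x i)\<^sup>2) \<le> (norm x)\<^sup>2"
  using finite_sum_le_has_sum[OF norm_ell2_sq_sums, of F] by simp

lemma norm_ell2_leI:
  assumes "\<And>F. finite F \<Longrightarrow> (\<Sum>i\<in>F. (coord x i)\<^sup>2) \<le> B\<^sup>2" "B \<ge> 0"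
  shows "norm x \<le> B"
proof -
  have "(norm x)\<^sup>2 = (\<Sum>\<^sub>\<infinity>i. (coord x i)\<^sup>2)"
    using norm_ell2_sq_sums infsumI by metis
  also have "\<dots> \<le> B\<^sup>2"
    by (intro infsum_le_finite_sums summable_coord_sq assms)
  finally show ?thesis
    using assms(2) by (rule power2_le_imp_le)
qed

lemma abs_coord_le: "\<bar>coord x i\<bar> \<le> norm x"
  using sum_coord_sq_le[of "{i}" x] abs_le_square_iff[of "coord x i" "norm x"] by simp

lemma bounded_linear_coord: "bounded_linear (\<lambda>x. coord x i)"
  by (rule bounded_linear_intro[of _ 1]) (auto simp: abs_coord_le)

text \<open>Bounds on finite sums are exactly what Bessel's inequality supplies, so this form serves
  the Fourier coefficients as well as the diagonal operators and the limit in the completeness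
  proof.\<close>

lemma Abs_ell2_bounded_sums:
  assumes "\<And>F. finite F \<Longrightarrow> (\<Sum>i\<in>F. (f i)\<^sup>2) \<le> B"
  shows "coord (Abs_ell2 f) = f"
proof (rule Abs_ell2_inverse)
  have "(\<lambda>i. (f i)\<^sup>2) summable_on UNIV"
    by (rule nonneg_bdd_above_summable_on) (auto intro!: bdd_aboveI2 assms)
  then show "f \<in> {f. (\<lambda>i. (f i)\<^sup>2) summable_on UNIV}"
    by simp
qed

instance ell2 :: (type) complete_space
proof
  fix X :: "nat \<Rightarrow> 'a ell2"
  assume X: "Cauchy X"
  have "Cauchy (\<lambda>n. coord (X n) i)" for i
    using bounded_linear.Cauchy[OF bounded_linear_coord X] .
  then have "\<exists>L. (\<lambda>n. coord (X n) i) \<longlonglongrightarrow> L" for i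
    by (simp add: Cauchy_convergent_iff convergent_def)
  then obtain L where L: "\<And>i. (\<lambda>n. coord (X n) i) \<longlonglongrightarrow> L i"
    by metis
  have bound: "\<exists>N. \<forall>n\<ge>N. \<forall>F. finite F \<longrightarrow> (\<Sum>i\<in>F. (coord (X n) i - L i)\<^sup>2) \<le> e\<^sup>2" if "e > 0" for e
  proof -
    obtain N where N: "\<And>m n. m \<ge> N \<Longrightarrow> n \<ge> N \<Longrightarrow> norm (X m - X n) < e"
      using X \<open>e > 0\<close> unfolding Cauchy_def dist_norm by blast
    have "(\<Sum>i\<in>F. (coord (X n) i - L i)\<^sup>2) \<le> e\<^sup>2" if "n \<ge> N" "finite F" for n F
    proof (rule tendsto_upperbound)
      show "(\<lambda>m. \<Sum>i\<in>F. (coord (X n) i - coord (X m) i)\<^sup>2) \<longlonglongrightarrow> (\<Sum>i\<in>F. (coord (X n) i - L i)\<^sup>2)"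
        by (intro tendsto_intros L)
      show "\<forall>\<^sub>F m in sequentially. (\<Sum>i\<in>F. (coord (X n) i - coord (X m) i)\<^sup>2) \<le> e\<^sup>2"
        unfolding eventually_sequentially
      proof (intro exI[of _ N] allI impI)
        fix m assume "m \<ge> N"
        have "(\<Sum>i\<in>F. (coord (X n - X m) i)\<^sup>2) \<le> (norm (X n - X m))\<^sup>2"
          by (rule sum_coord_sq_le) fact
        also have "\<dots> \<le> e\<^sup>2"
          using N[OF \<open>n \<ge> N\<close> \<open>m \<ge> N\<close>] by (intro power_mono) auto
        finally show "(\<Sum>i\<in>F. (coord (X n) i - coord (X m) i)\<^sup>2) \<le> e\<^sup>2"
          by simp
      qed
    qed simp
    then show ?thesis
      by blast
  qed
  obtain N where N: "\<And>F. finite F \<Longrightarrow> (\<Sum>i\<in>F. (coord (X N) i - L i)\<^sup>2) \<le> 1"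
    using bound[of 1] by auto
  \<comment> \<open>The coordinatewise limit \<open>L\<close> is not yet known to be
    square-summable, but its difference from \<open>X N\<close> is, by the bound just obtained.
    Subtracting that difference from \<open>X N\<close> gives \<open>L\<close> as an element of the
    space.\<close>
  define Y where "Y = X N - Abs_ell2 (\<lambda>i. coord (X N) i - L i)"
  have Y: "coord Y i = L i" for i
    by (simp add: Y_def Abs_ell2_bounded_sums[OF N])
  have "X \<longlonglongrightarrow> Y"
  proof (rule metric_LIMSEQ_I)
    fix r :: real
    assume "r > 0"
    then obtain N where N: "\<And>n F. n \<ge> N \<Longrightarrow> finite F \<Longrightarrow> (\<Sum>i\<in>F. (coord (X n) i - L i)\<^sup>2) \<le> (r/2)\<^sup>2"
      using bound[of "r/2"] by auto
    have "norm (X n - Y) \<le> r/2" if "n \<ge> N" for n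
      using N[OF that] \<open>r > 0\<close> by (intro norm_ell2_leI) (auto simp: Y)
    then show "\<exists>no. \<forall>n\<ge>no. dist (X n) Y < r"
      using \<open>r > 0\<close> by (intro exI[of _ N]) (force simp: dist_norm)
  qed
  then show "convergent X"
    by (auto simp: convergent_def)
qed

instance ell2 :: (type) banach ..

section \<open>Diagonal operators and coordinatewise calculus\<close>

text \<open>The multipliers that occur are \<open>1 / \<omega>\<close>, cosines and sines of a
  phase, and indicators of finite index sets. All are bounded, and a bound is what makes the
  coordinates of the result the expected ones.\<close>

definition diag :: "('i \<Rightarrow> real) \<Rightarrow> 'i ell2 \<Rightarrow> 'i ell2" where
  "diag m x = Abs_ell2 (\<lambda>i. m i * coord x i)"

lemma coord_diag:
  assumes "\<And>i. \<bar>m i\<bar> \<le> B"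
  shows "coord (diag m x) i = m i * coord x i"
proof -
  have "coord (Abs_ell2 (\<lambda>i. m i * coord x i)) = (\<lambda>i. m i * coord x i)"
  proof (rule Abs_ell2_bounded_sums)
    fix F :: "'a set" assume "finite F"
    have "(m i * coord x i)\<^sup>2 \<le> B\<^sup>2 * (coord x i)\<^sup>2" for i
      using assms[of i] by (auto simp: power_mult_distrib abs_le_square_iff[symmetric] intro!: mult_right_mono)
    then have "(\<Sum>i\<in>F. (m i * coord x i)\<^sup>2) \<le> (\<Sum>i\<in>F. B\<^sup>2 * (coord x i)\<^sup>2)"
      by (intro sum_mono)
    also have "\<dots> \<le> B\<^sup>2 * (norm x)\<^sup>2"
      using sum_coord_sq_le[OF \<open>finite F\<close>, of x] by (simp add: sum_distrib_left[symmetric] mult_left_mono)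
    finally show "(\<Sum>i\<in>F. (m i * coord x i)\<^sup>2) \<le> B\<^sup>2 * (norm x)\<^sup>2" .
  qed
  then show ?thesis
    by (simp add: diag_def)
qed

lemma norm_diag_le:
  assumes "\<And>i. \<bar>m i\<bar> \<le> B"
  shows "norm (diag m x) \<le> B * norm x"
proof (rule norm_ell2_leI)
  have "0 \<le> B"
    using assms[of undefined] by simp
  then show "0 \<le> B * norm x"
    by simp
  fix F :: "'a set" assume "finite F"
  have "(m i * coord x i)\<^sup>2 \<le> B\<^sup>2 * (coord x i)\<^sup>2" for i
    using assms[of i] \<open>0 \<le> B\<close> by (auto simp: power_mult_distrib abs_le_square_iff[symmetric] intro!: mult_right_mono)
  then have "(\<Sum>i\<in>F. (coord (diag m x) i)\<^sup>2) \<le> (\<Sum>i\<in>F. B\<^sup>2 * (coord x i)\<^sup>2)"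
    by (intro sum_mono) (simp add: coord_diag[OF assms])
  also have "\<dots> \<le> (B * norm x)\<^sup>2"
    using sum_coord_sq_le[OF \<open>finite F\<close>, of x]
    by (simp add: sum_distrib_left[symmetric] mult_left_mono power_mult_distrib)
  finally show "(\<Sum>i\<in>F. (coord (diag m x) i)\<^sup>2) \<le> (B * norm x)\<^sup>2" .
qed

lemma bounded_linear_diag:
  assumes "\<And>i. \<bar>m i\<bar> \<le> B"
  shows "bounded_linear (diag m)"
  by (rule bounded_linear_intro[of _ B])
    (auto intro!: ell2_eqI simp: coord_diag[OF assms] algebra_simps norm_diag_le[OF assms])

lemma inner_diag_commute:
  assumes "\<And>i. \<bar>m i\<bar> \<le> B"
  shows "inner (diag m x) y = inner x (diag m y)"
  by (simp add: inner_ell2_def coord_diag[OF assms] mult_ac)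

lemma ell2_finite_approx:
  fixes x :: "'i ell2"
  assumes "e > 0"
  shows "\<exists>F. finite F \<and> norm (x - diag (indicator F) x) < e"
proof -
  have "((\<lambda>F. \<Sum>i\<in>F. (coord x i)\<^sup>2) \<longlongrightarrow> (norm x)\<^sup>2) (finite_subsets_at_top UNIV)"
    using norm_ell2_sq_sums[of x] by (simp add: has_sum_def)
  then have "\<forall>\<^sub>F F in finite_subsets_at_top UNIV. (norm x)\<^sup>2 - (e/2)\<^sup>2 < (\<Sum>i\<in>F. (coord x i)\<^sup>2)"
    using assms by (intro order_tendstoD) auto
  then obtain F where F: "finite F" "(norm x)\<^sup>2 - (e/2)\<^sup>2 < (\<Sum>i\<in>F. (coord x i)\<^sup>2)"
    by (auto simp: eventually_finite_subsets_at_top)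
  have ind: "\<bar>indicator F i\<bar> \<le> (1::real)" for i
    by (simp add: indicator_def)
  have "norm (x - diag (indicator F) x) \<le> e/2"
  proof (rule norm_ell2_leI)
    fix G :: "'i set" assume "finite G"
    have "(\<Sum>i\<in>G. (coord (x - diag (indicator F) x) i)\<^sup>2) = (\<Sum>i\<in>G - F. (coord x i)\<^sup>2)"
      using \<open>finite G\<close> by (intro sum.mono_neutral_cong_right) (auto simp: coord_diag[OF ind])
    also have "\<dots> = (\<Sum>i\<in>G \<union> F. (coord x i)\<^sup>2) - (\<Sum>i\<in>F. (coord x i)\<^sup>2)"
      using \<open>finite G\<close> \<open>finite F\<close>
      by (subst sum.subset_diff[of F "G \<union> F"]) (auto simp: Un_Diff)
    also have "\<dots> \<le> (e/2)\<^sup>2"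
      using sum_coord_sq_le[of "G \<union> F" x] \<open>finite G\<close> F by simp
    finally show "(\<Sum>i\<in>G. (coord (x - diag (indicator F) x) i)\<^sup>2) \<le> (e/2)\<^sup>2" .
  qed (use assms in simp)
  then show ?thesis
    using F(1) assms by (intro exI[of _ F]) auto
qed

text \<open>The intended multipliers are \<open>cos (\<omega> i * s)\<close> with
  \<open>\<omega>\<close> unbounded, so continuity is not uniform in \<open>i\<close> and the
  operators need not be continuous in operator norm. For a fixed vector all but finitely many
  coordinates are negligible, and the uniform bound controls that tail.\<close>

lemma continuous_on_diag_strong:
  fixes x :: "'i ell2" and S :: "real set"
  assumes m: "\<And>i. continuous_on S (\<lambda>t. m t i)" and B: "\<And>t i. \<bar>m t i\<bar> \<le> B"
  shows "continuous_on S (\<lambda>t. diag (m t) x)"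
proof -
  have "0 \<le> B"
    using B[of undefined undefined] by simp
  show ?thesis
    unfolding continuous_on_iff dist_norm
  proof (intro ballI allI impI)
    fix t and e :: real
    assume "t \<in> S" "e > 0"
    \<comment> \<open>Each of the two tail terms costs at most \<open>B * e'\<close>, hence at most
      \<open>e / 4\<close>, which leaves \<open>e / 2\<close> for the finite part. The
      \<open>+ 1\<close> covers \<open>B = 0\<close>.\<close>
    define e' where "e' = (e / 4) / (B + 1)"
    have "e' > 0" and e': "(B + 1) * e' = e / 4"
      using \<open>e > 0\<close> \<open>0 \<le> B\<close> nonzero_mult_div_cancel_left[of "B + 1" "e / 4"]
      unfolding e'_def times_divide_eq_right[symmetric] by (simp_all add: divide_pos_pos)
    then obtain F where F: "finite F" "norm (x - diag (indicator F) x) < e'"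
      using ell2_finite_approx by blast
    define y where "y = diag (indicator F) x"
    have ind: "\<bar>indicator F i\<bar> \<le> (1::real)" for i
      by (simp add: indicator_def)
    \<comment> \<open>The sum of absolute values dominates the Euclidean norm; it is a finite sum of
      functions continuous in \<open>s\<close>, and it vanishes at \<open>s = t\<close>.\<close>
    have fin: "norm (diag (m s) y - diag (m t) y) \<le> (\<Sum>i\<in>F. \<bar>m s i - m t i\<bar> * \<bar>coord x i\<bar>)" for s
    proof (rule norm_ell2_leI)
      fix G :: "'i set" assume "finite G"
      have "(\<Sum>i\<in>G. (coord (diag (m s) y - diag (m t) y) i)\<^sup>2) =
            (\<Sum>i\<in>G \<inter> F. (\<bar>m s i - m t i\<bar> * \<bar>coord x i\<bar>)\<^sup>2)"
        using \<open>finite G\<close>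
        by (intro sum.mono_neutral_cong_right)
          (auto simp: y_def coord_diag[OF ind] coord_diag[OF B] power_mult_distrib power2_eq_square algebra_simps)
      also have "\<dots> \<le> (\<Sum>i\<in>F. (\<bar>m s i - m t i\<bar> * \<bar>coord x i\<bar>)\<^sup>2)"
        using F(1) by (intro sum_mono2) auto
      also have "\<dots> \<le> (\<Sum>i\<in>F. \<bar>m s i - m t i\<bar> * \<bar>coord x i\<bar>)\<^sup>2"
        using L2_set_le_sum[of F "\<lambda>i. \<bar>m s i - m t i\<bar> * \<bar>coord x i\<bar>"]
        unfolding L2_set_def by (simp add: real_sqrt_le_iff sqrt_le_D)
      finally show "(\<Sum>i\<in>G. (coord (diag (m s) y - diag (m t) y) i)\<^sup>2)
          \<le> (\<Sum>i\<in>F. \<bar>m s i - m t i\<bar> * \<bar>coord x i\<bar>)\<^sup>2" .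
    qed (intro sum_nonneg, simp)
    have "continuous_on S (\<lambda>s. \<Sum>i\<in>F. \<bar>m s i - m t i\<bar> * \<bar>coord x i\<bar>)"
      by (intro continuous_intros m)
    then have "\<forall>e>0. \<exists>d>0. \<forall>s\<in>S. dist s t < d \<longrightarrow>
        dist (\<Sum>i\<in>F. \<bar>m s i - m t i\<bar> * \<bar>coord x i\<bar>) (\<Sum>i\<in>F. \<bar>m t i - m t i\<bar> * \<bar>coord x i\<bar>) < e"
      using \<open>t \<in> S\<close> unfolding continuous_on_iff by blast
    then obtain d where d: "d > 0" "\<And>s. s \<in> S \<Longrightarrow> dist s t < d \<Longrightarrow>
        dist (\<Sum>i\<in>F. \<bar>m s i - m t i\<bar> * \<bar>coord x i\<bar>) (\<Sum>i\<in>F. \<bar>m t i - m t i\<bar> * \<bar>coord x i\<bar>) < e/2"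
      using half_gt_zero[OF \<open>e > 0\<close>] by blast
    have "norm (diag (m s) x - diag (m t) x) < e" if "s \<in> S" "norm (s - t) < d" for s
    proof -
      interpret D: bounded_linear "diag (m r)" for r
        by (rule bounded_linear_diag[OF B])
      have "diag (m s) x - diag (m t) x = diag (m s) (x - y) + (diag (m s) y - diag (m t) y) - diag (m t) (x - y)"
        by (simp add: D.diff)
      also have "norm \<dots> \<le> norm (diag (m s) (x - y)) + norm (diag (m s) y - diag (m t) y) + norm (diag (m t) (x - y))"
        by (meson norm_triangle_ineq norm_triangle_ineq4 add_mono order_refl order_trans)
      also have "\<dots> \<le> B * norm (x - y) + norm (diag (m s) y - diag (m t) y) + B * norm (x - y)"
        by (intro add_mono norm_diag_le B order_refl)
      also have "\<dots> \<le> B * e' + norm (diag (m s) y - diag (m t) y) + B * e'"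
        using F(2) \<open>0 \<le> B\<close> by (intro add_mono mult_left_mono) (auto simp: y_def)
      also have "\<dots> < B * e' + e/2 + B * e'"
        using fin[of s] d(2)[of s] that by (simp add: dist_norm)
      also have "\<dots> \<le> e"
        using \<open>0 \<le> B\<close> \<open>e' > 0\<close> e' by (simp add: algebra_simps)
      finally show ?thesis .
    qed
    then show "\<exists>d>0. \<forall>s\<in>S. norm (s - t) < d \<longrightarrow> norm (diag (m s) x - diag (m t) x) < e"
      using d(1) by blast
  qed
qed

text \<open>Coordinatewise derivatives alone do not control the norm of the difference quotient.
  Continuity of \<open>y\<close> does: its integral can be compared with \<open>x\<close> coordinate
  by coordinate, and the integral of a continuous function is differentiable in norm.\<close>

lemma has_vector_derivative_ell2:
  fixes x y :: "real \<Rightarrow> 'i ell2"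
  assumes der: "\<And>i t. t \<in> {0..T} \<Longrightarrow>
      ((\<lambda>s. coord (x s) i) has_real_derivative coord (y t) i) (at t within {0..T})"
    and cont: "continuous_on {0..T} y" and t: "t \<in> {0..T}"
  shows "(x has_vector_derivative y t) (at t within {0..T})"
proof -
  have eq: "x 0 + integral {0..s} y = x s" if "s \<in> {0..T}" for s
  proof (rule ell2_eqI)
    fix i
    have sub: "{0..s} \<subseteq> {0..T}"
      using that by auto
    have "y integrable_on {0..s}"
      by (intro integrable_continuous_interval continuous_on_subset[OF cont sub])
    then have "((\<lambda>t. coord (y t) i) has_integral coord (integral {0..s} y) i) {0..s}"
      using has_integral_linear[OF integrable_integral bounded_linear_coord]
      by (simp add: o_def)
    moreover have "((\<lambda>t. coord (y t) i) has_integral coord (x s) i - coord (x 0) i) {0..s}"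
      using that sub by (intro fundamental_theorem_of_calculus)
        (auto simp: has_real_derivative_iff_has_vector_derivative[symmetric]
          intro: DERIV_subset[OF der])
    ultimately show "coord (x 0 + integral {0..s} y) i = coord (x s) i"
      using has_integral_unique[of "\<lambda>t. coord (y t) i"] by (metis add_diff_cancel_left' coord_simps(2) diff_add_cancel add.commute)
  qed
  have "((\<lambda>s. x 0 + integral {0..s} y) has_vector_derivative y t) (at t within {0..T})"
    using integral_has_vector_derivative[OF cont t] by (auto intro!: derivative_eq_intros)
  then show ?thesis
    using t by (rule has_vector_derivative_transform[rotated 2]) (use eq in auto)
qed

section \<open>Globally Lipschitz differential equations on a half-line\<close>

text \<open>Integrating \<open>exp (r * s)\<close> gains the factor \<open>1 / r\<close>. With
  \<open>r\<close> twice the Lipschitz constant this halves distances in the weighted norm, on the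
  whole half-line at once.\<close>

lemma integral_norm_bound_exp:
  fixes f :: "real \<Rightarrow> 'a::banach"
  assumes "r > 0" "t \<ge> 0" "K \<ge> 0" "continuous_on {0..t} f"
    and "\<And>s. s \<in> {0..t} \<Longrightarrow> norm (f s) \<le> K * exp (r * s)"
  shows "norm (exp (- (r * t)) *\<^sub>R integral {0..t} f) \<le> K / r"
proof -
  have "((\<lambda>s. K * exp (r * s)) has_integral (K / r * exp (r * t) - K / r * exp (r * 0))) {0..t}"
    using assms(1,2) by (intro fundamental_theorem_of_calculus)
      (auto intro!: derivative_eq_intros simp: has_real_derivative_iff_has_vector_derivative[symmetric])
  then have int: "((\<lambda>s. K * exp (r * s)) has_integral (K / r * exp (r * t) - K / r)) {0..t}"
    by simp
  have "norm (integral {0..t} f) \<le> integral {0..t} (\<lambda>s. K * exp (r * s))"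
    using assms by (intro integral_norm_bound_integral integrable_continuous_interval[OF assms(4)] has_integral_integrable[OF int]) auto
  also have "\<dots> = K / r * exp (r * t) - K / r"
    by (rule integral_unique[OF int])
  also have "\<dots> \<le> K / r * exp (r * t)"
    using assms by simp
  finally have "exp (- (r * t)) * norm (integral {0..t} f) \<le> exp (- (r * t)) * (K / r * exp (r * t))"
    by (intro mult_left_mono) auto
  also have "\<dots> = K / r"
    by (simp add: exp_minus)
  finally show ?thesis
    by simp
qed

text \<open>Contraction in the norm weighted by \<open>exp (- 2Lt)\<close>.\<close>

lemma global_lipschitz_ode:
  fixes G :: "real \<Rightarrow> 'a::banach \<Rightarrow> 'a"
  assumes cont: "\<And>z. continuous_on {0..} z \<Longrightarrow> continuous_on {0..} (\<lambda>t. G t (z t))"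
    and lip: "\<And>t x y. t \<ge> 0 \<Longrightarrow> norm (G t x - G t y) \<le> L * norm (x - y)"
    and bound: "\<And>t. t \<ge> 0 \<Longrightarrow> norm (G t 0) \<le> M"
  shows "\<exists>z. z 0 = z0 \<and> (\<forall>t\<ge>0. (z has_vector_derivative G t (z t)) (at t within {0..}))"
proof -
  \<comment> \<open>The maximum with 1 keeps the weight \<open>r\<close> positive for every value of
    \<open>L\<close>.\<close>
  define L' where "L' = max L 1"
  define r where "r = 2 * L'"
  have lip': "norm (G t x - G t y) \<le> L' * norm (x - y)" if "t \<ge> 0" for t x y
    using lip[OF that, of x y] mult_right_mono[of L L' "norm (x - y)"] by (auto simp: L'_def r_def)
  have "L' \<ge> 1" "r > 0"
    by (auto simp: L'_def r_def)
  have "M \<ge> 0"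
    using bound[of 0] norm_ge_zero order_trans by blast
  define F where "F y s = G s (exp (r * s) *\<^sub>R apply_bcontfun y s)" for y :: "real \<Rightarrow>\<^sub>C 'a" and s
  \<comment> \<open>The Picard map for the solution multiplied by \<open>exp (- (r * t))\<close>,
    which is bounded, so that the fixed point can be sought among bounded continuous functions.
    These live on the whole line, hence the constant continuation \<open>max 0 t\<close> to negative
    times.\<close>
  define P where "P y t = exp (- (r * max 0 t)) *\<^sub>R (z0 + integral {0..max 0 t} (F y))" for y t
  have contF: "continuous_on {0..} (F y)" for y
    unfolding F_def by (intro cont continuous_intros continuous_on_apply_bcontfun)
  have diffF: "norm (F y s - F y' s) \<le> L' * dist y y' * exp (r * s)" if "s \<ge> 0" for y y' s
  proof -
    have "norm (F y s - F y' s) \<le> L' * norm (exp (r * s) *\<^sub>R (apply_bcontfun y s - apply_bcontfun y' s))"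
      unfolding F_def scaleR_diff_right by (rule lip') fact
    also have "\<dots> = L' * exp (r * s) * dist (apply_bcontfun y s) (apply_bcontfun y' s)"
      by (simp add: dist_norm)
    also have "\<dots> \<le> L' * exp (r * s) * dist y y'"
      using \<open>L' \<ge> 1\<close> by (intro mult_left_mono dist_bounded) auto
    finally show ?thesis
      by (simp add: mult_ac)
  qed
  have boundF: "norm (F y s) \<le> (L' * dist y 0 + M) * exp (r * s)" if "s \<ge> 0" for y s
  proof -
    have "norm (F y s) \<le> norm (F y s - F 0 s) + norm (F 0 s)"
      using norm_triangle_sub[of "F y s" "F 0 s"] by simp
    also have "\<dots> \<le> L' * dist y 0 * exp (r * s) + M * 1"
      using diffF[OF that, of y 0] bound[OF that] by (simp add: F_def)
    also have "\<dots> \<le> L' * dist y 0 * exp (r * s) + M * exp (r * s)"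
      using \<open>M \<ge> 0\<close> \<open>r > 0\<close> that by (intro add_left_mono mult_left_mono) auto
    finally show ?thesis
      by (simp add: algebra_simps)
  qed
  have contI: "continuous_on {0..} (\<lambda>t. integral {0..t} (F y))" for y
  proof -
    have "continuous (at t within {0..}) (\<lambda>t. integral {0..t} (F y))" if "t \<ge> 0" for t
    proof -
      have "continuous_on {0..t+1} (\<lambda>t. integral {0..t} (F y))"
        by (intro indefinite_integral_continuous_1 integrable_continuous_interval
            continuous_on_subset[OF contF]) auto
      then have "continuous (at t within {0..t+1}) (\<lambda>t. integral {0..t} (F y))"
        using that by (simp add: continuous_on_eq_continuous_within)
      moreover have "at t within {0..t+1} = at t within {0..}"
        using that by (intro at_within_nhd[of _ "{..<t+1}"]) auto
      ultimately show ?thesis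
        by (simp add: continuous_within)
    qed
    then show ?thesis
      by (simp add: continuous_on_eq_continuous_within)
  qed
  have contP: "continuous_on UNIV (P y)" for y
  proof -
    have "continuous_on UNIV (\<lambda>t. integral {0..max 0 t} (F y))"
      by (rule continuous_on_compose2[OF contI]) (auto intro!: continuous_intros)
    then show ?thesis
      unfolding P_def by (intro continuous_intros)
  qed
  have "norm (P y t) \<le> norm z0 + (L' * dist y 0 + M) / r" for y t
  proof -
    have "norm (exp (- (r * max 0 t)) *\<^sub>R integral {0..max 0 t} (F y)) \<le> (L' * dist y 0 + M) / r"
      using \<open>r > 0\<close> \<open>L' \<ge> 1\<close> \<open>M \<ge> 0\<close>
      by (intro integral_norm_bound_exp continuous_on_subset[OF contF] boundF) auto
    moreover have "norm (exp (- (r * max 0 t)) *\<^sub>R z0) \<le> 1 * norm z0"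
      using \<open>r > 0\<close> unfolding norm_scaleR by (intro mult_right_mono) auto
    ultimately show ?thesis
      unfolding P_def scaleR_add_right by (intro norm_triangle_le) simp
  qed
  then have P: "apply_bcontfun (Bcontfun (P y)) = P y" for y
    by (intro Bcontfun_inverse) (auto simp: bcontfun_def contP bounded_iff)
  have "\<exists>!y. Bcontfun (P y) = y"
  proof (rule banach_fix_type[of "1/2"])
    show "\<forall>y y'. dist (Bcontfun (P y)) (Bcontfun (P y')) \<le> 1 / 2 * dist y y'"
    proof (intro allI dist_bound)
      fix y y' and t :: real
      define s where "s = max 0 t"
      have int: "F w integrable_on {0..s}" for w
        by (intro integrable_continuous_interval continuous_on_subset[OF contF]) auto
      have "P y t - P y' t = exp (- (r * s)) *\<^sub>R integral {0..s} (\<lambda>u. F y u - F y' u)"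
        by (simp add: P_def s_def[symmetric] integral_diff[OF int int] algebra_simps)
      also have "norm \<dots> \<le> (L' * dist y y') / r"
        using \<open>r > 0\<close> \<open>L' \<ge> 1\<close>
        by (intro integral_norm_bound_exp continuous_on_diff continuous_on_subset[OF contF] diffF)
          (auto simp: s_def)
      also have "\<dots> = 1/2 * dist y y'"
        using \<open>L' \<ge> 1\<close> by (simp add: r_def)
      finally show "dist (apply_bcontfun (Bcontfun (P y)) t) (apply_bcontfun (Bcontfun (P y')) t) \<le> 1/2 * dist y y'"
        by (simp add: P dist_norm)
    qed
  qed auto
  then obtain y where "Bcontfun (P y) = y"
    by blast
  then have y: "apply_bcontfun y t = P y t" for t
    using P[of y] by simp
  define z where "z t = exp (r * t) *\<^sub>R apply_bcontfun y t" for t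
  have z: "z t = z0 + integral {0..t} (F y)" if "t \<ge> 0" for t
    using that by (simp add: z_def y P_def exp_minus)
  have zF: "F y t = G t (z t)" for t
    by (simp add: F_def z_def)
  show ?thesis
  proof (intro exI[of _ z] conjI allI impI)
    show "z 0 = z0"
      by (simp add: z)
    fix t :: real
    assume "t \<ge> 0"
    have "((\<lambda>t. z0 + integral {0..t} (F y)) has_vector_derivative F y t) (at t within {0..t+1})"
      using integral_has_vector_derivative[OF continuous_on_subset[OF contF], of 0 "t+1" t] \<open>t \<ge> 0\<close>
      by (auto intro!: derivative_eq_intros)
    then have "(z has_vector_derivative F y t) (at t within {0..t+1})"
      by (rule has_vector_derivative_transform[rotated 2]) (use \<open>t \<ge> 0\<close> in \<open>auto simp: z\<close>)
    moreover have "at t within {0..t+1} = at t within {0..}"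
      using \<open>t \<ge> 0\<close> by (intro at_within_nhd[of _ "{..<t+1}"]) auto
    ultimately show "(z has_vector_derivative G t (z t)) (at t within {0..})"
      by (simp add: zF)
  qed
qed

text \<open>Product rules with one merely continuous factor, and the definition of a solution, speak
  of limits of difference quotients; this is the bridge to them.\<close>

lemma has_vector_derivative_quotient:
  fixes f :: "real \<Rightarrow> 'a::real_normed_vector"
  shows "(f has_vector_derivative d) (at x within S) \<longleftrightarrow>
    ((\<lambda>y. (f y - f x) /\<^sub>R (y - x)) \<longlongrightarrow> d) (at x within S)"
proof -
  have "norm ((f y - f x - (y - x) *\<^sub>R d) /\<^sub>R norm (y - x)) = norm ((f y - f x) /\<^sub>R (y - x) - d)"
    if "y \<noteq> x" for y
  proof -
    have "(f y - f x) /\<^sub>R (y - x) - d = (f y - f x - (y - x) *\<^sub>R d) /\<^sub>R (y - x)"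
      using that by (simp add: scaleR_diff_right)
    then show ?thesis
      by simp
  qed
  then have "((\<lambda>y. norm ((f y - f x - (y - x) *\<^sub>R d) /\<^sub>R norm (y - x))) \<longlongrightarrow> 0) (at x within S) \<longleftrightarrow>
      ((\<lambda>y. norm ((f y - f x) /\<^sub>R (y - x) - d)) \<longlongrightarrow> 0) (at x within S)"
    by (intro tendsto_cong) (auto simp: eventually_at_filter)
  then show ?thesis
    unfolding has_vector_derivative_def has_derivative_at_within tendsto_norm_zero_iff
      LIM_zero_iff[symmetric, of _ d] by (simp add: bounded_linear_scaleR_left LIM_zero_iff)
qed

lemma at_within_halfline: "t \<ge> 0 \<Longrightarrow> at t within {0..t + 1} = at t within {0..}" for t :: real
  by (intro at_within_nhd[of _ "{..<t+1}"]) auto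

lemma has_vector_derivative_ell2_halfline:
  fixes x y :: "real \<Rightarrow> 'i ell2"
  assumes der: "\<And>i t. t \<ge> 0 \<Longrightarrow>
      ((\<lambda>s. coord (x s) i) has_real_derivative coord (y t) i) (at t within {0..})"
    and cont: "continuous_on {0..} y" and t: "t \<ge> 0"
  shows "(x has_vector_derivative y t) (at t within {0..})"
proof -
  have "(x has_vector_derivative y t) (at t within {0..t+1})"
    using t by (intro has_vector_derivative_ell2 continuous_on_subset[OF cont])
      (auto intro: DERIV_subset[OF der])
  then show ?thesis
    using t by (simp add: at_within_halfline)
qed

text \<open>Strong continuity together with the uniform bound on the operators allows the vector to
  move as well.\<close>

lemma continuous_on_diag:
  fixes x :: "real \<Rightarrow> 'i ell2"
  assumes m: "\<And>i. continuous_on S (\<lambda>t. m t i)" and B: "\<And>t i. \<bar>m t i\<bar> \<le> B"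
    and x: "continuous_on S x"
  shows "continuous_on S (\<lambda>t. diag (m t) (x t))"
  unfolding continuous_on_def
proof
  fix t assume "t \<in> S"
  interpret D: bounded_linear "diag (m r)" for r
    by (rule bounded_linear_diag[OF B])
  have "((\<lambda>s. B * norm (x s - x t)) \<longlongrightarrow> 0) (at t within S)"
    using x \<open>t \<in> S\<close> unfolding continuous_on_def
    by (auto intro!: tendsto_mult_right_zero tendsto_norm_zero simp: LIM_zero_iff)
  then have "((\<lambda>s. diag (m s) (x s - x t)) \<longlongrightarrow> 0) (at t within S)"
    by (rule Lim_null_comparison[rotated]) (simp add: norm_diag_le[OF B])
  moreover have "((\<lambda>s. diag (m s) (x t)) \<longlongrightarrow> diag (m t) (x t)) (at t within S)"
    using continuous_on_diag_strong[of S m, OF m B] \<open>t \<in> S\<close> by (auto simp: continuous_on_def)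
  ultimately show "((\<lambda>s. diag (m s) (x s)) \<longlongrightarrow> diag (m t) (x t)) (at t within S)"
    using tendsto_add by (fastforce simp: D.diff)
qed

lemma has_real_derivative_scaled_halfline:
  fixes f :: "real \<Rightarrow> real"
  assumes "\<And>\<tau>. \<tau> \<ge> 0 \<Longrightarrow> (f has_real_derivative f' \<tau>) (at \<tau> within {0..})" "\<epsilon> > 0" "t \<ge> 0"
  shows "((\<lambda>s. f (\<epsilon> * s)) has_real_derivative \<epsilon> * f' (\<epsilon> * t)) (at t within {0..})"
proof -
  have "((\<lambda>s. \<epsilon> * s) has_real_derivative \<epsilon>) (at t within {0..})"
    by (auto intro!: derivative_eq_intros)
  moreover have "(f has_real_derivative f' (\<epsilon> * t)) (at (\<epsilon> * t) within (\<lambda>s. \<epsilon> * s) ` {0..})"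
    using assms by (intro DERIV_subset[OF assms(1)]) auto
  ultimately show ?thesis
    using DERIV_image_chain[of f "f' (\<epsilon> * t)" "\<lambda>s. \<epsilon> * s" t "{0..}" \<epsilon>]
    by (simp add: o_def mult.commute)
qed

section \<open>A continuity argument\<close>

text \<open>If the bound failed, there would be a first time at which \<open>g\<close> equals
  \<open>r\<close>. Up to that time \<open>g\<close> is at most \<open>r\<close>, so the hypothesis
  \<open>step\<close> gives a strict inequality there.\<close>

lemma continuous_induction_bound:
  fixes g :: "real \<Rightarrow> real"
  assumes cont: "continuous_on {0..T} g" and "g 0 < r"
    and step: "\<And>t. t \<in> {0..T} \<Longrightarrow> (\<And>s. s \<in> {0..t} \<Longrightarrow> g s \<le> r) \<Longrightarrow> g t < r"
    and t: "t \<in> {0..T}"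
  shows "g t < r"
proof (rule ccontr)
  assume "\<not> g t < r"
  define A where "A = {s\<in>{0..T}. g s = r}"
  have "\<exists>s\<ge>0. s \<le> t \<and> g s = r"
    using t \<open>g 0 < r\<close> \<open>\<not> g t < r\<close>
    by (intro IVT' continuous_on_subset[OF cont]) auto
  then obtain s where "s \<ge> 0" "s \<le> t" "g s = r"
    by blast
  then have "s \<in> A"
    using t by (auto simp: A_def)
  then have "A \<noteq> {}"
    by blast
  moreover have "closed A"
    unfolding A_def using continuous_closed_preimage_constant[OF cont closed_atLeastAtMost] by simp
  then have "compact ({0..T} \<inter> A)"
    by (intro compact_Int_closed compact_Icc)
  moreover have "{0..T} \<inter> A = A"
    by (auto simp: A_def)
  ultimately obtain m where m: "m \<in> A" "\<And>s. s \<in> A \<Longrightarrow> m \<le> s"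
    using compact_attains_inf[of A] by auto
  have "g s \<le> r" if "s \<in> {0..m}" for s
  proof (rule ccontr)
    assume "\<not> g s \<le> r"
    then have "\<exists>u\<ge>0. u \<le> s \<and> g u = r"
      using that m(1) \<open>g 0 < r\<close> by (intro IVT' continuous_on_subset[OF cont]) (auto simp: A_def)
    then obtain u where "u \<ge> 0" "u \<le> s" "g u = r"
      by blast
    moreover have "m \<le> u"
      using m that calculation by (auto simp: A_def)
    ultimately have "u = s"
      using that by simp
    then show False
      using \<open>g u = r\<close> \<open>\<not> g s \<le> r\<close> by simp
  qed
  then show False
    using step[of m] m(1) by (auto simp: A_def)
qed

section \<open>Cubic wave equations in diagonal form\<close>

text \<open>The radial projection onto the ball of radius \<open>R\<close>, with the two cases
  merged into one formula by \<open>max\<close>.\<close>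

definition retract :: "real \<Rightarrow> 'a::real_normed_vector \<Rightarrow> 'a" where
  "retract R x = (R / max R (norm x)) *\<^sub>R x"

lemma norm_retract_le: "R > 0 \<Longrightarrow> norm (retract R x) \<le> R"
  by (simp add: retract_def divide_le_eq max_def mult_left_mono)

lemma retract_id: "R > 0 \<Longrightarrow> norm x \<le> R \<Longrightarrow> retract R x = x"
  by (simp add: retract_def max_def)

text \<open>The difference splits into moving the point with the scaling factor fixed and changing
  the factor with the point fixed. Each part costs at most \<open>norm (x - y)\<close>, whence the
  2.\<close>

lemma retract_lipschitz:
  assumes "R > 0"
  shows "norm (retract R x - retract R y) \<le> 2 * norm (x - y)"
proof -
  define s where "s z = max R (norm z)" for z :: 'a
  have s: "s z \<ge> R" "s z \<ge> norm z" "s z > 0" for z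
    using assms by (auto simp: s_def)
  have "R / s x - R / s y = (R / s x) * ((s y - s x) / s y)"
    using s(3)[of x] s(3)[of y] by (simp add: field_simps)
  then have "norm ((R / s x - R / s y) *\<^sub>R y) = (R / s x) * (norm y / s y) * \<bar>s y - s x\<bar>"
    using assms s(3)[of x] s(3)[of y] by (simp add: abs_mult)
  also have "\<dots> \<le> 1 * 1 * \<bar>s y - s x\<bar>"
    using s[of x] s[of y] assms by (intro mult_mono mult_right_mono) (auto simp: divide_le_eq)
  also have "\<bar>s y - s x\<bar> \<le> norm (x - y)"
    using norm_triangle_ineq3[of y x] by (auto simp: s_def max_def norm_minus_commute)
  finally have 1: "norm ((R / s x - R / s y) *\<^sub>R y) \<le> norm (x - y)"
    by simp
  have "norm ((R / s x) *\<^sub>R (x - y)) \<le> 1 * norm (x - y)"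
    using s[of x] assms unfolding norm_scaleR by (intro mult_right_mono) (auto simp: divide_le_eq)
  moreover have "retract R x - retract R y = (R / s x) *\<^sub>R (x - y) + (R / s x - R / s y) *\<^sub>R y"
    by (simp add: retract_def s_def algebra_simps)
  ultimately show ?thesis
    using 1 norm_triangle_ineq[of "(R / s x) *\<^sub>R (x - y)" "(R / s x - R / s y) *\<^sub>R y"] by simp
qed

text \<open>
  \<open>T\<close> stands for the product of three functions, in terms of the coefficients of their gradients.
  The assumption \<open>T_symm\<close> says that \<open>(a, b, c, d) \<mapsto> \<integral> a b c d\<close> is symmetric.
\<close>

locale trilinear_ell2 =
  fixes \<omega> :: "'i \<Rightarrow> real" and \<omega>0 K :: real and T :: "'i ell2 \<Rightarrow> 'i ell2 \<Rightarrow> 'i ell2 \<Rightarrow> 'i ell2"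
  assumes \<omega>0: "\<omega>0 > 0" and \<omega>: "\<And>i. \<omega> i \<ge> \<omega>0"
    and T_diff: "\<And>x y b c. T (x - y) b c = T x b c - T y b c"
    and T_swap12: "\<And>a b c. T a b c = T b a c"
    and T_swap23: "\<And>a b c. T a b c = T a c b"
    and T_bound: "\<And>a b c. norm (T a b c) \<le> K * norm a * norm b * norm c"
    and T_symm: "\<And>a b c d. inner (T a b c) (diag (\<lambda>i. 1 / \<omega> i) d) = inner (T d b c) (diag (\<lambda>i. 1 / \<omega> i) a)"
    and K: "K \<ge> 0"
begin

abbreviation D :: "'i ell2 \<Rightarrow> 'i ell2" where
  "D \<equiv> diag (\<lambda>i. 1 / \<omega> i)"

lemma \<omega>_pos: "\<omega> i > 0"
  using \<omega>0 \<omega>[of i] by simp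

lemma inv_\<omega>_bound: "\<bar>1 / \<omega> i\<bar> \<le> 1 / \<omega>0"
  using \<omega>[of i] \<omega>0 by (simp add: frac_le)

lemmas coord_D = coord_diag[where m = "\<lambda>i. 1 / \<omega> i", OF inv_\<omega>_bound]
  and norm_D_le = norm_diag_le[where m = "\<lambda>i. 1 / \<omega> i", OF inv_\<omega>_bound]
  and inner_D_commute = inner_diag_commute[where m = "\<lambda>i. 1 / \<omega> i", OF inv_\<omega>_bound]

sublocale D: bounded_linear D
  by (rule bounded_linear_diag[OF inv_\<omega>_bound])

lemma T_diff2: "T a (x - y) c = T a x c - T a y c"
  using T_diff T_swap12 by metis

lemma T_diff3: "T a b (x - y) = T a b x - T a b y"
  using T_diff2 T_swap23 by metis

lemma T_tendsto:
  assumes "(f \<longlongrightarrow> a) F" "(g \<longlongrightarrow> b) F" "(h \<longlongrightarrow> c) F"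
  shows "((\<lambda>s. T (f s) (g s) (h s)) \<longlongrightarrow> T a b c) F"
proof -
  have nz: "((\<lambda>s. norm (u s - v)) \<longlongrightarrow> 0) F" if "(u \<longlongrightarrow> v) F" for u and v :: "'i ell2"
    using that by (simp add: tendsto_norm_zero_iff LIM_zero_iff)
  note n = tendsto_norm[OF assms(1)] tendsto_norm[OF assms(2)] tendsto_norm[OF assms(3)]
  have "((\<lambda>s. K * norm (f s - a) * norm (g s) * norm (h s) + K * norm a * norm (g s - b) * norm (h s)
      + K * norm a * norm b * norm (h s - c)) \<longlongrightarrow>
      K * 0 * norm b * norm c + K * norm a * 0 * norm c + K * norm a * norm b * 0) F"
    by (intro tendsto_intros n nz assms)
  then have lim: "((\<lambda>s. K * norm (f s - a) * norm (g s) * norm (h s) + K * norm a * norm (g s - b) * norm (h s)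
      + K * norm a * norm b * norm (h s - c)) \<longlongrightarrow> 0) F"
    by simp
  have "((\<lambda>s. T (f s) (g s) (h s) - T a b c) \<longlongrightarrow> 0) F"
  proof (rule Lim_null_comparison[OF always_eventually lim], intro allI)
    fix s
    have "T (f s) (g s) (h s) - T a b c =
        T (f s - a) (g s) (h s) + T a (g s - b) (h s) + T a b (h s - c)"
      by (simp add: T_diff T_diff2 T_diff3)
    also have "norm \<dots> \<le> norm (T (f s - a) (g s) (h s)) + norm (T a (g s - b) (h s)) + norm (T a b (h s - c))"
      by (meson norm_triangle_ineq add_right_mono order_trans)
    also have "\<dots> \<le> K * norm (f s - a) * norm (g s) * norm (h s) + K * norm a * norm (g s - b) * norm (h s)
      + K * norm a * norm b * norm (h s - c)"
      by (intro add_mono T_bound)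
    finally show "norm (T (f s) (g s) (h s) - T a b c) \<le> K * norm (f s - a) * norm (g s) * norm (h s)
        + K * norm a * norm (g s - b) * norm (h s) + K * norm a * norm b * norm (h s - c)" .
  qed
  then show ?thesis
    by (simp add: LIM_zero_iff)
qed

definition cube :: "'i ell2 \<Rightarrow> 'i ell2" where
  "cube x = T x x x"

lemma cube_zero: "cube 0 = 0"
  using T_bound[of 0 0 0] by (simp add: cube_def)

text \<open>The 6 is a 3 from exchanging one argument of the trilinear map at a time and a 2 from
  the Lipschitz constant of the retraction.\<close>

lemma cube_retract_lipschitz:
  assumes "R > 0"
  shows "norm (cube (retract R x) - cube (retract R y)) \<le> 6 * K * R\<^sup>2 * norm (x - y)"
proof -
  define a b where "a = retract R x" and "b = retract R y"
  have a: "norm a \<le> R" and b: "norm b \<le> R" and ab: "norm (a - b) \<le> 2 * norm (x - y)"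
    using assms by (auto simp: a_def b_def norm_retract_le retract_lipschitz)
  have "T a a a - T b b b = T (a - b) a a + T b (a - b) a + T b b (a - b)"
    by (simp add: T_diff T_diff2 T_diff3)
  also have "norm \<dots> \<le> norm (T (a - b) a a) + norm (T b (a - b) a) + norm (T b b (a - b))"
    by (meson norm_triangle_ineq add_right_mono order_trans)
  also have "\<dots> \<le> K * norm (a - b) * norm a * norm a + K * norm b * norm (a - b) * norm a
      + K * norm b * norm b * norm (a - b)"
    by (intro add_mono T_bound)
  also have "\<dots> \<le> K * norm (a - b) * R * R + K * R * norm (a - b) * R + K * R * R * norm (a - b)"
    using a b K assms by (intro add_mono mult_mono mult_nonneg_nonneg) auto
  also have "\<dots> = 3 * K * R\<^sup>2 * norm (a - b)"
    by (simp add: power2_eq_square)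
  also have "\<dots> \<le> 3 * K * R\<^sup>2 * (2 * norm (x - y))"
    using ab K by (intro mult_left_mono) auto
  finally show ?thesis
    by (simp add: cube_def a_def b_def mult_ac)
qed

text \<open>If \<open>x\<close> holds the gradient coefficients of \<open>u\<close>, then
  \<open>D x\<close> holds the coefficients of \<open>u\<close> and \<open>quartic x\<close> is the
  integral of the fourth power of \<open>u\<close>.\<close>

definition quartic :: "'i ell2 \<Rightarrow> real" where
  "quartic x = inner (cube x) (D x)"

text \<open>This is the factorization of a difference of fourth powers. By \<open>T_symm\<close> the
  linear factor can always be moved to the slot behind \<open>D\<close>, so the difference of the
  arguments appears only as \<open>D x - D y\<close>.\<close>

lemma quartic_diff:
  "quartic x - quartic y = inner (T x x x + T x x y + T x y y + T y y y) (D x - D y)"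
proof -
  have [simp]: "T y x x = T x x y" "T y x y = T x y y" "T y y x = T x y y" "T x y x = T x x y"
    using T_swap12 T_swap23 by metis+
  have "inner (T x x x) (D y) = inner (T x x y) (D x)" "inner (T x x y) (D y) = inner (T x y y) (D x)"
      "inner (T x y y) (D y) = inner (T y y y) (D x)"
    using T_symm[of x x x y] T_symm[of x x y y] T_symm[of x y y y] by auto
  then show ?thesis
    by (simp add: quartic_def cube_def inner_add_left inner_diff_right)
qed

lemma abs_quartic_le: "\<bar>quartic x\<bar> \<le> K / \<omega>0 * norm x ^ 4"
proof -
  have "\<bar>quartic x\<bar> \<le> norm (cube x) * norm (D x)"
    unfolding quartic_def by (rule Cauchy_Schwarz_ineq2)
  also have "\<dots> \<le> (K * norm x * norm x * norm x) * (1 / \<omega>0 * norm x)"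
    unfolding cube_def using K by (intro mult_mono T_bound norm_D_le) auto
  finally show ?thesis
    by (simp add: power4_eq_xxxx mult_ac)
qed

text \<open>Here \<open>w\<close> is merely continuous and only \<open>D w\<close> is
  differentiable. The factorization puts the whole difference quotient on \<open>D w\<close>, and
  its cofactor converges to \<open>4\<close> times the cube.\<close>

lemma quartic_has_derivative:
  assumes w: "(w \<longlongrightarrow> w t) (at t within S)"
    and u: "((\<lambda>s. D (w s)) has_vector_derivative q) (at t within S)"
  shows "((\<lambda>s. quartic (w s)) has_real_derivative 4 * inner (cube (w t)) q) (at t within S)"
proof -
  define B where "B s = T (w s) (w s) (w s) + T (w s) (w s) (w t) + T (w s) (w t) (w t) + T (w t) (w t) (w t)" for s
  have "(B \<longlongrightarrow> B t) (at t within S)"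
    unfolding B_def by (intro tendsto_intros T_tendsto w)
  then have "((\<lambda>s. inner (B s) ((D (w s) - D (w t)) /\<^sub>R (s - t))) \<longlongrightarrow> inner (B t) q) (at t within S)"
    using u unfolding has_vector_derivative_quotient by (intro tendsto_inner)
  moreover have "inner (B t) q = 4 * inner (cube (w t)) q"
    by (simp add: B_def cube_def inner_add_left)
  moreover have "inner (B s) ((D (w s) - D (w t)) /\<^sub>R (s - t)) = (quartic (w s) - quartic (w t)) / (s - t)" for s
    by (simp add: quartic_diff B_def divide_inverse mult.commute)
  ultimately show ?thesis
    by (simp add: has_field_derivative_iff)
qed

end

subsection \<open>Rotation\<close>

lemma abs_cos_le_1: "\<bar>cos x\<bar> \<le> 1" and abs_sin_le_1: "\<bar>sin x\<bar> \<le> 1" for x :: real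
  by simp_all

text \<open>The exact flow, after time \<open>s\<close>, of the uncoupled oscillators with p' =
  \<omega> q and q' = - \<omega> p.\<close>

definition rot :: "('i \<Rightarrow> real) \<Rightarrow> real \<Rightarrow> 'i ell2 \<times> 'i ell2 \<Rightarrow> 'i ell2 \<times> 'i ell2" where
  "rot \<omega> s z = (diag (\<lambda>i. cos (\<omega> i * s)) (fst z) + diag (\<lambda>i. sin (\<omega> i * s)) (snd z),
               diag (\<lambda>i. cos (\<omega> i * s)) (snd z) - diag (\<lambda>i. sin (\<omega> i * s)) (fst z))"

lemmas coord_cos = coord_diag[OF abs_cos_le_1] and coord_sin = coord_diag[OF abs_sin_le_1]

lemma coord_rot:
  "coord (fst (rot \<omega> s z)) i = cos (\<omega> i * s) * coord (fst z) i + sin (\<omega> i * s) * coord (snd z) i"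
  "coord (snd (rot \<omega> s z)) i = cos (\<omega> i * s) * coord (snd z) i - sin (\<omega> i * s) * coord (fst z) i"
  by (simp_all add: rot_def coord_cos coord_sin)

lemma rot_zero: "rot \<omega> 0 z = z"
  by (simp add: prod_eq_iff ell2_eqI coord_rot)

lemma rot_rot: "rot \<omega> r (rot \<omega> s z) = rot \<omega> (r + s) z"
  by (auto simp: prod_eq_iff coord_rot cos_add sin_add algebra_simps intro!: ell2_eqI)

lemma rot_diff: "rot \<omega> s (x - y) = rot \<omega> s x - rot \<omega> s y"
  by (auto simp: prod_eq_iff coord_rot algebra_simps intro!: ell2_eqI)

lemma inner_rot: "inner (rot \<omega> s x) y = inner x (rot \<omega> (- s) y)"
proof -
  have "diag (\<lambda>i. - sin (\<omega> i * s)) v = - diag (\<lambda>i. sin (\<omega> i * s)) v" for v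
    by (rule ell2_eqI) (simp add: coord_sin coord_diag[where B = 1])
  then show ?thesis
    by (simp add: inner_prod_def rot_def inner_add_left inner_add_right inner_diff_left inner_diff_right
      inner_diag_commute[OF abs_cos_le_1] inner_diag_commute[OF abs_sin_le_1])
qed

lemma norm_rot: "norm (rot \<omega> s z) = norm z"
  by (simp add: norm_eq_sqrt_inner inner_rot rot_rot rot_zero)

lemma continuous_on_rot:
  fixes z :: "real \<Rightarrow> 'i ell2 \<times> 'i ell2"
  assumes "continuous_on S \<theta>" "continuous_on S z"
  shows "continuous_on S (\<lambda>t. rot \<omega> (\<theta> t) (z t))"
  unfolding rot_def
  by (intro continuous_on_Pair continuous_on_add continuous_on_diff continuous_on_fst continuous_on_snd
      continuous_on_diag[where B = 1] continuous_intros assms) auto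

subsection \<open>Slowly varying coefficients\<close>

text \<open>Three derivatives of \<open>c\<close> enter because the corrector contains
  \<open>b1\<close>, which involves \<open>c2\<close>, and is itself differentiated;
  \<open>a\<close> enters the corrector undifferentiated, through \<open>g\<close>.\<close>

locale slow_wave = trilinear_ell2 \<omega> \<omega>0 K T
  for \<omega> :: "'i \<Rightarrow> real" and \<omega>0 K and T :: "'i ell2 \<Rightarrow> 'i ell2 \<Rightarrow> 'i ell2 \<Rightarrow> 'i ell2" +
  fixes c c1 c2 c3 a a1 :: "real \<Rightarrow> real" and c0 :: real
  assumes c_deriv: "\<And>\<tau>. \<tau> \<ge> 0 \<Longrightarrow> (c has_real_derivative c1 \<tau>) (at \<tau> within {0..})"
    and c1_deriv: "\<And>\<tau>. \<tau> \<ge> 0 \<Longrightarrow> (c1 has_real_derivative c2 \<tau>) (at \<tau> within {0..})"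
    and c2_deriv: "\<And>\<tau>. \<tau> \<ge> 0 \<Longrightarrow> (c2 has_real_derivative c3 \<tau>) (at \<tau> within {0..})"
    and a_deriv: "\<And>\<tau>. \<tau> \<ge> 0 \<Longrightarrow> (a has_real_derivative a1 \<tau>) (at \<tau> within {0..})"
    and bounded_coeffs: "bounded (c ` {0..})" "bounded (c1 ` {0..})" "bounded (c2 ` {0..})"
      "bounded (c3 ` {0..})" "bounded (a ` {0..})" "bounded (a1 ` {0..})"
    and c0: "c0 > 0" and c_ge: "\<And>\<tau>. \<tau> \<ge> 0 \<Longrightarrow> c \<tau> \<ge> c0"
begin

lemma c_pos: "\<tau> \<ge> 0 \<Longrightarrow> c \<tau> > 0"
  using c0 c_ge[of \<tau>] by simp

lemma continuous_coeffs: "continuous_on {0..} c" "continuous_on {0..} c1" "continuous_on {0..} a"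
  by (auto intro!: DERIV_continuous_on[OF c_deriv] DERIV_continuous_on[OF c1_deriv] DERIV_continuous_on[OF a_deriv])

lemma continuous_on_scaled:
  assumes "continuous_on {0..} f" "\<epsilon> > 0"
  shows "continuous_on {0..} (\<lambda>t::real. f (\<epsilon> * t) :: real)"
  by (rule continuous_on_compose2[OF assms(1)]) (use assms(2) in \<open>auto intro!: continuous_intros\<close>)

text \<open>
  In the variables \<open>p = c \<omega> u\<close>, \<open>q = \<partial>\<^sub>t u\<close> the linear part of the equation is a rotation, up to a
  bounded term. In the rotating frame \<open>z\<close> the equation has a locally Lipschitz right-hand side,
  which the retraction makes globally Lipschitz.
\<close>

definition truncated_wave :: "real \<Rightarrow> real \<Rightarrow> (real \<Rightarrow> 'i ell2) \<Rightarrow> (real \<Rightarrow> 'i ell2) \<Rightarrow> bool" where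
  "truncated_wave \<epsilon> R p q \<longleftrightarrow> continuous_on {0..} p \<and> continuous_on {0..} q \<and>
    (\<forall>t\<ge>0. ((\<lambda>s. D (p s) /\<^sub>R c (\<epsilon> * s)) has_vector_derivative q t) (at t within {0..}) \<and>
       ((\<lambda>s. D (q s)) has_vector_derivative
          - c (\<epsilon> * t) *\<^sub>R p t + a (\<epsilon> * t) *\<^sub>R D (cube (retract R (p t /\<^sub>R c (\<epsilon> * t))))) (at t within {0..}) \<and>
       ((\<lambda>s. (norm (p s))\<^sup>2 + (norm (q s))\<^sup>2) has_real_derivative
          2 * (\<epsilon> * c1 (\<epsilon> * t) / c (\<epsilon> * t) * (norm (p t))\<^sup>2
            + a (\<epsilon> * t) * inner (cube (retract R (p t /\<^sub>R c (\<epsilon> * t)))) (q t))) (at t within {0..}))"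

lemma truncated_wave_exists:
  assumes \<epsilon>: "0 < \<epsilon>" "\<epsilon> \<le> 1" and R: "R > 0"
  shows "\<exists>p q. p 0 = p0 \<and> q 0 = q0 \<and> truncated_wave \<epsilon> R p q"
proof -
  \<comment> \<open>The accumulated phase: rotation by the angle
    \<open>\<omega> i * \<sigma> t\<close> has the instantaneous frequency
    \<open>\<omega> i * c (\<epsilon> * t)\<close>.\<close>
  define \<sigma> where "\<sigma> t = integral {0..t} (\<lambda>s. c (\<epsilon> * s))" for t
  have ct: "continuous_on {0..} (\<lambda>t. c (\<epsilon> * t))" "continuous_on {0..} (\<lambda>t. c1 (\<epsilon> * t))"
      "continuous_on {0..} (\<lambda>t. a (\<epsilon> * t))"
    by (intro continuous_on_scaled continuous_coeffs \<epsilon>)+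
  have cpos: "c (\<epsilon> * t) > 0" "c (\<epsilon> * t) \<ge> c0" if "t \<ge> 0" for t
    using that \<epsilon> by (auto intro: c_pos c_ge)
  have \<sigma>: "(\<sigma> has_real_derivative c (\<epsilon> * t)) (at t within {0..})" if "t \<ge> 0" for t
  proof -
    have "continuous_on {0..t+1} (\<lambda>t. c (\<epsilon> * t))"
      by (rule continuous_on_subset[OF ct(1)]) auto
    then show ?thesis
      using integral_has_real_derivative[of 0 "t+1" "\<lambda>s. c (\<epsilon> * s)" t] that
      by (simp add: \<sigma>_def[abs_def] at_within_halfline)
  qed
  have \<sigma>_cont: "continuous_on {0..} \<sigma>"
    by (rule DERIV_continuous_on) (use \<sigma> in auto)
  define N where "N t p = cube (retract R (p /\<^sub>R c (\<epsilon> * t)))" for t p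
  \<comment> \<open>What remains of the right-hand side without the rotation: the first component
    comes from the time dependence of the factor \<open>c\<close> in \<open>p\<close>, the second is
    the cubic force. Conjugation by the isometric rotation then keeps the Lipschitz
    constant.\<close>
  define H where "H t y = ((\<epsilon> * c1 (\<epsilon> * t) / c (\<epsilon> * t)) *\<^sub>R fst y, a (\<epsilon> * t) *\<^sub>R N t (fst y))" for t and y :: "'i ell2 \<times> 'i ell2"
  define G where "G t z = rot \<omega> (- \<sigma> t) (H t (rot \<omega> (\<sigma> t) z))" for t z
  have cont_cube: "continuous_on S (\<lambda>t. cube (f t))" if "continuous_on S f" for S :: "real set" and f
    using that unfolding cube_def continuous_on_def by (auto intro!: T_tendsto)
  have cont_retract: "continuous_on S (\<lambda>t. retract R (f t))" if "continuous_on S f" for S :: "real set" and f :: "real \<Rightarrow> 'i ell2"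
    unfolding retract_def using R that by (intro continuous_intros) (auto simp: max_def)
  have cont_N: "continuous_on {0..} (\<lambda>t. N t (f t))" if "continuous_on {0..} f" for f
    unfolding N_def using cpos
    by (intro cont_cube cont_retract continuous_on_scaleR continuous_on_inverse ct that) force
  have cont_H: "continuous_on {0..} (\<lambda>t. H t (f t))" if "continuous_on {0..} f" for f
    unfolding H_def using cpos
    by (intro continuous_on_Pair continuous_on_scaleR continuous_on_divide continuous_on_mult cont_N
        continuous_on_fst ct that continuous_on_const) force
  obtain A1 where A1: "\<And>\<tau>. \<tau> \<ge> 0 \<Longrightarrow> \<bar>c1 \<tau>\<bar> \<le> A1"
    using bounded_coeffs(2) by (auto simp: bounded_iff)
  obtain A2 where A2: "\<And>\<tau>. \<tau> \<ge> 0 \<Longrightarrow> \<bar>a \<tau>\<bar> \<le> A2"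
    using bounded_coeffs(5) by (auto simp: bounded_iff)
  have "A1 \<ge> 0" "A2 \<ge> 0"
    using A1[of 0] A2[of 0] by auto
  have nf: "norm (fst v) \<le> norm v" for v :: "'i ell2 \<times> 'i ell2"
    using norm_fst_le[of "fst v" "snd v"] by simp
  have H_lip: "norm (H t x - H t y) \<le> (A1 / c0 + A2 * (6 * K * R\<^sup>2 / c0)) * norm (x - y)" if "t \<ge> 0" for t x y
  proof -
    have "norm (N t (fst x) - N t (fst y)) \<le> 6 * K * R\<^sup>2 * norm (fst x /\<^sub>R c (\<epsilon> * t) - fst y /\<^sub>R c (\<epsilon> * t))"
      unfolding N_def by (rule cube_retract_lipschitz) fact
    also have "\<dots> = 6 * K * R\<^sup>2 / c (\<epsilon> * t) * norm (fst (x - y))"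
      using cpos[OF that] by (simp add: scaleR_diff_right[symmetric] divide_inverse)
    also have "\<dots> \<le> 6 * K * R\<^sup>2 / c0 * norm (x - y)"
      using cpos[OF that] c0 K nf[of "x - y"] by (intro mult_mono divide_left_mono) auto
    finally have 1: "norm (N t (fst x) - N t (fst y)) \<le> 6 * K * R\<^sup>2 / c0 * norm (x - y)" .
    have "\<bar>\<epsilon> * c1 (\<epsilon> * t) / c (\<epsilon> * t)\<bar> \<le> 1 * A1 / c0"
      using cpos[OF that] c0 A1[of "\<epsilon> * t"] \<epsilon> that unfolding abs_mult abs_divide
      by (intro frac_le mult_mono) auto
    then have 2: "norm ((\<epsilon> * c1 (\<epsilon> * t) / c (\<epsilon> * t)) *\<^sub>R fst (x - y)) \<le> A1 / c0 * norm (x - y)"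
      using nf[of "x - y"] \<open>A1 \<ge> 0\<close> c0 unfolding norm_scaleR by (intro mult_mono) auto
    have 3: "norm (a (\<epsilon> * t) *\<^sub>R (N t (fst x) - N t (fst y))) \<le> A2 * (6 * K * R\<^sup>2 / c0 * norm (x - y))"
      using 1 A2[of "\<epsilon> * t"] \<epsilon> that \<open>A2 \<ge> 0\<close> unfolding norm_scaleR by (intro mult_mono) auto
    have "H t x - H t y = ((\<epsilon> * c1 (\<epsilon> * t) / c (\<epsilon> * t)) *\<^sub>R fst (x - y), a (\<epsilon> * t) *\<^sub>R (N t (fst x) - N t (fst y)))"
      by (simp add: H_def scaleR_diff_right)
    also have "norm \<dots> \<le> norm ((\<epsilon> * c1 (\<epsilon> * t) / c (\<epsilon> * t)) *\<^sub>R fst (x - y)) + norm (a (\<epsilon> * t) *\<^sub>R (N t (fst x) - N t (fst y)))"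
      by (rule norm_Pair_le)
    also have "\<dots> \<le> A1 / c0 * norm (x - y) + A2 * (6 * K * R\<^sup>2 / c0 * norm (x - y))"
      by (intro add_mono 2 3)
    finally show ?thesis
      by (simp add: algebra_simps)
  qed
  have "\<exists>z. z 0 = (p0, q0) \<and> (\<forall>t\<ge>0. (z has_vector_derivative G t (z t)) (at t within {0..}))"
  proof (rule global_lipschitz_ode)
    show "continuous_on {0..} (\<lambda>t. G t (z t))" if "continuous_on {0..} z" for z
      unfolding G_def by (intro continuous_on_rot continuous_on_minus \<sigma>_cont cont_H that)
    show "norm (G t x - G t y) \<le> (A1 / c0 + A2 * (6 * K * R\<^sup>2 / c0)) * norm (x - y)" if "t \<ge> 0" for t x y
      using H_lip[OF that, of "rot \<omega> (\<sigma> t) x" "rot \<omega> (\<sigma> t) y"]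
      by (simp add: G_def rot_diff[symmetric] norm_rot)
    \<comment> \<open>Zero is an equilibrium, since the retraction and the cube both fix it.\<close>
    show "norm (G t 0) \<le> 0" if "t \<ge> 0" for t
    proof -
      have "rot \<omega> s 0 = 0" for s
        using norm_rot[of \<omega> s 0] by simp
      then show ?thesis
        by (simp add: G_def H_def N_def retract_def cube_zero zero_prod_def[symmetric])
    qed
  qed
  then obtain z where z0: "z 0 = (p0, q0)"
    and z: "\<And>t. t \<ge> 0 \<Longrightarrow> (z has_vector_derivative G t (z t)) (at t within {0..})"
    by blast
  have z_cont: "continuous_on {0..} z"
    using z by (auto simp: continuous_on_eq_continuous_within intro: has_vector_derivative_continuous)
  define y where "y t = rot \<omega> (\<sigma> t) (z t)" for t
  define p q where "p t = fst (y t)" and "q t = snd (y t)" for t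
  have y_cont: "continuous_on {0..} y"
    unfolding y_def by (intro continuous_on_rot \<sigma>_cont z_cont)
  then have p_cont: "continuous_on {0..} p" and q_cont: "continuous_on {0..} q"
    unfolding p_def q_def by (auto intro: continuous_on_fst continuous_on_snd)
  have rot_G: "rot \<omega> (\<sigma> t) (G t (z t)) = H t (y t)" for t
    by (simp add: G_def y_def rot_rot rot_zero)
  \<comment> \<open>For a single coordinate the frequency is one finite number, so the rotation may
    be differentiated; this is not possible for the whole vector.\<close>
  have p_deriv: "((\<lambda>s. coord (p s) i) has_real_derivative
        \<omega> i * c (\<epsilon> * t) * coord (q t) i + \<epsilon> * c1 (\<epsilon> * t) / c (\<epsilon> * t) * coord (p t) i) (at t within {0..})"
    and q_deriv: "((\<lambda>s. coord (q s) i) has_real_derivative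
        - (\<omega> i * c (\<epsilon> * t) * coord (p t) i) + a (\<epsilon> * t) * coord (N t (p t)) i) (at t within {0..})"
    if "t \<ge> 0" for t i
  proof -
    have bl: "bounded_linear (\<lambda>x :: 'i ell2 \<times> 'i ell2. coord (fst x) i)" "bounded_linear (\<lambda>x :: 'i ell2 \<times> 'i ell2. coord (snd x) i)"
      by (rule bounded_linear_compose[OF bounded_linear_coord bounded_linear_fst],
          rule bounded_linear_compose[OF bounded_linear_coord bounded_linear_snd])
    have d1: "((\<lambda>s. coord (fst (z s)) i) has_real_derivative coord (fst (G t (z t))) i) (at t within {0..})"
      and d2: "((\<lambda>s. coord (snd (z s)) i) has_real_derivative coord (snd (G t (z t))) i) (at t within {0..})"
      using bounded_linear.has_vector_derivative[OF bl(1) z[OF that]] bounded_linear.has_vector_derivative[OF bl(2) z[OF that]]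
      by (simp_all add: has_real_derivative_iff_has_vector_derivative)
    have e1: "cos (\<omega> i * \<sigma> t) * coord (fst (G t (z t))) i + sin (\<omega> i * \<sigma> t) * coord (snd (G t (z t))) i
        = \<epsilon> * c1 (\<epsilon> * t) / c (\<epsilon> * t) * coord (p t) i"
      using arg_cong[OF rot_G[of t], of "\<lambda>x. coord (fst x) i"] by (simp add: coord_rot H_def p_def)
    have e2: "cos (\<omega> i * \<sigma> t) * coord (snd (G t (z t))) i - sin (\<omega> i * \<sigma> t) * coord (fst (G t (z t))) i
        = a (\<epsilon> * t) * coord (N t (p t)) i"
      using arg_cong[OF rot_G[of t], of "\<lambda>x. coord (snd x) i"] by (simp add: coord_rot H_def p_def)
    have "((\<lambda>s. coord (p s) i) has_real_derivative
        \<omega> i * c (\<epsilon> * t) * coord (q t) i + (cos (\<omega> i * \<sigma> t) * coord (fst (G t (z t))) i + sin (\<omega> i * \<sigma> t) * coord (snd (G t (z t))) i))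
        (at t within {0..})"
      unfolding p_def q_def y_def coord_rot
      by (rule derivative_eq_intros d1 d2 \<sigma>[OF that] refl)+ (simp add: algebra_simps)
    then show "((\<lambda>s. coord (p s) i) has_real_derivative
        \<omega> i * c (\<epsilon> * t) * coord (q t) i + \<epsilon> * c1 (\<epsilon> * t) / c (\<epsilon> * t) * coord (p t) i) (at t within {0..})"
      unfolding e1 .
    have "((\<lambda>s. coord (q s) i) has_real_derivative
        - (\<omega> i * c (\<epsilon> * t) * coord (p t) i) + (cos (\<omega> i * \<sigma> t) * coord (snd (G t (z t))) i - sin (\<omega> i * \<sigma> t) * coord (fst (G t (z t))) i))
        (at t within {0..})"
      unfolding p_def q_def y_def coord_rot
      by (rule derivative_eq_intros d1 d2 \<sigma>[OF that] refl)+ (simp add: algebra_simps)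
    then show "((\<lambda>s. coord (q s) i) has_real_derivative
        - (\<omega> i * c (\<epsilon> * t) * coord (p t) i) + a (\<epsilon> * t) * coord (N t (p t)) i) (at t within {0..})"
      unfolding e2 .
  qed
  have c_deriv': "((\<lambda>s. c (\<epsilon> * s)) has_real_derivative \<epsilon> * c1 (\<epsilon> * t)) (at t within {0..})" if "t \<ge> 0" for t
    by (intro has_real_derivative_scaled_halfline c_deriv \<epsilon> that)
  \<comment> \<open>The derivative of \<open>1 / c\<close> cancels the term with \<open>c1\<close>
    in the equation for \<open>p\<close>, and division by \<open>\<omega>\<close> removes the
    unbounded factor. The remaining derivative is \<open>q\<close>, which is continuous, so the
    coordinates suffice.\<close>
  have u_deriv: "((\<lambda>s. D (p s) /\<^sub>R c (\<epsilon> * s)) has_vector_derivative q t) (at t within {0..})" if "t \<ge> 0" for t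
  proof (rule has_vector_derivative_ell2_halfline[OF _ q_cont that])
    fix i and t :: real
    assume "t \<ge> 0"
    have "((\<lambda>s. (1 / \<omega> i * coord (p s) i) / c (\<epsilon> * s)) has_real_derivative coord (q t) i) (at t within {0..})"
      by (rule DERIV_cong[OF DERIV_divide[OF DERIV_cmult[OF p_deriv] c_deriv']])
        (use cpos[OF \<open>t \<ge> 0\<close>] \<omega>_pos[of i] \<open>t \<ge> 0\<close> in \<open>auto simp: field_simps\<close>)
    moreover have "coord (D (p s) /\<^sub>R c (\<epsilon> * s)) i = (1 / \<omega> i * coord (p s) i) / c (\<epsilon> * s)" for s
      unfolding coord_simps coord_D by (simp add: field_simps)
    ultimately show "((\<lambda>s. coord (D (p s) /\<^sub>R c (\<epsilon> * s)) i) has_real_derivative coord (q t) i) (at t within {0..})"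
      by simp
  qed
  have Dq_deriv: "((\<lambda>s. D (q s)) has_vector_derivative
      - c (\<epsilon> * t) *\<^sub>R p t + a (\<epsilon> * t) *\<^sub>R D (N t (p t))) (at t within {0..})" if "t \<ge> 0" for t
  proof (rule has_vector_derivative_ell2_halfline[OF _ _ that])
    show "continuous_on {0..} (\<lambda>t. - c (\<epsilon> * t) *\<^sub>R p t + a (\<epsilon> * t) *\<^sub>R D (N t (p t)))"
      by (intro continuous_intros ct D.continuous_on cont_N p_cont)
    fix i and t :: real
    assume "t \<ge> 0"
    have "((\<lambda>s. 1 / \<omega> i * coord (q s) i) has_real_derivative
        1 / \<omega> i * (- (\<omega> i * c (\<epsilon> * t) * coord (p t) i) + a (\<epsilon> * t) * coord (N t (p t)) i)) (at t within {0..})"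
      by (intro DERIV_cmult q_deriv \<open>t \<ge> 0\<close>)
    then show "((\<lambda>s. coord (D (q s)) i) has_real_derivative
        coord (- c (\<epsilon> * t) *\<^sub>R p t + a (\<epsilon> * t) *\<^sub>R D (N t (p t))) i) (at t within {0..})"
      using \<omega>_pos[of i] by (simp add: coord_D field_simps)
  qed
  have E_deriv: "((\<lambda>s. (norm (p s))\<^sup>2 + (norm (q s))\<^sup>2) has_real_derivative
      2 * (\<epsilon> * c1 (\<epsilon> * t) / c (\<epsilon> * t) * (norm (p t))\<^sup>2 + a (\<epsilon> * t) * inner (N t (p t)) (q t))) (at t within {0..})"
    if "t \<ge> 0" for t
  proof -
    \<comment> \<open>The rotation is an isometry, so the energy is the squared norm of the
      differentiable curve \<open>z\<close>.\<close>
    have E: "(norm (p s))\<^sup>2 + (norm (q s))\<^sup>2 = inner (z s) (z s)" for s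
    proof -
      have "(norm (p s))\<^sup>2 + (norm (q s))\<^sup>2 = (norm (y s))\<^sup>2"
        by (simp add: p_def q_def norm_prod_def)
      then show ?thesis
        by (simp add: y_def norm_rot power2_norm_eq_inner)
    qed
    have "inner (z t) (G t (z t)) = inner (y t) (H t (y t))"
      by (simp add: G_def y_def inner_rot)
    also have "\<dots> = \<epsilon> * c1 (\<epsilon> * t) / c (\<epsilon> * t) * (norm (p t))\<^sup>2 + a (\<epsilon> * t) * inner (N t (p t)) (q t)"
      by (simp add: H_def inner_prod_def p_def q_def power2_norm_eq_inner inner_commute)
    finally have "2 * (\<epsilon> * c1 (\<epsilon> * t) / c (\<epsilon> * t) * (norm (p t))\<^sup>2 + a (\<epsilon> * t) * inner (N t (p t)) (q t))
        = inner (z t) (G t (z t)) + inner (G t (z t)) (z t)"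
      by (simp add: inner_commute)
    then show ?thesis
      unfolding E has_real_derivative_iff_has_vector_derivative
      using bounded_bilinear.has_vector_derivative[OF bounded_bilinear_inner z[OF that] z[OF that]] by simp
  qed
  have "\<sigma> 0 = 0"
    by (simp add: \<sigma>_def)
  then have "p 0 = p0" "q 0 = q0"
    by (simp_all add: p_def q_def y_def rot_zero z0)
  then show ?thesis
    using p_cont q_cont u_deriv Dq_deriv E_deriv unfolding N_def truncated_wave_def by blast
qed

end

section \<open>Coefficients of the corrected invariant and their bounds\<close>

definition bounded_halfline :: "(real \<Rightarrow> real) \<Rightarrow> bool" where
  "bounded_halfline f \<longleftrightarrow> (\<exists>B. \<forall>\<tau>\<ge>0. \<bar>f \<tau>\<bar> \<le> B)"

text \<open>With these closure rules the bounds on \<open>b\<close>, \<open>b1\<close>,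
  \<open>b2\<close>, \<open>g\<close> and \<open>g1\<close> follow from the form of their formulas,
  once the reciprocal of \<open>c\<close> is known to be bounded.\<close>

lemma bounded_halfline_intros:
  shows "bounded (f ` {0..}) \<Longrightarrow> bounded_halfline f"
    and "bounded_halfline f \<Longrightarrow> bounded_halfline g \<Longrightarrow> bounded_halfline (\<lambda>\<tau>. f \<tau> + g \<tau>)"
    and "bounded_halfline f \<Longrightarrow> bounded_halfline g \<Longrightarrow> bounded_halfline (\<lambda>\<tau>. f \<tau> - g \<tau>)"
    and "bounded_halfline f \<Longrightarrow> bounded_halfline g \<Longrightarrow> bounded_halfline (\<lambda>\<tau>. f \<tau> * g \<tau>)"
    and "bounded_halfline (\<lambda>_. r)"
proof -
  show "bounded (f ` {0..}) \<Longrightarrow> bounded_halfline f"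
    by (auto simp: bounded_iff bounded_halfline_def)
  show "bounded_halfline (\<lambda>_. r)"
    by (auto simp: bounded_halfline_def)
  assume "bounded_halfline f" "bounded_halfline g"
  then obtain B1 B2 where B: "\<And>\<tau>. \<tau> \<ge> 0 \<Longrightarrow> \<bar>f \<tau>\<bar> \<le> B1" "\<And>\<tau>. \<tau> \<ge> 0 \<Longrightarrow> \<bar>g \<tau>\<bar> \<le> B2"
    by (auto simp: bounded_halfline_def)
  have "\<bar>f \<tau> + g \<tau>\<bar> \<le> B1 + B2" "\<bar>f \<tau> - g \<tau>\<bar> \<le> B1 + B2" if "\<tau> \<ge> 0" for \<tau>
    using B(1)[OF that] B(2)[OF that] by linarith+
  then show "bounded_halfline (\<lambda>\<tau>. f \<tau> + g \<tau>)" "bounded_halfline (\<lambda>\<tau>. f \<tau> - g \<tau>)"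
    unfolding bounded_halfline_def by blast+
  have "\<bar>f \<tau> * g \<tau>\<bar> \<le> B1 * B2" if "\<tau> \<ge> 0" for \<tau>
    using B(1)[OF that] B(2)[OF that] unfolding abs_mult by (intro mult_mono) auto
  then show "bounded_halfline (\<lambda>\<tau>. f \<tau> * g \<tau>)"
    unfolding bounded_halfline_def by blast
qed

context slow_wave
begin

text \<open>Chosen so that the quadratic part of the derivative of \<open>invariant\<close> is
  \<open>\<epsilon> * b (\<epsilon> * t)\<close> times the difference of the squared norms of
  \<open>p\<close> and \<open>q\<close>.\<close>

definition b :: "real \<Rightarrow> real" where
  "b \<tau> = c1 \<tau> / (2 * (c \<tau>)\<^sup>2)"

definition b1 :: "real \<Rightarrow> real" where
  "b1 \<tau> = c2 \<tau> / (2 * (c \<tau>)\<^sup>2) - (c1 \<tau>)\<^sup>2 / (c \<tau>) ^ 3"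

definition b2 :: "real \<Rightarrow> real" where
  "b2 \<tau> = c3 \<tau> / (2 * (c \<tau>)\<^sup>2) - 3 * c1 \<tau> * c2 \<tau> / (c \<tau>) ^ 3 + 3 * (c1 \<tau>) ^ 3 / (c \<tau>) ^ 4"

text \<open>The work of the cubic force enters the derivative of \<open>invariant\<close> with the
  factor \<open>a / c\<close>. The 4 compensates the one in the derivative of
  \<open>quartic\<close>.\<close>

definition g :: "real \<Rightarrow> real" where
  "g \<tau> = a \<tau> / (4 * c \<tau>)"

definition g1 :: "real \<Rightarrow> real" where
  "g1 \<tau> = a1 \<tau> / (4 * c \<tau>) - a \<tau> * c1 \<tau> / (4 * (c \<tau>)\<^sup>2)"

lemma b_deriv: "\<tau> \<ge> 0 \<Longrightarrow> (b has_real_derivative b1 \<tau>) (at \<tau> within {0..})"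
  unfolding b_def[abs_def] b1_def using c_pos[of \<tau>]
  by (auto intro!: derivative_eq_intros c_deriv c1_deriv simp: field_simps power2_eq_square power3_eq_cube)

lemma b1_deriv: "\<tau> \<ge> 0 \<Longrightarrow> (b1 has_real_derivative b2 \<tau>) (at \<tau> within {0..})"
  unfolding b1_def[abs_def] b2_def using c_pos[of \<tau>]
  by (intro DERIV_cong[OF DERIV_diff[OF DERIV_divide[OF c2_deriv DERIV_cmult[OF DERIV_power[OF c_deriv]]]
          DERIV_divide[OF DERIV_power[OF c1_deriv] DERIV_power[OF c_deriv]]]])
    (auto simp: field_simps power2_eq_square power3_eq_cube power4_eq_xxxx)

lemma g_deriv: "\<tau> \<ge> 0 \<Longrightarrow> (g has_real_derivative g1 \<tau>) (at \<tau> within {0..})"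
  unfolding g_def[abs_def] g1_def using c_pos[of \<tau>]
  by (auto intro!: derivative_eq_intros c_deriv a_deriv simp: field_simps power2_eq_square)

lemma coeff_bound:
  obtains B where "B \<ge> 1" "\<And>\<tau>. \<tau> \<ge> 0 \<Longrightarrow>
    \<bar>a \<tau>\<bar> \<le> B \<and> \<bar>c \<tau>\<bar> \<le> B \<and> \<bar>b \<tau>\<bar> \<le> B \<and> \<bar>b1 \<tau>\<bar> \<le> B \<and> \<bar>b2 \<tau>\<bar> \<le> B \<and> \<bar>g \<tau>\<bar> \<le> B \<and> \<bar>g1 \<tau>\<bar> \<le> B"
proof -
  note bds = bounded_coeffs[THEN bounded_halfline_intros(1)]
  have inv: "bounded_halfline (\<lambda>\<tau>. inverse (c \<tau>))"
    unfolding bounded_halfline_def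
  proof (intro exI[of _ "inverse c0"] allI impI)
    fix \<tau> :: real assume "\<tau> \<ge> 0"
    then show "\<bar>inverse (c \<tau>)\<bar> \<le> inverse c0"
      using c_ge[of \<tau>] c0 by (simp add: le_imp_inverse_le)
  qed
  note intros = bounded_halfline_intros(2-5) bds inv
  have bd: "bounded_halfline b" "bounded_halfline b1" "bounded_halfline b2" "bounded_halfline g" "bounded_halfline g1"
    unfolding b_def[abs_def] b1_def[abs_def] b2_def[abs_def] g_def[abs_def] g1_def[abs_def]
      divide_inverse inverse_mult_distrib power2_eq_square power3_eq_cube power4_eq_xxxx
    by (intro intros)+
  obtain B1 where B1: "\<And>\<tau>. \<tau> \<ge> 0 \<Longrightarrow> \<bar>a \<tau>\<bar> \<le> B1"
    using bds(5) unfolding bounded_halfline_def by blast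
  obtain B2 where B2: "\<And>\<tau>. \<tau> \<ge> 0 \<Longrightarrow> \<bar>c \<tau>\<bar> \<le> B2"
    using bds(1) unfolding bounded_halfline_def by blast
  obtain B3 where B3: "\<And>\<tau>. \<tau> \<ge> 0 \<Longrightarrow> \<bar>b \<tau>\<bar> \<le> B3"
    using bd(1) unfolding bounded_halfline_def by blast
  obtain B4 where B4: "\<And>\<tau>. \<tau> \<ge> 0 \<Longrightarrow> \<bar>b1 \<tau>\<bar> \<le> B4"
    using bd(2) unfolding bounded_halfline_def by blast
  obtain B5 where B5: "\<And>\<tau>. \<tau> \<ge> 0 \<Longrightarrow> \<bar>b2 \<tau>\<bar> \<le> B5"
    using bd(3) unfolding bounded_halfline_def by blast
  obtain B6 where B6: "\<And>\<tau>. \<tau> \<ge> 0 \<Longrightarrow> \<bar>g \<tau>\<bar> \<le> B6"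
    using bd(4) unfolding bounded_halfline_def by blast
  obtain B7 where B7: "\<And>\<tau>. \<tau> \<ge> 0 \<Longrightarrow> \<bar>g1 \<tau>\<bar> \<le> B7"
    using bd(5) unfolding bounded_halfline_def by blast
  note Bs = B1 B2 B3 B4 B5 B6 B7
  have nonneg: "0 \<le> B1" "0 \<le> B2" "0 \<le> B3" "0 \<le> B4" "0 \<le> B5" "0 \<le> B6" "0 \<le> B7"
    using Bs[of 0, THEN order_trans[OF abs_ge_zero]] by simp_all
  show thesis
  proof (rule that[of "1 + B1 + B2 + B3 + B4 + B5 + B6 + B7"], goal_cases)
    case (2 \<tau>)
    show ?case
      by (intro conjI Bs[OF 2, THEN order_trans]) (use nonneg in simp_all)
  qed (use nonneg in simp)
qed

text \<open>
  Adding to \<open>I\<close> the terms in this definition removes from \<open>dI/dt\<close> all contributions that are larger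
  than \<open>\<epsilon>\<^sup>5\<close>: the two parts of the energy are compared through the derivative of \<open>\<langle>u, q\<rangle>\<close>, which is in
  turn half the derivative of \<open>\<parallel>u\<parallel>\<^sup>2\<close>, and the work of the cubic force is the derivative of \<open>quartic\<close>.
\<close>

definition invariant :: "real \<Rightarrow> (real \<Rightarrow> 'i ell2) \<Rightarrow> (real \<Rightarrow> 'i ell2) \<Rightarrow> real \<Rightarrow> real" where
  "invariant \<epsilon> p q t = ((norm (p t))\<^sup>2 + (norm (q t))\<^sup>2) / (2 * c (\<epsilon> * t))"

definition corrector :: "real \<Rightarrow> (real \<Rightarrow> 'i ell2) \<Rightarrow> (real \<Rightarrow> 'i ell2) \<Rightarrow> real \<Rightarrow> real" where
  "corrector \<epsilon> p q t = \<epsilon> * b (\<epsilon> * t) * inner (D (p t) /\<^sub>R c (\<epsilon> * t)) (q t)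
     - \<epsilon>\<^sup>2 * b1 (\<epsilon> * t) * (norm (D (p t) /\<^sub>R c (\<epsilon> * t)))\<^sup>2 / 2
     - g (\<epsilon> * t) * quartic (p t /\<^sub>R c (\<epsilon> * t))"

lemma corrected_derivative:
  assumes \<epsilon>: "0 < \<epsilon>" and R: "R > 0" and sol: "truncated_wave \<epsilon> R p q" and t: "t \<ge> 0"
    and small: "norm (p t /\<^sub>R c (\<epsilon> * t)) \<le> R"
  shows "((\<lambda>s. invariant \<epsilon> p q s + corrector \<epsilon> p q s) has_real_derivative
     \<epsilon> * (b (\<epsilon> * t) * a (\<epsilon> * t) - g1 (\<epsilon> * t)) * quartic (p t /\<^sub>R c (\<epsilon> * t))
       - \<epsilon> ^ 3 * b2 (\<epsilon> * t) * (norm (D (p t) /\<^sub>R c (\<epsilon> * t)))\<^sup>2 / 2) (at t within {0..})"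
proof -
  let ?F = "at t within {0..}"
  define w u where "w s = p s /\<^sub>R c (\<epsilon> * s)" and "u s = D (p s) /\<^sub>R c (\<epsilon> * s)" for s
  have uw: "u s = D (w s)" for s
    by (simp add: u_def w_def D.scaleR)
  have cp: "c (\<epsilon> * t) > 0"
    using \<epsilon> t by (intro c_pos) simp
  have id: "retract R (w t) = w t"
    using retract_id[OF R small] by (simp add: w_def)
  have pw: "p t = c (\<epsilon> * t) *\<^sub>R w t"
    using cp by (simp add: w_def)
  have cont: "continuous_on {0..} p" "continuous_on {0..} q"
    and u': "(u has_vector_derivative q t) ?F"
    and Dq': "((\<lambda>s. D (q s)) has_vector_derivative - c (\<epsilon> * t) *\<^sub>R p t + a (\<epsilon> * t) *\<^sub>R D (cube (w t))) ?F"
    and E': "((\<lambda>s. (norm (p s))\<^sup>2 + (norm (q s))\<^sup>2) has_real_derivative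
          2 * (\<epsilon> * c1 (\<epsilon> * t) / c (\<epsilon> * t) * (norm (p t))\<^sup>2 + a (\<epsilon> * t) * inner (cube (w t)) (q t))) ?F"
    using sol t id unfolding truncated_wave_def u_def[abs_def] w_def by auto
  note lims = cont[unfolded continuous_on_def, rule_format, of t, simplified, OF t]
  have c': "((\<lambda>s. c (\<epsilon> * s)) has_real_derivative \<epsilon> * c1 (\<epsilon> * t)) ?F"
    and b': "((\<lambda>s. b (\<epsilon> * s)) has_real_derivative \<epsilon> * b1 (\<epsilon> * t)) ?F"
    and b1': "((\<lambda>s. b1 (\<epsilon> * s)) has_real_derivative \<epsilon> * b2 (\<epsilon> * t)) ?F"
    and g': "((\<lambda>s. g (\<epsilon> * s)) has_real_derivative \<epsilon> * g1 (\<epsilon> * t)) ?F"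
    by (intro has_real_derivative_scaled_halfline c_deriv b_deriv b1_deriv g_deriv \<epsilon> t; assumption)+
  have w_lim: "(w \<longlongrightarrow> w t) ?F"
    unfolding w_def using lims(1) DERIV_continuous[OF c'] cp
    by (intro tendsto_scaleR tendsto_inverse) (auto simp: continuous_within)
  have V': "((\<lambda>s. quartic (w s)) has_real_derivative 4 * inner (cube (w t)) (q t)) ?F"
    using w_lim u' unfolding uw[abs_def] by (rule quartic_has_derivative)
  have Y': "((\<lambda>s. (norm (u s))\<^sup>2) has_real_derivative 2 * inner (u t) (q t)) ?F"
    using bounded_bilinear.has_vector_derivative[OF bounded_bilinear_inner u' u']
    by (simp add: has_real_derivative_iff_has_vector_derivative power2_norm_eq_inner inner_commute)
  \<comment> \<open>The curve \<open>q\<close> has no derivative in the space, but pairing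
    \<open>u t = D (w t)\<close> with an increment of \<open>q\<close> is pairing \<open>w t\<close>
    with an increment of \<open>D q\<close>, which has one. The other half of the quotient needs
    \<open>q\<close> only as a limit.\<close>
  have X': "((\<lambda>s. inner (u s) (q s)) has_real_derivative
      (norm (q t))\<^sup>2 - (norm (p t))\<^sup>2 + a (\<epsilon> * t) * quartic (w t)) ?F"
  proof -
    have "((\<lambda>s. inner ((u s - u t) /\<^sub>R (s - t)) (q s) + inner (w t) ((D (q s) - D (q t)) /\<^sub>R (s - t)))
        \<longlongrightarrow> inner (q t) (q t) + inner (w t) (- c (\<epsilon> * t) *\<^sub>R p t + a (\<epsilon> * t) *\<^sub>R D (cube (w t)))) ?F"
      using u' Dq' lims(2) unfolding has_vector_derivative_quotient by (intro tendsto_intros)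
    moreover have "inner (q t) (q t) + inner (w t) (- c (\<epsilon> * t) *\<^sub>R p t + a (\<epsilon> * t) *\<^sub>R D (cube (w t)))
        = (norm (q t))\<^sup>2 - (norm (p t))\<^sup>2 + a (\<epsilon> * t) * quartic (w t)"
    proof -
      have "inner (w t) (D (cube (w t))) = quartic (w t)"
        unfolding quartic_def by (subst inner_commute) (rule inner_D_commute)
      moreover have "c (\<epsilon> * t) * inner (w t) (p t) = (norm (p t))\<^sup>2"
        unfolding power2_norm_eq_inner pw by simp
      ultimately show ?thesis
        by (simp add: inner_add_right inner_diff_right power2_norm_eq_inner[of "q t"])
    qed
    moreover have "inner ((u s - u t) /\<^sub>R (s - t)) (q s) + inner (w t) ((D (q s) - D (q t)) /\<^sub>R (s - t))
        = (inner (u s) (q s) - inner (u t) (q t)) / (s - t)" for s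
    proof -
      have "inner (w t) (D v) = inner (u t) v" for v
        by (simp add: uw inner_D_commute)
      then show ?thesis
        by (simp add: divide_inverse inner_diff_left inner_diff_right algebra_simps)
    qed
    ultimately show ?thesis
      by (simp add: has_field_derivative_iff)
  qed
  \<comment> \<open>In this notation the derivative of \<open>X\<close> is \<open>Q - P\<close> up
    to a multiple of \<open>V\<close>, that of \<open>Y\<close> is \<open>2 * X\<close>, and that of
    \<open>V\<close> is \<open>4 * N\<close>. Thus \<open>b\<close> with \<open>X\<close> removes
    \<open>P - Q\<close>, \<open>b1\<close> with \<open>Y\<close> removes the \<open>X\<close> left
    over, and \<open>g\<close> with \<open>V\<close> removes \<open>N\<close>.\<close>
  define P Q V X Y N where "P = (norm (p t))\<^sup>2" and "Q = (norm (q t))\<^sup>2" and "V = quartic (w t)"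
    and "X = inner (u t) (q t)" and "Y = (norm (u t))\<^sup>2" and "N = inner (cube (w t)) (q t)"
  note deriv = DERIV_add[OF DERIV_divide[OF E' DERIV_cmult[OF c', of 2]]
      DERIV_diff[OF DERIV_diff[OF DERIV_mult[OF DERIV_cmult[OF b', of \<epsilon>] X']
          DERIV_cdivide[OF DERIV_mult[OF DERIV_cmult[OF b1', of "\<epsilon>\<^sup>2"] Y'], of 2]] DERIV_mult[OF g' V']],
      folded P_def Q_def V_def X_def Y_def N_def]
  \<comment> \<open>Expressing \<open>c1\<close> and \<open>a\<close> through \<open>b\<close> and
    \<open>g\<close> makes the cancellation a polynomial identity.\<close>
  have c1: "c1 (\<epsilon> * t) = 2 * (c (\<epsilon> * t))\<^sup>2 * b (\<epsilon> * t)" and a: "a (\<epsilon> * t) = 4 * c (\<epsilon> * t) * g (\<epsilon> * t)"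
    using cp by (simp_all add: b_def g_def)
  define ct bt b1t b2t gt g1t where defs: "ct = c (\<epsilon> * t)" "bt = b (\<epsilon> * t)" "b1t = b1 (\<epsilon> * t)"
    "b2t = b2 (\<epsilon> * t)" "gt = g (\<epsilon> * t)" "g1t = g1 (\<epsilon> * t)"
  have "ct > 0"
    using cp by (simp add: defs)
  have energy: "(2 * (\<epsilon> * (2 * ct\<^sup>2 * bt) / ct * P + 4 * ct * gt * N) * (2 * ct) -
      (P + Q) * (2 * (\<epsilon> * (2 * ct\<^sup>2 * bt)))) / (2 * ct * (2 * ct)) = \<epsilon> * bt * (P - Q) + 4 * gt * N"
    using \<open>ct > 0\<close> by (simp add: field_simps power2_eq_square)
  show ?thesis
    unfolding invariant_def corrector_def u_def[symmetric] w_def[symmetric] V_def[symmetric] Y_def[symmetric]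
    by (rule DERIV_cong[OF deriv[unfolded c1 a]], unfold c1 a defs[symmetric] energy)
      (use \<open>ct > 0\<close> in \<open>simp_all add: algebra_simps power2_eq_square power3_eq_cube\<close>)
qed

text \<open>The constants depend on \<rho> but not on \<epsilon>, on the solution or on the time.
  The condition relating \<rho> to \<open>R\<close> guarantees that the retraction acts as the
  identity as long as the energy bound holds.\<close>

lemma invariant_estimate:
  assumes "\<rho> > 0" "\<rho> / c0 \<le> R"
  obtains C C' where "C \<ge> 0" "C' \<ge> 0"
    "\<And>\<epsilon> p q t. \<lbrakk>0 < \<epsilon>; \<epsilon> \<le> 1; truncated_wave \<epsilon> R p q; t \<ge> 0;
        \<And>s. s \<in> {0..t} \<Longrightarrow> (norm (p s))\<^sup>2 + (norm (q s))\<^sup>2 \<le> (\<rho> * \<epsilon>)\<^sup>2\<rbrakk>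
      \<Longrightarrow> \<bar>invariant \<epsilon> p q t - invariant \<epsilon> p q 0\<bar> \<le> C * \<epsilon> ^ 3 + C' * t * \<epsilon> ^ 5"
proof -
  obtain B where B: "B \<ge> 1" "\<And>\<tau>. \<tau> \<ge> 0 \<Longrightarrow>
    \<bar>a \<tau>\<bar> \<le> B \<and> \<bar>c \<tau>\<bar> \<le> B \<and> \<bar>b \<tau>\<bar> \<le> B \<and> \<bar>b1 \<tau>\<bar> \<le> B \<and> \<bar>b2 \<tau>\<bar> \<le> B \<and> \<bar>g \<tau>\<bar> \<le> B \<and> \<bar>g1 \<tau>\<bar> \<le> B"
    using coeff_bound by blast
  \<comment> \<open>\<open>k2\<close> bounds the norm of \<open>u\<close> relative to \<epsilon>,
    and \<open>k4\<close> bounds \<open>quartic\<close> relative to the fourth power of \<epsilon>.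
    The three summands of \<open>C\<close> belong to the three terms of the corrector.\<close>
  define k2 k4 where "k2 = \<rho> / (c0 * \<omega>0)" and "k4 = K / \<omega>0 * (\<rho> / c0) ^ 4"
  have k: "k2 \<ge> 0" "k4 \<ge> 0"
    using assms c0 \<omega>0 K by (auto simp: k2_def k4_def)
  define C where "C = B * (k2 * \<rho>) + B * k2\<^sup>2 / 2 + B * k4"
  define C' where "C' = (B * B + B) * k4 + B * k2\<^sup>2 / 2"
  have R: "R > 0"
    using assms c0 by (meson divide_pos_pos less_le_trans)
  have C: "C \<ge> 0" "C' \<ge> 0"
    using k B(1) assms by (auto simp: C_def C'_def)
  show thesis
  \<comment> \<open>The factor 2 appears because the corrector has to be removed at time
    \<open>t\<close> and at time 0.\<close>
  proof (rule that[of "2 * C" C'])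
    fix \<epsilon> p q t
    assume \<epsilon>: "0 < \<epsilon>" "\<epsilon> \<le> 1" and sol: "truncated_wave \<epsilon> R p q" and t: "t \<ge> 0"
      and small: "\<And>s. s \<in> {0..t} \<Longrightarrow> (norm (p s))\<^sup>2 + (norm (q s))\<^sup>2 \<le> (\<rho> * \<epsilon>)\<^sup>2"
    define w u where "w s = p s /\<^sub>R c (\<epsilon> * s)" and "u s = D (p s) /\<^sub>R c (\<epsilon> * s)" for s
    have pw: "norm (p s) \<le> \<rho> * \<epsilon>" "norm (q s) \<le> \<rho> * \<epsilon>" "norm (w s) \<le> \<rho> / c0 * \<epsilon>" "norm (w s) \<le> R"
        "norm (u s) \<le> k2 * \<epsilon>" "\<bar>quartic (w s)\<bar> \<le> k4 * \<epsilon> ^ 4" if "s \<in> {0..t}" for s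
    proof -
      have pos: "\<rho> * \<epsilon> \<ge> 0"
        using \<epsilon> assms by simp
      show p: "norm (p s) \<le> \<rho> * \<epsilon>"
        by (rule power2_le_imp_le[OF _ pos]) (use small[OF that] zero_le_power2[of "norm (q s)"] in linarith)
      show "norm (q s) \<le> \<rho> * \<epsilon>"
        by (rule power2_le_imp_le[OF _ pos]) (use small[OF that] zero_le_power2[of "norm (p s)"] in linarith)
      have cp: "c (\<epsilon> * s) \<ge> c0" "c (\<epsilon> * s) > 0"
        using that \<epsilon> by (auto intro: c_ge c_pos)
      have "norm (w s) = norm (p s) / c (\<epsilon> * s)"
        using cp by (simp add: w_def divide_inverse mult.commute)
      also have "\<dots> \<le> \<rho> * \<epsilon> / c0"
        using p cp c0 pos by (intro frac_le) auto
      finally show w: "norm (w s) \<le> \<rho> / c0 * \<epsilon>"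
        by simp
      also have "\<dots> \<le> \<rho> / c0 * 1"
        using \<epsilon> assms c0 by (intro mult_left_mono) auto
      finally show "norm (w s) \<le> R"
        using assms by simp
      have "norm (u s) \<le> 1 / \<omega>0 * norm (w s)"
        using norm_D_le[where x = "w s"] by (simp add: u_def w_def D.scaleR)
      also have "\<dots> \<le> 1 / \<omega>0 * (\<rho> / c0 * \<epsilon>)"
        using w \<omega>0 by (intro mult_left_mono) auto
      finally show "norm (u s) \<le> k2 * \<epsilon>"
        by (simp add: k2_def mult.commute)
      have "\<bar>quartic (w s)\<bar> \<le> K / \<omega>0 * norm (w s) ^ 4"
        by (rule abs_quartic_le)
      also have "\<dots> \<le> K / \<omega>0 * (\<rho> / c0 * \<epsilon>) ^ 4"
        using w K \<omega>0 by (intro mult_left_mono power_mono) auto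
      finally show "\<bar>quartic (w s)\<bar> \<le> k4 * \<epsilon> ^ 4"
        by (simp add: k4_def power_mult_distrib power_divide mult_ac)
    qed
    have u2: "(norm (u s))\<^sup>2 \<le> k2\<^sup>2 * \<epsilon>\<^sup>2" if "s \<in> {0..t}" for s
      using power_mono[OF pw(5)[OF that], of 2] by (simp add: power_mult_distrib)
    have Bs: "\<bar>a (\<epsilon> * s)\<bar> \<le> B" "\<bar>b (\<epsilon> * s)\<bar> \<le> B" "\<bar>b1 (\<epsilon> * s)\<bar> \<le> B" "\<bar>b2 (\<epsilon> * s)\<bar> \<le> B" "\<bar>g (\<epsilon> * s)\<bar> \<le> B" "\<bar>g1 (\<epsilon> * s)\<bar> \<le> B"
      if "s \<in> {0..t}" for s
      using B(2)[of "\<epsilon> * s"] that \<epsilon> by auto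
    have corr: "\<bar>corrector \<epsilon> p q s\<bar> \<le> C * \<epsilon> ^ 3" if "s \<in> {0..t}" for s
    proof -
      have x: "\<bar>\<epsilon> * b (\<epsilon> * s) * inner (u s) (q s)\<bar> \<le> \<epsilon> * B * ((k2 * \<epsilon>) * (\<rho> * \<epsilon>))"
      proof -
        have "\<bar>inner (u s) (q s)\<bar> \<le> (k2 * \<epsilon>) * (\<rho> * \<epsilon>)"
          using pw(5)[OF that] pw(2)[OF that] k \<epsilon>
          by (intro order_trans[OF Cauchy_Schwarz_ineq2] mult_mono) auto
        then show ?thesis
          unfolding abs_mult using Bs[OF that] B(1) \<epsilon> by (intro mult_mono) auto
      qed
      have y: "\<bar>\<epsilon>\<^sup>2 * b1 (\<epsilon> * s) * (norm (u s))\<^sup>2 / 2\<bar> \<le> \<epsilon>\<^sup>2 * B * (k2\<^sup>2 * \<epsilon>\<^sup>2) / 2"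
        unfolding abs_mult abs_divide abs_numeral using Bs[OF that] B(1) \<epsilon> u2[OF that]
        by (intro mult_mono divide_right_mono) auto
      have z: "\<bar>g (\<epsilon> * s) * quartic (w s)\<bar> \<le> B * (k4 * \<epsilon> ^ 4)"
        unfolding abs_mult using Bs[OF that] B(1) by (intro mult_mono pw that) auto
      \<comment> \<open>Two of the three terms of the corrector are of order 4 and are absorbed into
        order 3.\<close>
      have e4: "\<epsilon> ^ 4 \<le> \<epsilon> ^ 3"
        using \<epsilon> by (intro power_decreasing) auto
      have "\<bar>corrector \<epsilon> p q s\<bar> \<le> \<epsilon> * B * ((k2 * \<epsilon>) * (\<rho> * \<epsilon>)) + \<epsilon>\<^sup>2 * B * (k2\<^sup>2 * \<epsilon>\<^sup>2) / 2 + B * (k4 * \<epsilon> ^ 4)"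
        unfolding corrector_def u_def[symmetric] w_def[symmetric] using x y z by linarith
      also have "\<dots> = B * (k2 * \<rho>) * \<epsilon> ^ 3 + (B * k2\<^sup>2 / 2 + B * k4) * \<epsilon> ^ 4"
        by (simp add: algebra_simps power2_eq_square power3_eq_cube power4_eq_xxxx)
      also have "\<dots> \<le> B * (k2 * \<rho>) * \<epsilon> ^ 3 + (B * k2\<^sup>2 / 2 + B * k4) * \<epsilon> ^ 3"
        using e4 B(1) k by (intro add_left_mono mult_left_mono) auto
      finally show ?thesis
        by (simp add: C_def algebra_simps)
    qed
    define M where "M s = invariant \<epsilon> p q s + corrector \<epsilon> p q s" for s
    \<comment> \<open>The sum of invariant and corrector has a derivative of order 5, so the mean
      value inequality gives the part that grows with time.\<close>
    have "norm (M t - M 0) \<le> C' * \<epsilon> ^ 5 * norm (t - 0)"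
    proof (rule field_differentiable_bound[of "{0..t}"])
      fix s assume s: "s \<in> {0..t}"
      show "(M has_real_derivative \<epsilon> * (b (\<epsilon> * s) * a (\<epsilon> * s) - g1 (\<epsilon> * s)) * quartic (w s)
         - \<epsilon> ^ 3 * b2 (\<epsilon> * s) * (norm (u s))\<^sup>2 / 2) (at s within {0..t})"
        unfolding M_def[abs_def] u_def w_def using s pw(4)[OF s]
        by (intro DERIV_subset[OF corrected_derivative[OF \<epsilon>(1) R sol]]) (auto simp: w_def)
      have "\<bar>b (\<epsilon> * s) * a (\<epsilon> * s)\<bar> \<le> B * B"
        unfolding abs_mult using Bs[OF s] B(1) by (intro mult_mono) auto
      then have "\<bar>b (\<epsilon> * s) * a (\<epsilon> * s) - g1 (\<epsilon> * s)\<bar> \<le> B * B + B"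
        using Bs(6)[OF s] by linarith
      then have x: "\<bar>\<epsilon> * (b (\<epsilon> * s) * a (\<epsilon> * s) - g1 (\<epsilon> * s)) * quartic (w s)\<bar> \<le> \<epsilon> * (B * B + B) * (k4 * \<epsilon> ^ 4)"
        unfolding abs_mult using \<epsilon> B(1) by (intro mult_mono pw s) auto
      have y: "\<bar>\<epsilon> ^ 3 * b2 (\<epsilon> * s) * (norm (u s))\<^sup>2 / 2\<bar> \<le> \<epsilon> ^ 3 * B * (k2\<^sup>2 * \<epsilon>\<^sup>2) / 2"
        unfolding abs_mult abs_divide abs_numeral using Bs[OF s] B(1) \<epsilon> u2[OF s]
        by (intro mult_mono divide_right_mono) auto
      have "\<bar>\<epsilon> * (b (\<epsilon> * s) * a (\<epsilon> * s) - g1 (\<epsilon> * s)) * quartic (w s)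
         - \<epsilon> ^ 3 * b2 (\<epsilon> * s) * (norm (u s))\<^sup>2 / 2\<bar> \<le> \<epsilon> * (B * B + B) * (k4 * \<epsilon> ^ 4) + \<epsilon> ^ 3 * B * (k2\<^sup>2 * \<epsilon>\<^sup>2) / 2"
        using x y by linarith
      also have "\<dots> = C' * \<epsilon> ^ 5"
        by (simp add: C'_def algebra_simps eval_nat_numeral)
      finally show "norm (\<epsilon> * (b (\<epsilon> * s) * a (\<epsilon> * s) - g1 (\<epsilon> * s)) * quartic (w s)
         - \<epsilon> ^ 3 * b2 (\<epsilon> * s) * (norm (u s))\<^sup>2 / 2) \<le> C' * \<epsilon> ^ 5"
        by simp
    qed (use t in auto)
    then have "\<bar>M t - M 0\<bar> \<le> C' * t * \<epsilon> ^ 5"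
      using t by (simp add: mult_ac)
    then show "\<bar>invariant \<epsilon> p q t - invariant \<epsilon> p q 0\<bar> \<le> 2 * C * \<epsilon> ^ 3 + C' * t * \<epsilon> ^ 5"
      using corr[of t] corr[of 0] t unfolding M_def by auto
  qed (use C in auto)
qed

text \<open>A bootstrap on the energy. The estimate of the invariant presupposes that the energy
  stays below \<open>(\<rho> * \<epsilon>)\<^sup>2\<close>, and in turn shows, for small
  \<open>t1 * \<epsilon> ^ 3\<close>, that it stays strictly below. Hence the truncation is never
  active on the interval.\<close>

theorem long_time_invariant:
  "\<exists>\<epsilon>0>0. \<exists>\<kappa>>0. \<exists>C\<ge>0. \<exists>C'\<ge>0. \<epsilon>0 \<le> 1 \<and> (\<forall>\<epsilon> w0 v0 t1. 0 < \<epsilon> \<and> \<epsilon> \<le> \<epsilon>0 \<and>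
     norm w0 \<le> C0 * \<epsilon> \<and> norm v0 \<le> C0 * \<epsilon> \<and> t1 * \<epsilon> ^ 3 \<le> \<kappa> \<longrightarrow>
     (\<exists>p q. p 0 = c 0 *\<^sub>R w0 \<and> q 0 = v0 \<and> continuous_on {0..} p \<and> continuous_on {0..} q \<and>
       (\<forall>t\<in>{0..t1}.
         ((\<lambda>s. D (p s) /\<^sub>R c (\<epsilon> * s)) has_vector_derivative q t) (at t within {0..}) \<and>
         ((\<lambda>s. D (q s)) has_vector_derivative
            - c (\<epsilon> * t) *\<^sub>R p t + a (\<epsilon> * t) *\<^sub>R D (cube (p t /\<^sub>R c (\<epsilon> * t)))) (at t within {0..}) \<and>
         \<bar>invariant \<epsilon> p q t - invariant \<epsilon> p q 0\<bar> \<le> C * \<epsilon> ^ 3 + C' * t * \<epsilon> ^ 5)))"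
proof -
  obtain B where B: "B \<ge> 1" "\<And>\<tau>. \<tau> \<ge> 0 \<Longrightarrow> c \<tau> \<le> B"
    using coeff_bound by (metis abs_le_D1)
  \<comment> \<open>Bounds the initial energy relative to the square of \<epsilon>:
    \<open>norm (p 0)\<close> carries the additional factor \<open>c 0\<close>, which is at most
    \<open>B\<close>.\<close>
  define E0 where "E0 = (B\<^sup>2 + 1) * C0\<^sup>2"
  \<comment> \<open>The first summand exceeds the energy that an invariant of size
    \<open>E0 / (2 * c0) + 1 / 2\<close> permits, with room for strictness; \<open>E0 + 1\<close>
    leaves room for the initial energy. No constant of the later estimate occurs here, so there is
    no circularity in fixing \<open>R\<close> next.\<close>
  define \<rho> where "\<rho> = sqrt (2 * B * (E0 / (2 * c0) + 1) + E0 + 1)"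
  have "E0 \<ge> 0"
    by (simp add: E0_def)
  then have pos: "2 * B * (E0 / (2 * c0) + 1) \<ge> 0"
    using B(1) c0 by simp
  have \<rho>2: "\<rho>\<^sup>2 = 2 * B * (E0 / (2 * c0) + 1) + E0 + 1" and \<rho>: "\<rho> > 0"
    using \<open>E0 \<ge> 0\<close> pos by (auto simp: \<rho>_def)
  define R where "R = \<rho> / c0"
  have R: "R > 0"
    using \<rho> c0 by (simp add: R_def)
  obtain C C' where C: "C \<ge> 0" "C' \<ge> 0" and est:
    "\<And>\<epsilon> p q t. \<lbrakk>0 < \<epsilon>; \<epsilon> \<le> 1; truncated_wave \<epsilon> R p q; t \<ge> 0;
        \<And>s. s \<in> {0..t} \<Longrightarrow> (norm (p s))\<^sup>2 + (norm (q s))\<^sup>2 \<le> (\<rho> * \<epsilon>)\<^sup>2\<rbrakk>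
      \<Longrightarrow> \<bar>invariant \<epsilon> p q t - invariant \<epsilon> p q 0\<bar> \<le> C * \<epsilon> ^ 3 + C' * t * \<epsilon> ^ 5"
    using invariant_estimate[OF \<rho>, of R] by (auto simp: R_def)
  \<comment> \<open>Each of the two error terms is allowed a quarter of the square of \<epsilon>,
    which together gives the \<open>1 / 2\<close> foreseen in the choice of \<rho>.\<close>
  define \<epsilon>0 \<kappa> where "\<epsilon>0 = 1 / (4 * (C + 1))" and "\<kappa> = 1 / (4 * (C' + 1))"
  have \<epsilon>0: "\<epsilon>0 > 0" "\<epsilon>0 \<le> 1" "C * \<epsilon>0 \<le> 1/4" and \<kappa>: "\<kappa> > 0" "C' * \<kappa> \<le> 1/4"
    using C by (auto simp: \<epsilon>0_def \<kappa>_def divide_simps)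
  show ?thesis
  proof (rule exI[of _ \<epsilon>0], intro conjI \<epsilon>0(1), rule exI[of _ \<kappa>], intro conjI \<kappa>(1), rule exI[of _ C],
      intro conjI C(1), rule exI[of _ C'], intro conjI C(2) \<epsilon>0(2) allI impI)
    fix \<epsilon> t1 :: real and w0 v0 :: "'i ell2"
    assume "0 < \<epsilon> \<and> \<epsilon> \<le> \<epsilon>0 \<and> norm w0 \<le> C0 * \<epsilon> \<and> norm v0 \<le> C0 * \<epsilon> \<and> t1 * \<epsilon> ^ 3 \<le> \<kappa>"
    then have \<epsilon>: "0 < \<epsilon>" "\<epsilon> \<le> \<epsilon>0" "\<epsilon> \<le> 1" and w0: "norm w0 \<le> C0 * \<epsilon>" and v0: "norm v0 \<le> C0 * \<epsilon>"
      and t1: "t1 * \<epsilon> ^ 3 \<le> \<kappa>"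
      using \<epsilon>0(2) by auto
    obtain p q where init: "p 0 = c 0 *\<^sub>R w0" "q 0 = v0" and sol: "truncated_wave \<epsilon> R p q"
      using truncated_wave_exists[OF \<epsilon>(1,3) R] by blast
    define E where "E t = (norm (p t))\<^sup>2 + (norm (q t))\<^sup>2" for t
    have E_inv: "E t = 2 * c (\<epsilon> * t) * invariant \<epsilon> p q t" if "t \<ge> 0" for t
      using c_pos[of "\<epsilon> * t"] that \<epsilon> by (simp add: E_def invariant_def)
    have "\<epsilon>\<^sup>2 > 0"
      using \<epsilon> by simp
    have E0: "E 0 \<le> E0 * \<epsilon>\<^sup>2"
    proof -
      have "norm (p 0) \<le> B * (C0 * \<epsilon>)"
        using w0 B c_pos[of 0] by (auto simp: init intro!: mult_mono)
      then have "(norm (p 0))\<^sup>2 \<le> (B * (C0 * \<epsilon>))\<^sup>2"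
        by (intro power_mono) auto
      moreover have "(norm (q 0))\<^sup>2 \<le> (C0 * \<epsilon>)\<^sup>2"
        using v0 unfolding init by (intro power_mono) auto
      ultimately show ?thesis
        by (simp add: E_def E0_def power_mult_distrib algebra_simps)
    qed
    have inv0: "invariant \<epsilon> p q 0 \<le> E0 / (2 * c0) * \<epsilon>\<^sup>2"
    proof -
      have "invariant \<epsilon> p q 0 \<le> E0 * \<epsilon>\<^sup>2 / (2 * c0)"
        unfolding invariant_def using E0 c_ge[of 0] c0 \<open>E0 \<ge> 0\<close> by (intro frac_le) (auto simp: E_def)
      then show ?thesis
        by simp
    qed
    have "E t < (\<rho> * \<epsilon>)\<^sup>2" if "t \<in> {0..t1}" for t
    proof (rule continuous_induction_bound[OF _ _ _ that])
      have "continuous_on {0..} p" "continuous_on {0..} q"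
        using sol by (auto simp: truncated_wave_def)
      then have "continuous_on {0..} E"
        unfolding E_def by (intro continuous_intros)
      then show "continuous_on {0..t1} E"
        by (rule continuous_on_subset) auto
      have "E0 * \<epsilon>\<^sup>2 < \<rho>\<^sup>2 * \<epsilon>\<^sup>2"
        using pos \<open>\<epsilon>\<^sup>2 > 0\<close> by (intro mult_strict_right_mono) (auto simp: \<rho>2)
      then show "E 0 < (\<rho> * \<epsilon>)\<^sup>2"
        using E0 by (simp add: power_mult_distrib)
      fix t assume t: "t \<in> {0..t1}" and small: "\<And>s. s \<in> {0..t} \<Longrightarrow> E s \<le> (\<rho> * \<epsilon>)\<^sup>2"
      have cp: "c (\<epsilon> * t) > 0" "c (\<epsilon> * t) \<le> B"
        using t \<epsilon> B by (auto intro: c_pos)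
      have "\<bar>invariant \<epsilon> p q t - invariant \<epsilon> p q 0\<bar> \<le> C * \<epsilon> ^ 3 + C' * t * \<epsilon> ^ 5"
        using t small by (intro est[OF \<epsilon>(1,3) sol]) (auto simp: E_def)
      \<comment> \<open>Splitting off the square of \<epsilon> from the second term leaves
        \<open>t * \<epsilon> ^ 3\<close>, the quantity controlled by \<kappa>.\<close>
      also have "\<dots> = (C * \<epsilon>) * \<epsilon>\<^sup>2 + C' * (t * \<epsilon> ^ 3) * \<epsilon>\<^sup>2"
        by (simp add: eval_nat_numeral algebra_simps)
      also have "\<dots> \<le> (C * \<epsilon>0) * \<epsilon>\<^sup>2 + C' * \<kappa> * \<epsilon>\<^sup>2"
      proof -
        have "t * \<epsilon> ^ 3 \<le> t1 * \<epsilon> ^ 3"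
          using t \<epsilon> by (intro mult_right_mono) auto
        then have "t * \<epsilon> ^ 3 \<le> \<kappa>"
          using t1 by simp
        then show ?thesis
          using C \<epsilon> by (intro add_mono mult_right_mono mult_left_mono) auto
      qed
      also have "\<dots> \<le> 1/4 * \<epsilon>\<^sup>2 + 1/4 * \<epsilon>\<^sup>2"
        using \<epsilon>0 \<kappa> by (intro add_mono mult_right_mono) auto
      finally have "invariant \<epsilon> p q t \<le> (E0 / (2 * c0) + 1/2) * \<epsilon>\<^sup>2"
        using inv0 unfolding distrib_right by linarith
      moreover have "invariant \<epsilon> p q t \<ge> 0"
        using cp by (simp add: invariant_def)
      ultimately have "E t \<le> 2 * B * ((E0 / (2 * c0) + 1/2) * \<epsilon>\<^sup>2)"
        using t cp by (auto simp: E_inv intro!: mult_mono)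
      also have "\<dots> = (2 * B * (E0 / (2 * c0) + 1/2)) * \<epsilon>\<^sup>2"
        by simp
      also have "\<dots> < \<rho>\<^sup>2 * \<epsilon>\<^sup>2"
        using B(1) \<open>E0 \<ge> 0\<close> \<open>\<epsilon>\<^sup>2 > 0\<close> by (intro mult_strict_right_mono) (auto simp: \<rho>2 algebra_simps)
      finally show "E t < (\<rho> * \<epsilon>)\<^sup>2"
        by (simp add: power_mult_distrib)
    qed
    then have small: "(norm (p t))\<^sup>2 + (norm (q t))\<^sup>2 \<le> (\<rho> * \<epsilon>)\<^sup>2" if "t \<in> {0..t1}" for t
      using that by (fastforce simp: E_def)
    have id: "retract R (p t /\<^sub>R c (\<epsilon> * t)) = p t /\<^sub>R c (\<epsilon> * t)" if "t \<in> {0..t1}" for t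
    proof (rule retract_id[OF R])
      have "norm (p t) \<le> \<rho> * \<epsilon>"
        by (rule power2_le_imp_le)
          (use small[OF that] zero_le_power2[of "norm (q t)"] \<rho> \<epsilon> in \<open>linarith, simp\<close>)
      also have "\<dots> \<le> \<rho> * 1"
        using \<rho> \<epsilon> by (intro mult_left_mono) auto
      finally have "norm (p t) / c (\<epsilon> * t) \<le> \<rho> / c0"
        using c_ge[of "\<epsilon> * t"] c0 that \<epsilon> \<rho> by (intro frac_le) auto
      moreover have "norm (p t /\<^sub>R c (\<epsilon> * t)) = norm (p t) / c (\<epsilon> * t)"
        using c_pos[of "\<epsilon> * t"] that \<epsilon> by (simp add: divide_inverse mult.commute)
      ultimately show "norm (p t /\<^sub>R c (\<epsilon> * t)) \<le> R"
        by (simp add: R_def)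
    qed
    show "\<exists>p q. p 0 = c 0 *\<^sub>R w0 \<and> q 0 = v0 \<and> continuous_on {0..} p \<and> continuous_on {0..} q \<and>
       (\<forall>t\<in>{0..t1}.
         ((\<lambda>s. D (p s) /\<^sub>R c (\<epsilon> * s)) has_vector_derivative q t) (at t within {0..}) \<and>
         ((\<lambda>s. D (q s)) has_vector_derivative
            - c (\<epsilon> * t) *\<^sub>R p t + a (\<epsilon> * t) *\<^sub>R D (cube (p t /\<^sub>R c (\<epsilon> * t)))) (at t within {0..}) \<and>
         \<bar>invariant \<epsilon> p q t - invariant \<epsilon> p q 0\<bar> \<le> C * \<epsilon> ^ 3 + C' * t * \<epsilon> ^ 5)"
    proof (rule exI[of _ p], rule exI[of _ q], intro conjI init ballI)
      show "continuous_on {0..} p" "continuous_on {0..} q"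
        using sol by (auto simp: truncated_wave_def)
      fix t assume t: "t \<in> {0..t1}"
      show "((\<lambda>s. D (p s) /\<^sub>R c (\<epsilon> * s)) has_vector_derivative q t) (at t within {0..})"
        using sol t by (auto simp: truncated_wave_def)
      show "((\<lambda>s. D (q s)) has_vector_derivative
            - c (\<epsilon> * t) *\<^sub>R p t + a (\<epsilon> * t) *\<^sub>R D (cube (p t /\<^sub>R c (\<epsilon> * t)))) (at t within {0..})"
        using sol t unfolding truncated_wave_def by (subst id[OF t, symmetric]) auto
      show "\<bar>invariant \<epsilon> p q t - invariant \<epsilon> p q 0\<bar> \<le> C * \<epsilon> ^ 3 + C' * t * \<epsilon> ^ 5"
        using t small by (intro est[OF \<epsilon>(1,3) sol]) auto
    qed
  qed
qed

end

section \<open>The space of square-integrable functions\<close>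

lemma L2_measurable: "f \<in> L2_space Q \<Longrightarrow> f \<in> borel_measurable (lebesgue_on Q)"
  and L2_integrable_sq: "f \<in> L2_space Q \<Longrightarrow> integrable (lebesgue_on Q) (\<lambda>x. (norm (f x))\<^sup>2)"
  by (auto simp: L2_space_def)

lemma L2_integrable_inner:
  fixes f g :: "real^'n::finite \<Rightarrow> 'b::euclidean_space"
  assumes "f \<in> L2_space Q" "g \<in> L2_space Q"
  shows "integrable (lebesgue_on Q) (\<lambda>x. f x \<bullet> g x)"
proof (rule Bochner_Integration.integrable_bound)
  show "integrable (lebesgue_on Q) (\<lambda>x. (norm (f x))\<^sup>2 + (norm (g x))\<^sup>2)"
    using assms by (intro Bochner_Integration.integrable_add L2_integrable_sq)
  show "(\<lambda>x. f x \<bullet> g x) \<in> borel_measurable (lebesgue_on Q)"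
    using assms by (intro borel_measurable_inner L2_measurable)
  have "\<bar>f x \<bullet> g x\<bar> \<le> (norm (f x))\<^sup>2 + (norm (g x))\<^sup>2" for x
  proof -
    have "\<bar>f x \<bullet> g x\<bar> \<le> norm (f x) * norm (g x)"
      by (rule Cauchy_Schwarz_ineq2)
    moreover have "2 * norm (f x) * norm (g x) \<le> (norm (f x))\<^sup>2 + (norm (g x))\<^sup>2"
      by (rule sum_squares_bound)
    moreover have "0 \<le> norm (f x) * norm (g x)"
      by simp
    ultimately show ?thesis
      by linarith
  qed
  then show "AE x in lebesgue_on Q. norm (f x \<bullet> g x) \<le> norm ((norm (f x))\<^sup>2 + (norm (g x))\<^sup>2)"
    by (intro always_eventually) (simp add: abs_le_iff)
qed

lemma L2_zero: "(\<lambda>_. 0) \<in> L2_space Q"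
  by (simp add: L2_space_def)

lemma L2_scaleR: "f \<in> L2_space Q \<Longrightarrow> (\<lambda>x. r *\<^sub>R f x) \<in> L2_space Q"
  by (auto simp: L2_space_def power_mult_distrib)

lemma L2_add:
  fixes f g :: "real^'n::finite \<Rightarrow> 'b::euclidean_space"
  assumes "f \<in> L2_space Q" "g \<in> L2_space Q"
  shows "(\<lambda>x. f x + g x) \<in> L2_space Q"
proof -
  have "integrable (lebesgue_on Q) (\<lambda>x. f x \<bullet> f x + g x \<bullet> g x + 2 * (f x \<bullet> g x))"
    using assms by (intro Bochner_Integration.integrable_add integrable_mult_right L2_integrable_inner)
  moreover have "f x \<bullet> f x + g x \<bullet> g x + 2 * (f x \<bullet> g x) = (norm (f x + g x))\<^sup>2" for x
    by (simp add: power2_norm_eq_inner inner_add_left inner_add_right inner_commute)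
  ultimately show ?thesis
    using assms by (auto simp: L2_space_def intro: borel_measurable_add)
qed

lemma L2_uminus: "f \<in> L2_space Q \<Longrightarrow> (\<lambda>x. - f x) \<in> L2_space Q"
  using L2_scaleR[of f Q "-1"] by simp

lemma L2_diff: "f \<in> L2_space Q \<Longrightarrow> g \<in> L2_space Q \<Longrightarrow> (\<lambda>x. f x - g x) \<in> L2_space Q"
  using L2_add[OF _ L2_uminus, of f Q g] by simp

lemma L2_sum: "(\<And>i. i \<in> F \<Longrightarrow> f i \<in> L2_space Q) \<Longrightarrow> (\<lambda>x. \<Sum>i\<in>F. f i x) \<in> L2_space Q"
  by (induction F rule: infinite_finite_induct) (auto intro: L2_zero L2_add)

lemma L2_inner_commute: "L2_inner Q f g = L2_inner Q g f"
  by (simp add: L2_inner_def inner_commute)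

lemma L2_inner_add_left:
  "f \<in> L2_space Q \<Longrightarrow> g \<in> L2_space Q \<Longrightarrow> h \<in> L2_space Q \<Longrightarrow>
    L2_inner Q (\<lambda>x. f x + g x) h = L2_inner Q f h + L2_inner Q g h"
  by (simp add: L2_inner_def inner_add_left L2_integrable_inner)

lemma L2_inner_diff_left:
  "f \<in> L2_space Q \<Longrightarrow> g \<in> L2_space Q \<Longrightarrow> h \<in> L2_space Q \<Longrightarrow>
    L2_inner Q (\<lambda>x. f x - g x) h = L2_inner Q f h - L2_inner Q g h"
  by (simp add: L2_inner_def inner_diff_left L2_integrable_inner)

lemma L2_inner_scaleR_left: "L2_inner Q (\<lambda>x. r *\<^sub>R f x) h = r * L2_inner Q f h"
  by (simp add: L2_inner_def)

lemma L2_inner_add_right: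
  "f \<in> L2_space Q \<Longrightarrow> g \<in> L2_space Q \<Longrightarrow> h \<in> L2_space Q \<Longrightarrow>
    L2_inner Q h (\<lambda>x. f x + g x) = L2_inner Q h f + L2_inner Q h g"
  by (simp add: L2_inner_def inner_add_right L2_integrable_inner)

lemma L2_inner_diff_right:
  "f \<in> L2_space Q \<Longrightarrow> g \<in> L2_space Q \<Longrightarrow> h \<in> L2_space Q \<Longrightarrow>
    L2_inner Q h (\<lambda>x. f x - g x) = L2_inner Q h f - L2_inner Q h g"
  by (simp add: L2_inner_def inner_diff_right L2_integrable_inner)

lemma L2_inner_scaleR_right: "L2_inner Q h (\<lambda>x. r *\<^sub>R f x) = r * L2_inner Q h f"
  by (simp add: L2_inner_def)

lemma L2_inner_zero_left: "L2_inner Q (\<lambda>_. 0) h = 0"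
  by (simp add: L2_inner_def)

lemma L2_inner_sum_left:
  "(\<And>i. i \<in> F \<Longrightarrow> f i \<in> L2_space Q) \<Longrightarrow> h \<in> L2_space Q \<Longrightarrow>
    L2_inner Q (\<lambda>x. \<Sum>i\<in>F. f i x) h = (\<Sum>i\<in>F. L2_inner Q (f i) h)"
  by (induction F rule: infinite_finite_induct) (auto simp: L2_inner_zero_left L2_inner_add_left L2_sum)

lemma L2_norm_nonneg: "L2_norm Q f \<ge> 0"
  by (simp add: L2_norm_def)

lemma L2_norm_sq: "(L2_norm Q f)\<^sup>2 = L2_inner Q f f"
  by (simp add: L2_norm_def L2_inner_def power2_norm_eq_inner)

lemma L2_norm_eq_sqrt: "L2_norm Q f = sqrt (L2_inner Q f f)"
  by (simp add: L2_norm_def L2_inner_def power2_norm_eq_inner)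

lemma L2_norm_scaleR: "L2_norm Q (\<lambda>x. r *\<^sub>R f x) = \<bar>r\<bar> * L2_norm Q f"
  by (simp add: L2_norm_eq_sqrt L2_inner_scaleR_left L2_inner_scaleR_right real_sqrt_mult)

lemma L2_norm_minus_commute: "L2_norm Q (\<lambda>x. f x - g x) = L2_norm Q (\<lambda>x. g x - f x)"
  by (simp add: L2_norm_def norm_minus_commute)

lemma L2_norm_sq_add:
  "f \<in> L2_space Q \<Longrightarrow> g \<in> L2_space Q \<Longrightarrow>
    (L2_norm Q (\<lambda>x. f x + g x))\<^sup>2 = (L2_norm Q f)\<^sup>2 + 2 * L2_inner Q f g + (L2_norm Q g)\<^sup>2"
  by (simp add: L2_norm_sq L2_inner_add_left L2_inner_add_right L2_add L2_inner_commute)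

lemma L2_norm_sq_diff:
  "f \<in> L2_space Q \<Longrightarrow> g \<in> L2_space Q \<Longrightarrow>
    (L2_norm Q (\<lambda>x. f x - g x))\<^sup>2 = (L2_norm Q f)\<^sup>2 - 2 * L2_inner Q f g + (L2_norm Q g)\<^sup>2"
  by (simp add: L2_norm_sq L2_inner_diff_left L2_inner_diff_right L2_diff L2_inner_commute)

text \<open>Functions are not identified almost everywhere, so \<open>L2_norm\<close> is only a
  seminorm here. The argument uses nothing but the nonnegativity of the quadratic polynomial in
  \<open>t\<close>.\<close>

lemma L2_Cauchy_Schwarz:
  assumes f: "f \<in> L2_space Q" and g: "g \<in> L2_space Q"
  shows "\<bar>L2_inner Q f g\<bar> \<le> L2_norm Q f * L2_norm Q g"
proof -
  define A B C where "A = (L2_norm Q f)\<^sup>2" and "B = (L2_norm Q g)\<^sup>2" and "C = L2_inner Q f g"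
  have q: "0 \<le> A - 2 * (t * C) + t\<^sup>2 * B" for t
  proof -
    have "0 \<le> (L2_norm Q (\<lambda>x. f x - t *\<^sub>R g x))\<^sup>2"
      by simp
    also have "\<dots> = A - 2 * (t * C) + t\<^sup>2 * B"
      by (simp add: L2_norm_sq_diff f g L2_scaleR L2_inner_scaleR_right L2_norm_scaleR A_def B_def C_def
          power_mult_distrib)
    finally show ?thesis .
  qed
  have "C\<^sup>2 \<le> A * B"
  proof (cases "B = 0")
    case True
    have "C = 0"
    proof (rule ccontr)
      assume "C \<noteq> 0"
      then show False
        \<comment> \<open>This value of \<open>t\<close> makes the polynomial, which is linear when
          \<open>B = 0\<close>, equal to - 1.\<close>
        using q[of "(A + 1) / (2 * C)"] True by (simp add: field_simps A_def)
    qed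
    then show ?thesis
      by (simp add: A_def B_def)
  next
    case False
    then have "B > 0"
      by (simp add: B_def)
    then show ?thesis
      \<comment> \<open>The minimum of the polynomial.\<close>
      using q[of "C / B"] by (simp add: field_simps power2_eq_square)
  qed
  then have "C\<^sup>2 \<le> (L2_norm Q f * L2_norm Q g)\<^sup>2"
    by (simp add: A_def B_def power_mult_distrib)
  then show ?thesis
    unfolding C_def by (simp add: abs_le_square_iff[symmetric] L2_norm_nonneg)
qed

lemma L2_norm_triangle:
  assumes "f \<in> L2_space Q" "g \<in> L2_space Q"
  shows "L2_norm Q (\<lambda>x. f x + g x) \<le> L2_norm Q f + L2_norm Q g"
proof (rule power2_le_imp_le)
  show "(L2_norm Q (\<lambda>x. f x + g x))\<^sup>2 \<le> (L2_norm Q f + L2_norm Q g)\<^sup>2"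
    using L2_Cauchy_Schwarz[OF assms] by (simp add: L2_norm_sq_add[OF assms] power2_sum)
qed (simp add: L2_norm_nonneg)

lemma L2_norm_triangle_diff:
  assumes "f \<in> L2_space Q" "g \<in> L2_space Q" "h \<in> L2_space Q"
  shows "L2_norm Q (\<lambda>x. f x - h x) \<le> L2_norm Q (\<lambda>x. f x - g x) + L2_norm Q (\<lambda>x. g x - h x)"
  using L2_norm_triangle[OF L2_diff[OF assms(1,2)] L2_diff[OF assms(2,3)]] by simp

lemma L2_norm_abs_diff:
  assumes "f \<in> L2_space Q" "g \<in> L2_space Q"
  shows "\<bar>L2_norm Q f - L2_norm Q g\<bar> \<le> L2_norm Q (\<lambda>x. f x - g x)"
  using L2_norm_triangle[OF L2_diff[OF assms] assms(2)] L2_norm_triangle[OF L2_diff[OF assms(2,1)] assms(1)]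
  by (simp add: L2_norm_minus_commute[of Q g f])

lemma L2_norm_eq_0_iff:
  assumes "f \<in> L2_space Q"
  shows "L2_norm Q f = 0 \<longleftrightarrow> (AE x in lebesgue_on Q. f x = 0)"
  using integral_nonneg_eq_0_iff_AE[OF L2_integrable_sq[OF assms]] by (simp add: L2_norm_def)

lemma L2_norm_cong_AE:
  assumes "f \<in> L2_space Q" "g \<in> L2_space Q" "AE x in lebesgue_on Q. f x = g x"
  shows "L2_norm Q f = L2_norm Q g"
proof -
  have "L2_norm Q (\<lambda>x. f x - g x) = 0"
    using assms by (subst L2_norm_eq_0_iff) (auto intro: L2_diff)
  then show ?thesis
    using L2_norm_abs_diff[OF assms(1,2)] by simp
qed

lemma L2_inner_cong_AE:
  assumes "f \<in> L2_space Q" "g \<in> L2_space Q" "h \<in> L2_space Q" "AE x in lebesgue_on Q. f x = g x"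
  shows "L2_inner Q f h = L2_inner Q g h"
proof -
  have "L2_norm Q (\<lambda>x. f x - g x) = 0"
    using assms by (subst L2_norm_eq_0_iff) (auto intro: L2_diff)
  then show ?thesis
    using L2_Cauchy_Schwarz[OF L2_diff[OF assms(1,2)] assms(3)] assms by (simp add: L2_inner_diff_left)
qed

lemma L2_norm_tendsto_inner:
  assumes "\<And>n. f n \<in> L2_space Q" "g \<in> L2_space Q" "h \<in> L2_space Q"
    and lim: "((\<lambda>n. L2_norm Q (\<lambda>x. f n x - g x)) \<longlongrightarrow> 0) F"
  shows "((\<lambda>n. L2_inner Q (f n) h) \<longlongrightarrow> L2_inner Q g h) F"
proof -
  have "((\<lambda>n. L2_norm Q (\<lambda>x. f n x - g x) * L2_norm Q h) \<longlongrightarrow> 0) F"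
    using tendsto_mult_left_zero[OF lim] .
  then have "((\<lambda>n. L2_inner Q (f n) h - L2_inner Q g h) \<longlongrightarrow> 0) F"
    by (rule Lim_null_comparison[OF always_eventually, OF allI, rotated])
      (use assms L2_Cauchy_Schwarz[OF L2_diff[OF assms(1,2)] assms(3)] in \<open>simp add: L2_inner_diff_left\<close>)
  then show ?thesis
    by (simp add: LIM_zero_iff)
qed

lemma L2_norm_tendsto:
  assumes "\<And>n. f n \<in> L2_space Q" "g \<in> L2_space Q"
    and lim: "((\<lambda>n. L2_norm Q (\<lambda>x. f n x - g x)) \<longlongrightarrow> 0) F"
  shows "((\<lambda>n. L2_norm Q (f n)) \<longlongrightarrow> L2_norm Q g) F"
proof -
  have "((\<lambda>n. L2_norm Q (f n) - L2_norm Q g) \<longlongrightarrow> 0) F"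
    by (rule Lim_null_comparison[OF _ lim]) (use assms L2_norm_abs_diff in \<open>auto intro!: always_eventually\<close>)
  then show ?thesis
    by (simp add: LIM_zero_iff)
qed

lemma nn_integral_norm_sq:
  assumes "f \<in> L2_space Q"
  shows "(\<integral>\<^sup>+x. ennreal ((norm (f x))\<^sup>2) \<partial>lebesgue_on Q) = ennreal ((L2_norm Q f)\<^sup>2)"
  using nn_integral_eq_integral[OF L2_integrable_sq[OF assms]] by (simp add: L2_norm_def)

text \<open>Membership and bound pass to a limit that is known only almost everywhere. This is used
  for the completeness of the space and for cubes of functions, where convergence in norm is not at
  hand.\<close>

lemma L2_Fatou:
  fixes f :: "nat \<Rightarrow> real^'n::finite \<Rightarrow> 'b::euclidean_space"
  assumes f: "\<And>n. f n \<in> L2_space Q" and g: "g \<in> borel_measurable (lebesgue_on Q)"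
    and lim: "AE x in lebesgue_on Q. (\<lambda>n. f n x) \<longlonglongrightarrow> g x"
    and bound: "\<And>n. L2_norm Q (f n) \<le> B"
  shows "g \<in> L2_space Q" "L2_norm Q g \<le> B"
proof -
  have "B \<ge> 0"
    using bound[of 0] L2_norm_nonneg order_trans by blast
  have "(\<integral>\<^sup>+x. ennreal ((norm (g x))\<^sup>2) \<partial>lebesgue_on Q)
      = (\<integral>\<^sup>+x. liminf (\<lambda>n. ennreal ((norm (f n x))\<^sup>2)) \<partial>lebesgue_on Q)"
  proof (rule nn_integral_cong_AE, use lim in eventually_elim)
    fix x assume "(\<lambda>n. f n x) \<longlonglongrightarrow> g x"
    then have "(\<lambda>n. ennreal ((norm (f n x))\<^sup>2)) \<longlonglongrightarrow> ennreal ((norm (g x))\<^sup>2)"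
      by (intro tendsto_ennrealI tendsto_intros)
    then show "ennreal ((norm (g x))\<^sup>2) = liminf (\<lambda>n. ennreal ((norm (f n x))\<^sup>2))"
      by (intro lim_imp_Liminf[symmetric]) auto
  qed
  also have "\<dots> \<le> liminf (\<lambda>n. \<integral>\<^sup>+x. ennreal ((norm (f n x))\<^sup>2) \<partial>lebesgue_on Q)"
    using L2_measurable[OF f] by (intro nn_integral_liminf) auto
  also have "\<dots> \<le> ennreal (B\<^sup>2)"
  proof -
    have "ennreal ((L2_norm Q (f n))\<^sup>2) \<le> ennreal (B\<^sup>2)" for n
      using bound[of n] by (intro ennreal_leI power_mono) (auto simp: L2_norm_nonneg)
    then show ?thesis
      unfolding nn_integral_norm_sq[OF f]
      by (intro order_trans[OF Liminf_le_Limsup Limsup_bounded]) auto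
  qed
  finally have le: "(\<integral>\<^sup>+x. ennreal ((norm (g x))\<^sup>2) \<partial>lebesgue_on Q) \<le> ennreal (B\<^sup>2)" .
  have "integrable (lebesgue_on Q) (\<lambda>x. (norm (g x))\<^sup>2)"
    using g le by (intro integrableI_bounded) (auto simp: le_less_trans[OF _ ennreal_less_top])
  then show "g \<in> L2_space Q"
    using g by (simp add: L2_space_def)
  then have "(L2_norm Q g)\<^sup>2 \<le> B\<^sup>2"
    using le \<open>B \<ge> 0\<close> by (simp add: nn_integral_norm_sq)
  then show "L2_norm Q g \<le> B"
    using \<open>B \<ge> 0\<close> by (rule power2_le_imp_le)
qed

text \<open>The almost everywhere convergent subsequence is delivered together with the limit
  because the cube of a limit is identified pointwise later on.\<close>

lemma L2_complete:
  fixes f :: "nat \<Rightarrow> real^'n::finite \<Rightarrow> 'b::euclidean_space"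
  assumes f: "\<And>n. f n \<in> L2_space Q"
    and Cauchy: "\<And>e. e > 0 \<Longrightarrow> \<exists>N. \<forall>m\<ge>N. \<forall>n\<ge>N. L2_norm Q (\<lambda>x. f m x - f n x) < e"
  obtains g r where "g \<in> L2_space Q" "(\<lambda>n. L2_norm Q (\<lambda>x. f n x - g x)) \<longlonglongrightarrow> 0"
    "strict_mono r" "AE x in lebesgue_on Q. (\<lambda>k. f (r k) x) \<longlonglongrightarrow> g x"
proof -
  have "\<exists>N. \<forall>m\<ge>N. \<forall>n\<ge>N. L2_norm Q (\<lambda>x. f m x - f n x) < (1/2) ^ k" for k
    by (rule Cauchy) simp
  then obtain N where N: "\<And>k m n. m \<ge> N k \<Longrightarrow> n \<ge> N k \<Longrightarrow> L2_norm Q (\<lambda>x. f m x - f n x) < (1/2) ^ k"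
    by metis
  \<comment> \<open>The sum puts \<open>r k\<close> beyond \<open>N k\<close>, and the summand
    \<open>k\<close> makes \<open>r\<close> strictly increasing.\<close>
  define r where "r k = (\<Sum>i\<le>k. N i) + k" for k
  have r: "strict_mono r"
    by (rule strict_monoI_Suc) (simp add: r_def)
  have rN: "r k \<ge> N k" for k
    using member_le_sum[of k "{..k}" N] by (simp add: r_def)
  define d where "d k x = f (r (Suc k)) x - f (r k) x" for k x
  have dL2: "d k \<in> L2_space Q" for k
    unfolding d_def by (intro L2_diff f)
  have d: "L2_norm Q (d k) \<le> (1/2) ^ k" for k
    unfolding d_def using N[of k "r (Suc k)" "r k"] rN[of k] strict_mono_less[OF r, of k "Suc k"] by simp
  \<comment> \<open>The squared norms of \<open>d k\<close> decay like the powers of 1/4, so a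
    weight \<open>2 ^ k\<close> is affordable. Pointwise it allows \<open>norm (d k x)\<close> to be
    bounded by \<open>(1/2) ^ k + 2 ^ k * (norm (d k x))\<^sup>2\<close>, so that the telescoping
    series converges.\<close>
  have "(\<integral>\<^sup>+x. (\<Sum>k. ennreal (2 ^ k * (norm (d k x))\<^sup>2)) \<partial>lebesgue_on Q)
      = (\<Sum>k. \<integral>\<^sup>+x. ennreal (2 ^ k * (norm (d k x))\<^sup>2) \<partial>lebesgue_on Q)"
    using L2_measurable[OF dL2] by (intro nn_integral_suminf) auto
  also have "\<dots> = (\<Sum>k. ennreal (2 ^ k * (L2_norm Q (d k))\<^sup>2))"
    using L2_measurable[OF dL2]
    by (simp add: ennreal_mult nn_integral_cmult nn_integral_norm_sq[OF dL2])
  also have "\<dots> \<le> (\<Sum>k. ennreal ((1/2) ^ k))"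
  proof (intro suminf_le summableI ennreal_leI)
    fix k
    have "2 ^ k * (L2_norm Q (d k))\<^sup>2 \<le> 2 ^ k * ((1/2) ^ k)\<^sup>2"
      using d[of k] by (intro mult_left_mono power_mono) (auto simp: L2_norm_nonneg)
    also have "\<dots> = (1/2) ^ k"
      by (simp add: power2_eq_square power_mult_distrib[symmetric] mult.assoc[symmetric])
    finally show "2 ^ k * (L2_norm Q (d k))\<^sup>2 \<le> (1/2) ^ k" .
  qed
  also have "\<dots> < \<infinity>"
    using summable_geometric[of "1/2 :: real"]
    by (subst suminf_ennreal2) auto
  finally have "(\<integral>\<^sup>+x. (\<Sum>k. ennreal (2 ^ k * (norm (d k x))\<^sup>2)) \<partial>lebesgue_on Q) \<noteq> \<infinity>"
    by simp
  then have fin: "AE x in lebesgue_on Q. (\<Sum>k. ennreal (2 ^ k * (norm (d k x))\<^sup>2)) \<noteq> \<infinity>"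
    using L2_measurable[OF dL2] by (intro nn_integral_PInf_AE) auto
  define g where "g x = lim (\<lambda>k. f (r k) x)" for x
  have g: "g \<in> borel_measurable (lebesgue_on Q)"
    unfolding g_def by (intro borel_measurable_lim_metric L2_measurable f)
  have lim: "AE x in lebesgue_on Q. (\<lambda>k. f (r k) x) \<longlonglongrightarrow> g x"
    using fin
  proof eventually_elim
    fix x assume "(\<Sum>k. ennreal (2 ^ k * (norm (d k x))\<^sup>2)) \<noteq> \<infinity>"
    then have s: "summable (\<lambda>k. 2 ^ k * (norm (d k x))\<^sup>2)"
      by (intro summable_suminf_not_top) auto
    have "summable (\<lambda>k. (1/2) ^ k + 2 ^ k * (norm (d k x))\<^sup>2)"
      by (intro summable_add s summable_geometric) simp
    then have "summable (\<lambda>k. d k x)"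
    proof (rule summable_comparison_test'[where N = 0])
      fix k
      define y where "y = norm (d k x)"
      have "a \<le> 1 + a\<^sup>2" if "a \<ge> 0" for a :: real
      proof -
        have "0 \<le> (a - 1)\<^sup>2 + a"
          using that by simp
        then show ?thesis
          by (simp add: power2_diff)
      qed
      then have "2 ^ k * y \<le> 1 + (2 ^ k * y)\<^sup>2"
        by (simp add: y_def)
      then have "(1/2) ^ k * (2 ^ k * y) \<le> (1/2) ^ k * (1 + (2 ^ k * y)\<^sup>2)"
        by (intro mult_left_mono) auto
      then show "norm (d k x) \<le> (1/2) ^ k + 2 ^ k * (norm (d k x))\<^sup>2"
        by (simp add: y_def[symmetric] power_one_over field_simps power2_eq_square)
    qed
    then have "(\<lambda>n. f (r 0) x + (\<Sum>k<n. d k x)) \<longlonglongrightarrow> f (r 0) x + (\<Sum>k. d k x)"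
      by (intro tendsto_intros summable_LIMSEQ)
    moreover have "f (r 0) x + (\<Sum>k<n. d k x) = f (r n) x" for n
      unfolding d_def by (simp add: sum_lessThan_telescope[of "\<lambda>k. f (r k) x"])
    ultimately have "convergent (\<lambda>k. f (r k) x)"
      unfolding convergent_def by auto
    then show "(\<lambda>k. f (r k) x) \<longlonglongrightarrow> g x"
      unfolding g_def by (simp add: convergent_LIMSEQ_iff)
  qed
  \<comment> \<open>Fatou's lemma for the differences between \<open>f n\<close> and the subsequence
    upgrades pointwise convergence to convergence in norm of the full sequence.\<close>
  have est: "(\<lambda>x. f n x - g x) \<in> L2_space Q \<and> L2_norm Q (\<lambda>x. f n x - g x) \<le> (1/2) ^ k" if "n \<ge> N k" for n k
  proof -
    have AE: "AE x in lebesgue_on Q. (\<lambda>j. f n x - f (r (j + k)) x) \<longlonglongrightarrow> f n x - g x"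
      using lim
    proof eventually_elim
      fix x assume "(\<lambda>k. f (r k) x) \<longlonglongrightarrow> g x"
      then show "(\<lambda>j. f n x - f (r (j + k)) x) \<longlonglongrightarrow> f n x - g x"
        by (intro tendsto_intros LIMSEQ_ignore_initial_segment[of "\<lambda>k. f (r k) x"])
    qed
    have "r (j + k) \<ge> N k" for j
      using rN[of k] strict_mono_less_eq[OF r, of k "j + k"] by simp
    then have bound: "L2_norm Q (\<lambda>x. f n x - f (r (j + k)) x) \<le> (1/2) ^ k" for j
      using N[OF that, of "r (j + k)"] by (simp add: less_imp_le)
    have "(\<lambda>x. f n x - f (r (j + k)) x) \<in> L2_space Q" for j
      by (intro L2_diff f)
    moreover have "(\<lambda>x. f n x - g x) \<in> borel_measurable (lebesgue_on Q)"
      by (intro borel_measurable_diff L2_measurable[OF f] g)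
    ultimately show ?thesis
      using L2_Fatou[of "\<lambda>j x. f n x - f (r (j + k)) x" Q "\<lambda>x. f n x - g x", OF _ _ AE bound] by simp
  qed
  have "(\<lambda>x. f (N 0) x - (f (N 0) x - g x)) \<in> L2_space Q"
    by (intro L2_diff[OF f conjunct1[OF est[of 0]]]) simp
  then have gL2: "g \<in> L2_space Q"
    by simp
  have "(\<lambda>n. L2_norm Q (\<lambda>x. f n x - g x)) \<longlonglongrightarrow> 0"
  proof (rule LIMSEQ_I)
    fix e :: real assume "e > 0"
    then obtain k where "(1/2) ^ k < e"
      using real_arch_pow_inv[of e "1/2"] by auto
    then show "\<exists>no. \<forall>n\<ge>no. norm (L2_norm Q (\<lambda>x. f n x - g x) - 0) < e"
      using est[of k] by (intro exI[of _ "N k"]) (force simp: L2_norm_nonneg)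
  qed
  then show thesis
    using that gL2 r lim by blast
qed

section \<open>Orthonormal systems\<close>

text \<open>The value type is left open since one system consists of functions and the other of
  gradient fields.\<close>

definition orthonormal :: "(real^'n::finite) set \<Rightarrow> ('i \<Rightarrow> real^'n \<Rightarrow> 'b::euclidean_space) \<Rightarrow> bool" where
  "orthonormal Q e \<longleftrightarrow> (\<forall>i. e i \<in> L2_space Q) \<and> (\<forall>i j. L2_inner Q (e i) (e j) = (if i = j then 1 else 0))"

lemma orthonormal_inner_sum:
  assumes "orthonormal Q e" "finite F"
  shows "L2_inner Q (\<lambda>x. \<Sum>i\<in>F. z i *\<^sub>R e i x) (e j) = (if j \<in> F then z j else 0)"
proof -
  have "L2_inner Q (\<lambda>x. \<Sum>i\<in>F. z i *\<^sub>R e i x) (e j) = (\<Sum>i\<in>F. z i * L2_inner Q (e i) (e j))"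
    using assms by (subst L2_inner_sum_left) (auto simp: orthonormal_def L2_scaleR L2_inner_scaleR_left)
  also have "\<dots> = (\<Sum>i\<in>F. if i = j then z i else 0)"
    using assms by (intro sum.cong) (auto simp: orthonormal_def)
  finally show ?thesis
    using assms by (simp add: sum.delta)
qed

lemma orthonormal_sum_L2: "orthonormal Q e \<Longrightarrow> (\<lambda>x. \<Sum>i\<in>F. z i *\<^sub>R e i x) \<in> L2_space Q"
  by (intro L2_sum L2_scaleR) (auto simp: orthonormal_def)

lemma orthonormal_inner_sum_right:
  assumes "orthonormal Q e" "f \<in> L2_space Q"
  shows "L2_inner Q f (\<lambda>x. \<Sum>i\<in>F. z i *\<^sub>R e i x) = (\<Sum>i\<in>F. z i * L2_inner Q f (e i))"
  using assms
  by (subst L2_inner_commute, subst L2_inner_sum_left)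
    (auto simp: orthonormal_def L2_scaleR L2_inner_scaleR_left L2_inner_commute)

lemma orthonormal_norm_sum:
  assumes "orthonormal Q e" "finite F"
  shows "(L2_norm Q (\<lambda>x. \<Sum>i\<in>F. z i *\<^sub>R e i x))\<^sup>2 = (\<Sum>i\<in>F. (z i)\<^sup>2)"
  unfolding L2_norm_sq
  by (subst orthonormal_inner_sum_right[OF assms(1) orthonormal_sum_L2[OF assms(1)]])
    (simp add: orthonormal_inner_sum[OF assms] power2_eq_square)

lemma orthonormal_diff_sum:
  assumes "orthonormal Q e" "finite F" "f \<in> L2_space Q"
  shows "(L2_norm Q (\<lambda>x. f x - (\<Sum>i\<in>F. L2_inner Q f (e i) *\<^sub>R e i x)))\<^sup>2 =
    (L2_norm Q f)\<^sup>2 - (\<Sum>i\<in>F. (L2_inner Q f (e i))\<^sup>2)"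
proof -
  have "(\<Sum>i\<in>F. L2_inner Q f (e i) * L2_inner Q f (e i)) = (\<Sum>i\<in>F. (L2_inner Q f (e i))\<^sup>2)"
    by (simp add: power2_eq_square)
  then show ?thesis
    by (simp add: L2_norm_sq_diff assms orthonormal_sum_L2 orthonormal_norm_sum orthonormal_inner_sum_right)
qed

lemma Bessel:
  assumes "orthonormal Q e" "finite F" "f \<in> L2_space Q"
  shows "(\<Sum>i\<in>F. (L2_inner Q f (e i))\<^sup>2) \<le> (L2_norm Q f)\<^sup>2"
  using zero_le_power2[of "L2_norm Q (\<lambda>x. f x - (\<Sum>i\<in>F. L2_inner Q f (e i) *\<^sub>R e i x))"]
  unfolding orthonormal_diff_sum[OF assms] by simp

text \<open>Sums over the countable set of modes are limits along finite sets. This enumeration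
  replaces them by sequences, to which the limit theorems for functions apply.\<close>

definition index_below :: "nat \<Rightarrow> 'i::countable set" where
  "index_below n = {i. to_nat i < n}"

lemma finite_index_below: "finite (index_below n)"
proof -
  have "finite (to_nat -` {..<n} :: 'a set)"
    by (intro finite_vimageI) auto
  then show ?thesis
    by (simp add: index_below_def vimage_def)
qed

lemma index_below_mono: "m \<le> n \<Longrightarrow> index_below m \<subseteq> index_below n"
  by (auto simp: index_below_def)

lemma filterlim_index_below: "filterlim index_below (finite_subsets_at_top UNIV) sequentially"
  unfolding filterlim_finite_subsets_at_top
proof (intro allI impI)
  fix X :: "'a set" assume "finite X \<and> X \<subseteq> UNIV"
  then have "finite (to_nat ` X)"
    by simp
  then obtain N where "\<And>i. i \<in> X \<Longrightarrow> to_nat i < N"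
    by (metis finite_nat_set_iff_bounded imageI)
  then show "\<forall>\<^sub>F n in sequentially. finite (index_below n :: 'a set) \<and> X \<subseteq> index_below n \<and> index_below n \<subseteq> UNIV"
    by (intro eventually_sequentiallyI[of N], auto simp: finite_index_below)
      (auto simp: index_below_def dest: less_le_trans)
qed

lemma ell2_partial_sums:
  "(\<lambda>n. \<Sum>i\<in>index_below n. (coord z i)\<^sup>2) \<longlonglongrightarrow> (norm z)\<^sup>2"
  using filterlim_compose[OF norm_ell2_sq_sums[of z, unfolded has_sum_def] filterlim_index_below] .

text \<open>Orthonormality turns the distance of two partial sums into a difference of partial sums
  of the convergent series of squared coordinates.\<close>

lemma Riesz_Fischer:
  fixes z :: "'i::countable ell2"
  assumes e: "orthonormal Q e"
  obtains f where "f \<in> L2_space Q" "\<And>i. L2_inner Q f (e i) = coord z i"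
    "(\<lambda>n. L2_norm Q (\<lambda>x. (\<Sum>i\<in>index_below n. coord z i *\<^sub>R e i x) - f x)) \<longlonglongrightarrow> 0"
proof -
  define s where "s n x = (\<Sum>i\<in>index_below n. coord z i *\<^sub>R e i x)" for n x
  have sL2: "s n \<in> L2_space Q" for n
    unfolding s_def by (rule orthonormal_sum_L2[OF e])
  have diff: "(L2_norm Q (\<lambda>x. s m x - s n x))\<^sup>2 \<le> \<bar>(\<Sum>i\<in>index_below m. (coord z i)\<^sup>2) - (\<Sum>i\<in>index_below n. (coord z i)\<^sup>2)\<bar>" for m n
  proof (induction m n rule: linorder_wlog)
    case (le m n)
    have sub: "(\<Sum>i\<in>index_below n. g i) - (\<Sum>i\<in>index_below m. g i) = (\<Sum>i\<in>index_below n - index_below m. g i)"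
      for g :: "'i \<Rightarrow> 'c::real_vector"
      using sum.subset_diff[OF index_below_mono[OF le] finite_index_below, of g] by simp
    have "(L2_norm Q (\<lambda>x. s m x - s n x))\<^sup>2 = (L2_norm Q (\<lambda>x. s n x - s m x))\<^sup>2"
      by (subst L2_norm_minus_commute) simp
    also have "(\<lambda>x. s n x - s m x) = (\<lambda>x. \<Sum>i\<in>index_below n - index_below m. coord z i *\<^sub>R e i x)"
      by (simp add: s_def sub fun_eq_iff)
    also have "(L2_norm Q \<dots>)\<^sup>2 = (\<Sum>i\<in>index_below n. (coord z i)\<^sup>2) - (\<Sum>i\<in>index_below m. (coord z i)\<^sup>2)"
      by (simp add: sub orthonormal_norm_sum[OF e] finite_index_below)
    finally show ?case
      by simp
  next
    case (sym m n)
    then show ?case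
      by (simp add: L2_norm_minus_commute[of Q "s m"] abs_minus_commute)
  qed
  have Cauchy: "\<exists>N. \<forall>m\<ge>N. \<forall>n\<ge>N. L2_norm Q (\<lambda>x. s m x - s n x) < r" if "r > 0" for r
  proof -
    have partial: "Cauchy (\<lambda>n. \<Sum>i\<in>index_below n. (coord z i)\<^sup>2)"
      using ell2_partial_sums by (rule LIMSEQ_imp_Cauchy)
    obtain N where N: "\<And>m n. m \<ge> N \<Longrightarrow> n \<ge> N \<Longrightarrow>
        \<bar>(\<Sum>i\<in>index_below m. (coord z i)\<^sup>2) - (\<Sum>i\<in>index_below n. (coord z i)\<^sup>2)\<bar> < r\<^sup>2"
      using \<open>r > 0\<close> partial[unfolded Cauchy_iff real_norm_def, rule_format, of "r\<^sup>2"] by auto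
    have "L2_norm Q (\<lambda>x. s m x - s n x) < r" if "m \<ge> N" "n \<ge> N" for m n
      using le_less_trans[OF diff N[OF that]] \<open>r > 0\<close> by (intro power2_less_imp_less[of _ r]) auto
    then show ?thesis
      by blast
  qed
  obtain f where f: "f \<in> L2_space Q" and lim: "(\<lambda>n. L2_norm Q (\<lambda>x. s n x - f x)) \<longlonglongrightarrow> 0"
    by (rule L2_complete[OF sL2 Cauchy])
  have "L2_inner Q f (e i) = coord z i" for i
  proof (rule LIMSEQ_unique)
    show "(\<lambda>n. L2_inner Q (s n) (e i)) \<longlonglongrightarrow> L2_inner Q f (e i)"
      using e by (intro L2_norm_tendsto_inner sL2 f lim) (simp add: orthonormal_def)
    have "\<forall>\<^sub>F n in sequentially. L2_inner Q (s n) (e i) = coord z i"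
      unfolding s_def using orthonormal_inner_sum[OF e finite_index_below]
      by (intro eventually_sequentiallyI[of "Suc (to_nat i)"]) (auto simp: index_below_def)
    then show "(\<lambda>n. L2_inner Q (s n) (e i)) \<longlonglongrightarrow> coord z i"
      by (rule tendsto_eventually)
  qed
  then show thesis
    using that f lim unfolding s_def by blast
qed

section \<open>Smooth functions\<close>

lemma partial_deriv_eq: "(f has_derivative f') (at x) \<Longrightarrow> partial_deriv i f x = f' (axis i 1)"
  by (metis frechet_derivative_at partial_deriv_def)

lemma partial_deriv_const: "partial_deriv i (\<lambda>_. r) = (\<lambda>_. 0)"
  by (intro ext) (simp add: partial_deriv_eq[OF has_derivative_const])

lemma partial_deriv_add:
  assumes "\<And>x. f differentiable (at x)" "\<And>x. g differentiable (at x)"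
  shows "partial_deriv i (\<lambda>x. f x + g x) = (\<lambda>x. partial_deriv i f x + partial_deriv i g x)"
proof
  fix x
  show "partial_deriv i (\<lambda>x. f x + g x) x = partial_deriv i f x + partial_deriv i g x"
    using partial_deriv_eq[OF has_derivative_add[OF assms[unfolded frechet_derivative_works]], of i x]
    by (simp add: partial_deriv_def)
qed

lemma partial_deriv_mult:
  assumes "\<And>x. f differentiable (at x)" "\<And>x. g differentiable (at x)"
  shows "partial_deriv i (\<lambda>x. f x * g x) = (\<lambda>x. f x * partial_deriv i g x + partial_deriv i f x * g x)"
proof
  fix x
  show "partial_deriv i (\<lambda>x. f x * g x) x = f x * partial_deriv i g x + partial_deriv i f x * g x"
    using partial_deriv_eq[OF has_derivative_mult[OF assms[unfolded frechet_derivative_works]], of i x]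
    by (simp add: partial_deriv_def)
qed

lemma C_k_continuous: "C_k k f \<Longrightarrow> continuous_on UNIV f"
  by (cases k) (auto simp: continuous_on_eq_continuous_at intro: differentiable_imp_continuous_within)

lemma C_k_Suc: "C_k (Suc k) f \<Longrightarrow> C_k k f"
  by (induction k arbitrary: f) (auto intro: C_k_continuous[of "Suc 0"])

lemma C_k_const: "C_k k (\<lambda>_. r)"
  by (induction k arbitrary: r) (auto simp: partial_deriv_const)

lemma C_k_add: "C_k k f \<Longrightarrow> C_k k g \<Longrightarrow> C_k k (\<lambda>x. f x + g x)"
  by (induction k arbitrary: f g) (auto simp: partial_deriv_add intro: continuous_on_add differentiable_add)

lemma C_k_mult: "C_k k f \<Longrightarrow> C_k k g \<Longrightarrow> C_k k (\<lambda>x. f x * g x)"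
proof (induction k arbitrary: f g)
  case (Suc k)
  note C_k_Suc[OF Suc.prems(1)] C_k_Suc[OF Suc.prems(2)]
  with Suc show ?case
    by (auto simp: partial_deriv_mult intro!: differentiable_mult C_k_add Suc.IH)
qed (auto intro: continuous_on_mult)

lemma C_k_prod: "(\<And>i. i \<in> I \<Longrightarrow> C_k k (f i)) \<Longrightarrow> C_k k (\<lambda>x. \<Prod>i\<in>I. f i x)"
  by (induction I rule: infinite_finite_induct) (auto intro: C_k_const C_k_mult)

text \<open>All smooth functions that have to be constructed are sums and products of functions of
  one coordinate, so their smoothness can be settled on the line.\<close>

primrec C_k_line :: "nat \<Rightarrow> (real \<Rightarrow> real) \<Rightarrow> bool" where
  "C_k_line 0 f \<longleftrightarrow> continuous_on UNIV f"
| "C_k_line (Suc k) f \<longleftrightarrow> (\<exists>f'. (\<forall>x. (f has_real_derivative f' x) (at x)) \<and> C_k_line k f')"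

lemma C_k_line_continuous: "C_k_line k f \<Longrightarrow> continuous_on UNIV f"
  by (cases k) (auto simp: continuous_on_eq_continuous_at intro: DERIV_isCont)

lemma C_k_line_Suc: "C_k_line (Suc k) f \<Longrightarrow> C_k_line k f"
proof (induction k arbitrary: f)
  case 0
  then show ?case
    using C_k_line_continuous by fastforce
next
  case (Suc k)
  then show ?case
    by (metis C_k_line.simps(2))
qed

lemma C_k_line_const: "C_k_line k (\<lambda>_. r)"
proof (induction k arbitrary: r)
  case (Suc k)
  then show ?case
    by (auto intro!: exI[of _ "\<lambda>_. 0"])
qed simp

lemma C_k_line_add: "C_k_line k f \<Longrightarrow> C_k_line k g \<Longrightarrow> C_k_line k (\<lambda>x. f x + g x)"
proof (induction k arbitrary: f g)
  case (Suc k)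
  then obtain f' g' where "\<And>x. (f has_real_derivative f' x) (at x)" "C_k_line k f'"
      "\<And>x. (g has_real_derivative g' x) (at x)" "C_k_line k g'"
    by auto
  then show ?case
    using Suc.IH by (auto intro!: exI[of _ "\<lambda>x. f' x + g' x"] DERIV_add)
qed (auto intro: continuous_on_add)

lemma C_k_line_mult: "C_k_line k f \<Longrightarrow> C_k_line k g \<Longrightarrow> C_k_line k (\<lambda>x. f x * g x)"
proof (induction k arbitrary: f g)
  case (Suc k)
  then obtain f' g' where *: "\<And>x. (f has_real_derivative f' x) (at x)" "C_k_line k f'"
      "\<And>x. (g has_real_derivative g' x) (at x)" "C_k_line k g'"
    by auto
  have "C_k_line k (\<lambda>x. f' x * g x + g' x * f x)"
    using * C_k_line_Suc[OF Suc.prems(1)] C_k_line_Suc[OF Suc.prems(2)] by (intro C_k_line_add Suc.IH)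
  then show ?case
    using * by (auto intro!: exI[of _ "\<lambda>x. f' x * g x + g' x * f x"] DERIV_mult)
qed (auto intro: continuous_on_mult)

lemma C_k_line_affine: "C_k_line k f \<Longrightarrow> C_k_line k (\<lambda>x. f (r * x + s))"
proof (induction k arbitrary: f)
  case 0
  then show ?case
    by (auto intro!: continuous_on_compose2[of UNIV f] continuous_intros)
next
  case (Suc k)
  then obtain f' where *: "\<And>x. (f has_real_derivative f' x) (at x)" "C_k_line k f'"
    by auto
  have "C_k_line k (\<lambda>x. f' (r * x + s) * r)"
    using Suc.IH[OF *(2)] by (intro C_k_line_mult C_k_line_const)
  moreover have "((\<lambda>x. f (r * x + s)) has_real_derivative f' (r * x + s) * r) (at x)" for x
    by (rule DERIV_chain2[OF *(1)]) (auto intro!: derivative_eq_intros)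
  ultimately show ?case
    by (auto intro!: exI[of _ "\<lambda>x. f' (r * x + s) * r"])
qed

lemma C_k_line_sin_cos: "C_k_line k (\<lambda>x. sin x) \<and> C_k_line k (\<lambda>x. cos x)"
proof (induction k)
  case (Suc k)
  then have "C_k_line k (\<lambda>x. (-1) * sin x)"
    by (intro C_k_line_mult C_k_line_const) auto
  with Suc show ?case
    unfolding C_k_line.simps
    by (intro conjI, intro exI[of _ cos]) (auto intro!: exI[of _ "\<lambda>x. - sin x"] DERIV_sin DERIV_cos)
qed (auto intro: continuous_intros)

lemma has_derivative_coordinate:
  assumes "(f has_real_derivative f') (at (x $ i))"
  shows "((\<lambda>x. f (x $ i)) has_derivative (\<lambda>h. f' * h $ i)) (at (x :: real^'n))"
proof -
  have "((\<lambda>x. x $ i) has_derivative (\<lambda>h. h $ i)) (at x)"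
    by (intro bounded_linear_imp_has_derivative bounded_linear_vec_nth)
  then show ?thesis
    using has_derivative_compose[of "\<lambda>x. x $ i" "\<lambda>h. h $ i" x UNIV f "(*) f'"] assms
    by (simp add: has_field_derivative_def)
qed

lemma C_k_coordinate: "C_k_line k f \<Longrightarrow> C_k k (\<lambda>x :: real^'n. f (x $ i))"
proof (induction k arbitrary: f)
  case 0
  then show ?case
    by (auto intro!: continuous_on_compose2[of UNIV f] continuous_intros)
next
  case (Suc k)
  then obtain f' where *: "\<And>x. (f has_real_derivative f' x) (at x)" "C_k_line k f'"
    by auto
  have "partial_deriv m (\<lambda>x :: real^'n. f (x $ i)) = (\<lambda>x. f' (x $ i) * (if m = i then 1 else 0))" for m
    by (intro ext) (simp add: partial_deriv_eq[OF has_derivative_coordinate[OF *(1)]] axis_def)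
  then show ?case
    using Suc.IH[OF *(2)] has_derivative_coordinate[OF *(1)]
    by (auto intro!: C_k_mult C_k_const simp: differentiable_def)
qed

subsection \<open>A smooth function that vanishes on a half-line\<close>

text \<open>The index \<open>m\<close> closes the family under differentiation up to linear
  combinations, so that smoothness of the case \<open>m = 0\<close> follows by induction over all
  members.\<close>

definition flat_exp :: "nat \<Rightarrow> real \<Rightarrow> real" where
  "flat_exp m x = (if x > 0 then exp (- 1 / x) / x ^ m else 0)"

lemma flat_exp_deriv:
  "(flat_exp m has_real_derivative flat_exp (m + 2) x - real m * flat_exp (m + 1) x) (at x)"
proof (cases x "0 :: real" rule: linorder_cases)
  case greater
  have "((\<lambda>x. exp (- 1 / x) / x ^ m) has_real_derivative flat_exp (m + 2) x - real m * flat_exp (m + 1) x) (at x)"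
  proof -
    have pow: "k = 0 \<or> x ^ k = x * x ^ (k - Suc 0)" for k
      by (cases k) auto
    show ?thesis
      using greater by (cases m; auto intro!: derivative_eq_intros
        simp: flat_exp_def field_simps power2_eq_square; use pow in blast)
  qed
  then show ?thesis
    by (rule has_field_derivative_transform_within_open[where S = "{0<..}"])
      (use greater in \<open>auto simp: flat_exp_def\<close>)
next
  case less
  have "((\<lambda>x. 0) has_real_derivative flat_exp (m + 2) x - real m * flat_exp (m + 1) x) (at x)"
    using less by (simp add: flat_exp_def)
  then show ?thesis
    by (rule has_field_derivative_transform_within_open[where S = "{..<0}"])
      (use less in \<open>auto simp: flat_exp_def\<close>)
next
  case equal
  \<comment> \<open>In the variable \<open>inverse y\<close> this says that the exponential outgrows
    every power.\<close>
  have "((\<lambda>y. inverse y ^ Suc m / exp (inverse y)) \<longlongrightarrow> (0 :: real)) (at_right 0)"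
    by (rule filterlim_compose[OF tendsto_power_div_exp_0 filterlim_inverse_at_top_right])
  then have "((\<lambda>y. flat_exp m y / y) \<longlongrightarrow> 0) (at_right 0)"
    by (rule Lim_transform_eventually)
      (auto simp: eventually_at_filter flat_exp_def exp_minus field_simps inverse_eq_divide)
  moreover have "((\<lambda>y. flat_exp m y / y) \<longlongrightarrow> 0) (at_left 0)"
    by (rule tendsto_eventually) (auto simp: eventually_at_filter flat_exp_def)
  ultimately have "((\<lambda>y. flat_exp m y / y) \<longlongrightarrow> 0) (at 0)"
    by (simp add: filterlim_split_at)
  then show ?thesis
    using equal by (simp add: has_field_derivative_iff flat_exp_def)
qed

lemma C_k_line_flat_exp: "C_k_line k (flat_exp m)"
proof (induction k arbitrary: m)
  case 0
  show ?case
    using flat_exp_deriv[of m] by (auto simp: continuous_on_eq_continuous_at intro: DERIV_isCont)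
next
  case (Suc k)
  have "C_k_line k (\<lambda>x. flat_exp (m + 2) x + (- real m) * flat_exp (m + 1) x)"
    by (intro C_k_line_add C_k_line_mult C_k_line_const Suc)
  then show ?case
    using flat_exp_deriv[of m]
    by (auto intro!: exI[of _ "\<lambda>x. flat_exp (m + 2) x - real m * flat_exp (m + 1) x"])
qed

section \<open>Test functions and integration by parts\<close>

lemma compact_closure_subset:
  "compact (closure S) \<Longrightarrow> closure T \<subseteq> closure S \<Longrightarrow> compact (closure T)"
  by (metis closed_closure compact_Int_closed inf.absorb2)

lemma partial_deriv_zero_outside:
  assumes "x \<notin> closure {x. f x \<noteq> 0}"
  shows "partial_deriv i f x = 0"
proof -
  have "((\<lambda>_. 0) has_derivative (\<lambda>_. 0)) (at x)"
    by simp
  then have "(f has_derivative (\<lambda>_. 0)) (at x)"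
    by (rule has_derivative_transform_within_open[where s = "- closure {x. f x \<noteq> 0}"])
      (use assms closure_subset[of "{x. f x \<noteq> 0}"] in auto)
  then show ?thesis
    by (simp add: partial_deriv_eq)
qed

lemma closure_support_partial_deriv:
  "closure {x. partial_deriv i f x \<noteq> 0} \<subseteq> closure {x. f x \<noteq> 0}"
  using partial_deriv_zero_outside[of _ f i] by (intro closure_minimal) auto

lemma test_functions_partial_deriv:
  assumes "\<phi> \<in> test_functions Q"
  shows "partial_deriv i \<phi> \<in> test_functions Q"
proof -
  have "C_k k (partial_deriv i \<phi>)" for k
    using assms C_k.simps(2)[of k \<phi>] by (auto simp: test_functions_def simp del: C_k.simps)
  moreover have "compact (closure {x. partial_deriv i \<phi> x \<noteq> 0})"
    using assms compact_closure_subset[OF _ closure_support_partial_deriv[of i \<phi>]]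
    by (simp add: test_functions_def)
  ultimately show ?thesis
    using assms closure_support_partial_deriv[of i \<phi>] by (auto simp: test_functions_def)
qed

lemma C_1_partial_deriv_continuous: "C_k 1 f \<Longrightarrow> continuous_on UNIV (partial_deriv i f)"
  by simp

lemma C_1_has_derivative:
  "C_k 1 f \<Longrightarrow> (f has_derivative frechet_derivative f (at x)) (at x)"
  using frechet_derivative_works by auto

lemma partial_deriv_along:
  assumes "C_k 1 f"
  shows "((\<lambda>t. f (x + t *\<^sub>R axis i 1)) has_real_derivative partial_deriv i f (x + t *\<^sub>R axis i 1)) (at t)"
proof -
  have "((\<lambda>t. x + t *\<^sub>R axis i 1) has_derivative (\<lambda>h. h *\<^sub>R axis i 1)) (at t)"
    by (auto intro!: derivative_eq_intros)
  from has_derivative_compose[OF this C_1_has_derivative[OF assms]]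
  have "((\<lambda>t. f (x + t *\<^sub>R axis i 1)) has_derivative
      (\<lambda>h. frechet_derivative f (at (x + t *\<^sub>R axis i 1)) (h *\<^sub>R axis i 1))) (at t)" .
  moreover have "frechet_derivative f (at y) (h *\<^sub>R axis i 1) = h * partial_deriv i f y" for y h
    using has_derivative_linear[OF C_1_has_derivative[OF assms]]
    by (simp add: partial_deriv_def linear_cmul)
  ultimately show ?thesis
    by (simp add: has_field_derivative_def mult_commute_abs)
qed

lemma continuous_compact_support_bounded:
  fixes f :: "real^'n \<Rightarrow> real"
  assumes "continuous_on UNIV f" "compact (closure {x. f x \<noteq> 0})"
  obtains B where "B \<ge> 0" "\<And>x. \<bar>f x\<bar> \<le> B"
proof -
  let ?K = "closure {x. f x \<noteq> 0}"
  have "compact (f ` ?K)"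
    using assms by (intro compact_continuous_image continuous_on_subset[OF assms(1)]) auto
  then obtain B where B: "\<And>x. x \<in> ?K \<Longrightarrow> \<bar>f x\<bar> \<le> B"
    by (force dest!: compact_imp_bounded simp: bounded_iff)
  have "\<bar>f x\<bar> \<le> max B 0" for x
  proof (cases "f x = 0")
    case False
    then have "x \<in> ?K"
      using closure_subset[of "{x. f x \<noteq> 0}"] by auto
    then show ?thesis
      using B[of x] by simp
  qed simp
  then show thesis
    by (intro that[of "max B 0"]) auto
qed

lemma continuous_compact_support_integrable:
  fixes f :: "real^'n \<Rightarrow> real"
  assumes "continuous_on UNIV f" "compact (closure {x. f x \<noteq> 0})"
  shows "integrable lborel f"
proof -
  have "integrable lborel (\<lambda>x. indicator (closure {x. f x \<noteq> 0}) x *\<^sub>R f x)"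
    using assms by (intro borel_integrable_compact continuous_on_subset[OF assms(1)]) auto
  moreover have "(\<lambda>x. indicator (closure {x. f x \<noteq> 0}) x *\<^sub>R f x) = f"
    using closure_subset[of "{x. f x \<noteq> 0}"] by (auto simp: fun_eq_iff indicator_def)
  ultimately show ?thesis
    by simp
qed

lemma lborel_integral_shift:
  fixes f :: "'a::euclidean_space \<Rightarrow> real"
  assumes "f \<in> borel_measurable borel"
  shows "(\<integral>x. f (v + x) \<partial>lborel) = (\<integral>x. f x \<partial>lborel)"
proof -
  have "(\<integral>x. f x \<partial>lborel) = (\<integral>x. f x \<partial>distr lborel borel ((+) v))"
    by (simp add: lborel_distr_plus)
  also have "\<dots> = (\<integral>x. f (v + x) \<partial>lborel)"
    using assms by (intro integral_distr) auto
  finally show ?thesis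
    by simp
qed

text \<open>Translation invariance makes the integrals of the difference quotients vanish, and
  dominated convergence carries this to the derivative. No splitting into iterated integrals is
  involved.\<close>

lemma integral_partial_deriv_zero:
  fixes f :: "real^'n \<Rightarrow> real"
  assumes C1: "C_k 1 f" and K: "compact (closure {x. f x \<noteq> 0})"
  shows "(\<integral>x. partial_deriv i f x \<partial>lborel) = 0"
proof -
  let ?e = "axis i 1 :: real^'n"
  have cont: "continuous_on UNIV f" "continuous_on UNIV (partial_deriv i f)"
    using C_k_continuous[OF C1] C_1_partial_deriv_continuous[OF C1] by auto
  have "compact (closure {x. partial_deriv i f x \<noteq> 0})"
    using K closure_support_partial_deriv by (rule compact_closure_subset)
  then obtain B where B: "B \<ge> 0" "\<And>x. \<bar>partial_deriv i f x\<bar> \<le> B"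
    using continuous_compact_support_bounded[OF cont(2)] by blast
  obtain r where r: "\<And>x. x \<in> closure {x. f x \<noteq> 0} \<Longrightarrow> norm x \<le> r"
    using compact_imp_bounded[OF K] by (auto simp: bounded_iff)
  then have r: "f x = 0" if "norm x > r" for x
    using that closure_subset[of "{x. f x \<noteq> 0}"] by force
  define q where "q n x = (f (x + (1 / real (Suc n)) *\<^sub>R ?e) - f x) * real (Suc n)" for n x
  have [measurable]: "f \<in> borel_measurable borel" "partial_deriv i f \<in> borel_measurable borel"
    using cont by (auto intro: borel_measurable_continuous_onI)
  have int: "integrable lborel f"
    by (rule continuous_compact_support_integrable[OF cont(1) K])
  have q0: "(\<integral>x. q n x \<partial>lborel) = 0" for n
  proof -
    have "integrable lborel (\<lambda>x. f (x + (1 / real (Suc n)) *\<^sub>R ?e))"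
    proof -
      have "integrable (distr lborel borel ((+) ((1 / real (Suc n)) *\<^sub>R ?e))) f"
        using int by (simp add: lborel_distr_plus)
      then show ?thesis
        by (subst (asm) integrable_distr_eq) (auto simp: add.commute)
    qed
    then have "(\<integral>x. q n x \<partial>lborel) = ((\<integral>x. f (x + (1 / real (Suc n)) *\<^sub>R ?e) \<partial>lborel) - (\<integral>x. f x \<partial>lborel)) * real (Suc n)"
      unfolding q_def using int by simp
    also have "\<dots> = 0"
      using lborel_integral_shift[of f "(1 / real (Suc n)) *\<^sub>R ?e"] by (simp add: add.commute)
    finally show ?thesis .
  qed
  \<comment> \<open>The mean value theorem bounds the quotient by the maximum of the derivative. The
    shifts have length at most 1, so outside radius \<open>r + 1\<close> both function values
    vanish.\<close>
  have bound: "\<bar>q n x\<bar> \<le> B * indicator (cball 0 (r + 1)) x" for n x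
  proof (cases "norm x \<le> r + 1")
    case True
    have "\<exists>z>0. z < 1 / real (Suc n) \<and>
        f (x + (1 / real (Suc n)) *\<^sub>R ?e) - f (x + 0 *\<^sub>R ?e) = (1 / real (Suc n) - 0) * partial_deriv i f (x + z *\<^sub>R ?e)"
      by (rule MVT2) (auto intro: partial_deriv_along[OF C1])
    then obtain z where "f (x + (1 / real (Suc n)) *\<^sub>R ?e) - f x = (1 / real (Suc n)) * partial_deriv i f (x + z *\<^sub>R ?e)"
      by auto
    then have "q n x = partial_deriv i f (x + z *\<^sub>R ?e)"
      unfolding q_def by (simp add: field_simps)
    then show ?thesis
      using B True by simp
  next
    case False
    have "norm x \<le> norm (x + (1 / real (Suc n)) *\<^sub>R ?e) + norm ((1 / real (Suc n)) *\<^sub>R ?e)"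
      using norm_triangle_ineq4[of "x + (1 / real (Suc n)) *\<^sub>R ?e" "(1 / real (Suc n)) *\<^sub>R ?e"] by simp
    moreover have "norm ((1 / real (Suc n)) *\<^sub>R ?e) \<le> 1"
      by (simp add: norm_axis_1 divide_le_eq)
    ultimately have "norm (x + (1 / real (Suc n)) *\<^sub>R ?e) > r" "norm x > r"
      using False by linarith+
    then have "f (x + (1 / real (Suc n)) *\<^sub>R ?e) = 0" "f x = 0"
      by (auto intro!: r)
    then show ?thesis
      by (simp add: q_def B)
  qed
  have lim: "(\<lambda>n. q n x) \<longlonglongrightarrow> partial_deriv i f x" for x
  proof -
    have "((\<lambda>h. (f (x + h *\<^sub>R ?e) - f x) / h) \<longlongrightarrow> partial_deriv i f x) (at 0)"
      using partial_deriv_along[OF C1, of x i 0] by (simp add: has_field_derivative_iff)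
    moreover have "filterlim (\<lambda>n. 1 / real (Suc n)) (at 0) sequentially"
      using LIMSEQ_inverse_real_of_nat by (auto simp: filterlim_at inverse_eq_divide)
    ultimately have "(\<lambda>n. (f (x + (1 / real (Suc n)) *\<^sub>R ?e) - f x) / (1 / real (Suc n))) \<longlonglongrightarrow> partial_deriv i f x"
      by (rule filterlim_compose)
    then show ?thesis
      by (simp add: q_def)
  qed
  have "(\<lambda>n. \<integral>x. q n x \<partial>lborel) \<longlonglongrightarrow> (\<integral>x. partial_deriv i f x \<partial>lborel)"
  proof (rule integral_dominated_convergence[where w = "\<lambda>x. B * indicator (cball 0 (r + 1)) x"])
    show "q n \<in> borel_measurable lborel" for n
      unfolding q_def by measurable
    show "integrable lborel (\<lambda>x :: real^'n. B * indicator (cball 0 (r + 1)) x)"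
      using emeasure_compact_finite[of "cball 0 (r + 1) :: (real^'n) set"]
      by (intro integrable_mult_right integrable_real_indicator) auto
  qed (use bound lim in auto)
  then show ?thesis
    by (simp add: q0 LIMSEQ_const_iff)
qed

lemma integral_lebesgue_on_eq_lborel:
  fixes f :: "real^'n \<Rightarrow> real"
  assumes "Q \<in> sets lebesgue" "f \<in> borel_measurable borel" "\<And>x. x \<notin> Q \<Longrightarrow> f x = 0"
  shows "(LINT x|lebesgue_on Q. f x) = (\<integral>x. f x \<partial>lborel)"
proof -
  have "(LINT x|lebesgue_on Q. f x) = (LINT x|lebesgue. indicator Q x *\<^sub>R f x)"
    using assms by (intro integral_restrict_space) auto
  also have "(\<lambda>x. indicator Q x *\<^sub>R f x) = f"
    using assms by (auto simp: fun_eq_iff indicator_def)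
  also have "(LINT x|lebesgue. f x) = (\<integral>x. f x \<partial>lborel)"
    using assms by (intro integral_completion) auto
  finally show ?thesis .
qed

text \<open>Apply the preceding result to the product: its support lies in that of \<phi>, so
  \<open>f\<close> itself may be arbitrary near the boundary.\<close>

lemma integration_by_parts:
  assumes Q: "Q \<in> sets lebesgue" and \<phi>: "\<phi> \<in> test_functions Q" and f: "C_k 1 f"
  shows "(LINT x|lebesgue_on Q. f x * partial_deriv i \<phi> x) = - (LINT x|lebesgue_on Q. partial_deriv i f x * \<phi> x)"
proof -
  have \<phi>1: "C_k 1 \<phi>" and K: "compact (closure {x. \<phi> x \<noteq> 0})" and sub: "closure {x. \<phi> x \<noteq> 0} \<subseteq> Q"
    using \<phi> by (auto simp: test_functions_def simp del: C_k.simps)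
  have cont: "continuous_on UNIV f" "continuous_on UNIV (partial_deriv i f)"
      "continuous_on UNIV \<phi>" "continuous_on UNIV (partial_deriv i \<phi>)"
    using C_k_continuous[OF f] C_k_continuous[OF \<phi>1] C_1_partial_deriv_continuous[OF f]
      C_1_partial_deriv_continuous[OF \<phi>1] by auto
  have "closure {x. f x * \<phi> x \<noteq> 0} \<subseteq> closure {x. \<phi> x \<noteq> 0}"
    by (intro closure_mono) auto
  with K have "compact (closure {x. f x * \<phi> x \<noteq> 0})"
    by (rule compact_closure_subset)
  from integral_partial_deriv_zero[OF C_k_mult[OF f \<phi>1] this]
  have "(\<integral>x. f x * partial_deriv i \<phi> x + partial_deriv i f x * \<phi> x \<partial>lborel) = 0"
    using f \<phi>1 by (simp add: partial_deriv_mult)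
  moreover have supp: "compact (closure {x. g x * h x \<noteq> 0})"
    if "closure {x. h x \<noteq> 0} \<subseteq> closure {x. \<phi> x \<noteq> 0}" for g h :: "real^'a \<Rightarrow> real"
  proof -
    have "closure {x. g x * h x \<noteq> 0} \<subseteq> closure {x. \<phi> x \<noteq> 0}"
      using closure_mono[of "{x. g x * h x \<noteq> 0}" "{x. h x \<noteq> 0}"] that by auto
    with K show ?thesis
      by (rule compact_closure_subset)
  qed
  have "integrable lborel (\<lambda>x. f x * partial_deriv i \<phi> x)" "integrable lborel (\<lambda>x. partial_deriv i f x * \<phi> x)"
    by (intro continuous_compact_support_integrable continuous_on_mult cont supp closure_support_partial_deriv subset_refl)+
  ultimately have "(\<integral>x. f x * partial_deriv i \<phi> x \<partial>lborel) = - (\<integral>x. partial_deriv i f x * \<phi> x \<partial>lborel)"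
    by simp
  moreover have "\<phi> x = 0" "partial_deriv i \<phi> x = 0" if "x \<notin> Q" for x
    using that sub partial_deriv_zero_outside[of x \<phi> i] closure_subset[of "{x. \<phi> x \<noteq> 0}"] by auto
  ultimately show ?thesis
    using cont by (subst (1 2) integral_lebesgue_on_eq_lborel[OF Q])
      (auto intro!: borel_measurable_continuous_onI continuous_on_mult)
qed

section \<open>Eigenfunctions of the box\<close>

lemma has_real_derivative_prod_line:
  fixes F :: "'n::finite \<Rightarrow> real \<Rightarrow> real" and x :: "real^'n"
  assumes "(F i has_real_derivative G (x $ i)) (at (x $ i))"
  shows "((\<lambda>t. \<Prod>m\<in>UNIV. F m ((x + t *\<^sub>R axis i 1) $ m)) has_real_derivative
    (\<Prod>m\<in>UNIV. (F(i := G)) m (x $ m))) (at 0)"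
proof -
  have split: "(\<Prod>m\<in>UNIV. H m) = H i * (\<Prod>m\<in>UNIV - {i}. H m)" for H :: "'n \<Rightarrow> real"
    by (simp add: prod.remove[of UNIV i])
  have "(\<lambda>t. \<Prod>m\<in>UNIV. F m ((x + t *\<^sub>R axis i 1) $ m)) = (\<lambda>t. F i (x $ i + t) * (\<Prod>m\<in>UNIV - {i}. F m (x $ m)))"
    unfolding split by (intro ext arg_cong2[where f = "(*)"] prod.cong) (auto simp: axis_def)
  moreover have "((\<lambda>t. F i (x $ i + t)) has_real_derivative G (x $ i) * 1) (at 0)"
    by (rule DERIV_chain2[where g = "\<lambda>t. x $ i + t"]) (use assms in \<open>auto intro!: derivative_eq_intros\<close>)
  then have "((\<lambda>t. F i (x $ i + t) * (\<Prod>m\<in>UNIV - {i}. F m (x $ m))) has_real_derivative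
      G (x $ i) * (\<Prod>m\<in>UNIV - {i}. F m (x $ m))) (at 0)"
    by (auto intro!: derivative_eq_intros)
  moreover have "G (x $ i) * (\<Prod>m\<in>UNIV - {i}. F m (x $ m)) = (\<Prod>m\<in>UNIV. (F(i := G)) m (x $ m))"
    unfolding split by simp
  ultimately show ?thesis
    by simp
qed

lemma C_k_prod_line:
  fixes F :: "'n::finite \<Rightarrow> real \<Rightarrow> real"
  shows "(\<And>m. C_k_line k (F m)) \<Longrightarrow> C_k k (\<lambda>x :: real^'n. \<Prod>m\<in>UNIV. F m (x $ m))"
  by (intro C_k_prod C_k_coordinate)

lemma partial_deriv_prod_line:
  fixes F :: "'n::finite \<Rightarrow> real \<Rightarrow> real"
  assumes "\<And>m. C_k_line 1 (F m)" "\<And>x. (F i has_real_derivative G x) (at x)"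
  shows "partial_deriv i (\<lambda>x :: real^'n. \<Prod>m\<in>UNIV. F m (x $ m)) = (\<lambda>x. \<Prod>m\<in>UNIV. (F(i := G)) m (x $ m))"
proof
  fix x :: "real^'n"
  show "partial_deriv i (\<lambda>x :: real^'n. \<Prod>m\<in>UNIV. F m (x $ m)) x = (\<Prod>m\<in>UNIV. (F(i := G)) m (x $ m))"
    using partial_deriv_along[OF C_k_prod_line[of 1 F, OF assms(1)], where x = x and i = i and t = 0]
      has_real_derivative_prod_line[where F = F and i = i and G = G and x = x, OF assms(2)]
    by (auto intro: DERIV_unique)
qed

definition grad :: "(real^'n::finite \<Rightarrow> real) \<Rightarrow> real^'n \<Rightarrow> real^'n" where
  "grad f x = (\<chi> i. partial_deriv i f x)"

lemma grad_continuous: "C_k 1 f \<Longrightarrow> continuous_on UNIV (grad f)"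
  unfolding grad_def by (intro continuous_on_vec_lambda C_1_partial_deriv_continuous)

locale box_domain =
  fixes l :: "real^'n::finite"
  assumes l_pos: "\<And>i. l $ i > 0"
begin

abbreviation Q :: "(real^'n) set" where
  "Q \<equiv> box 0 l"

abbreviation M :: "(real^'n) measure" where
  "M \<equiv> lebesgue_on Q"

lemma Q_iff: "x \<in> Q \<longleftrightarrow> (\<forall>i. 0 < x $ i \<and> x $ i < l $ i)"
  by (simp add: mem_box_cart)

lemma Q_sets: "Q \<in> sets lebesgue"
  by simp

sublocale M: finite_measure M
  by (intro finite_measure_lebesgue_on lmeasurable_box)

lemma M_measurable: "f \<in> borel_measurable borel \<Longrightarrow> f \<in> borel_measurable M"
  by (rule measurable_restrict_space1) (simp add: measurable_completion)

lemma M_measurable_continuous: "continuous_on UNIV f \<Longrightarrow> f \<in> borel_measurable M"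
  by (intro M_measurable borel_measurable_continuous_onI)

lemma L2_bounded:
  assumes "f \<in> borel_measurable M" "\<And>x. x \<in> Q \<Longrightarrow> norm (f x) \<le> B"
  shows "f \<in> L2_space Q"
proof -
  have "integrable M (\<lambda>x. (norm (f x))\<^sup>2)"
    by (rule M.integrable_const_bound[of _ "B\<^sup>2"])
      (use assms in \<open>auto intro!: AE_I2 power_mono simp: abs_le_square_iff\<close>)
  then show ?thesis
    using assms by (simp add: L2_space_def)
qed

lemma L2_continuous:
  assumes "continuous_on UNIV f"
  shows "f \<in> L2_space Q"
proof -
  have "compact (f ` cbox 0 l)"
    by (intro compact_continuous_image continuous_on_subset[OF assms]) auto
  then obtain B where "\<And>x. x \<in> cbox 0 l \<Longrightarrow> norm (f x) \<le> B"
    by (force dest!: compact_imp_bounded simp: bounded_iff)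
  then show ?thesis
    using box_subset_cbox[of 0 l] by (intro L2_bounded[of f B] M_measurable_continuous assms) auto
qed

lemma L2_integrable:
  assumes "f \<in> L2_space Q"
  shows "integrable M f"
proof (rule Bochner_Integration.integrable_bound)
  show "integrable M (\<lambda>x. 1 + (norm (f x))\<^sup>2)"
    using L2_integrable_sq[OF assms] by simp
  have "y \<le> 1 + y\<^sup>2" if "y \<ge> 0" for y :: real
  proof -
    have "0 \<le> (y - 1)\<^sup>2 + y"
      using that by simp
    then show ?thesis
      by (simp add: power2_diff)
  qed
  then show "AE x in M. norm (f x) \<le> norm (1 + (norm (f x))\<^sup>2)"
    by (intro AE_I2) simp
qed (rule L2_measurable[OF assms])

lemma L2_dominated_convergence:
  fixes f :: "nat \<Rightarrow> real^'n \<Rightarrow> 'b::euclidean_space"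
  assumes "\<And>n. f n \<in> borel_measurable M" "g \<in> borel_measurable M"
    and bound: "\<And>n x. x \<in> Q \<Longrightarrow> norm (f n x) \<le> B"
    and lim: "\<And>x. x \<in> Q \<Longrightarrow> (\<lambda>n. f n x) \<longlonglongrightarrow> g x"
  shows "(\<lambda>n. L2_norm Q (\<lambda>x. f n x - g x)) \<longlonglongrightarrow> 0"
proof -
  have "(\<lambda>n. LINT x|M. (norm (f n x - g x))\<^sup>2) \<longlonglongrightarrow> (LINT x|M. 0)"
  proof (rule integral_dominated_convergence[where w = "\<lambda>_. (2 * B)\<^sup>2"])
    show "AE x in M. (\<lambda>n. (norm (f n x - g x))\<^sup>2) \<longlonglongrightarrow> 0"
      using lim by (intro AE_I2) (auto intro!: tendsto_eq_intros simp: LIM_zero_iff)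
    have "norm (g x) \<le> B" if "x \<in> Q" for x
      using bound[OF that] by (intro LIMSEQ_le_const2[OF tendsto_norm[OF lim[OF that]]]) auto
    then have "norm (f n x - g x) \<le> 2 * B" if "x \<in> Q" for n x
      using bound[OF that, of n] norm_triangle_ineq4[of "f n x" "g x"] that by force
    then have "(norm (f n x - g x))\<^sup>2 \<le> (2 * B)\<^sup>2" if "x \<in> Q" for n x
      using that by (intro power_mono) auto
    then show "AE x in M. norm ((norm (f n x - g x))\<^sup>2) \<le> (2 * B)\<^sup>2" for n
      by (intro AE_I2) simp
  qed (use assms in auto)
  then show ?thesis
    unfolding L2_norm_def using tendsto_real_sqrt by fastforce
qed

lemma weak_gradient_grad: "C_k 1 f \<Longrightarrow> is_weak_gradient Q f (grad f)"
  unfolding is_weak_gradient_def using integration_by_parts[OF Q_sets] by (auto simp: grad_def)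

lemma grad_L2: "C_k 1 f \<Longrightarrow> grad f \<in> L2_space Q"
  by (intro L2_continuous grad_continuous)

lemma test_C_k: "\<phi> \<in> test_functions Q \<Longrightarrow> C_k k \<phi>"
  by (simp add: test_functions_def)

lemma test_L2: "\<phi> \<in> test_functions Q \<Longrightarrow> \<phi> \<in> L2_space Q"
  by (intro L2_continuous C_k_continuous test_C_k)

lemma test_functions_prod:
  fixes F :: "'n \<Rightarrow> real \<Rightarrow> real"
  assumes smooth: "\<And>m k. C_k_line k (F m)"
    and supp: "\<And>m x. F m x \<noteq> 0 \<Longrightarrow> \<alpha> \<le> x \<and> x \<le> l $ m - \<alpha>" and "\<alpha> > 0"
  shows "(\<lambda>x. \<Prod>m\<in>UNIV. F m (x $ m)) \<in> test_functions Q"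
proof -
  let ?f = "\<lambda>x :: real^'n. \<Prod>m\<in>UNIV. F m (x $ m)"
  have "{x. ?f x \<noteq> 0} \<subseteq> cbox (\<chi> i. \<alpha>) (\<chi> i. l $ i - \<alpha>)"
  proof
    fix x assume "x \<in> {x. ?f x \<noteq> 0}"
    then have "F i (x $ i) \<noteq> 0" for i
      by simp
    from supp[OF this] show "x \<in> cbox (\<chi> i. \<alpha>) (\<chi> i. l $ i - \<alpha>)"
      by (simp add: mem_box_cart)
  qed
  then have sub: "closure {x. ?f x \<noteq> 0} \<subseteq> cbox (\<chi> i. \<alpha>) (\<chi> i. l $ i - \<alpha>)"
    by (intro closure_minimal closed_cbox)
  moreover have "cbox (\<chi> i. \<alpha>) (\<chi> i. l $ i - \<alpha>) \<subseteq> Q"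
    using \<open>\<alpha> > 0\<close> by (auto simp: mem_box_cart) (smt (verit))+
  moreover have "compact (closure {x. ?f x \<noteq> 0})"
    using sub compact_closure_subset[of "cbox (\<chi> i. \<alpha>) (\<chi> i. l $ i - \<alpha>)"] by simp
  ultimately show ?thesis
    unfolding test_functions_def using C_k_prod_line[OF smooth] by (auto simp del: C_k.simps)
qed

text \<open>The successor lets every multi-index of natural numbers stand for a nonzero mode that
  vanishes on the boundary.\<close>

definition freq :: "('n \<Rightarrow> nat) \<Rightarrow> 'n \<Rightarrow> real" where
  "freq j i = real (Suc (j i)) * pi / l $ i"

definition sines :: "('n \<Rightarrow> nat) \<Rightarrow> real^'n \<Rightarrow> real" where
  "sines j x = (\<Prod>m\<in>UNIV. sin (freq j m * x $ m))"

lemma freq_pos: "freq j i > 0"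
  using l_pos[of i] by (simp add: freq_def)

text \<open>The reflection that transfers estimates near 0 to the opposite end of the edge.\<close>

lemma sin_freq_reflect: "\<bar>sin (freq j i * (l $ i - y))\<bar> = \<bar>sin (freq j i * y)\<bar>"
proof -
  have "freq j i * (l $ i - y) = real (Suc (j i)) * pi - freq j i * y"
    using l_pos[of i] by (simp add: freq_def field_simps)
  moreover have "sin (real (Suc (j i)) * pi) = 0" "\<bar>cos (real (Suc (j i)) * pi)\<bar> = 1"
    by (auto simp: sin_npi cos_npi power_abs simp del: of_nat_Suc)
  ultimately show ?thesis
    by (simp only: sin_diff abs_mult mult_zero_left diff_0 abs_minus mult_1)
qed

lemma C_k_line_sin: "C_k_line k (\<lambda>x. sin (r * x))" and C_k_line_cos: "C_k_line k (\<lambda>x. cos (r * x))"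
  using C_k_line_affine[of k sin r 0] C_k_line_affine[of k cos r 0] C_k_line_sin_cos[of k] by auto

lemma sines_C_k: "C_k k (sines j)"
  unfolding sines_def by (intro C_k_prod_line C_k_line_sin)

lemma sin_deriv: "((\<lambda>x. sin (r * x)) has_real_derivative r * cos (r * x)) (at x)"
  and cos_deriv: "((\<lambda>x. r * cos (r * x)) has_real_derivative - (r\<^sup>2) * sin (r * x)) (at x)"
  for r x :: real
  by (auto intro!: derivative_eq_intros simp: power2_eq_square)

lemma partial_deriv_sines:
  "partial_deriv i (sines j) = (\<lambda>x. \<Prod>m\<in>UNIV. ((\<lambda>m x. sin (freq j m * x))(i := \<lambda>x. freq j i * cos (freq j i * x))) m (x $ m))"
  unfolding sines_def by (rule partial_deriv_prod_line) (use C_k_line_sin sin_deriv in auto)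

lemma partial_deriv2_sines:
  "partial_deriv i (partial_deriv i (sines j)) = (\<lambda>x. - (freq j i)\<^sup>2 * sines j x)"
proof -
  let ?F = "(\<lambda>m x. sin (freq j m * x))(i := \<lambda>x. freq j i * cos (freq j i * x))"
  have "partial_deriv i (partial_deriv i (sines j)) =
      (\<lambda>x. \<Prod>m\<in>UNIV. (?F(i := \<lambda>x. - ((freq j i)\<^sup>2) * sin (freq j i * x))) m (x $ m))"
    unfolding partial_deriv_sines
  proof (rule partial_deriv_prod_line)
    show "C_k_line 1 (?F m)" for m
      using C_k_line_mult[OF C_k_line_const C_k_line_cos, of 1 "freq j i" "freq j i"] C_k_line_sin[of 1]
      by (simp del: C_k_line.simps)
    show "(?F i has_real_derivative - ((freq j i)\<^sup>2) * sin (freq j i * x)) (at x)" for x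
      using cos_deriv by simp
  qed
  also have "\<dots> = (\<lambda>x. - (freq j i)\<^sup>2 * sines j x)"
    unfolding sines_def by (intro ext) (simp add: prod.remove[of UNIV i])
  finally show ?thesis .
qed

subsection \<open>Approximation by test functions\<close>

text \<open>Vanishes for \<open>y \<le> 1 / real (Suc n)\<close> and tends to 1 for each positive
  \<open>y\<close>. No plateau at the value 1 is built in: pointwise convergence with uniform bounds
  is enough for dominated convergence.\<close>

definition cutoff :: "nat \<Rightarrow> real \<Rightarrow> real" where
  "cutoff n y = flat_exp 0 (real (Suc n) * y - 1)"

definition cutoff' :: "nat \<Rightarrow> real \<Rightarrow> real" where
  "cutoff' n y = real (Suc n) * flat_exp 2 (real (Suc n) * y - 1)"

lemma cutoff_smooth: "C_k_line k (cutoff n)"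
  using C_k_line_affine[OF C_k_line_flat_exp, of k 0 "real (Suc n)" "-1"] by (simp add: cutoff_def[abs_def])

lemma cutoff_deriv: "(cutoff n has_real_derivative cutoff' n y) (at y)"
  unfolding cutoff_def[abs_def] cutoff'_def
  by (rule DERIV_cong[OF DERIV_chain2[OF flat_exp_deriv]])
    (auto intro!: derivative_eq_intros simp: numeral_2_eq_2)

lemma cutoff_bounds: "0 \<le> cutoff n y" "cutoff n y \<le> 1" "\<bar>cutoff n y\<bar> \<le> 1"
  by (auto simp: cutoff_def flat_exp_def)

lemma cutoff_support: "cutoff n y \<noteq> 0 \<Longrightarrow> y \<ge> 1 / real (Suc n)"
  by (auto simp: cutoff_def flat_exp_def field_simps split: if_splits)

lemma filterlim_scaled: "y > 0 \<Longrightarrow> filterlim (\<lambda>n. real (Suc n) * y - 1) at_top sequentially"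
  by real_asymp

lemma cutoff_tendsto:
  assumes "y > 0"
  shows "(\<lambda>n. cutoff n y) \<longlonglongrightarrow> 1"
proof -
  have "((\<lambda>x. exp (- 1 / x)) \<longlongrightarrow> (1 :: real)) at_top"
    by real_asymp
  moreover have "\<forall>\<^sub>F x :: real in at_top. exp (- 1 / x) = flat_exp 0 x"
    using eventually_gt_at_top[of 0] by eventually_elim (simp add: flat_exp_def)
  ultimately have "(flat_exp 0 \<longlongrightarrow> 1) at_top"
    by (rule Lim_transform_eventually)
  from filterlim_compose[OF this filterlim_scaled[OF assms]] show ?thesis
    unfolding cutoff_def .
qed

lemma cutoff'_nonneg: "cutoff' n y \<ge> 0"
  by (simp add: cutoff'_def flat_exp_def)

text \<open>The bounds \<open>exp (- 1 / x) \<le> x\<close> and \<open>exp (- 1 / x) \<le> 2 x\<^sup>2\<close> control the derivative of the cutoff.\<close>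

lemma cutoff'_bound:
  assumes "y \<ge> 0"
  shows "y * cutoff' n y \<le> 3"
proof -
  define x where "x = real (Suc n) * y - 1"
  have *: "y * cutoff' n y = (x + 1) * flat_exp 2 x"
    by (simp add: cutoff'_def x_def)
  show ?thesis
  proof (cases "x > 0")
    case True
    have "1 + 1 / x + (1 / x)\<^sup>2 / 2 \<le> exp (1 / x)"
      using True by (intro exp_lower_Taylor_quadratic) simp
    then have "1 / x \<le> exp (1 / x)" "(1 / x)\<^sup>2 / 2 \<le> exp (1 / x)"
      using True by (smt (verit) divide_nonneg_nonneg zero_le_power2 zero_le_divide_1_iff)+
    then have "exp (- 1 / x) \<le> x" "exp (- 1 / x) \<le> 2 * x\<^sup>2"
      using True by (auto simp: exp_minus field_simps)
    then have "exp (- 1 / x) / x \<le> 1" "exp (- 1 / x) / x\<^sup>2 \<le> 2"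
      using True by (auto simp: field_simps)
    moreover have "(x + 1) * flat_exp 2 x = exp (- 1 / x) / x + exp (- 1 / x) / x\<^sup>2"
      using True by (simp add: flat_exp_def field_simps power2_eq_square)
    ultimately show ?thesis
      unfolding * by linarith
  qed (simp add: * flat_exp_def)
qed

lemma cutoff'_tendsto:
  assumes "y > 0"
  shows "(\<lambda>n. y * cutoff' n y) \<longlonglongrightarrow> 0"
proof -
  have "((\<lambda>x. (x + 1) * (exp (- 1 / x) / x ^ 2)) \<longlongrightarrow> (0 :: real)) at_top"
    by real_asymp
  moreover have "\<forall>\<^sub>F x :: real in at_top. (x + 1) * (exp (- 1 / x) / x ^ 2) = (x + 1) * flat_exp 2 x"
    using eventually_gt_at_top[of 0] by eventually_elim (simp add: flat_exp_def)
  ultimately have "((\<lambda>x. (x + 1) * flat_exp 2 x) \<longlongrightarrow> 0) at_top"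
    by (rule Lim_transform_eventually)
  from filterlim_compose[OF this filterlim_scaled[OF assms]] show ?thesis
    by (simp add: cutoff'_def mult_ac)
qed

text \<open>The second cutoff is the first one reflected, so that the support avoids both ends of
  the edge.\<close>

definition cut_sin :: "('n \<Rightarrow> nat) \<Rightarrow> nat \<Rightarrow> 'n \<Rightarrow> real \<Rightarrow> real" where
  "cut_sin j n m y = sin (freq j m * y) * (cutoff n y * cutoff n (l $ m - y))"

definition cut_sin' :: "('n \<Rightarrow> nat) \<Rightarrow> nat \<Rightarrow> 'n \<Rightarrow> real \<Rightarrow> real" where
  "cut_sin' j n m y = freq j m * cos (freq j m * y) * (cutoff n y * cutoff n (l $ m - y))
     + sin (freq j m * y) * (cutoff' n y * cutoff n (l $ m - y))
     - sin (freq j m * y) * (cutoff n y * cutoff' n (l $ m - y))"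

lemma cut_sin_smooth: "C_k_line k (cut_sin j n m)"
  unfolding cut_sin_def[abs_def]
  using C_k_line_affine[OF cutoff_smooth, of k n "-1" "l $ m"]
  by (intro C_k_line_mult C_k_line_sin cutoff_smooth) (simp add: algebra_simps)

lemma cut_sin_deriv: "(cut_sin j n m has_real_derivative cut_sin' j n m y) (at y)"
proof -
  have "((\<lambda>y. cutoff n (l $ m - y)) has_real_derivative cutoff' n (l $ m - y) * (-1)) (at y)"
    by (rule DERIV_chain2[OF cutoff_deriv]) (auto intro!: derivative_eq_intros)
  then show ?thesis
    unfolding cut_sin_def[abs_def]
    by (intro DERIV_cong[OF DERIV_mult[OF sin_deriv DERIV_mult[OF cutoff_deriv]]])
      (auto simp: cut_sin'_def algebra_simps)
qed

lemma cut_sin_support: "cut_sin j n m y \<noteq> 0 \<Longrightarrow> 1 / real (Suc n) \<le> y \<and> y \<le> l $ m - 1 / real (Suc n)"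
  using cutoff_support[of n y] cutoff_support[of n "l $ m - y"] by (auto simp: cut_sin_def)

lemma cut_sin_bound: "\<bar>cut_sin j n m y\<bar> \<le> 1"
  unfolding cut_sin_def abs_mult using cutoff_bounds
  by (intro mult_le_one) (auto intro!: mult_le_one mult_nonneg_nonneg simp: abs_of_nonneg)

lemma cut_sin_tendsto:
  assumes "0 < y" "y < l $ m"
  shows "(\<lambda>n. cut_sin j n m y) \<longlonglongrightarrow> sin (freq j m * y)"
  using cutoff_tendsto[of y] cutoff_tendsto[of "l $ m - y"] assms
  unfolding cut_sin_def by (auto intro!: tendsto_eq_intros)

lemma abs_sin_freq_le: "y \<ge> 0 \<Longrightarrow> \<bar>sin (freq j m * y)\<bar> \<le> freq j m * y"
  using abs_sin_le_one abs_sin_x_le_abs_x[of "freq j m * y"] freq_pos[of j m] by (simp add: abs_mult)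

text \<open>The derivative of the cutoff is large near an endpoint, but the sine vanishes there
  linearly. The product is controlled by the distance to the endpoint times \<open>cutoff'\<close>,
  which is bounded and tends to 0.\<close>

lemma cut_sin'_terms:
  assumes "0 < y" "y < l $ m"
  shows "\<bar>sin (freq j m * y) * (cutoff' n y * cutoff n (l $ m - y))\<bar> \<le> freq j m * (y * cutoff' n y)"
    and "\<bar>sin (freq j m * y) * (cutoff n y * cutoff' n (l $ m - y))\<bar> \<le> freq j m * ((l $ m - y) * cutoff' n (l $ m - y))"
proof -
  have "\<bar>sin (freq j m * y)\<bar> * (\<bar>cutoff' n y\<bar> * \<bar>cutoff n (l $ m - y)\<bar>) \<le> (freq j m * y) * (cutoff' n y * 1)"
    using assms cutoff_bounds cutoff'_nonneg abs_sin_freq_le[of y j m] freq_pos[of j m]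
    by (intro mult_mono) (auto simp: abs_of_nonneg)
  then show "\<bar>sin (freq j m * y) * (cutoff' n y * cutoff n (l $ m - y))\<bar> \<le> freq j m * (y * cutoff' n y)"
    by (simp add: abs_mult mult_ac)
  have "\<bar>sin (freq j m * y)\<bar> \<le> freq j m * (l $ m - y)"
    using abs_sin_freq_le[of "l $ m - y" j m] assms by (simp add: sin_freq_reflect)
  then have "\<bar>sin (freq j m * y)\<bar> * (\<bar>cutoff n y\<bar> * \<bar>cutoff' n (l $ m - y)\<bar>) \<le> (freq j m * (l $ m - y)) * (1 * cutoff' n (l $ m - y))"
    using assms cutoff_bounds cutoff'_nonneg freq_pos[of j m]
    by (intro mult_mono) (auto simp: abs_of_nonneg)
  then show "\<bar>sin (freq j m * y) * (cutoff n y * cutoff' n (l $ m - y))\<bar> \<le> freq j m * ((l $ m - y) * cutoff' n (l $ m - y))"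
    by (simp add: abs_mult mult_ac)
qed

text \<open>The 7 is 1 for the derivative of the sine and 3 for each of the two cutoffs.\<close>

lemma cut_sin'_bound:
  assumes "0 < y" "y < l $ m"
  shows "\<bar>cut_sin' j n m y\<bar> \<le> 7 * freq j m"
proof -
  have "\<bar>freq j m * cos (freq j m * y) * (cutoff n y * cutoff n (l $ m - y))\<bar> \<le> freq j m * 1 * (1 * 1)"
    unfolding abs_mult using freq_pos[of j m] cutoff_bounds by (intro mult_mono) auto
  moreover have "freq j m * (y * cutoff' n y) \<le> freq j m * 3"
      "freq j m * ((l $ m - y) * cutoff' n (l $ m - y)) \<le> freq j m * 3"
    using cutoff'_bound assms freq_pos[of j m] by (intro mult_left_mono; simp)+
  ultimately show ?thesis
    unfolding cut_sin'_def using cut_sin'_terms[OF assms, of j n] by linarith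
qed

lemma cut_sin'_tendsto:
  assumes "0 < y" "y < l $ m"
  shows "(\<lambda>n. cut_sin' j n m y) \<longlonglongrightarrow> freq j m * cos (freq j m * y)"
proof -
  have t1: "(\<lambda>n. sin (freq j m * y) * (cutoff' n y * cutoff n (l $ m - y))) \<longlonglongrightarrow> 0"
    by (rule Lim_null_comparison[OF always_eventually tendsto_mult_right_zero[OF cutoff'_tendsto[OF assms(1)]]])
      (use cut_sin'_terms(1)[OF assms] in auto)
  have t2: "(\<lambda>n. sin (freq j m * y) * (cutoff n y * cutoff' n (l $ m - y))) \<longlonglongrightarrow> 0"
    by (rule Lim_null_comparison[OF always_eventually tendsto_mult_right_zero[OF cutoff'_tendsto[of "l $ m - y"], of "freq j m"]])
      (use cut_sin'_terms(2)[OF assms] assms in auto)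
  have t3: "(\<lambda>n. freq j m * cos (freq j m * y) * (cutoff n y * cutoff n (l $ m - y))) \<longlonglongrightarrow> freq j m * cos (freq j m * y) * (1 * 1)"
    using assms by (intro tendsto_intros cutoff_tendsto) auto
  show ?thesis
    unfolding cut_sin'_def using tendsto_diff[OF tendsto_add[OF t3 t1] t2] by simp
qed

definition cut_sines :: "('n \<Rightarrow> nat) \<Rightarrow> nat \<Rightarrow> real^'n \<Rightarrow> real" where
  "cut_sines j n x = (\<Prod>m\<in>UNIV. cut_sin j n m (x $ m))"

lemma cut_sines_test: "cut_sines j n \<in> test_functions Q"
  unfolding cut_sines_def[abs_def]
  by (rule test_functions_prod[where \<alpha> = "1 / real (Suc n)"]) (use cut_sin_smooth cut_sin_support in auto)

lemma cut_sines_tendsto: "(\<lambda>n. L2_norm Q (\<lambda>x. cut_sines j n x - sines j x)) \<longlonglongrightarrow> 0"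
proof (rule L2_dominated_convergence)
  show "cut_sines j n \<in> borel_measurable M" for n
    by (intro M_measurable_continuous C_k_continuous[of 0] test_C_k cut_sines_test)
  show "sines j \<in> borel_measurable M"
    by (intro M_measurable_continuous C_k_continuous[OF sines_C_k[of 0]])
  show "norm (cut_sines j n x) \<le> 1" for n x
    unfolding cut_sines_def real_norm_def abs_prod by (intro prod_le_1) (simp add: cut_sin_bound)
  show "(\<lambda>n. cut_sines j n x) \<longlonglongrightarrow> sines j x" if "x \<in> Q" for x
    unfolding cut_sines_def sines_def using that by (intro tendsto_prod cut_sin_tendsto) (auto simp: Q_iff)
qed

lemma grad_cut_sines_tendsto: "(\<lambda>n. L2_norm Q (\<lambda>x. grad (cut_sines j n) x - grad (sines j) x)) \<longlonglongrightarrow> 0"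
proof (rule L2_dominated_convergence)
  show "grad (cut_sines j n) \<in> borel_measurable M" for n
    by (intro M_measurable_continuous grad_continuous test_C_k cut_sines_test)
  show "grad (sines j) \<in> borel_measurable M"
    by (intro M_measurable_continuous grad_continuous sines_C_k)
  have pd: "partial_deriv i (cut_sines j n) = (\<lambda>x. \<Prod>m\<in>UNIV. ((cut_sin j n)(i := cut_sin' j n i)) m (x $ m))" for n i
    unfolding cut_sines_def[abs_def] by (rule partial_deriv_prod_line) (intro cut_sin_smooth cut_sin_deriv)+
  have split: "(\<Prod>m\<in>UNIV. H m) = H i * (\<Prod>m\<in>UNIV - {i}. H m)" for H :: "'n \<Rightarrow> real" and i
    by (simp add: prod.remove[of UNIV i])
  have "\<bar>partial_deriv i (cut_sines j n) x\<bar> \<le> 7 * freq j i" if "x \<in> Q" for n i x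
  proof -
    have "\<bar>\<Prod>m\<in>UNIV - {i}. cut_sin j n m (x $ m)\<bar> \<le> 1"
      unfolding abs_prod by (intro prod_le_1) (simp add: cut_sin_bound)
    then have "\<bar>cut_sin' j n i (x $ i)\<bar> * \<bar>\<Prod>m\<in>UNIV - {i}. cut_sin j n m (x $ m)\<bar> \<le> 7 * freq j i * 1"
      using that freq_pos[of j i] by (intro mult_mono cut_sin'_bound) (auto simp: Q_iff)
    then show ?thesis
      unfolding pd split[of _ i] abs_mult by simp
  qed
  then have "(\<Sum>i\<in>UNIV. \<bar>grad (cut_sines j n) x $ i\<bar>) \<le> (\<Sum>i\<in>UNIV. 7 * freq j i)" if "x \<in> Q" for n x
    using that by (intro sum_mono) (simp add: grad_def)
  then show "norm (grad (cut_sines j n) x) \<le> (\<Sum>i\<in>UNIV. 7 * freq j i)" if "x \<in> Q" for n x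
    using that norm_le_l1_cart[of "grad (cut_sines j n) x"] order_trans by blast
  have "(\<lambda>n. partial_deriv i (cut_sines j n) x) \<longlonglongrightarrow> partial_deriv i (sines j) x" if "x \<in> Q" for i x
    unfolding pd partial_deriv_sines using that
    by (intro tendsto_prod) (auto simp: Q_iff intro!: cut_sin_tendsto cut_sin'_tendsto)
  then show "(\<lambda>n. grad (cut_sines j n) x) \<longlonglongrightarrow> grad (sines j) x" if "x \<in> Q" for x
    unfolding grad_def using that by (intro tendsto_vec_lambda) auto
qed

end

subsection \<open>Completeness of the eigenfunctions\<close>

text \<open>Multiplying a sine by the cosine yields the mean of the two neighbouring sines, so
  orthogonality to all sines is inherited by their products with powers of the cosine. The measure
  and the weight \<open>w\<close> are general because \<open>w\<close> later absorbs the other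
  coordinates.\<close>

lemma sines_span_step:
  fixes w :: "'a \<Rightarrow> real"
  assumes w: "integrable M w" and [measurable]: "\<theta> \<in> borel_measurable M"
    and orth: "\<And>k. (LINT x|M. w x * sin (real (Suc k) * \<theta> x)) = 0"
  shows "(LINT x|M. w x * (cos (\<theta> x) ^ p * sin (real k * \<theta> x))) = 0"
proof (induction p arbitrary: k)
  case 0
  then show ?case
    using orth[of "k - 1"] by (cases k) auto
next
  case (Suc p)
  show ?case
  proof (cases k)
    case (Suc k')
    have [measurable]: "w \<in> borel_measurable M"
      using w by simp
    have int: "integrable M (\<lambda>x. w x * (cos (\<theta> x) ^ p * sin (real m * \<theta> x)))" for m
    proof (rule Bochner_Integration.integrable_bound[OF w])
      have "\<bar>cos y ^ p * sin z\<bar> \<le> 1" for y z :: real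
        unfolding abs_mult power_abs by (intro mult_le_one power_le_one) auto
      then have "\<bar>w x\<bar> * \<bar>cos (\<theta> x) ^ p * sin (real m * \<theta> x)\<bar> \<le> \<bar>w x\<bar> * 1" for x
        by (intro mult_left_mono) auto
      then show "AE x in M. norm (w x * (cos (\<theta> x) ^ p * sin (real m * \<theta> x))) \<le> norm (w x)"
        by (intro AE_I2) (simp add: abs_mult)
    qed simp
    have trig: "cos y * sin (real k * y) = (sin (real (Suc k) * y) + sin (real k' * y)) / 2" for y
    proof -
      have "real (Suc k) * y = real k * y + y" "real k' * y = real k * y - y"
        by (auto simp: Suc algebra_simps)
      then show ?thesis
        by (simp only: sin_add sin_diff) simp
    qed
    have eq: "w x * (cos (\<theta> x) ^ Suc p * sin (real k * \<theta> x)) =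
        (w x * (cos (\<theta> x) ^ p * sin (real (Suc k) * \<theta> x)) + w x * (cos (\<theta> x) ^ p * sin (real k' * \<theta> x))) / 2" for x
    proof -
      have "w x * (cos (\<theta> x) ^ Suc p * sin (real k * \<theta> x)) = w x * (cos (\<theta> x) ^ p * (cos (\<theta> x) * sin (real k * \<theta> x)))"
        by simp
      then show ?thesis
        unfolding trig by (simp add: distrib_left add_divide_distrib)
    qed
    show ?thesis
      unfolding eq using int Suc.IH by (simp del: of_nat_Suc)
  qed simp
qed

text \<open>Powers of the cosine give polynomials in it, and by Weierstrass these approximate
  \<open>G\<close> uniformly on \<open>{-1..1}\<close>, the range of the cosine.\<close>

lemma sines_cos_continuous:
  fixes w :: "'a \<Rightarrow> real"
  assumes w: "integrable M w" and [measurable]: "\<theta> \<in> borel_measurable M"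
    and orth: "\<And>k. (LINT x|M. w x * sin (real (Suc k) * \<theta> x)) = 0"
    and G: "continuous_on UNIV (G :: real \<Rightarrow> real)"
  shows "(LINT x|M. w x * (G (cos (\<theta> x)) * sin (\<theta> x))) = 0"
proof -
  have [measurable]: "w \<in> borel_measurable M" "G \<in> borel_measurable borel"
    using w G by (auto intro: borel_measurable_continuous_onI)
  have bounded_int: "integrable M (\<lambda>x. w x * (H (cos (\<theta> x)) * sin (\<theta> x)))"
    if H: "continuous_on UNIV H" for H :: "real \<Rightarrow> real"
  proof -
    have [measurable]: "H \<in> borel_measurable borel"
      using H by (rule borel_measurable_continuous_onI)
    have "compact (H ` {-1..1})"
      by (intro compact_continuous_image continuous_on_subset[OF H]) auto
    then obtain B where B: "\<And>y. y \<in> {-1..1} \<Longrightarrow> \<bar>H y\<bar> \<le> B"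
      by (force dest!: compact_imp_bounded simp: bounded_iff)
    have "B \<ge> 0"
      using B[of 1] by simp
    have "\<bar>w x\<bar> * (\<bar>H (cos (\<theta> x))\<bar> * \<bar>sin (\<theta> x)\<bar>) \<le> \<bar>w x\<bar> * (B * 1)" for x
      using B[of "cos (\<theta> x)"] by (intro mult_mono mult_nonneg_nonneg) auto
    then show ?thesis
      by (intro Bochner_Integration.integrable_bound[OF integrable_mult_right[OF integrable_abs[OF w], of B]] AE_I2)
        (use \<open>B \<ge> 0\<close> in \<open>auto simp: abs_mult mult_ac\<close>)
  qed
  have poly: "(LINT x|M. w x * (H (cos (\<theta> x)) * sin (\<theta> x))) = 0" if H: "real_polynomial_function H" for H
  proof -
    obtain a n where Hs: "H = (\<lambda>x. \<Sum>i\<le>n. a i * x ^ i)"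
      using H real_polynomial_function_iff_sum by blast
    have "integrable M (\<lambda>x. w x * (cos (\<theta> x) ^ i * sin (\<theta> x)))" for i
      using bounded_int[of "\<lambda>y. y ^ i"] by (simp add: continuous_intros)
    moreover have "(LINT x|M. w x * (cos (\<theta> x) ^ i * sin (\<theta> x))) = 0" for i
      using sines_span_step[OF w _ orth, of i 1] by simp
    moreover have "w x * (H (cos (\<theta> x)) * sin (\<theta> x)) = (\<Sum>i\<le>n. a i * (w x * (cos (\<theta> x) ^ i * sin (\<theta> x))))" for x
      by (simp add: Hs sum_distrib_left sum_distrib_right mult_ac)
    ultimately show ?thesis
      by simp
  qed
  define W where "W = (LINT x|M. \<bar>w x\<bar>)"
  have W: "W \<ge> 0"
    by (simp add: W_def)
  have est: "\<bar>LINT x|M. w x * (G (cos (\<theta> x)) * sin (\<theta> x))\<bar> \<le> e * W" if "e > 0" for e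
  proof -
    have "continuous_on {-1..1} G"
      by (rule continuous_on_subset[OF G]) simp
    then obtain H where H: "real_polynomial_function H" "\<And>y. y \<in> {-1..1} \<Longrightarrow> \<bar>G y - H y\<bar> < e"
      using Stone_Weierstrass_real_polynomial_function[OF compact_Icc _ \<open>e > 0\<close>] by blast
    have contH: "continuous_on UNIV H"
      using H(1) by (simp add: continuous_on_polymonial_function real_polynomial_function_eq)
    have "(LINT x|M. w x * (G (cos (\<theta> x)) * sin (\<theta> x)))
        = (LINT x|M. w x * (G (cos (\<theta> x)) * sin (\<theta> x)) - w x * (H (cos (\<theta> x)) * sin (\<theta> x)))"
      using bounded_int[OF G] bounded_int[OF contH] poly[OF H(1)] by simp
    also have "\<bar>\<dots>\<bar> \<le> (LINT x|M. e * \<bar>w x\<bar>)"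
    proof (rule order_trans[OF integral_abs_bound], rule integral_mono)
      show "integrable M (\<lambda>x. \<bar>w x * (G (cos (\<theta> x)) * sin (\<theta> x)) - w x * (H (cos (\<theta> x)) * sin (\<theta> x))\<bar>)"
        using bounded_int[OF G] bounded_int[OF contH] by simp
      show "integrable M (\<lambda>x. e * \<bar>w x\<bar>)"
        using w by simp
      fix x
      have "\<bar>w x\<bar> * \<bar>G (cos (\<theta> x)) - H (cos (\<theta> x))\<bar> * \<bar>sin (\<theta> x)\<bar> \<le> \<bar>w x\<bar> * e * 1"
        using H(2)[of "cos (\<theta> x)"] \<open>e > 0\<close> by (intro mult_mono mult_left_mono) auto
      moreover have "w x * (G (cos (\<theta> x)) * sin (\<theta> x)) - w x * (H (cos (\<theta> x)) * sin (\<theta> x))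
          = w x * (G (cos (\<theta> x)) - H (cos (\<theta> x))) * sin (\<theta> x)"
        by (simp add: algebra_simps)
      ultimately show "\<bar>w x * (G (cos (\<theta> x)) * sin (\<theta> x)) - w x * (H (cos (\<theta> x)) * sin (\<theta> x))\<bar> \<le> e * \<bar>w x\<bar>"
        by (simp add: abs_mult mult.commute)
    qed
    also have "\<dots> = e * W"
      by (simp add: W_def)
    finally show ?thesis .
  qed
  have "\<bar>LINT x|M. w x * (G (cos (\<theta> x)) * sin (\<theta> x))\<bar> \<le> 0 + e" if "e > 0" for e
  proof -
    have "\<bar>LINT x|M. w x * (G (cos (\<theta> x)) * sin (\<theta> x))\<bar> \<le> e / (W + 1) * W"
      by (rule est) (use that W in simp)
    also have "e / (W + 1) * W \<le> 0 + e"
      using that W by (simp add: field_simps)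
    finally show ?thesis .
  qed
  then have "\<bar>LINT x|M. w x * (G (cos (\<theta> x)) * sin (\<theta> x))\<bar> \<le> 0"
    by (rule field_le_epsilon)
  then show ?thesis
    by simp
qed

text \<open>
  Continuous functions of \<open>cos \<theta>\<close> approximate the indicator of \<open>\<theta> \<in> [\<alpha>, \<beta>]\<close> divided by \<open>sin \<theta>\<close>,
  since \<open>cos\<close> decreases and \<open>sin\<close> is positive on \<open>(0, \<pi>)\<close>.
\<close>

lemma sines_indicator:
  fixes w :: "'a \<Rightarrow> real"
  assumes w: "integrable M w" and [measurable]: "\<theta> \<in> borel_measurable M"
    and orth: "\<And>k. (LINT x|M. w x * sin (real (Suc k) * \<theta> x)) = 0"
    and range: "\<And>x. x \<in> space M \<Longrightarrow> 0 < \<theta> x \<and> \<theta> x < pi"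
    and ab: "0 < \<alpha>" "\<alpha> \<le> \<beta>" "\<beta> < pi"
  shows "(LINT x|M. w x * indicator {\<alpha>..\<beta>} (\<theta> x)) = 0"
proof -
  have [measurable]: "w \<in> borel_measurable M"
    using w by simp
  have "continuous_on {\<alpha>..\<beta>} sin" "{\<alpha>..\<beta>} \<noteq> {}"
    using ab by (auto intro: continuous_intros)
  then obtain y0 where y0: "y0 \<in> {\<alpha>..\<beta>}" "\<And>y. y \<in> {\<alpha>..\<beta>} \<Longrightarrow> sin y0 \<le> sin y"
    using continuous_attains_inf[OF compact_Icc] by metis
  define \<delta> where "\<delta> = sin y0"
  have \<delta>: "\<delta> > 0" "\<And>y. y \<in> {\<alpha>..\<beta>} \<Longrightarrow> \<delta> \<le> sin y"
    using y0 ab by (auto simp: \<delta>_def intro: sin_gt_zero)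
  \<comment> \<open>Equal to 1 on the interval from \<open>cos \<beta>\<close> to
    \<open>cos \<alpha>\<close> and decreasing linearly with slope \<open>n\<close> outside, down to
    0.\<close>
  define tent where "tent n y = max 0 (1 - real n * max 0 (max (cos \<beta> - y) (y - cos \<alpha>)))" for n y
  \<comment> \<open>The square root is the sine expressed through the cosine. The maximum with
    \<delta> changes nothing for angles between \<alpha> and \<beta> and keeps the quotient bounded
    elsewhere.\<close>
  define G where "G n y = tent n y / max \<delta> (sqrt (1 - y\<^sup>2))" for n y
  have contG: "continuous_on UNIV (G n)" for n
    unfolding G_def tent_def using \<delta>(1) by (intro continuous_intros) (auto simp: max_def)
  have G0: "(LINT x|M. w x * (G n (cos (\<theta> x)) * sin (\<theta> x))) = 0" for n
    by (rule sines_cos_continuous[OF w _ orth contG]) simp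
  have tent: "0 \<le> tent n y" "tent n y \<le> 1" for n y
    by (auto simp: tent_def)
  have lim: "(\<lambda>n. G n (cos \<phi>) * sin \<phi>) \<longlonglongrightarrow> indicator {\<alpha>..\<beta>} \<phi>" if "0 < \<phi>" "\<phi> < pi" for \<phi>
  proof -
    have "sin \<phi> > 0"
      using that by (rule sin_gt_zero)
    then have s: "sqrt (1 - (cos \<phi>)\<^sup>2) = sin \<phi>" "sin \<phi> > 0"
      by (simp_all add: sin_squared_eq[symmetric])
    have le: "cos \<beta> \<le> cos \<phi> \<longleftrightarrow> \<phi> \<le> \<beta>" "cos \<phi> \<le> cos \<alpha> \<longleftrightarrow> \<alpha> \<le> \<phi>"
      using that ab by (intro cos_mono_le_eq; simp)+
    show ?thesis
    proof (cases "\<phi> \<in> {\<alpha>..\<beta>}")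
      case True
      then have "tent n (cos \<phi>) = 1" for n
        using le by (simp add: tent_def max_def)
      then show ?thesis
        using s \<delta>(2)[OF True] True by (simp add: G_def max_def)
    next
      case False
      define D where "D = max 0 (max (cos \<beta> - cos \<phi>) (cos \<phi> - cos \<alpha>))"
      have "D > 0"
        using False le by (auto simp: D_def max_def)
      have "\<forall>\<^sub>F n in sequentially. G n (cos \<phi>) * sin \<phi> = 0"
      proof -
        obtain N where N: "real N > 1 / D"
          using reals_Archimedean2 by blast
        have "tent n (cos \<phi>) = 0" if "n \<ge> N" for n
        proof -
          have "real N * D \<le> real n * D"
            using that \<open>D > 0\<close> by (intro mult_right_mono) auto
          moreover have "1 < real N * D"
            using N \<open>D > 0\<close> by (simp add: field_simps)
          ultimately have "1 \<le> real n * D"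
            by linarith
          then show ?thesis
            unfolding tent_def D_def[symmetric] by simp
        qed
        then show ?thesis
          by (intro eventually_sequentiallyI[of N]) (simp add: G_def)
      qed
      then show ?thesis
        using False by (simp add: tendsto_eventually)
    qed
  qed
  have Gb: "\<bar>G n y\<bar> \<le> 1 / \<delta>" for n y
    using tent[of n y] \<delta>(1) unfolding G_def abs_divide by (intro frac_le) auto
  have "(\<lambda>n. LINT x|M. w x * (G n (cos (\<theta> x)) * sin (\<theta> x))) \<longlonglongrightarrow> (LINT x|M. w x * indicator {\<alpha>..\<beta>} (\<theta> x))"
  proof (rule integral_dominated_convergence[where w = "\<lambda>x. \<bar>w x\<bar> * (1 / \<delta>)"])
    have [measurable]: "G n \<in> borel_measurable borel" for n
      by (intro borel_measurable_continuous_onI contG)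
    show "(\<lambda>x. w x * (G n (cos (\<theta> x)) * sin (\<theta> x))) \<in> borel_measurable M" for n
      by measurable
    show "(\<lambda>x. w x * indicator {\<alpha>..\<beta>} (\<theta> x)) \<in> borel_measurable M"
      by measurable
    show "integrable M (\<lambda>x. \<bar>w x\<bar> * (1 / \<delta>))"
      using w by simp
    show "AE x in M. (\<lambda>n. w x * (G n (cos (\<theta> x)) * sin (\<theta> x))) \<longlonglongrightarrow> w x * indicator {\<alpha>..\<beta>} (\<theta> x)"
      using range by (intro AE_I2 tendsto_mult_left lim) auto
    have "\<bar>w x\<bar> * (\<bar>G n (cos (\<theta> x))\<bar> * \<bar>sin (\<theta> x)\<bar>) \<le> \<bar>w x\<bar> * (1 / \<delta> * 1)" for n x
      using Gb \<delta>(1) by (intro mult_left_mono mult_mono) auto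
    then show "AE x in M. norm (w x * (G n (cos (\<theta> x)) * sin (\<theta> x))) \<le> \<bar>w x\<bar> * (1 / \<delta>)" for n
      by (intro AE_I2) (simp add: abs_mult)
  qed
  then show ?thesis
    by (simp add: G0 LIMSEQ_const_iff)
qed

context box_domain
begin

text \<open>Sine factors are exchanged for indicators of intervals one coordinate at a time. At each
  step the remaining factors, of either kind, are bounded and join \<open>f\<close> in the
  weight.\<close>

lemma orthogonal_sines_boxes:
  assumes f: "integrable M f" and orth: "\<And>j. (LINT x|M. f x * sines j x) = 0"
    and ab: "\<And>i. 0 < a $ i \<and> a $ i \<le> b $ i \<and> b $ i < l $ i"
  shows "(LINT x|M. f x * indicator (cbox a b) x) = 0"
proof -
  have claim: "(LINT x|M. f x * ((\<Prod>i\<in>I. indicator {a $ i..b $ i} (x $ i)) * (\<Prod>i\<in>UNIV - I. sin (freq j i * x $ i)))) = 0"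
    for I :: "'n set" and j
  proof (induction I arbitrary: j rule: infinite_finite_induct)
    case (infinite A)
    then show ?case by simp
  next
    case empty
    then show ?case
      using orth[of j] by (simp add: sines_def)
  next
    case (insert i I)
    define rest where "rest x = (\<Prod>i\<in>I. indicator {a $ i..b $ i} (x $ i)) * (\<Prod>i\<in>UNIV - insert i I. sin (freq j i * x $ i))" for x :: "real^'n"
    define w where "w x = f x * rest x" for x
    define \<theta> where "\<theta> x = pi * x $ i / l $ i" for x
    have [measurable]: "f \<in> borel_measurable M"
      using f by simp
    have coord [measurable]: "(\<lambda>x. x $ k) \<in> borel_measurable M" for k
      by (intro M_measurable_continuous continuous_intros)
    have [measurable]: "rest \<in> borel_measurable M" "\<theta> \<in> borel_measurable M"
      unfolding rest_def \<theta>_def by measurable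
    have "\<bar>rest x\<bar> \<le> 1" for x
      unfolding rest_def abs_mult abs_prod
      by (intro mult_le_one prod_le_1 prod_nonneg) (auto simp: indicator_def)
    then have "\<bar>f x\<bar> * \<bar>rest x\<bar> \<le> \<bar>f x\<bar> * 1" for x
      by (intro mult_left_mono) auto
    then have w: "integrable M w"
      unfolding w_def by (intro Bochner_Integration.integrable_bound[OF f] AE_I2) (auto simp: abs_mult)
    have sub: "UNIV - I = insert i (UNIV - insert i I)"
      using insert by auto
    \<comment> \<open>The induction hypothesis holds for every multi-index, so the mode in direction
      \<open>i\<close> may be varied while the others stay fixed.\<close>
    have "(LINT x|M. w x * sin (real (Suc k) * \<theta> x)) = 0" for k
    proof -
      have "w x * sin (real (Suc k) * \<theta> x) = f x * ((\<Prod>i\<in>I. indicator {a $ i..b $ i} (x $ i)) * (\<Prod>m\<in>UNIV - I. sin (freq (j(i := k)) m * x $ m)))" for x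
      proof -
        have "sin (real (Suc k) * \<theta> x) = sin (freq (j(i := k)) i * x $ i)"
          by (simp add: \<theta>_def freq_def mult.assoc)
        moreover have "(\<Prod>m\<in>UNIV - insert i I. sin (freq j m * x $ m)) = (\<Prod>m\<in>UNIV - insert i I. sin (freq (j(i := k)) m * x $ m))"
          by (intro prod.cong) (auto simp: freq_def)
        ultimately show ?thesis
          unfolding sub by (simp add: w_def rest_def mult_ac)
      qed
      then show ?thesis
        by (simp only: insert.IH[of "j(i := k)"])
    qed
    moreover have "0 < \<theta> x \<and> \<theta> x < pi" if "x \<in> space M" for x
      using that l_pos[of i] by (auto simp: \<theta>_def Q_iff field_simps)
    moreover have "0 < pi * a $ i / l $ i" "pi * a $ i / l $ i \<le> pi * b $ i / l $ i" "pi * b $ i / l $ i < pi"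
      using ab[of i] l_pos[of i] by (auto simp: field_simps)
    ultimately have "(LINT x|M. w x * indicator {pi * a $ i / l $ i..pi * b $ i / l $ i} (\<theta> x)) = 0"
      by (intro sines_indicator w) auto
    moreover have "indicator {pi * a $ i / l $ i..pi * b $ i / l $ i} (\<theta> x) = (indicator {a $ i..b $ i} (x $ i) :: real)" for x
      using l_pos[of i] by (auto simp: \<theta>_def indicator_def field_simps)
    ultimately show ?case
      using insert by (simp add: w_def rest_def mult_ac)
  qed
  have "(\<Prod>i\<in>UNIV. indicator {a $ i..b $ i} (x $ i)) = (indicator (cbox a b) x :: real)" for x
    by (auto simp: indicator_def mem_box_cart)
  then show ?thesis
    using claim[of UNIV] by simp
qed

text \<open>The closed boxes treated before stay away from the boundary. Growing closed boxes
  exhaust the open one inside the domain.\<close>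

lemma orthogonal_sines_open_boxes:
  assumes f: "integrable M f" and orth: "\<And>j. (LINT x|M. f x * sines j x) = 0"
  shows "(LINT x|M. f x * indicator (box a b) x) = 0"
proof -
  \<comment> \<open>Clipping to the domain does not affect the integral and makes the shrunken boxes
    admissible.\<close>
  define a' where "a' = (\<chi> i. max (a $ i) 0)"
  define b' where "b' = (\<chi> i. min (b $ i) (l $ i))"
  have eq: "x \<in> box a b \<longleftrightarrow> x \<in> box a' b'" if "x \<in> Q" for x
    using that by (auto simp: mem_box_cart a'_def b'_def)
  define an bn where "an n = (\<chi> i. a' $ i + 1 / real (Suc n))" and "bn n = (\<chi> i. b' $ i - 1 / real (Suc n))" for n
  have in_cbox: "x \<in> cbox (an n) (bn n) \<longleftrightarrow> (\<forall>i. a' $ i + 1 / real (Suc n) \<le> x $ i \<and> x $ i \<le> b' $ i - 1 / real (Suc n))" for x n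
    by (simp add: mem_box_cart an_def bn_def)
  have pos: "1 / real (Suc n) > 0" for n
    by simp
  have zero: "(LINT x|M. f x * indicator (cbox (an n) (bn n)) x) = 0" for n
  proof (cases "\<forall>i. an n $ i \<le> bn n $ i")
    case True
    have "0 < an n $ i \<and> an n $ i \<le> bn n $ i \<and> bn n $ i < l $ i" for i
    proof -
      have "0 \<le> a' $ i" "b' $ i \<le> l $ i" "an n $ i = a' $ i + 1 / real (Suc n)" "bn n $ i = b' $ i - 1 / real (Suc n)"
        by (simp_all add: a'_def b'_def an_def bn_def)
      then show ?thesis
        using True[rule_format, of i] pos[of n] by linarith
    qed
    then show ?thesis
      by (intro orthogonal_sines_boxes[OF f orth])
  next
    case False
    then obtain i where i: "\<not> an n $ i \<le> bn n $ i"
      by blast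
    have "x \<notin> cbox (an n) (bn n)" for x
    proof
      assume "x \<in> cbox (an n) (bn n)"
      then have "an n $ i \<le> x $ i" "x $ i \<le> bn n $ i"
        by (simp_all add: mem_box_cart)
      with i show False
        by simp
    qed
    then have "cbox (an n) (bn n) = {}"
      by blast
    then show ?thesis
      by simp
  qed
  have "(\<lambda>n. LINT x|M. f x * indicator (cbox (an n) (bn n)) x) \<longlonglongrightarrow> (LINT x|M. f x * indicator (box a b) x)"
  proof (rule integral_dominated_convergence[where w = "\<lambda>x. \<bar>f x\<bar>"])
    have [measurable]: "f \<in> borel_measurable M" "indicator (box a b) \<in> borel_measurable M" "indicator (cbox u v) \<in> borel_measurable M" for u v
      using f by (auto intro!: M_measurable)
    show "(\<lambda>x. f x * indicator (box a b) x) \<in> borel_measurable M"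
      "(\<lambda>x. f x * indicator (cbox (an n) (bn n)) x) \<in> borel_measurable M" for n
      by measurable
    show "AE x in M. norm (f x * indicator (cbox (an n) (bn n)) x) \<le> \<bar>f x\<bar>" for n
      by (intro AE_I2) (auto simp: indicator_def)
    show "AE x in M. (\<lambda>n. f x * indicator (cbox (an n) (bn n)) x) \<longlonglongrightarrow> f x * indicator (box a b) x"
    proof (intro AE_I2 tendsto_mult_left)
      fix x assume "x \<in> space M"
      then have "x \<in> Q"
        by simp
      show "(\<lambda>n. indicator (cbox (an n) (bn n)) x :: real) \<longlonglongrightarrow> indicator (box a b) x"
      proof (cases "x \<in> box a b")
        case True
        then have x: "x \<in> box a' b'"
          using eq[OF \<open>x \<in> Q\<close>] by simp
        have "\<forall>\<^sub>F n in sequentially. a' $ i + 1 / real (Suc n) \<le> x $ i \<and> x $ i \<le> b' $ i - 1 / real (Suc n)" for i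
        proof -
          have "(\<lambda>n. a' $ i + 1 / real (Suc n)) \<longlonglongrightarrow> a' $ i + 0" "(\<lambda>n. b' $ i - 1 / real (Suc n)) \<longlonglongrightarrow> b' $ i - 0"
            by (intro tendsto_add tendsto_diff tendsto_const LIMSEQ_inverse_real_of_nat[unfolded inverse_eq_divide])+
          moreover have "a' $ i + 0 < x $ i" "x $ i < b' $ i - 0"
            using x by (auto simp: mem_box_cart)
          ultimately have "\<forall>\<^sub>F n in sequentially. a' $ i + 1 / real (Suc n) < x $ i" "\<forall>\<^sub>F n in sequentially. x $ i < b' $ i - 1 / real (Suc n)"
            by (auto dest: order_tendstoD)
          then show ?thesis
            by eventually_elim simp
        qed
        then have "\<forall>\<^sub>F n in sequentially. x \<in> cbox (an n) (bn n)"
          unfolding in_cbox by (intro eventually_all_finite) auto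
        then show ?thesis
          using True by (intro tendsto_eventually) (auto elim: eventually_mono)
      next
        case False
        have "x \<notin> cbox (an n) (bn n)" for n
        proof
          assume "x \<in> cbox (an n) (bn n)"
          then have "a' $ i + 1 / real (Suc n) \<le> x $ i" "x $ i \<le> b' $ i - 1 / real (Suc n)" for i
            unfolding in_cbox by auto
          then have "a' $ i < x $ i \<and> x $ i < b' $ i" for i
            using pos[of n] by (smt (verit, best))
          then show False
            using False eq[OF \<open>x \<in> Q\<close>] by (auto simp: mem_box_cart)
        qed
        then show ?thesis
          using False by simp
      qed
    qed
  qed (use f in auto)
  then show ?thesis
    by (simp add: zero LIMSEQ_const_iff)
qed

text \<open>Open boxes are stable under intersection and generate the Borel sets, so the integral
  over every Borel set vanishes, and then over every Lebesgue set.\<close>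

lemma orthogonal_sines_AE_zero:
  assumes f: "integrable M f" and orth: "\<And>j. (LINT x|M. f x * sines j x) = 0"
  shows "AE x in M. f x = 0"
proof -
  have [measurable]: "f \<in> borel_measurable M"
    using f by simp
  have indM: "indicator A \<in> borel_measurable M" if "A \<in> sets borel" for A
    using that by (intro M_measurable) auto
  have int: "integrable M (\<lambda>x. f x * indicator A x)" if "A \<in> sets borel" for A
  proof (rule Bochner_Integration.integrable_bound[OF f borel_measurable_times[OF _ indM[OF that]]])
    show "AE x in M. norm (f x * indicator A x) \<le> norm (f x)"
      by (intro AE_I2) (auto simp: indicator_def)
  qed simp
  \<comment> \<open>The domain is itself an open box; its integral is what the complement step below
    requires.\<close>
  have "(LINT x|M. f x * indicator (box 0 l) x) = (LINT x|M. f x)"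
    by (intro Bochner_Integration.integral_cong) auto
  then have total: "(LINT x|M. f x) = 0"
    using orthogonal_sines_open_boxes[OF f orth, of 0 l] by simp
  have borel: "(LINT x|M. f x * indicator A x) = 0" if "A \<in> sets borel" for A
  proof -
    have "Int_stable (range (\<lambda>(a, b). box a b :: (real^'n) set))"
      unfolding Int_stable_def by (auto simp: box_Int_box)
    moreover have "range (\<lambda>(a, b). box a b :: (real^'n) set) \<subseteq> Pow UNIV"
      by simp
    moreover have "A \<in> sigma_sets UNIV (range (\<lambda>(a, b). box a b :: (real^'n) set))"
      using that unfolding borel_eq_box by simp
    ultimately show ?thesis
    proof (induction A rule: sigma_sets_induct_disjoint)
      case (basic A)
      then show ?case
        using orthogonal_sines_open_boxes[OF f orth] by auto
    next
      case (compl A)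
      have A: "A \<in> sets borel"
        using compl unfolding borel_eq_box by simp
      have "(LINT x|M. f x * indicator (UNIV - A) x) = (LINT x|M. f x - f x * indicator A x)"
        by (intro Bochner_Integration.integral_cong) (auto simp: indicator_def)
      then show ?case
        using compl total f int[OF A] by simp
    next
      case (union A)
      have A: "A i \<in> sets borel" for i
        using union unfolding borel_eq_box by auto
      have "(LINT x|M. f x * indicator (\<Union>i<n. A i) x) = 0" for n :: nat
      proof -
        have eq: "f x * indicator (\<Union>i<n. A i) x = (\<Sum>i<n. f x * indicator (A i) x)" for x
          using union(1) by (subst indicator_UN_disjoint)
            (auto simp: sum_distrib_left disjoint_family_on_def)
        show ?thesis
          unfolding eq by (subst Bochner_Integration.integral_sum) (rule int[OF A], simp only: union.IH sum.neutral_const)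
      qed
      moreover have "(\<lambda>n. LINT x|M. f x * indicator (\<Union>i<n. A i) x) \<longlonglongrightarrow> (LINT x|M. f x * indicator (\<Union>i. A i) x)"
      proof (rule integral_dominated_convergence[where w = "\<lambda>x. \<bar>f x\<bar>"])
        show "(\<lambda>x. f x * indicator (\<Union>i. A i) x) \<in> borel_measurable M"
          "(\<lambda>x. f x * indicator (\<Union>i<n. A i) x) \<in> borel_measurable M" for n :: nat
          using A by (auto intro!: borel_measurable_times indM)
        show "AE x in M. norm (f x * indicator (\<Union>i<n. A i) x) \<le> \<bar>f x\<bar>" for n :: nat
          by (intro AE_I2) (auto simp: indicator_def)
        show "AE x in M. (\<lambda>n. f x * indicator (\<Union>i<n. A i) x) \<longlonglongrightarrow> f x * indicator (\<Union>i. A i) x"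
          by (intro AE_I2 tendsto_mult_left LIMSEQ_indicator_UN)
      qed (use f in auto)
      ultimately show ?case
        by (simp add: LIMSEQ_const_iff)
    qed simp
  qed
  show ?thesis
  proof (rule M.density_zero[OF f])
    fix A assume "A \<in> sets M"
    then have A: "A \<in> sets lebesgue" "A \<subseteq> Q"
      by (auto simp: sets_restrict_space)
    \<comment> \<open>A Lebesgue set is a Borel set up to a null set.\<close>
    then obtain S N where S: "A = S \<union> N" "S \<in> sets lborel" and N: "N \<in> null_sets lebesgue"
      using sets_completionE[of A lborel] null_sets_completion_iff2 by (smt (verit))
    have "AE x in lebesgue. x \<notin> N"
      using N by (rule AE_not_in)
    then have "AE x in M. x \<notin> N"
      by (subst AE_restrict_space_iff) (auto elim: eventually_mono)
    then have "AE x in M. indicator A x *\<^sub>R f x = f x * indicator S x"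
      by eventually_elim (auto simp: S indicator_def)
    then have "(LINT x|M. indicator A x *\<^sub>R f x) = (LINT x|M. f x * indicator S x)"
    proof (intro integral_cong_AE)
      show "(\<lambda>x. indicator A x *\<^sub>R f x) \<in> borel_measurable M"
        using \<open>A \<in> sets M\<close> by measurable
      show "(\<lambda>x. f x * indicator S x) \<in> borel_measurable M"
        using S(2) by (intro borel_measurable_times indM) auto
    qed
    then show "set_lebesgue_integral M A f = 0"
      using borel[of S] S by (simp add: set_lebesgue_integral_def)
  qed
qed

end

section \<open>Sobolev spaces on the box\<close>

context box_domain
begin

lemma sines_complete:
  assumes "f \<in> L2_space Q" "\<And>j. L2_inner Q f (sines j) = 0"
  shows "AE x in M. f x = 0"
  using assms(2) by (intro orthogonal_sines_AE_zero L2_integrable[OF assms(1)]) (simp add: L2_inner_def)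

lemma sines_L2: "sines j \<in> L2_space Q"
  by (intro L2_continuous C_k_continuous[OF sines_C_k[of 0]])

lemma L2_component:
  fixes g :: "real^'n \<Rightarrow> real^'n"
  assumes "g \<in> L2_space Q"
  shows "(\<lambda>x. g x $ i) \<in> L2_space Q"
proof -
  have m: "(\<lambda>x. g x $ i) \<in> borel_measurable M"
    using borel_measurable_inner[OF L2_measurable[OF assms] borel_measurable_const, of "axis i 1"]
    by (simp add: inner_axis)
  have "integrable M (\<lambda>x. (g x $ i)\<^sup>2)"
  proof (rule Bochner_Integration.integrable_bound[OF L2_integrable_sq[OF assms]])
    show "AE x in M. norm ((g x $ i)\<^sup>2) \<le> norm ((norm (g x))\<^sup>2)"
      using component_le_norm_cart by (intro AE_I2) (simp add: abs_le_square_iff[symmetric])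
  qed (use m in simp)
  with m show ?thesis
    by (simp add: L2_space_def)
qed

lemma L2_norm_component_le:
  fixes g :: "real^'n \<Rightarrow> real^'n"
  assumes "g \<in> L2_space Q"
  shows "L2_norm Q (\<lambda>x. g x $ i) \<le> L2_norm Q g"
  unfolding L2_norm_def
proof (intro real_sqrt_le_mono integral_mono)
  show "integrable M (\<lambda>x. (norm (g x $ i))\<^sup>2)" "integrable M (\<lambda>x. (norm (g x))\<^sup>2)"
    using L2_integrable_sq[OF L2_component[OF assms]] L2_integrable_sq[OF assms] by auto
  show "(norm (g x $ i))\<^sup>2 \<le> (norm (g x))\<^sup>2" for x
    using component_le_norm_cart[of "g x" i] by (simp add: abs_le_square_iff[symmetric])
qed

lemma weak_gradient_iff:
  "is_weak_gradient Q f g \<longleftrightarrow> (\<forall>\<phi>\<in>test_functions Q. \<forall>i.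
     L2_inner Q f (partial_deriv i \<phi>) = - L2_inner Q (\<lambda>x. g x $ i) \<phi>)"
  by (simp add: is_weak_gradient_def L2_inner_def)

text \<open>The cut-off sines are test functions converging to the complete system of sines, so a
  component that annihilates all test functions vanishes almost everywhere.\<close>

lemma weak_gradient_unique:
  assumes g: "g \<in> L2_space Q" "is_weak_gradient Q f g" and g': "g' \<in> L2_space Q" "is_weak_gradient Q f g'"
  shows "AE x in M. g x = g' x"
proof -
  have "AE x in M. g x $ i - g' x $ i = 0" for i
  proof (rule sines_complete)
    note gi = L2_component[OF g(1), of i] L2_component[OF g'(1), of i]
    then show h: "(\<lambda>x. g x $ i - g' x $ i) \<in> L2_space Q"
      by (rule L2_diff)
    fix j
    have "L2_inner Q (\<lambda>x. g x $ i - g' x $ i) (cut_sines j n) = 0" for n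
      using g(2) g'(2) gi test_L2[OF cut_sines_test] cut_sines_test[of j n]
      by (simp add: L2_inner_diff_left weak_gradient_iff)
    moreover have "(\<lambda>n. L2_inner Q (cut_sines j n) (\<lambda>x. g x $ i - g' x $ i)) \<longlonglongrightarrow> L2_inner Q (sines j) (\<lambda>x. g x $ i - g' x $ i)"
      by (intro L2_norm_tendsto_inner test_L2 cut_sines_test sines_L2 h cut_sines_tendsto)
    ultimately show "L2_inner Q (\<lambda>x. g x $ i - g' x $ i) (sines j) = 0"
      by (simp add: L2_inner_commute[of Q "cut_sines _ _"] L2_inner_commute[of Q "sines _"] LIMSEQ_const_iff)
  qed
  then have "AE x in M. \<forall>i. g x $ i - g' x $ i = 0"
    by (simp add: AE_all_countable)
  then show ?thesis
    by eventually_elim (simp add: vec_eq_iff)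
qed

lemma weak_gradient_limit:
  assumes "\<And>n. f n \<in> L2_space Q" "\<And>n. g n \<in> L2_space Q" "\<And>n. is_weak_gradient Q (f n) (g n)"
    and fg: "f' \<in> L2_space Q" "g' \<in> L2_space Q"
    and lim: "(\<lambda>n. L2_norm Q (\<lambda>x. f n x - f' x)) \<longlonglongrightarrow> 0" "(\<lambda>n. L2_norm Q (\<lambda>x. g n x - g' x)) \<longlonglongrightarrow> 0"
  shows "is_weak_gradient Q f' g'"
  unfolding weak_gradient_iff
proof (intro ballI allI)
  fix \<phi> i assume \<phi>: "\<phi> \<in> test_functions Q"
  have 1: "(\<lambda>n. L2_inner Q (f n) (partial_deriv i \<phi>)) \<longlonglongrightarrow> L2_inner Q f' (partial_deriv i \<phi>)"
    by (intro L2_norm_tendsto_inner assms test_L2 test_functions_partial_deriv \<phi>)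
  have "(\<lambda>n. L2_norm Q (\<lambda>x. g n x $ i - g' x $ i)) \<longlonglongrightarrow> 0"
  proof (rule Lim_null_comparison[OF always_eventually lim(2)], intro allI)
    show "norm (L2_norm Q (\<lambda>x. g n x $ i - g' x $ i)) \<le> L2_norm Q (\<lambda>x. g n x - g' x)" for n
      using L2_norm_component_le[OF L2_diff[OF assms(2)[of n] fg(2)], of i] by (simp add: L2_norm_nonneg)
  qed
  then have "(\<lambda>n. L2_inner Q (\<lambda>x. g n x $ i) \<phi>) \<longlonglongrightarrow> L2_inner Q (\<lambda>x. g' x $ i) \<phi>"
    by (intro L2_norm_tendsto_inner L2_component assms test_L2 \<phi>)
  then have "(\<lambda>n. - L2_inner Q (\<lambda>x. g n x $ i) \<phi>) \<longlonglongrightarrow> - L2_inner Q (\<lambda>x. g' x $ i) \<phi>"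
    by (rule tendsto_minus)
  moreover have "- L2_inner Q (\<lambda>x. g n x $ i) \<phi> = L2_inner Q (f n) (partial_deriv i \<phi>)" for n
    using assms(3)[of n] \<phi> by (simp add: weak_gradient_iff)
  ultimately show "L2_inner Q f' (partial_deriv i \<phi>) = - L2_inner Q (\<lambda>x. g' x $ i) \<phi>"
    using LIMSEQ_unique[OF 1] by simp
qed

lemma test_functions_add:
  assumes "\<phi> \<in> test_functions Q" "\<psi> \<in> test_functions Q"
  shows "(\<lambda>x. \<phi> x + \<psi> x) \<in> test_functions Q"
proof -
  have "closure {x. \<phi> x + \<psi> x \<noteq> 0} \<subseteq> closure ({x. \<phi> x \<noteq> 0} \<union> {x. \<psi> x \<noteq> 0})"
    by (intro closure_mono) auto
  then have sub: "closure {x. \<phi> x + \<psi> x \<noteq> 0} \<subseteq> closure {x. \<phi> x \<noteq> 0} \<union> closure {x. \<psi> x \<noteq> 0}"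
    by simp
  moreover have "compact (closure ({x. \<phi> x \<noteq> 0} \<union> {x. \<psi> x \<noteq> 0}))"
    unfolding closure_Un using assms by (intro compact_Un) (auto simp: test_functions_def)
  then have "compact (closure {x. \<phi> x + \<psi> x \<noteq> 0})"
    by (rule compact_closure_subset) (use sub in \<open>simp add: closure_Un\<close>)
  ultimately show ?thesis
    using assms by (auto simp: test_functions_def intro: C_k_add)
qed

lemma test_functions_scaleR:
  assumes "\<phi> \<in> test_functions Q"
  shows "(\<lambda>x. r * \<phi> x) \<in> test_functions Q"
proof -
  have "closure {x. r * \<phi> x \<noteq> 0} \<subseteq> closure {x. \<phi> x \<noteq> 0}"
    by (intro closure_mono) auto
  with assms show ?thesis
    using compact_closure_subset[of "{x. \<phi> x \<noteq> 0}" "{x. r * \<phi> x \<noteq> 0}"]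
    by (auto simp: test_functions_def intro: C_k_mult C_k_const)
qed

lemma grad_add: "C_k 1 f \<Longrightarrow> C_k 1 g \<Longrightarrow> grad (\<lambda>x. f x + g x) = (\<lambda>x. grad f x + grad g x)"
  by (simp add: grad_def partial_deriv_add fun_eq_iff vec_eq_iff)

lemma grad_scaleR:
  assumes "C_k 1 f"
  shows "grad (\<lambda>x. r * f x) = (\<lambda>x. r *\<^sub>R grad f x)"
  using assms by (simp add: grad_def partial_deriv_mult partial_deriv_const fun_eq_iff vec_eq_iff)

text \<open>
  Membership in \<open>H\<^sup>1\<^sub>0\<close> together with a given representative of the gradient; this avoids the choice
  in \<^const>\<open>weak_grad\<close>.
\<close>

definition H10_grad :: "(real^'n \<Rightarrow> real) \<Rightarrow> (real^'n \<Rightarrow> real^'n) \<Rightarrow> bool" where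
  "H10_grad f g \<longleftrightarrow> f \<in> L2_space Q \<and> g \<in> L2_space Q \<and>
     (\<exists>\<phi> :: nat \<Rightarrow> real^'n \<Rightarrow> real. (\<forall>n. \<phi> n \<in> test_functions Q) \<and>
        (\<lambda>n. L2_norm Q (\<lambda>x. \<phi> n x - f x)) \<longlonglongrightarrow> 0 \<and>
        (\<lambda>n. L2_norm Q (\<lambda>x. grad (\<phi> n) x - g x)) \<longlonglongrightarrow> 0)"

lemma H10_grad_L2: "H10_grad f g \<Longrightarrow> f \<in> L2_space Q" "H10_grad f g \<Longrightarrow> g \<in> L2_space Q"
  by (auto simp: H10_grad_def)

lemma grad_test_L2: "\<phi> \<in> test_functions Q \<Longrightarrow> grad \<phi> \<in> L2_space Q"
  by (intro grad_L2 test_C_k)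

lemma H10_grad_weak: "H10_grad f g \<Longrightarrow> is_weak_gradient Q f g"
proof -
  assume H: "H10_grad f g"
  then obtain \<phi> where \<phi>: "\<And>n. \<phi> n \<in> test_functions Q" "(\<lambda>n. L2_norm Q (\<lambda>x. \<phi> n x - f x)) \<longlonglongrightarrow> 0"
        "(\<lambda>n. L2_norm Q (\<lambda>x. grad (\<phi> n) x - g x)) \<longlonglongrightarrow> 0"
    unfolding H10_grad_def by blast
  show ?thesis
    by (rule weak_gradient_limit[OF test_L2[OF \<phi>(1)] grad_test_L2[OF \<phi>(1)] weak_gradient_grad[OF test_C_k[OF \<phi>(1)]]
          H10_grad_L2[OF H] \<phi>(2,3)])
qed

lemma weak_grad_AE:
  assumes "g \<in> L2_space Q" "is_weak_gradient Q f g"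
  shows "weak_grad Q f \<in> L2_space Q" "is_weak_gradient Q f (weak_grad Q f)" "AE x in M. weak_grad Q f x = g x"
proof -
  have "weak_grad Q f \<in> L2_space Q \<and> is_weak_gradient Q f (weak_grad Q f)"
    unfolding weak_grad_def
    using someI[of "\<lambda>g. g \<in> L2_space Q \<and> is_weak_gradient Q f g", OF conjI[OF assms]] .
  then show "weak_grad Q f \<in> L2_space Q" "is_weak_gradient Q f (weak_grad Q f)"
    by auto
  then show "AE x in M. weak_grad Q f x = g x"
    by (rule weak_gradient_unique[OF _ _ assms])
qed

lemma L2_norm_weak_grad:
  "g \<in> L2_space Q \<Longrightarrow> is_weak_gradient Q f g \<Longrightarrow> L2_norm Q (weak_grad Q f) = L2_norm Q g"
  by (intro L2_norm_cong_AE weak_grad_AE)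

lemma H1_norm_eq:
  "g \<in> L2_space Q \<Longrightarrow> is_weak_gradient Q f g \<Longrightarrow> H1_norm Q f = sqrt ((L2_norm Q f)\<^sup>2 + (L2_norm Q g)\<^sup>2)"
  by (simp add: H1_norm_def L2_norm_weak_grad)

lemma weak_gradient_diff:
  assumes "f \<in> L2_space Q" "g \<in> L2_space Q" "is_weak_gradient Q f g"
    "f' \<in> L2_space Q" "g' \<in> L2_space Q" "is_weak_gradient Q f' g'"
  shows "is_weak_gradient Q (\<lambda>x. f x - f' x) (\<lambda>x. g x - g' x)"
  using assms
  by (auto simp: weak_gradient_iff L2_inner_diff_left test_L2 test_functions_partial_deriv L2_component)

lemma L2_norm_tendsto_0_mono:
  assumes "(\<lambda>n. b n) \<longlonglongrightarrow> 0" "\<And>n. L2_norm Q (f n) \<le> b n"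
  shows "(\<lambda>n. L2_norm Q (f n)) \<longlonglongrightarrow> 0"
  by (rule Lim_null_comparison[OF always_eventually assms(1)]) (use assms(2) in \<open>simp add: L2_norm_nonneg\<close>)

lemma H10_grad_imp_H10:
  assumes "H10_grad f g"
  shows "f \<in> H10_space Q"
proof -
  obtain \<phi> where \<phi>: "\<And>n. \<phi> n \<in> test_functions Q" "(\<lambda>n. L2_norm Q (\<lambda>x. \<phi> n x - f x)) \<longlonglongrightarrow> 0"
        "(\<lambda>n. L2_norm Q (\<lambda>x. grad (\<phi> n) x - g x)) \<longlonglongrightarrow> 0" and L2: "f \<in> L2_space Q" "g \<in> L2_space Q"
    using assms unfolding H10_grad_def by blast
  have w: "is_weak_gradient Q f g"
    using assms by (rule H10_grad_weak)
  have eq: "H1_norm Q (\<lambda>x. \<phi> n x - f x) = sqrt ((L2_norm Q (\<lambda>x. \<phi> n x - f x))\<^sup>2 + (L2_norm Q (\<lambda>x. grad (\<phi> n) x - g x))\<^sup>2)" for n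
    by (intro H1_norm_eq weak_gradient_diff L2_diff test_L2 grad_test_L2 \<phi> L2 w weak_gradient_grad test_C_k)
  have "(\<lambda>n. sqrt ((L2_norm Q (\<lambda>x. \<phi> n x - f x))\<^sup>2 + (L2_norm Q (\<lambda>x. grad (\<phi> n) x - g x))\<^sup>2)) \<longlonglongrightarrow> sqrt (0\<^sup>2 + 0\<^sup>2)"
    by (intro tendsto_intros \<phi>)
  then have "(\<lambda>n. H1_norm Q (\<lambda>x. \<phi> n x - f x)) \<longlonglongrightarrow> 0"
    by (simp add: eq)
  then show ?thesis
    using \<phi>(1) L2 w by (auto simp: H10_space_def H1_space_def)
qed

lemma H10_imp_H10_grad:
  assumes "f \<in> H10_space Q"
  shows "H10_grad f (weak_grad Q f)"
proof -
  obtain \<phi> :: "nat \<Rightarrow> real^'n \<Rightarrow> real" where \<phi>: "\<And>n. \<phi> n \<in> test_functions Q"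
      and lim: "(\<lambda>n. H1_norm Q (\<lambda>x. \<phi> n x - f x)) \<longlonglongrightarrow> 0"
    using assms unfolding H10_space_def by blast
  have f: "f \<in> L2_space Q"
    using assms by (simp add: H10_space_def H1_space_def)
  obtain g where "g \<in> L2_space Q" "is_weak_gradient Q f g"
    using assms by (auto simp: H10_space_def H1_space_def)
  note g = weak_grad_AE(1,2)[OF this]
  have eq: "H1_norm Q (\<lambda>x. \<phi> n x - f x) =
      sqrt ((L2_norm Q (\<lambda>x. \<phi> n x - f x))\<^sup>2 + (L2_norm Q (\<lambda>x. grad (\<phi> n) x - weak_grad Q f x))\<^sup>2)" for n
    by (intro H1_norm_eq weak_gradient_diff L2_diff test_L2 grad_test_L2 \<phi> f g weak_gradient_grad test_C_k)
  have le: "L2_norm Q (\<lambda>x. \<phi> n x - f x) \<le> H1_norm Q (\<lambda>x. \<phi> n x - f x)"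
    "L2_norm Q (\<lambda>x. grad (\<phi> n) x - weak_grad Q f x) \<le> H1_norm Q (\<lambda>x. \<phi> n x - f x)" for n
    unfolding eq by (intro real_le_rsqrt; simp)+
  show ?thesis
    unfolding H10_grad_def
    by (intro conjI exI[of _ \<phi>] allI f g \<phi> L2_norm_tendsto_0_mono[OF lim] le)
qed

lemma H10_grad_unique: "H10_grad f g \<Longrightarrow> H10_grad f g' \<Longrightarrow> AE x in M. g x = g' x"
  by (intro weak_gradient_unique H10_grad_weak H10_grad_L2)

lemma sines_H10: "H10_grad (sines j) (grad (sines j))"
  unfolding H10_grad_def
  by (intro conjI sines_L2 grad_L2 sines_C_k exI[of _ "cut_sines j"] allI cut_sines_test cut_sines_tendsto
      grad_cut_sines_tendsto)

text \<open>A diagonal choice: the n-th test function approximates the n-th member of the sequence,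
  with its gradient, up to \<open>1 / real (Suc n)\<close>.\<close>

lemma H10_grad_limit:
  assumes H: "\<And>n. H10_grad (f n) (g n)" and L2: "f' \<in> L2_space Q" "g' \<in> L2_space Q"
    and lim: "(\<lambda>n. L2_norm Q (\<lambda>x. f n x - f' x)) \<longlonglongrightarrow> 0" "(\<lambda>n. L2_norm Q (\<lambda>x. g n x - g' x)) \<longlonglongrightarrow> 0"
  shows "H10_grad f' g'"
proof -
  have "\<exists>\<phi>\<in>test_functions Q. L2_norm Q (\<lambda>x. \<phi> x - f n x) < 1 / real (Suc n) \<and> L2_norm Q (\<lambda>x. grad \<phi> x - g n x) < 1 / real (Suc n)" for n
  proof -
    obtain \<phi> where \<phi>: "\<And>k. \<phi> k \<in> test_functions Q" "(\<lambda>k. L2_norm Q (\<lambda>x. \<phi> k x - f n x)) \<longlonglongrightarrow> 0"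
        "(\<lambda>k. L2_norm Q (\<lambda>x. grad (\<phi> k) x - g n x)) \<longlonglongrightarrow> 0"
      using H[of n] unfolding H10_grad_def by blast
    have "0 < 1 / real (Suc n)"
      by simp
    note order_tendstoD(2)[OF \<phi>(2) this] order_tendstoD(2)[OF \<phi>(3) this]
    then have "\<forall>\<^sub>F k in sequentially. L2_norm Q (\<lambda>x. \<phi> k x - f n x) < 1 / real (Suc n) \<and> L2_norm Q (\<lambda>x. grad (\<phi> k) x - g n x) < 1 / real (Suc n)"
      by (rule eventually_conj)
    then obtain k where "L2_norm Q (\<lambda>x. \<phi> k x - f n x) < 1 / real (Suc n) \<and> L2_norm Q (\<lambda>x. grad (\<phi> k) x - g n x) < 1 / real (Suc n)"
      using eventually_happens'[OF sequentially_bot] by blast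
    then show ?thesis
      using \<phi>(1) by (intro bexI[of _ "\<phi> k"])
  qed
  then have "\<forall>n. \<exists>\<phi>. \<phi> \<in> test_functions Q \<and> L2_norm Q (\<lambda>x. \<phi> x - f n x) < 1 / real (Suc n) \<and> L2_norm Q (\<lambda>x. grad \<phi> x - g n x) < 1 / real (Suc n)"
    by blast
  from choice[OF this] obtain \<phi> where \<phi>: "\<And>n. \<phi> n \<in> test_functions Q" "\<And>n. L2_norm Q (\<lambda>x. \<phi> n x - f n x) < 1 / real (Suc n)"
      "\<And>n. L2_norm Q (\<lambda>x. grad (\<phi> n) x - g n x) < 1 / real (Suc n)"
    by auto
  note inv = LIMSEQ_inverse_real_of_nat[unfolded inverse_eq_divide]
  have "(\<lambda>n. L2_norm Q (\<lambda>x. \<phi> n x - f' x)) \<longlonglongrightarrow> 0"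
  proof (rule L2_norm_tendsto_0_mono)
    show "(\<lambda>n. 1 / real (Suc n) + L2_norm Q (\<lambda>x. f n x - f' x)) \<longlonglongrightarrow> 0"
      using tendsto_add[OF inv lim(1)] by simp
    show "L2_norm Q (\<lambda>x. \<phi> n x - f' x) \<le> 1 / real (Suc n) + L2_norm Q (\<lambda>x. f n x - f' x)" for n
      using L2_norm_triangle_diff[OF test_L2[OF \<phi>(1)] H10_grad_L2(1)[OF H] L2(1), of n n] \<phi>(2)[of n] by linarith
  qed
  moreover have "(\<lambda>n. L2_norm Q (\<lambda>x. grad (\<phi> n) x - g' x)) \<longlonglongrightarrow> 0"
  proof (rule L2_norm_tendsto_0_mono)
    show "(\<lambda>n. 1 / real (Suc n) + L2_norm Q (\<lambda>x. g n x - g' x)) \<longlonglongrightarrow> 0"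
      using tendsto_add[OF inv lim(2)] by simp
    show "L2_norm Q (\<lambda>x. grad (\<phi> n) x - g' x) \<le> 1 / real (Suc n) + L2_norm Q (\<lambda>x. g n x - g' x)" for n
      using L2_norm_triangle_diff[OF grad_test_L2[OF \<phi>(1)] H10_grad_L2(2)[OF H] L2(2), of n n] \<phi>(3)[of n] by linarith
  qed
  ultimately show ?thesis
    unfolding H10_grad_def using L2 \<phi>(1) by blast
qed

lemma H10_grad_add:
  assumes "H10_grad f g" "H10_grad f' g'"
  shows "H10_grad (\<lambda>x. f x + f' x) (\<lambda>x. g x + g' x)"
proof -
  obtain \<phi> where \<phi>: "\<And>n. \<phi> n \<in> test_functions Q" "(\<lambda>n. L2_norm Q (\<lambda>x. \<phi> n x - f x)) \<longlonglongrightarrow> 0"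
        "(\<lambda>n. L2_norm Q (\<lambda>x. grad (\<phi> n) x - g x)) \<longlonglongrightarrow> 0" and L2: "f \<in> L2_space Q" "g \<in> L2_space Q"
    using assms(1) unfolding H10_grad_def by blast
  obtain \<psi> where \<psi>: "\<And>n. \<psi> n \<in> test_functions Q" "(\<lambda>n. L2_norm Q (\<lambda>x. \<psi> n x - f' x)) \<longlonglongrightarrow> 0"
        "(\<lambda>n. L2_norm Q (\<lambda>x. grad (\<psi> n) x - g' x)) \<longlonglongrightarrow> 0" and L2': "f' \<in> L2_space Q" "g' \<in> L2_space Q"
    using assms(2) unfolding H10_grad_def by blast
  have "(\<lambda>n. L2_norm Q (\<lambda>x. (\<phi> n x + \<psi> n x) - (f x + f' x))) \<longlonglongrightarrow> 0"
  proof (rule L2_norm_tendsto_0_mono)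
    show "(\<lambda>n. L2_norm Q (\<lambda>x. \<phi> n x - f x) + L2_norm Q (\<lambda>x. \<psi> n x - f' x)) \<longlonglongrightarrow> 0"
      using tendsto_add[OF \<phi>(2) \<psi>(2)] by simp
    show "L2_norm Q (\<lambda>x. (\<phi> n x + \<psi> n x) - (f x + f' x)) \<le> L2_norm Q (\<lambda>x. \<phi> n x - f x) + L2_norm Q (\<lambda>x. \<psi> n x - f' x)" for n
      using L2_norm_triangle[OF L2_diff[OF test_L2[OF \<phi>(1)] L2(1)] L2_diff[OF test_L2[OF \<psi>(1)] L2'(1)], of n n]
      by (simp add: algebra_simps)
  qed
  moreover have "(\<lambda>n. L2_norm Q (\<lambda>x. grad (\<lambda>x. \<phi> n x + \<psi> n x) x - (g x + g' x))) \<longlonglongrightarrow> 0"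
  proof (rule L2_norm_tendsto_0_mono)
    show "(\<lambda>n. L2_norm Q (\<lambda>x. grad (\<phi> n) x - g x) + L2_norm Q (\<lambda>x. grad (\<psi> n) x - g' x)) \<longlonglongrightarrow> 0"
      using tendsto_add[OF \<phi>(3) \<psi>(3)] by simp
    show "L2_norm Q (\<lambda>x. grad (\<lambda>x. \<phi> n x + \<psi> n x) x - (g x + g' x)) \<le> L2_norm Q (\<lambda>x. grad (\<phi> n) x - g x) + L2_norm Q (\<lambda>x. grad (\<psi> n) x - g' x)" for n
      using L2_norm_triangle[OF L2_diff[OF grad_test_L2[OF \<phi>(1)] L2(2)] L2_diff[OF grad_test_L2[OF \<psi>(1)] L2'(2)], of n n]
      unfolding grad_add[OF test_C_k[OF \<phi>(1)] test_C_k[OF \<psi>(1)]] by (simp add: algebra_simps)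
  qed
  ultimately show ?thesis
    unfolding H10_grad_def using L2 L2' test_functions_add[OF \<phi>(1) \<psi>(1)]
    by (auto intro!: L2_add exI[of _ "\<lambda>n x. \<phi> n x + \<psi> n x"])
qed

lemma H10_grad_scaleR:
  assumes "H10_grad f g"
  shows "H10_grad (\<lambda>x. r * f x) (\<lambda>x. r *\<^sub>R g x)"
proof -
  obtain \<phi> where \<phi>: "\<And>n. \<phi> n \<in> test_functions Q" "(\<lambda>n. L2_norm Q (\<lambda>x. \<phi> n x - f x)) \<longlonglongrightarrow> 0"
        "(\<lambda>n. L2_norm Q (\<lambda>x. grad (\<phi> n) x - g x)) \<longlonglongrightarrow> 0" and L2: "f \<in> L2_space Q" "g \<in> L2_space Q"
    using assms(1) unfolding H10_grad_def by blast
  have 1: "L2_norm Q (\<lambda>x. r * \<phi> n x - r * f x) = \<bar>r\<bar> * L2_norm Q (\<lambda>x. \<phi> n x - f x)" for n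
    using L2_norm_scaleR[of Q r "\<lambda>x. \<phi> n x - f x"] by (simp add: right_diff_distrib)
  have 2: "L2_norm Q (\<lambda>x. grad (\<lambda>x. r * \<phi> n x) x - r *\<^sub>R g x) = \<bar>r\<bar> * L2_norm Q (\<lambda>x. grad (\<phi> n) x - g x)" for n
    using L2_norm_scaleR[of Q r "\<lambda>x. grad (\<phi> n) x - g x"]
    unfolding grad_scaleR[OF test_C_k[OF \<phi>(1)]] by (simp add: scaleR_diff_right)
  have "(\<lambda>n. L2_norm Q (\<lambda>x. r * \<phi> n x - r * f x)) \<longlonglongrightarrow> 0"
      "(\<lambda>n. L2_norm Q (\<lambda>x. grad (\<lambda>x. r * \<phi> n x) x - r *\<^sub>R g x)) \<longlonglongrightarrow> 0"
    unfolding 1 2 using \<phi> by (auto intro!: tendsto_mult_right_zero)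
  then show ?thesis
    unfolding H10_grad_def using L2 test_functions_scaleR[OF \<phi>(1)] L2_scaleR[OF L2(1), of r]
    by (auto intro!: L2_scaleR exI[of _ "\<lambda>n x. r * \<phi> n x"])
qed

lemma H10_grad_sum:
  "finite F \<Longrightarrow> (\<And>i. i \<in> F \<Longrightarrow> H10_grad (f i) (g i)) \<Longrightarrow>
    H10_grad (\<lambda>x. \<Sum>i\<in>F. z i * f i x) (\<lambda>x. \<Sum>i\<in>F. z i *\<^sub>R g i x)"
proof (induction F rule: finite_induct)
  case empty
  have "H10_grad (\<lambda>x. 0 * sines (\<lambda>_. 0) x) (\<lambda>x. 0 *\<^sub>R grad (sines (\<lambda>_. 0)) x)"
    by (intro H10_grad_scaleR sines_H10)
  then show ?case
    by simp
next
  case (insert i F)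
  then show ?case
    using H10_grad_add[OF H10_grad_scaleR[of "f i" "g i" "z i"]] by simp
qed

lemma H10_grad_cong_AE:
  assumes "H10_grad f g" "f' \<in> L2_space Q" "g' \<in> L2_space Q"
    "AE x in M. f x = f' x" "AE x in M. g x = g' x"
  shows "H10_grad f' g'"
proof (rule H10_grad_limit[of "\<lambda>_. f" "\<lambda>_. g"])
  have "L2_norm Q (\<lambda>x. f x - f' x) = 0" "L2_norm Q (\<lambda>x. g x - g' x) = 0"
    using assms H10_grad_L2[OF assms(1)] by (auto simp: L2_norm_eq_0_iff L2_diff)
  then show "(\<lambda>n. L2_norm Q (\<lambda>x. f x - f' x)) \<longlonglongrightarrow> 0" "(\<lambda>n. L2_norm Q (\<lambda>x. g x - g' x)) \<longlonglongrightarrow> 0"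
    by auto
qed (use assms in auto)

subsection \<open>The orthonormal basis\<close>

text \<open>For test functions this is one integration by parts: they have compact support, and the
  partial derivative of the sine product is smooth on the whole space. Both sides are continuous in
  the norms in which test functions approximate \<open>f\<close> and \<open>g\<close>.\<close>

lemma H10_grad_component_sines:
  assumes "H10_grad f g"
  shows "L2_inner Q (\<lambda>x. g x $ i) (partial_deriv i (sines j)) = (freq j i)\<^sup>2 * L2_inner Q f (sines j)"
proof -
  have C1: "C_k 1 (partial_deriv i (sines j))"
    using sines_C_k[of 2 j] by (simp add: numeral_2_eq_2)
  have "is_weak_gradient Q (sines j) (grad (sines j))"
    by (intro weak_gradient_grad sines_C_k)
  have pL2: "partial_deriv i (sines j) \<in> L2_space Q"
    by (intro L2_continuous C_k_continuous[OF C1])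
  have test: "L2_inner Q (\<lambda>x. grad \<phi> x $ i) (partial_deriv i (sines j)) = (freq j i)\<^sup>2 * L2_inner Q \<phi> (sines j)"
    if "\<phi> \<in> test_functions Q" for \<phi>
  proof -
    have "L2_inner Q (partial_deriv i (sines j)) (\<lambda>x. grad \<phi> x $ i) = (freq j i)\<^sup>2 * L2_inner Q (sines j) \<phi>"
      using integration_by_parts[OF Q_sets that C1, where i = i]
      by (simp add: L2_inner_def grad_def partial_deriv2_sines mult.assoc)
    then show ?thesis
      by (simp only: L2_inner_commute[of Q "sines j"] L2_inner_commute[of Q "partial_deriv i (sines j)"])
  qed
  obtain \<phi> where \<phi>: "\<And>n. \<phi> n \<in> test_functions Q" "(\<lambda>n. L2_norm Q (\<lambda>x. \<phi> n x - f x)) \<longlonglongrightarrow> 0"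
        "(\<lambda>n. L2_norm Q (\<lambda>x. grad (\<phi> n) x - g x)) \<longlonglongrightarrow> 0" and L2: "f \<in> L2_space Q" "g \<in> L2_space Q"
    using assms unfolding H10_grad_def by blast
  have "(\<lambda>n. L2_norm Q (\<lambda>x. grad (\<phi> n) x $ i - g x $ i)) \<longlonglongrightarrow> 0"
    using L2_norm_component_le[OF L2_diff[OF grad_test_L2[OF \<phi>(1)] L2(2)], where i = i]
    by (intro L2_norm_tendsto_0_mono[OF \<phi>(3)]) simp
  then have 1: "(\<lambda>n. L2_inner Q (\<lambda>x. grad (\<phi> n) x $ i) (partial_deriv i (sines j))) \<longlonglongrightarrow> L2_inner Q (\<lambda>x. g x $ i) (partial_deriv i (sines j))"
    by (intro L2_norm_tendsto_inner L2_component grad_test_L2 \<phi> L2 pL2)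
  have "(\<lambda>n. (freq j i)\<^sup>2 * L2_inner Q (\<phi> n) (sines j)) \<longlonglongrightarrow> (freq j i)\<^sup>2 * L2_inner Q f (sines j)"
    by (intro tendsto_intros L2_norm_tendsto_inner test_L2 \<phi> L2 sines_L2)
  with 1 show ?thesis
    unfolding test[OF \<phi>(1)] by (rule LIMSEQ_unique)
qed

text \<open>Eigenvalues of the Laplacian may coincide for different modes, so the usual symmetry
  argument is made with the second derivative in one direction in which the modes differ; there the
  eigenvalues are distinct.\<close>

lemma sines_orthogonal:
  assumes "j \<noteq> k"
  shows "L2_inner Q (sines j) (sines k) = 0"
proof -
  obtain i where i: "j i \<noteq> k i"
    using assms by auto
  have "(freq k i)\<^sup>2 * L2_inner Q (sines j) (sines k) = (freq j i)\<^sup>2 * L2_inner Q (sines k) (sines j)"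
    using H10_grad_component_sines[OF sines_H10, of j i k] H10_grad_component_sines[OF sines_H10, of k i j]
    by (simp add: grad_def L2_inner_commute[of Q "partial_deriv i (sines j)"])
  moreover have "(freq k i)\<^sup>2 \<noteq> (freq j i)\<^sup>2"
  proof
    assume "(freq k i)\<^sup>2 = (freq j i)\<^sup>2"
    then have "freq k i = freq j i"
      using freq_pos[of k i] freq_pos[of j i] by (simp add: power2_eq_iff)
    then show False
      using i l_pos[of i] by (simp add: freq_def)
  qed
  ultimately show ?thesis
    by (simp add: L2_inner_commute[of Q "sines k"])
qed

lemma sines_norm_pos: "L2_norm Q (sines j) > 0"
proof (rule ccontr)
  assume "\<not> L2_norm Q (sines j) > 0"
  then have "L2_norm Q (sines j) = 0"
    using L2_norm_nonneg[of Q "sines j"] by simp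
  then have AE: "AE x in M. sines j x = 0"
    by (simp add: L2_norm_eq_0_iff sines_L2)
  define S where "S = {x \<in> Q. sines j x \<noteq> 0}"
  \<comment> \<open>At this point every sine factor has the argument \<open>pi / 2\<close>.\<close>
  define p where "p = (\<chi> i. l $ i / (2 * real (Suc (j i))))"
  have "p \<in> S"
  proof -
    have "freq j i * p $ i = pi / 2" for i
      using l_pos[of i] by (simp add: freq_def p_def del: of_nat_Suc)
    then have "sin (freq j i * p $ i) = 1" for i
      by (simp only: sin_pi_half)
    moreover have "p $ i < l $ i" for i
      using l_pos[of i] by (simp add: p_def divide_less_eq)
    moreover have "p $ i > 0" for i
      using l_pos[of i] by (simp add: p_def)
    ultimately show ?thesis
      by (simp add: S_def Q_iff sines_def)
  qed
  moreover have "open S"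
  proof -
    have "S = Q \<inter> (sines j -` (- {0}))"
      by (auto simp: S_def)
    moreover have "open (sines j -` (- {0}))"
      using C_k_continuous[OF sines_C_k[of 0 j]] by (intro open_vimage) auto
    ultimately show ?thesis
      by (simp add: open_Int open_box)
  qed
  ultimately have "\<not> negligible S"
    using open_not_negligible by blast
  moreover have "negligible S"
  proof -
    have "AE x in lebesgue. x \<in> Q \<longrightarrow> sines j x = 0"
      using AE by (subst (asm) AE_restrict_space_iff) auto
    then have "AE x in lebesgue. x \<notin> S"
      by eventually_elim (auto simp: S_def)
    moreover have "S \<in> sets lebesgue"
      using \<open>open S\<close> by auto
    ultimately have "S \<in> null_sets lebesgue"
      by (simp add: AE_iff_null_sets)
    then show ?thesis
      by (simp add: negligible_iff_null_sets)
  qed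
  ultimately show False
    by simp
qed

definition basis :: "('n \<Rightarrow> nat) \<Rightarrow> real^'n \<Rightarrow> real" where
  "basis j x = (1 / L2_norm Q (sines j)) * sines j x"

definition \<omega> :: "('n \<Rightarrow> nat) \<Rightarrow> real" where
  "\<omega> j = sqrt (\<Sum>i\<in>UNIV. (freq j i)\<^sup>2)"

text \<open>The gradients of the basis functions, divided by their norms \<open>\<omega> j\<close>.
  In this system the gradient of a function has \<open>\<omega> j\<close> times its own
  coefficients.\<close>

definition gbasis :: "('n \<Rightarrow> nat) \<Rightarrow> real^'n \<Rightarrow> real^'n" where
  "gbasis j x = (1 / (\<omega> j * L2_norm Q (sines j))) *\<^sub>R grad (sines j) x"

text \<open>\<open>undefined\<close> merely picks some coordinate: the lowest frequency in any
  single direction is a positive lower bound for all \<open>\<omega> j\<close>.\<close>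

definition \<omega>0 :: real where
  "\<omega>0 = pi / l $ undefined"

lemma \<omega>0_pos: "\<omega>0 > 0"
  using l_pos by (simp add: \<omega>0_def)

lemma \<omega>_ge: "\<omega> j \<ge> \<omega>0"
  unfolding \<omega>_def
proof (rule real_le_rsqrt)
  have "\<omega>0 \<le> freq j undefined"
    using l_pos[of undefined] by (simp add: \<omega>0_def freq_def divide_right_mono)
  then have "\<omega>0\<^sup>2 \<le> (freq j undefined)\<^sup>2"
    using \<omega>0_pos by (intro power_mono) auto
  also have "\<dots> \<le> (\<Sum>i\<in>UNIV. (freq j i)\<^sup>2)"
    by (intro member_le_sum) auto
  finally show "\<omega>0\<^sup>2 \<le> (\<Sum>i\<in>UNIV. (freq j i)\<^sup>2)" .
qed

lemma \<omega>_pos: "\<omega> j > 0"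
  using \<omega>_ge[of j] \<omega>0_pos by simp

lemma H10_grad_basis: "H10_grad (basis j) (\<lambda>x. \<omega> j *\<^sub>R gbasis j x)"
  using H10_grad_scaleR[OF sines_H10, of "1 / L2_norm Q (sines j)" j] \<omega>_pos[of j]
  by (simp add: basis_def[abs_def] gbasis_def)

lemma basis_L2: "basis j \<in> L2_space Q"
  using H10_grad_basis by (rule H10_grad_L2)

lemma gbasis_L2: "gbasis j \<in> L2_space Q"
  unfolding gbasis_def[abs_def] by (intro L2_scaleR grad_L2 sines_C_k)

lemma L2_inner_vec:
  fixes f g :: "real^'n \<Rightarrow> real^'n"
  assumes "f \<in> L2_space Q" "g \<in> L2_space Q"
  shows "L2_inner Q f g = (\<Sum>i\<in>UNIV. L2_inner Q (\<lambda>x. f x $ i) (\<lambda>x. g x $ i))"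
proof -
  have "integrable M (\<lambda>x. f x $ i * g x $ i)" for i
    using L2_integrable_inner[OF L2_component[OF assms(1), of i] L2_component[OF assms(2), of i]] by simp
  then show ?thesis
    by (simp add: L2_inner_def inner_vec_def)
qed

lemma H10_grad_sines:
  assumes "H10_grad f g"
  shows "L2_inner Q g (grad (sines j)) = (\<omega> j)\<^sup>2 * L2_inner Q f (sines j)"
proof -
  have "L2_inner Q g (grad (sines j)) = (\<Sum>i\<in>UNIV. L2_inner Q (\<lambda>x. g x $ i) (partial_deriv i (sines j)))"
    using assms H10_grad_L2 by (subst L2_inner_vec) (auto simp: grad_def intro: grad_L2[OF sines_C_k])
  also have "\<dots> = (\<Sum>i\<in>UNIV. (freq j i)\<^sup>2) * L2_inner Q f (sines j)"
    by (simp add: H10_grad_component_sines[OF assms] sum_distrib_right)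
  finally show ?thesis
    by (simp add: \<omega>_def sum_nonneg)
qed

lemma H10_grad_gbasis:
  assumes "H10_grad f g"
  shows "L2_inner Q g (gbasis j) = \<omega> j * L2_inner Q f (basis j)"
  unfolding gbasis_def[abs_def] basis_def[abs_def]
  using \<omega>_pos[of j] L2_inner_scaleR_right[of Q f "1 / L2_norm Q (sines j)" "sines j"]
  by (simp add: L2_inner_scaleR_right H10_grad_sines[OF assms] power2_eq_square)

lemma orthonormal_basis: "orthonormal Q basis"
proof -
  have eq: "basis j = (\<lambda>x. (1 / L2_norm Q (sines j)) *\<^sub>R sines j x)" for j
    by (simp add: basis_def[abs_def])
  have "L2_inner Q (basis j) (basis k) = (if j = k then 1 else 0)" for j k
    using sines_orthogonal[of j k] sines_norm_pos[of j]
    unfolding eq L2_inner_scaleR_left L2_inner_scaleR_right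
    by (auto simp: L2_norm_sq[symmetric] power2_eq_square)
  then show ?thesis
    by (simp add: orthonormal_def basis_L2)
qed

lemma orthonormal_gbasis: "orthonormal Q gbasis"
proof -
  have "L2_inner Q (gbasis j) (gbasis k) = (if j = k then 1 else 0)" for j k
  proof -
    have "\<omega> j * L2_inner Q (gbasis j) (gbasis k) = \<omega> k * L2_inner Q (basis j) (basis k)"
      using H10_grad_gbasis[OF H10_grad_basis, of j k] by (simp add: L2_inner_scaleR_left)
    then show ?thesis
      using orthonormal_basis \<omega>_pos[of j] by (auto simp: orthonormal_def split: if_splits)
  qed
  then show ?thesis
    by (simp add: orthonormal_def gbasis_L2)
qed

lemma basis_complete:
  assumes "f \<in> L2_space Q" "\<And>j. L2_inner Q f (basis j) = 0"
  shows "AE x in M. f x = 0"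
proof (rule sines_complete[OF assms(1)])
  fix j
  show "L2_inner Q f (sines j) = 0"
    using assms(2)[of j] sines_norm_pos[of j] L2_inner_scaleR_right[of Q f "1 / L2_norm Q (sines j)" "sines j"]
    by (simp add: basis_def[abs_def])
qed

end

section \<open>The Sobolev inequality in dimension two and three\<close>

lemma abs_le_nn_integral_deriv:
  fixes g g' :: "real \<Rightarrow> real"
  assumes deriv: "\<And>x. (g has_real_derivative g' x) (at x)" and cont: "continuous_on UNIV g'"
    and zero: "\<And>x. \<bar>x\<bar> > r \<Longrightarrow> g x = 0"
  shows "ennreal \<bar>g x\<bar> \<le> (\<integral>\<^sup>+t. ennreal \<bar>g' t\<bar> \<partial>lborel)"
proof -
  \<comment> \<open>A point to the left of \<open>x\<close> and of the region where \<open>g\<close>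
    may be nonzero, from which the derivative is integrated.\<close>
  define a where "a = min x (- \<bar>r\<bar> - 1)"
  have ga: "g a = 0" and "a \<le> x"
    by (auto intro!: zero simp: a_def)
  have "has_bochner_integral lborel (\<lambda>t. g' t * indicator {a..x} t) (g x - g a)"
    using \<open>a \<le> x\<close> cont by (intro has_bochner_integral_FTC_Icc_real deriv)
      (auto simp: continuous_on_eq_continuous_at)
  then have int: "integrable lborel (\<lambda>t. g' t * indicator {a..x} t)"
    and eq: "(\<integral>t. g' t * indicator {a..x} t \<partial>lborel) = g x"
    using ga by (auto simp: has_bochner_integral_iff)
  have "ennreal \<bar>g x\<bar> \<le> ennreal (\<integral>t. \<bar>g' t * indicator {a..x} t\<bar> \<partial>lborel)"
    unfolding eq[symmetric] by (intro ennreal_leI integral_abs_bound)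
  also have "\<dots> = (\<integral>\<^sup>+t. ennreal \<bar>g' t * indicator {a..x} t\<bar> \<partial>lborel)"
    using int by (subst nn_integral_eq_integral) auto
  also have "\<dots> \<le> (\<integral>\<^sup>+t. ennreal \<bar>g' t\<bar> \<partial>lborel)"
    by (intro nn_integral_mono ennreal_leI) (auto simp: indicator_def)
  finally show ?thesis .
qed

text \<open>The one-dimensional bound for a power of \<open>g\<close>. Third powers
  (\<open>k = 2\<close>) drive the plane estimate, fourth powers (\<open>k = 3\<close>) remove the
  integral of the fourth power from it.\<close>

lemma power_deriv_bound:
  fixes g g' :: "real \<Rightarrow> real"
  assumes deriv: "\<And>x. (g has_real_derivative g' x) (at x)" and cont: "continuous_on UNIV g'"
    and zero: "\<And>x. \<bar>x\<bar> > r \<Longrightarrow> g x = 0"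
  shows "ennreal (\<bar>g x\<bar> ^ Suc k) \<le> (\<integral>\<^sup>+t. ennreal (real (Suc k) * (\<bar>g t\<bar> ^ k * \<bar>g' t\<bar>)) \<partial>lborel)"
proof -
  have contg: "continuous_on UNIV g"
    using deriv by (auto simp: continuous_on_eq_continuous_at intro: DERIV_isCont)
  have "((\<lambda>x. g x ^ Suc k) has_real_derivative real (Suc k) * (g x ^ k * g' x)) (at x)" for x
    by (rule DERIV_cong[OF DERIV_power[OF deriv]]) (simp add: mult_ac)
  from abs_le_nn_integral_deriv[OF this, of r x]
  have "ennreal \<bar>g x ^ Suc k\<bar> \<le> (\<integral>\<^sup>+t. ennreal \<bar>real (Suc k) * (g t ^ k * g' t)\<bar> \<partial>lborel)"
    using cont contg zero by (simp add: continuous_intros)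
  then show ?thesis
    by (simp add: abs_mult power_abs del: power_Suc)
qed

text \<open>
  In two dimensions, \<open>\<bar>f\<bar>\<^sup>3\<close> is bounded by a function of \<open>x\<close> alone and by a function of \<open>y\<close> alone.
\<close>

lemma plane_sixth_power:
  fixes f fx fy :: "real \<Rightarrow> real \<Rightarrow> real"
  assumes [measurable]: "case_prod f \<in> borel_measurable borel" "case_prod fx \<in> borel_measurable borel"
      "case_prod fy \<in> borel_measurable borel"
    and fx: "\<And>x y. ennreal (\<bar>f x y\<bar> ^ 3) \<le> (\<integral>\<^sup>+t. ennreal (3 * (\<bar>f t y\<bar>\<^sup>2 * \<bar>fx t y\<bar>)) \<partial>lborel)"
    and fy: "\<And>x y. ennreal (\<bar>f x y\<bar> ^ 3) \<le> (\<integral>\<^sup>+t. ennreal (3 * (\<bar>f x t\<bar>\<^sup>2 * \<bar>fy x t\<bar>)) \<partial>lborel)"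
    and gx: "\<And>x y. \<bar>fx x y\<bar> \<le> g x y" and gy: "\<And>x y. \<bar>fy x y\<bar> \<le> g x y"
    and [measurable]: "case_prod g \<in> borel_measurable borel"
  shows "(\<integral>\<^sup>+x. \<integral>\<^sup>+y. ennreal (f x y ^ 6) \<partial>lborel \<partial>lborel) \<le>
    9 * (\<integral>\<^sup>+x. \<integral>\<^sup>+y. ennreal (f x y ^ 4) \<partial>lborel \<partial>lborel) * (\<integral>\<^sup>+x. \<integral>\<^sup>+y. ennreal ((g x y)\<^sup>2) \<partial>lborel \<partial>lborel)"
proof -
  have meas: "case_prod h \<in> borel_measurable (lborel \<Otimes>\<^sub>M lborel)" if "case_prod h \<in> borel_measurable borel" for h :: "real \<Rightarrow> real \<Rightarrow> real"
    using that by (simp add: lborel_prod)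
  note [measurable] = meas[OF assms(1)] meas[OF assms(2)] meas[OF assms(3)] meas[OF assms(8)]
  define P where "P = (\<integral>\<^sup>+x. \<integral>\<^sup>+y. ennreal (\<bar>f x y\<bar>\<^sup>2 * g x y) \<partial>lborel \<partial>lborel)"
  have g0: "g x y \<ge> 0" for x y
    using gx[of x y] by simp
  \<comment> \<open>\<open>A\<close> depends on \<open>y\<close> alone and \<open>B\<close> on
    \<open>x\<close> alone, so the integral of their product factors into two integrals with the
    same value up to the constant.\<close>
  define A where "A y = (\<integral>\<^sup>+t. ennreal (3 * (\<bar>f t y\<bar>\<^sup>2 * g t y)) \<partial>lborel)" for y
  define B where "B x = (\<integral>\<^sup>+t. ennreal (3 * (\<bar>f x t\<bar>\<^sup>2 * g x t)) \<partial>lborel)" for x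
  have [measurable]: "A \<in> borel_measurable lborel" "B \<in> borel_measurable lborel"
    unfolding A_def B_def by measurable
  have "ennreal (f x y ^ 6) \<le> B x * A y" for x y
  proof -
    have "(\<integral>\<^sup>+t. ennreal (3 * (\<bar>f t y\<bar>\<^sup>2 * \<bar>fx t y\<bar>)) \<partial>lborel) \<le> A y"
      unfolding A_def using gx by (intro nn_integral_mono ennreal_leI mult_left_mono) auto
    moreover have "(\<integral>\<^sup>+t. ennreal (3 * (\<bar>f x t\<bar>\<^sup>2 * \<bar>fy x t\<bar>)) \<partial>lborel) \<le> B x"
      unfolding B_def using gy by (intro nn_integral_mono ennreal_leI mult_left_mono) auto
    ultimately have "ennreal (\<bar>f x y\<bar> ^ 3) * ennreal (\<bar>f x y\<bar> ^ 3) \<le> B x * A y"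
      by (intro mult_mono order_trans[OF fx] order_trans[OF fy]) auto
    moreover have "ennreal (\<bar>f x y\<bar> ^ 3) * ennreal (\<bar>f x y\<bar> ^ 3) = ennreal (f x y ^ 6)"
    proof -
      have "f x y ^ 6 = \<bar>f x y\<bar> ^ 6"
        by (simp add: power_even_abs)
      also have "\<dots> = \<bar>f x y\<bar> ^ 3 * \<bar>f x y\<bar> ^ 3"
        by (simp flip: power_add)
      finally have "f x y ^ 6 = \<bar>f x y\<bar> ^ 3 * \<bar>f x y\<bar> ^ 3" .
      then show ?thesis
        by (simp only: ennreal_mult[OF zero_le_power[OF abs_ge_zero] zero_le_power[OF abs_ge_zero]])
    qed
    ultimately show ?thesis
      by simp
  qed
  then have "(\<integral>\<^sup>+x. \<integral>\<^sup>+y. ennreal (f x y ^ 6) \<partial>lborel \<partial>lborel) \<le> (\<integral>\<^sup>+x. \<integral>\<^sup>+y. B x * A y \<partial>lborel \<partial>lborel)"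
    by (intro nn_integral_mono)
  also have "\<dots> = (\<integral>\<^sup>+x. B x \<partial>lborel) * (\<integral>\<^sup>+y. A y \<partial>lborel)"
    by (simp add: nn_integral_cmult nn_integral_multc)
  also have "(\<integral>\<^sup>+x. B x \<partial>lborel) = 3 * P"
    unfolding B_def P_def using g0
    by (simp add: ennreal_mult nn_integral_cmult)
  also have "(\<integral>\<^sup>+y. A y \<partial>lborel) = 3 * P"
  proof -
    have "(\<integral>\<^sup>+y. A y \<partial>lborel) = 3 * (\<integral>\<^sup>+y. \<integral>\<^sup>+x. ennreal (\<bar>f x y\<bar>\<^sup>2 * g x y) \<partial>lborel \<partial>lborel)"
      unfolding A_def using g0 by (simp add: ennreal_mult nn_integral_cmult)
    also have "(\<integral>\<^sup>+y. \<integral>\<^sup>+x. ennreal (\<bar>f x y\<bar>\<^sup>2 * g x y) \<partial>lborel \<partial>lborel) = P"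
      unfolding P_def by (rule lborel_pair.Fubini') measurable
    finally show ?thesis .
  qed
  also have "3 * P * (3 * P) = 9 * P\<^sup>2"
    by (simp add: power2_eq_square mult_ac)
  \<comment> \<open>Cauchy-Schwarz for the product of the square of \<open>f\<close> with
    \<open>g\<close>, over the plane.\<close>
  also have "P\<^sup>2 \<le> (\<integral>\<^sup>+x. \<integral>\<^sup>+y. ennreal (f x y ^ 4) \<partial>lborel \<partial>lborel) * (\<integral>\<^sup>+x. \<integral>\<^sup>+y. ennreal ((g x y)\<^sup>2) \<partial>lborel \<partial>lborel)"
  proof -
    have [measurable]: "(\<lambda>p. f (fst p) (snd p)) \<in> borel_measurable (lborel \<Otimes>\<^sub>M lborel)"
        "(\<lambda>p. g (fst p) (snd p)) \<in> borel_measurable (lborel \<Otimes>\<^sub>M lborel)"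
      using meas[OF assms(1)] meas[OF assms(8)] by (simp_all add: case_prod_beta')
    have "P = (\<integral>\<^sup>+p. ennreal (\<bar>f (fst p) (snd p)\<bar>\<^sup>2) * ennreal (g (fst p) (snd p)) \<partial>(lborel \<Otimes>\<^sub>M lborel))"
      unfolding P_def using g0
      by (subst lborel.nn_integral_fst[symmetric]) (auto simp: ennreal_mult)
    also have "\<dots>\<^sup>2 \<le> (\<integral>\<^sup>+p. (ennreal (\<bar>f (fst p) (snd p)\<bar>\<^sup>2))\<^sup>2 \<partial>(lborel \<Otimes>\<^sub>M lborel)) * (\<integral>\<^sup>+p. (ennreal (g (fst p) (snd p)))\<^sup>2 \<partial>(lborel \<Otimes>\<^sub>M lborel))"
      by (rule Cauchy_Schwarz_nn_integral) measurable
    also have "(\<integral>\<^sup>+p. (ennreal (\<bar>f (fst p) (snd p)\<bar>\<^sup>2))\<^sup>2 \<partial>(lborel \<Otimes>\<^sub>M lborel)) = (\<integral>\<^sup>+x. \<integral>\<^sup>+y. ennreal (f x y ^ 4) \<partial>lborel \<partial>lborel)"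
      by (subst lborel.nn_integral_fst[symmetric]) (auto simp: ennreal_power power_mult[symmetric])
    also have "(\<integral>\<^sup>+p. (ennreal (g (fst p) (snd p)))\<^sup>2 \<partial>(lborel \<Otimes>\<^sub>M lborel)) = (\<integral>\<^sup>+x. \<integral>\<^sup>+y. ennreal ((g x y)\<^sup>2) \<partial>lborel \<partial>lborel)"
      using g0 by (subst lborel.nn_integral_fst[symmetric]) (auto simp: ennreal_power)
    finally show ?thesis .
  qed
  finally show ?thesis
    by (simp add: mult.assoc mult_left_mono)
qed

section \<open>Splitting integrals over two or three coordinates\<close>

lemma nn_integral_lborel_pair:
  fixes h :: "'a::euclidean_space \<times> 'b::euclidean_space \<Rightarrow> ennreal"
  assumes "h \<in> borel_measurable borel"
  shows "(\<integral>\<^sup>+p. h p \<partial>lborel) = (\<integral>\<^sup>+x. \<integral>\<^sup>+y. h (x, y) \<partial>lborel \<partial>lborel)"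
proof -
  have "h \<in> borel_measurable (lborel \<Otimes>\<^sub>M lborel)"
    using assms by (simp add: lborel_prod)
  then show ?thesis
    using lborel.nn_integral_fst[of h lborel] by (simp add: lborel_prod)
qed

lemma prod_Basis_vec:
  fixes f :: "real^'n \<Rightarrow> real"
  shows "(\<Prod>b\<in>Basis. f b) = (\<Prod>m\<in>UNIV. f (axis m 1))"
proof -
  have B: "(Basis :: (real^'n) set) = range (\<lambda>m. axis m 1)"
    by (auto simp: Basis_vec_def)
  have inj: "inj (\<lambda>m :: 'n. axis m (1::real))"
    by (auto simp: inj_on_def axis_eq_axis)
  show ?thesis
    unfolding B by (subst prod.reindex[OF inj]) (simp add: o_def)
qed

lemma emeasure_box_eqI:
  fixes N :: "(real^'n) measure"
  assumes "sets N = sets borel"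
    and "\<And>a b. (\<And>m. a $ m \<le> b $ m) \<Longrightarrow> emeasure N (box a b) = ennreal (\<Prod>m\<in>UNIV. b $ m - a $ m)"
  shows "lborel = N"
proof (rule lborel_eqI)
  fix a b :: "real^'n"
  assume "\<And>u. u \<in> Basis \<Longrightarrow> a \<bullet> u \<le> b \<bullet> u"
  then have "a $ m \<le> b $ m" for m
    by (metis axis_in_Basis_iff cart_eq_inner_axis Basis_real_def singletonI)
  then show "emeasure N (box a b) = ennreal (\<Prod>u\<in>Basis. (b - a) \<bullet> u)"
    using assms(2)[of a b] by (simp add: prod_Basis_vec inner_axis)
qed (rule assms(1))

text \<open>The index type is an abstract type with two or three elements, so a point is assembled
  by singling out a coordinate by name. As a function of \<open>t\<close> it is the line in
  direction \<open>i\<close>.\<close>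

definition vec_of :: "'n::finite \<Rightarrow> real \<Rightarrow> ('n \<Rightarrow> real) \<Rightarrow> real^'n" where
  "vec_of i t v = (\<chi> m. if m = i then t else v m)"

lemma vec_of_shift: "vec_of i t v = vec_of i 0 v + t *\<^sub>R axis i 1"
  by (simp add: vec_of_def vec_eq_iff axis_def)

lemma partial_deriv_vec_of:
  assumes "C_k 1 f"
  shows "((\<lambda>t. f (vec_of i t v)) has_real_derivative partial_deriv i f (vec_of i t v)) (at t)"
  using partial_deriv_along[OF assms, of "vec_of i 0 v" i t] by (simp add: vec_of_shift[symmetric])

lemma continuous_vec_of: "continuous_on UNIV (\<lambda>t. vec_of i t v)"
proof -
  have "continuous_on UNIV (\<lambda>t :: real. if m = i then t else v m)" for m
    by (cases "m = i") (auto intro: continuous_intros)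
  then show ?thesis
    unfolding vec_of_def by (intro continuous_on_vec_lambda)
qed

lemma continuous_on_componentwise_vec:
  fixes V :: "'a::topological_space \<Rightarrow> real^'n"
  assumes "\<And>m. continuous_on S (\<lambda>p. V p $ m)"
  shows "continuous_on S V"
  using continuous_on_vec_lambda[of S "\<lambda>m p. V p $ m", OF assms] by simp

text \<open>The identification of pairs with vectors preserves the volume of boxes, hence Lebesgue
  measure.\<close>

lemma nn_integral_vec2:
  fixes h :: "real^'n \<Rightarrow> ennreal"
  assumes ij: "(UNIV :: 'n set) = {i, j}" "i \<noteq> j" and h: "h \<in> borel_measurable borel"
  shows "(\<integral>\<^sup>+x. h x \<partial>lborel) = (\<integral>\<^sup>+p. h (vec_of i (fst p) (\<lambda>_. snd p)) \<partial>lborel)"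
proof -
  define V :: "real \<times> real \<Rightarrow> real^'n" where "V p = vec_of i (fst p) (\<lambda>_. snd p)" for p
  have "continuous_on UNIV (\<lambda>p. V p $ m)" for m
    unfolding V_def vec_of_def by (cases "m = i") (auto intro!: continuous_intros)
  then have "continuous_on UNIV V"
    by (rule continuous_on_componentwise_vec)
  then have [measurable]: "V \<in> borel_measurable borel"
    by (rule borel_measurable_continuous_onI)
  have "lborel = distr lborel borel V"
  proof (rule emeasure_box_eqI)
    fix a b :: "real^'n" assume ab: "\<And>m. a $ m \<le> b $ m"
    have "V -` box a b = {a $ i<..<b $ i} \<times> {a $ j<..<b $ j}"
    proof -
      have all: "(\<forall>m. P m) \<longleftrightarrow> P i \<and> P j" for P :: "'n \<Rightarrow> bool"
      proof -
        have "(\<forall>m\<in>UNIV. P m) \<longleftrightarrow> P i \<and> P j"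
          unfolding ij(1) by simp
        then show ?thesis
          by simp
      qed
      have "V p \<in> box a b \<longleftrightarrow> p \<in> {a $ i<..<b $ i} \<times> {a $ j<..<b $ j}" for p
        unfolding mem_box_cart all using ij(2) by (cases p) (auto simp: V_def vec_of_def)
      then show ?thesis
        by blast
    qed
    then have "emeasure (distr lborel borel V) (box a b) = emeasure (lborel \<Otimes>\<^sub>M lborel) ({a $ i<..<b $ i} \<times> {a $ j<..<b $ j})"
      by (simp add: emeasure_distr lborel_prod)
    also have "\<dots> = ennreal (b $ i - a $ i) * ennreal (b $ j - a $ j)"
      using ab by (subst lborel.emeasure_pair_measure_Times) auto
    also have "\<dots> = ennreal (\<Prod>m\<in>UNIV. b $ m - a $ m)"
      unfolding ij(1) using ab ij(2) by (simp add: ennreal_mult)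
    finally show "emeasure (distr lborel borel V) (box a b) = ennreal (\<Prod>m\<in>UNIV. b $ m - a $ m)" .
  qed simp
  then have "(\<integral>\<^sup>+x. h x \<partial>lborel) = (\<integral>\<^sup>+x. h x \<partial>distr lborel borel V)"
    by simp
  also have "\<dots> = (\<integral>\<^sup>+p. h (V p) \<partial>lborel)"
    using h by (intro nn_integral_distr) auto
  finally show ?thesis
    by (simp add: V_def)
qed

text \<open>The coordinate \<open>k\<close> is the outer variable, so that fixing it leaves a plane
  in the other two directions.\<close>

lemma nn_integral_vec3:
  fixes h :: "real^'n \<Rightarrow> ennreal"
  assumes ijk: "(UNIV :: 'n set) = {i, j, k}" "i \<noteq> j" "i \<noteq> k" "j \<noteq> k" and h: "h \<in> borel_measurable borel"
  shows "(\<integral>\<^sup>+x. h x \<partial>lborel) =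
    (\<integral>\<^sup>+p. h (vec_of k (fst p) (\<lambda>m. if m = i then fst (snd p) else snd (snd p))) \<partial>lborel)"
proof -
  define V :: "real \<times> real \<times> real \<Rightarrow> real^'n"
    where "V p = vec_of k (fst p) (\<lambda>m. if m = i then fst (snd p) else snd (snd p))" for p
  have "continuous_on UNIV (\<lambda>p. V p $ m)" for m
    unfolding V_def vec_of_def by (cases "m = k"; cases "m = i") (auto intro!: continuous_intros)
  then have "continuous_on UNIV V"
    by (rule continuous_on_componentwise_vec)
  then have [measurable]: "V \<in> borel_measurable borel"
    by (rule borel_measurable_continuous_onI)
  have "lborel = distr lborel borel V"
  proof (rule emeasure_box_eqI)
    fix a b :: "real^'n" assume ab: "\<And>m. a $ m \<le> b $ m"
    have "V -` box a b = {a $ k<..<b $ k} \<times> ({a $ i<..<b $ i} \<times> {a $ j<..<b $ j})"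
    proof -
      have all: "(\<forall>m. P m) \<longleftrightarrow> P i \<and> P j \<and> P k" for P :: "'n \<Rightarrow> bool"
      proof -
        have "(\<forall>m\<in>UNIV. P m) \<longleftrightarrow> P i \<and> P j \<and> P k"
          unfolding ijk(1) by simp
        then show ?thesis
          by simp
      qed
      have "V p \<in> box a b \<longleftrightarrow> p \<in> {a $ k<..<b $ k} \<times> ({a $ i<..<b $ i} \<times> {a $ j<..<b $ j})" for p
        unfolding mem_box_cart all using ijk(2-4) by (cases p) (auto simp: V_def vec_of_def)
      then show ?thesis
        by blast
    qed
    then have "emeasure (distr lborel borel V) (box a b) =
        emeasure (lborel \<Otimes>\<^sub>M (lborel \<Otimes>\<^sub>M lborel)) ({a $ k<..<b $ k} \<times> ({a $ i<..<b $ i} \<times> {a $ j<..<b $ j}))"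
      by (simp add: emeasure_distr lborel_prod)
    also have "\<dots> = ennreal (b $ k - a $ k) * (ennreal (b $ i - a $ i) * ennreal (b $ j - a $ j))"
      using ab lborel.emeasure_pair_measure_Times[of "{a $ i<..<b $ i}" lborel "{a $ j<..<b $ j}"]
        lborel.emeasure_pair_measure_Times[of "{a $ k<..<b $ k}" lborel "{a $ i<..<b $ i} \<times> {a $ j<..<b $ j}"]
      by (simp add: lborel_prod borel_open open_Times)
    also have "\<dots> = ennreal (\<Prod>m\<in>UNIV. b $ m - a $ m)"
      unfolding ijk(1) using ab ijk(2-4) by (simp add: ennreal_mult mult_ac)
    finally show "emeasure (distr lborel borel V) (box a b) = ennreal (\<Prod>m\<in>UNIV. b $ m - a $ m)" .
  qed simp
  then have "(\<integral>\<^sup>+x. h x \<partial>lborel) = (\<integral>\<^sup>+x. h x \<partial>distr lborel borel V)"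
    by simp
  also have "\<dots> = (\<integral>\<^sup>+p. h (V p) \<partial>lborel)"
    using h by (intro nn_integral_distr) auto
  finally show ?thesis
    by (simp add: V_def)
qed

lemma continuous_vec_of_pair:
  "continuous_on UNIV (\<lambda>p. vec_of i (fst p) (\<lambda>_. snd p))"
  "continuous_on UNIV (\<lambda>p. vec_of k (fst p) (\<lambda>m. if m = i then fst (snd p) else snd (snd p)))"
proof -
  have "continuous_on UNIV (\<lambda>p. vec_of i (fst p) (\<lambda>_. snd p) $ m)" for m
    unfolding vec_of_def by (cases "m = i") (auto intro!: continuous_intros)
  then show "continuous_on UNIV (\<lambda>p. vec_of i (fst p) (\<lambda>_. snd p))"
    by (rule continuous_on_componentwise_vec)
  have "continuous_on UNIV (\<lambda>p. vec_of k (fst p) (\<lambda>m. if m = i then fst (snd p) else snd (snd p)) $ m)" for m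
    unfolding vec_of_def by (cases "m = k"; cases "m = i") (auto intro!: continuous_intros)
  then show "continuous_on UNIV (\<lambda>p. vec_of k (fst p) (\<lambda>m. if m = i then fst (snd p) else snd (snd p)))"
    by (rule continuous_on_componentwise_vec)
qed

section \<open>The Sobolev inequality for test functions\<close>

context box_domain
begin

lemma nn_integral_M_eq_lborel:
  assumes "h \<in> borel_measurable borel" "\<And>x. x \<notin> Q \<Longrightarrow> h x = 0"
  shows "(\<integral>\<^sup>+x. h x \<partial>M) = (\<integral>\<^sup>+x. h x \<partial>lborel)"
proof -
  have "(\<integral>\<^sup>+x. h x \<partial>M) = (\<integral>\<^sup>+x. h x * indicator Q x \<partial>lebesgue)"
    by (intro nn_integral_restrict_space) simp
  also have "(\<lambda>x. h x * indicator Q x) = h"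
    using assms(2) by (auto simp: fun_eq_iff indicator_def)
  also have "(\<integral>\<^sup>+x. h x \<partial>lebesgue) = (\<integral>\<^sup>+x. h x \<partial>lborel)"
    by (rule nn_integral_completion)
  finally show ?thesis .
qed

lemma abs_partial_deriv_le: "\<bar>partial_deriv i f x\<bar> \<le> norm (grad f x)"
  using component_le_norm_cart[of "grad f x" i] by (simp add: grad_def)

lemma test_power_bound:
  assumes \<phi>: "\<phi> \<in> test_functions Q"
  shows "ennreal (\<bar>\<phi> (vec_of i s v)\<bar> ^ Suc k) \<le>
    (\<integral>\<^sup>+t. ennreal (real (Suc k) * (\<bar>\<phi> (vec_of i t v)\<bar> ^ k * \<bar>partial_deriv i \<phi> (vec_of i t v)\<bar>)) \<partial>lborel)"
proof (rule power_deriv_bound[of "\<lambda>t. \<phi> (vec_of i t v)" _ "l $ i"])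
  show "((\<lambda>t. \<phi> (vec_of i t v)) has_real_derivative partial_deriv i \<phi> (vec_of i t v)) (at t)" for t
    by (rule partial_deriv_vec_of[OF test_C_k[OF \<phi>]])
  show "continuous_on UNIV (\<lambda>t. partial_deriv i \<phi> (vec_of i t v))"
    by (rule continuous_on_compose2[OF C_1_partial_deriv_continuous[OF test_C_k[OF \<phi>]] continuous_vec_of]) simp
  fix t assume "\<bar>t\<bar> > l $ i"
  then have "vec_of i t v \<notin> Q"
    by (auto simp: Q_iff vec_of_def intro!: exI[of _ i])
  then show "\<phi> (vec_of i t v) = 0"
    using \<phi> closure_subset[of "{x. \<phi> x \<noteq> 0}"] by (auto simp: test_functions_def)
qed

lemma test_zero_outside: "\<phi> \<in> test_functions Q \<Longrightarrow> x \<notin> Q \<Longrightarrow> \<phi> x = 0"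
  using closure_subset[of "{x. \<phi> x \<noteq> 0}"] by (auto simp: test_functions_def)

lemma grad_zero_outside: "\<phi> \<in> test_functions Q \<Longrightarrow> x \<notin> Q \<Longrightarrow> grad \<phi> x = 0"
  using test_zero_outside[OF test_functions_partial_deriv] by (simp add: grad_def vec_eq_iff)

text \<open>The plane estimate leaves the integral of the fourth power. Bounding that power along
  lines in direction \<open>i\<close> and using that \<open>x\<close> ranges over an edge of length
  \<open>l $ i\<close> brings it to the form valid in dimension three, with 36 = 9 * 4.\<close>

lemma sobolev_pre_2:
  assumes ij: "(UNIV :: 'n set) = {i, j}" "i \<noteq> j" and \<phi>: "\<phi> \<in> test_functions Q"
  shows "(\<integral>\<^sup>+x. ennreal (\<phi> x ^ 6) \<partial>lborel) \<le> ennreal (36 * l $ i) *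
    (\<integral>\<^sup>+x. ennreal (\<bar>\<phi> x\<bar> ^ 3 * norm (grad \<phi> x)) \<partial>lborel) * (\<integral>\<^sup>+x. ennreal ((norm (grad \<phi> x))\<^sup>2) \<partial>lborel)"
proof -
  define V where "V p = vec_of i (fst p) (\<lambda>_. snd p)" for p
  have contV: "continuous_on UNIV V"
    unfolding V_def[abs_def] by (rule continuous_vec_of_pair)
  have C1: "C_k 1 \<phi>"
    by (rule test_C_k[OF \<phi>])
  note cont = C_k_continuous[OF C1] grad_continuous[OF C1] C_1_partial_deriv_continuous[OF C1]
  note contV' = cont(1)[THEN continuous_on_compose2, OF contV subset_UNIV]
    cont(2)[THEN continuous_on_compose2, OF contV subset_UNIV] cont(3)[THEN continuous_on_compose2, OF contV subset_UNIV]
  have [measurable]: "\<phi> \<in> borel_measurable borel" "grad \<phi> \<in> borel_measurable borel" "V \<in> borel_measurable borel"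
    "\<And>m. partial_deriv m \<phi> \<in> borel_measurable borel"
    using cont contV by (auto intro: borel_measurable_continuous_onI)
  have swap: "V (x, y) = vec_of j y (\<lambda>_. x)" for x y
    using ij by (auto simp: V_def vec_of_def vec_eq_iff)
  have vint: "(\<integral>\<^sup>+x. ennreal (h x) \<partial>lborel) = (\<integral>\<^sup>+x. \<integral>\<^sup>+y. ennreal (h (V (x, y))) \<partial>lborel \<partial>lborel)"
    if [measurable]: "h \<in> borel_measurable borel" for h
    by (subst nn_integral_vec2[OF ij]) (auto simp: V_def[symmetric] nn_integral_lborel_pair)
  have "(\<integral>\<^sup>+x. \<integral>\<^sup>+y. ennreal (\<phi> (V (x, y)) ^ 6) \<partial>lborel \<partial>lborel) \<le>
    9 * (\<integral>\<^sup>+x. \<integral>\<^sup>+y. ennreal (\<phi> (V (x, y)) ^ 4) \<partial>lborel \<partial>lborel) * (\<integral>\<^sup>+x. \<integral>\<^sup>+y. ennreal ((norm (grad \<phi> (V (x, y))))\<^sup>2) \<partial>lborel \<partial>lborel)"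
  proof (rule plane_sixth_power[where fx = "\<lambda>x y. partial_deriv i \<phi> (V (x, y))" and fy = "\<lambda>x y. partial_deriv j \<phi> (V (x, y))"])
    show "ennreal (\<bar>\<phi> (V (x, y))\<bar> ^ 3) \<le> (\<integral>\<^sup>+t. ennreal (3 * (\<bar>\<phi> (V (t, y))\<bar>\<^sup>2 * \<bar>partial_deriv i \<phi> (V (t, y))\<bar>)) \<partial>lborel)" for x y
      using test_power_bound[OF \<phi>, of i x "\<lambda>_. y" 2] by (simp add: V_def eval_nat_numeral)
    show "ennreal (\<bar>\<phi> (V (x, y))\<bar> ^ 3) \<le> (\<integral>\<^sup>+t. ennreal (3 * (\<bar>\<phi> (V (x, t))\<bar>\<^sup>2 * \<bar>partial_deriv j \<phi> (V (x, t))\<bar>)) \<partial>lborel)" for x y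
      using test_power_bound[OF \<phi>, of j y "\<lambda>_. x" 2] by (simp add: swap eval_nat_numeral)
  qed (auto simp: case_prod_beta' intro: abs_partial_deriv_le)
  also have "(\<integral>\<^sup>+x. \<integral>\<^sup>+y. ennreal (\<phi> (V (x, y)) ^ 4) \<partial>lborel \<partial>lborel) \<le>
      ennreal (l $ i) * (4 * (\<integral>\<^sup>+x. ennreal (\<bar>\<phi> x\<bar> ^ 3 * norm (grad \<phi> x)) \<partial>lborel))"
  proof -
    define B where "B y = (\<integral>\<^sup>+t. ennreal (4 * (\<bar>\<phi> (V (t, y))\<bar> ^ 3 * norm (grad \<phi> (V (t, y))))) \<partial>lborel)" for y
    have le: "ennreal (\<phi> (V (x, y)) ^ 4) \<le> indicator {0..l $ i} x * B y" for x y
    proof (cases "x \<in> {0..l $ i}")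
      case True
      have "ennreal (\<phi> (V (x, y)) ^ 4) \<le> (\<integral>\<^sup>+t. ennreal (4 * (\<bar>\<phi> (V (t, y))\<bar> ^ 3 * \<bar>partial_deriv i \<phi> (V (t, y))\<bar>)) \<partial>lborel)"
        using test_power_bound[OF \<phi>, of i x "\<lambda>_. y" 3] by (simp add: V_def)
      also have "\<dots> \<le> B y"
        unfolding B_def by (intro nn_integral_mono ennreal_leI mult_left_mono abs_partial_deriv_le) auto
      finally show ?thesis
        using True by simp
    next
      case False
      then have "V (x, y) \<notin> Q"
        by (auto simp: Q_iff V_def vec_of_def intro!: exI[of _ i])
      then show ?thesis
        using test_zero_outside[OF \<phi>] by simp
    qed
    have meas_B [measurable]: "(\<lambda>p. ennreal (4 * (\<bar>\<phi> (V (snd p, fst p))\<bar> ^ 3 * norm (grad \<phi> (V (snd p, fst p)))))) \<in> borel_measurable (lborel \<Otimes>\<^sub>M lborel)"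
    proof -
      have sw: "continuous_on UNIV (\<lambda>p. V (snd p, fst p))"
        by (rule continuous_on_compose2[OF contV]) (auto intro!: continuous_intros)
      have "continuous_on UNIV (\<lambda>p. 4 * (\<bar>\<phi> (V (snd p, fst p))\<bar> ^ 3 * norm (grad \<phi> (V (snd p, fst p)))))"
        using continuous_on_compose2[OF cont(1) sw] continuous_on_compose2[OF cont(2) sw]
        by (intro continuous_intros) auto
      then have "(\<lambda>p. 4 * (\<bar>\<phi> (V (snd p, fst p))\<bar> ^ 3 * norm (grad \<phi> (V (snd p, fst p))))) \<in> borel_measurable borel"
        by (rule borel_measurable_continuous_onI)
      from measurable_compose[OF this measurable_ennreal] show ?thesis
        unfolding lborel_prod by (subst measurable_cong_sets[OF sets_lborel refl])
    qed
    have [measurable]: "B \<in> borel_measurable lborel"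
      unfolding B_def using lborel.borel_measurable_nn_integral_fst[of "\<lambda>p. ennreal (4 * (\<bar>\<phi> (V (snd p, fst p))\<bar> ^ 3 * norm (grad \<phi> (V (snd p, fst p)))))" lborel]
      by simp
    have "(\<integral>\<^sup>+x. \<integral>\<^sup>+y. ennreal (\<phi> (V (x, y)) ^ 4) \<partial>lborel \<partial>lborel) \<le> (\<integral>\<^sup>+x. \<integral>\<^sup>+y. indicator {0..l $ i} x * B y \<partial>lborel \<partial>lborel)"
      by (intro nn_integral_mono le)
    also have "\<dots> = ennreal (l $ i) * (\<integral>\<^sup>+y. B y \<partial>lborel)"
      using l_pos[of i] by (simp add: nn_integral_cmult nn_integral_multc)
    also have "(\<integral>\<^sup>+y. B y \<partial>lborel) = (\<integral>\<^sup>+x. \<integral>\<^sup>+y. ennreal (4 * (\<bar>\<phi> (V (x, y))\<bar> ^ 3 * norm (grad \<phi> (V (x, y))))) \<partial>lborel \<partial>lborel)"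
      unfolding B_def by (rule lborel_pair.Fubini'[symmetric]) (use meas_B in \<open>simp only: case_prod_beta'\<close>)
    also have "\<dots> = 4 * (\<integral>\<^sup>+x. ennreal (\<bar>\<phi> x\<bar> ^ 3 * norm (grad \<phi> x)) \<partial>lborel)"
      by (subst vint[symmetric]) (auto simp: ennreal_mult nn_integral_cmult)
    finally show ?thesis .
  qed
  finally have "(\<integral>\<^sup>+x. ennreal (\<phi> x ^ 6) \<partial>lborel) \<le>
      9 * (ennreal (l $ i) * (4 * (\<integral>\<^sup>+x. ennreal (\<bar>\<phi> x\<bar> ^ 3 * norm (grad \<phi> x)) \<partial>lborel))) * (\<integral>\<^sup>+x. ennreal ((norm (grad \<phi> x))\<^sup>2) \<partial>lborel)"
    by (simp add: vint mult_left_mono mult_right_mono)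
  moreover have "ennreal (36 * l $ i) = 9 * ennreal (l $ i) * 4"
    using l_pos[of i] by (simp add: ennreal_mult mult_ac)
  ultimately show ?thesis
    by (simp add: mult_ac)
qed

text \<open>The plane estimate is applied on slices with the coordinate \<open>k\<close> fixed. The
  fourth-power integral over a slice is bounded, uniformly in the slice, by integrating the
  derivative in direction \<open>k\<close>; the gradient term is then integrated over all
  slices.\<close>

lemma sobolev_pre_3:
  assumes ijk: "(UNIV :: 'n set) = {i, j, k}" "i \<noteq> j" "i \<noteq> k" "j \<noteq> k" and \<phi>: "\<phi> \<in> test_functions Q"
  shows "(\<integral>\<^sup>+x. ennreal (\<phi> x ^ 6) \<partial>lborel) \<le> ennreal 36 *
    (\<integral>\<^sup>+x. ennreal (\<bar>\<phi> x\<bar> ^ 3 * norm (grad \<phi> x)) \<partial>lborel) * (\<integral>\<^sup>+x. ennreal ((norm (grad \<phi> x))\<^sup>2) \<partial>lborel)"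
proof -
  define V where "V p = vec_of k (fst p) (\<lambda>m. if m = i then fst (snd p) else snd (snd p))" for p
  have contV: "continuous_on UNIV V"
    unfolding V_def[abs_def] by (rule continuous_vec_of_pair)
  have C1: "C_k 1 \<phi>"
    by (rule test_C_k[OF \<phi>])
  note cont = C_k_continuous[OF C1] grad_continuous[OF C1] C_1_partial_deriv_continuous[OF C1]
  have [measurable]: "\<phi> \<in> borel_measurable borel" "grad \<phi> \<in> borel_measurable borel" "V \<in> borel_measurable borel"
    "\<And>m. partial_deriv m \<phi> \<in> borel_measurable borel"
    using cont contV by (auto intro: borel_measurable_continuous_onI)
  have Vi: "V (z, x, y) = vec_of i x (\<lambda>m. if m = k then z else y)"
    and Vj: "V (z, x, y) = vec_of j y (\<lambda>m. if m = k then z else x)" for x y z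
  proof -
    have all: "(\<forall>m. P m) \<longleftrightarrow> P i \<and> P j \<and> P k" for P :: "'n \<Rightarrow> bool"
    proof -
      have "(\<forall>m\<in>UNIV. P m) \<longleftrightarrow> P i \<and> P j \<and> P k"
        unfolding ijk(1) by simp
      then show ?thesis
        by simp
    qed
    show "V (z, x, y) = vec_of i x (\<lambda>m. if m = k then z else y)"
      "V (z, x, y) = vec_of j y (\<lambda>m. if m = k then z else x)"
      unfolding vec_eq_iff all using ijk(2-4) by (auto simp: V_def vec_of_def)
  qed
  have vint: "(\<integral>\<^sup>+x. ennreal (h x) \<partial>lborel) = (\<integral>\<^sup>+z. \<integral>\<^sup>+w. ennreal (h (V (z, w))) \<partial>lborel \<partial>lborel)"
    if [measurable]: "h \<in> borel_measurable borel" for h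
    by (subst nn_integral_vec3[OF ijk]) (auto simp: V_def[symmetric] nn_integral_lborel_pair)
  define W where "W = (\<integral>\<^sup>+x. ennreal (\<bar>\<phi> x\<bar> ^ 3 * norm (grad \<phi> x)) \<partial>lborel)"
  have F: "(\<integral>\<^sup>+w. ennreal (\<phi> (V (z, w)) ^ 4) \<partial>lborel) \<le> 4 * W" for z
  proof -
    have "(\<integral>\<^sup>+w. ennreal (\<phi> (V (z, w)) ^ 4) \<partial>lborel) \<le>
        (\<integral>\<^sup>+w. \<integral>\<^sup>+t. ennreal (4 * (\<bar>\<phi> (V (t, w))\<bar> ^ 3 * norm (grad \<phi> (V (t, w))))) \<partial>lborel \<partial>lborel)"
    proof (rule nn_integral_mono)
      fix w
      have "ennreal (\<phi> (V (z, w)) ^ 4) \<le> (\<integral>\<^sup>+t. ennreal (4 * (\<bar>\<phi> (V (t, w))\<bar> ^ 3 * \<bar>partial_deriv k \<phi> (V (t, w))\<bar>)) \<partial>lborel)"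
        using test_power_bound[OF \<phi>, of k z "\<lambda>m. if m = i then fst w else snd w" 3] by (simp add: V_def cong: if_cong)
      also have "\<dots> \<le> (\<integral>\<^sup>+t. ennreal (4 * (\<bar>\<phi> (V (t, w))\<bar> ^ 3 * norm (grad \<phi> (V (t, w))))) \<partial>lborel)"
        by (intro nn_integral_mono ennreal_leI mult_left_mono abs_partial_deriv_le) auto
      finally show "ennreal (\<phi> (V (z, w)) ^ 4) \<le> (\<integral>\<^sup>+t. ennreal (4 * (\<bar>\<phi> (V (t, w))\<bar> ^ 3 * norm (grad \<phi> (V (t, w))))) \<partial>lborel)" .
    qed
    also have "\<dots> = (\<integral>\<^sup>+t. \<integral>\<^sup>+w. ennreal (4 * (\<bar>\<phi> (V (t, w))\<bar> ^ 3 * norm (grad \<phi> (V (t, w))))) \<partial>lborel \<partial>lborel)"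
      by (rule lborel_pair.Fubini') (simp add: lborel_prod case_prod_beta')
    also have "\<dots> = 4 * W"
      unfolding W_def by (subst vint[symmetric]) (auto simp: ennreal_mult nn_integral_cmult)
    finally show ?thesis .
  qed
  have slice: "(\<integral>\<^sup>+w. ennreal (\<phi> (V (z, w)) ^ 6) \<partial>lborel) \<le> 9 * (4 * W) * (\<integral>\<^sup>+w. ennreal ((norm (grad \<phi> (V (z, w))))\<^sup>2) \<partial>lborel)" for z
  proof -
    have "(\<integral>\<^sup>+x. \<integral>\<^sup>+y. ennreal (\<phi> (V (z, x, y)) ^ 6) \<partial>lborel \<partial>lborel) \<le>
      9 * (\<integral>\<^sup>+x. \<integral>\<^sup>+y. ennreal (\<phi> (V (z, x, y)) ^ 4) \<partial>lborel \<partial>lborel) * (\<integral>\<^sup>+x. \<integral>\<^sup>+y. ennreal ((norm (grad \<phi> (V (z, x, y))))\<^sup>2) \<partial>lborel \<partial>lborel)"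
    proof (rule plane_sixth_power[where fx = "\<lambda>x y. partial_deriv i \<phi> (V (z, x, y))" and fy = "\<lambda>x y. partial_deriv j \<phi> (V (z, x, y))"])
      show "ennreal (\<bar>\<phi> (V (z, x, y))\<bar> ^ 3) \<le> (\<integral>\<^sup>+t. ennreal (3 * (\<bar>\<phi> (V (z, t, y))\<bar>\<^sup>2 * \<bar>partial_deriv i \<phi> (V (z, t, y))\<bar>)) \<partial>lborel)" for x y
        using test_power_bound[OF \<phi>, of i x "\<lambda>m. if m = k then z else y" 2] by (simp add: Vi eval_nat_numeral)
      show "ennreal (\<bar>\<phi> (V (z, x, y))\<bar> ^ 3) \<le> (\<integral>\<^sup>+t. ennreal (3 * (\<bar>\<phi> (V (z, x, t))\<bar>\<^sup>2 * \<bar>partial_deriv j \<phi> (V (z, x, t))\<bar>)) \<partial>lborel)" for x y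
        using test_power_bound[OF \<phi>, of j y "\<lambda>m. if m = k then z else x" 2] by (simp add: Vj eval_nat_numeral)
    qed (auto simp: case_prod_beta' intro: abs_partial_deriv_le)
    then have "(\<integral>\<^sup>+w. ennreal (\<phi> (V (z, w)) ^ 6) \<partial>lborel) \<le>
      9 * (\<integral>\<^sup>+w. ennreal (\<phi> (V (z, w)) ^ 4) \<partial>lborel) * (\<integral>\<^sup>+w. ennreal ((norm (grad \<phi> (V (z, w))))\<^sup>2) \<partial>lborel)"
      by (simp add: nn_integral_lborel_pair)
    also have "\<dots> \<le> 9 * (4 * W) * (\<integral>\<^sup>+w. ennreal ((norm (grad \<phi> (V (z, w))))\<^sup>2) \<partial>lborel)"
      by (intro mult_right_mono mult_left_mono F) auto
    finally show ?thesis .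
  qed
  have "(\<lambda>p. ennreal ((norm (grad \<phi> (V p)))\<^sup>2)) \<in> borel_measurable (lborel \<Otimes>\<^sub>M lborel)"
    unfolding lborel_prod by measurable
  then have [measurable]: "(\<lambda>z. \<integral>\<^sup>+w. ennreal ((norm (grad \<phi> (V (z, w))))\<^sup>2) \<partial>lborel) \<in> borel_measurable lborel"
    by (rule lborel.borel_measurable_nn_integral_fst)
  have "(\<integral>\<^sup>+x. ennreal (\<phi> x ^ 6) \<partial>lborel) \<le> (\<integral>\<^sup>+z. 9 * (4 * W) * (\<integral>\<^sup>+w. ennreal ((norm (grad \<phi> (V (z, w))))\<^sup>2) \<partial>lborel) \<partial>lborel)"
    unfolding vint[of "\<lambda>x. \<phi> x ^ 6", simplified] by (intro nn_integral_mono slice)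
  also have "\<dots> = 9 * (4 * W) * (\<integral>\<^sup>+x. ennreal ((norm (grad \<phi> x))\<^sup>2) \<partial>lborel)"
    by (simp add: nn_integral_cmult vint)
  also have "9 * (4 * W) = ennreal 36 * W"
    by (simp add: mult.assoc[symmetric])
  finally show ?thesis
    unfolding W_def .
qed

text \<open>Cauchy-Schwarz makes the sought norm \<open>X\<close> reappear on the right to the first
  power only, so one factor can be divided out. It is finite from the outset because \<phi> is a
  test function.\<close>

lemma sobolev_test:
  assumes "CARD('n) = 2 \<or> CARD('n) = 3"
  obtains K where "K \<ge> 0" "\<And>\<phi>. \<phi> \<in> test_functions Q \<Longrightarrow> L2_norm Q (\<lambda>x. \<phi> x ^ 3) \<le> K * L2_norm Q (grad \<phi>) ^ 3"
proof -
  obtain K where "K \<ge> 0" and pre: "\<And>\<phi>. \<phi> \<in> test_functions Q \<Longrightarrow> (\<integral>\<^sup>+x. ennreal (\<phi> x ^ 6) \<partial>lborel) \<le> ennreal K *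
    (\<integral>\<^sup>+x. ennreal (\<bar>\<phi> x\<bar> ^ 3 * norm (grad \<phi> x)) \<partial>lborel) * (\<integral>\<^sup>+x. ennreal ((norm (grad \<phi> x))\<^sup>2) \<partial>lborel)"
    using assms
  proof
    assume "CARD('n) = 2"
    then obtain i j where ij: "(UNIV :: 'n set) = {i, j}" "i \<noteq> j"
      by (auto simp: card_2_iff)
    show thesis
      by (rule that[OF _ sobolev_pre_2[OF ij]]) (use l_pos[of i] in auto)
  next
    assume "CARD('n) = 3"
    then obtain i j k where ijk: "(UNIV :: 'n set) = {i, j, k}" "i \<noteq> j" "i \<noteq> k" "j \<noteq> k"
      by (auto simp: card_3_iff)
    show thesis
      by (rule that[OF _ sobolev_pre_3[OF ijk]]) auto
  qed
  show thesis
  proof (rule that[OF \<open>K \<ge> 0\<close>])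
    fix \<phi> assume \<phi>: "\<phi> \<in> test_functions Q"
    have cont: "continuous_on UNIV \<phi>" "continuous_on UNIV (grad \<phi>)"
      by (intro C_k_continuous[of 1] grad_continuous test_C_k \<phi>)+
    have [measurable]: "\<phi> \<in> borel_measurable borel" "grad \<phi> \<in> borel_measurable borel"
      using cont by (auto intro: borel_measurable_continuous_onI)
    have c3: "(\<lambda>x. \<phi> x ^ 3) \<in> L2_space Q" "(\<lambda>x. \<bar>\<phi> x\<bar> ^ 3) \<in> L2_space Q" "(\<lambda>x. norm (grad \<phi> x)) \<in> L2_space Q"
        "grad \<phi> \<in> L2_space Q"
      using cont by (auto intro!: L2_continuous continuous_intros)
    define X G where "X = L2_norm Q (\<lambda>x. \<phi> x ^ 3)" and "G = L2_norm Q (grad \<phi>)"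
    have nn: "X \<ge> 0" "G \<ge> 0"
      by (simp_all add: X_def G_def L2_norm_nonneg)
    have 1: "(\<integral>\<^sup>+x. ennreal (\<phi> x ^ 6) \<partial>lborel) = ennreal (X\<^sup>2)"
    proof -
      have "(\<integral>\<^sup>+x. ennreal (\<phi> x ^ 6) \<partial>lborel) = (\<integral>\<^sup>+x. ennreal ((norm (\<phi> x ^ 3))\<^sup>2) \<partial>M)"
        by (subst nn_integral_M_eq_lborel) (auto simp: test_zero_outside[OF \<phi>] power_mult[symmetric])
      then show ?thesis
        unfolding X_def nn_integral_norm_sq[OF c3(1)] .
    qed
    have 2: "(\<integral>\<^sup>+x. ennreal ((norm (grad \<phi> x))\<^sup>2) \<partial>lborel) = ennreal (G\<^sup>2)"
      unfolding G_def nn_integral_norm_sq[OF c3(4), symmetric]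
      by (subst nn_integral_M_eq_lborel) (auto simp: grad_zero_outside[OF \<phi>])
    have 3: "(\<integral>\<^sup>+x. ennreal (\<bar>\<phi> x\<bar> ^ 3 * norm (grad \<phi> x)) \<partial>lborel) \<le> ennreal (X * G)"
    proof -
      have "(\<integral>\<^sup>+x. ennreal (\<bar>\<phi> x\<bar> ^ 3 * norm (grad \<phi> x)) \<partial>lborel) = (\<integral>\<^sup>+x. ennreal (\<bar>\<phi> x\<bar> ^ 3 * norm (grad \<phi> x)) \<partial>M)"
        by (subst nn_integral_M_eq_lborel) (auto simp: test_zero_outside[OF \<phi>])
      also have "\<dots> = ennreal (L2_inner Q (\<lambda>x. \<bar>\<phi> x\<bar> ^ 3) (\<lambda>x. norm (grad \<phi> x)))"
        using L2_integrable_inner[OF c3(2,3)] by (subst nn_integral_eq_integral) (auto simp: L2_inner_def)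
      also have "\<dots> \<le> ennreal (L2_norm Q (\<lambda>x. \<bar>\<phi> x\<bar> ^ 3) * L2_norm Q (\<lambda>x. norm (grad \<phi> x)))"
        using L2_Cauchy_Schwarz[OF c3(2,3)] by (intro ennreal_leI) auto
      also have "L2_norm Q (\<lambda>x. \<bar>\<phi> x\<bar> ^ 3) * L2_norm Q (\<lambda>x. norm (grad \<phi> x)) = X * G"
        by (simp add: X_def G_def L2_norm_def power_abs)
      finally show ?thesis .
    qed
    have "ennreal (X\<^sup>2) \<le> ennreal K * ennreal (X * G) * ennreal (G\<^sup>2)"
      unfolding 1[symmetric] 2[symmetric]
      by (rule order_trans[OF pre[OF \<phi>]]) (intro mult_right_mono mult_left_mono 3; simp)
    also have "\<dots> = ennreal (K * (X * G) * G\<^sup>2)"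
      using nn \<open>K \<ge> 0\<close> by (simp add: ennreal_mult)
    finally have "X\<^sup>2 \<le> K * (X * G) * G\<^sup>2"
      using nn \<open>K \<ge> 0\<close> by (subst (asm) ennreal_le_iff) auto
    then have "X * X \<le> X * (K * G ^ 3)"
      by (simp add: power2_eq_square power3_eq_cube mult_ac)
    then have "X \<le> K * G ^ 3"
      using nn \<open>K \<ge> 0\<close> by (cases "X = 0") auto
    then show "L2_norm Q (\<lambda>x. \<phi> x ^ 3) \<le> K * L2_norm Q (grad \<phi>) ^ 3"
      by (simp add: X_def G_def)
  qed
qed

end

section \<open>Coefficients\<close>

context box_domain
begin

definition coef :: "(real^'n \<Rightarrow> real) \<Rightarrow> ('n \<Rightarrow> nat) ell2" where
  "coef f = Abs_ell2 (\<lambda>j. L2_inner Q f (basis j))"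

definition coefs_of_grad :: "(real^'n \<Rightarrow> real^'n) \<Rightarrow> ('n \<Rightarrow> nat) ell2" where
  "coefs_of_grad g = Abs_ell2 (\<lambda>j. L2_inner Q g (gbasis j))"

lemma coord_coef: "f \<in> L2_space Q \<Longrightarrow> coord (coef f) j = L2_inner Q f (basis j)"
  unfolding coef_def using Abs_ell2_bounded_sums[OF Bessel[OF orthonormal_basis]] by metis

lemma coord_coefs_of_grad: "g \<in> L2_space Q \<Longrightarrow> coord (coefs_of_grad g) j = L2_inner Q g (gbasis j)"
  unfolding coefs_of_grad_def using Abs_ell2_bounded_sums[OF Bessel[OF orthonormal_gbasis]] by metis

lemma coef_add: "f \<in> L2_space Q \<Longrightarrow> g \<in> L2_space Q \<Longrightarrow> coef (\<lambda>x. f x + g x) = coef f + coef g"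
  by (rule ell2_eqI) (simp add: coord_coef L2_add L2_inner_add_left basis_L2)

lemma coef_diff: "f \<in> L2_space Q \<Longrightarrow> g \<in> L2_space Q \<Longrightarrow> coef (\<lambda>x. f x - g x) = coef f - coef g"
  by (rule ell2_eqI) (simp add: coord_coef L2_diff L2_inner_diff_left basis_L2)

lemma coef_scaleR: "f \<in> L2_space Q \<Longrightarrow> coef (\<lambda>x. r * f x) = r *\<^sub>R coef f"
  using L2_scaleR[of f Q r] L2_inner_scaleR_left[of Q r f]
  by (intro ell2_eqI) (simp add: coord_coef)

lemma coef_cong_AE:
  "f \<in> L2_space Q \<Longrightarrow> g \<in> L2_space Q \<Longrightarrow> AE x in M. f x = g x \<Longrightarrow> coef f = coef g"
  by (rule ell2_eqI) (simp add: coord_coef L2_inner_cong_AE[of f Q g] basis_L2)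

lemma coef_eq_imp_AE:
  assumes "f \<in> L2_space Q" "g \<in> L2_space Q" "coef f = coef g"
  shows "AE x in M. f x = g x"
proof -
  have "AE x in M. f x - g x = 0"
  proof (rule basis_complete)
    fix j
    show "L2_inner Q (\<lambda>x. f x - g x) (basis j) = 0"
      using assms coord_coef[OF assms(1), of j] coord_coef[OF assms(2), of j]
      by (simp add: L2_inner_diff_left basis_L2)
  qed (intro L2_diff assms)
  then show ?thesis
    by eventually_elim simp
qed

lemma partial_sums_norm:
  assumes "orthonormal Q e" "f \<in> L2_space Q"
    "(\<lambda>n. L2_norm Q (\<lambda>x. (\<Sum>i\<in>index_below n. coord z i *\<^sub>R e i x) - f x)) \<longlonglongrightarrow> 0"
  shows "L2_norm Q f = norm z"
proof -
  have "(\<lambda>n. L2_norm Q (\<lambda>x. \<Sum>i\<in>index_below n. coord z i *\<^sub>R e i x)) \<longlonglongrightarrow> L2_norm Q f"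
    by (intro L2_norm_tendsto orthonormal_sum_L2 assms)
  then have "(\<lambda>n. (L2_norm Q (\<lambda>x. \<Sum>i\<in>index_below n. coord z i *\<^sub>R e i x))\<^sup>2) \<longlonglongrightarrow> (L2_norm Q f)\<^sup>2"
    by (rule tendsto_power)
  then have "(\<lambda>n. \<Sum>i\<in>index_below n. (coord z i)\<^sup>2) \<longlonglongrightarrow> (L2_norm Q f)\<^sup>2"
    by (simp add: orthonormal_norm_sum[OF assms(1)] finite_index_below)
  then have "(L2_norm Q f)\<^sup>2 = (norm z)\<^sup>2"
    using ell2_partial_sums LIMSEQ_unique by blast
  then show ?thesis
    by (simp add: L2_norm_nonneg power2_eq_iff_nonneg)
qed

text \<open>A chosen representative of the function with coefficients \<open>z\<close>. It is
  determined up to null sets, so identities between synthesized functions hold almost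
  everywhere.\<close>

definition synth :: "('n \<Rightarrow> nat) ell2 \<Rightarrow> real^'n \<Rightarrow> real" where
  "synth z = (SOME f. f \<in> L2_space Q \<and> coef f = z)"

lemma synth_exists:
  obtains f where "f \<in> L2_space Q" "coef f = z"
    "(\<lambda>n. L2_norm Q (\<lambda>x. (\<Sum>i\<in>index_below n. coord z i *\<^sub>R basis i x) - f x)) \<longlonglongrightarrow> 0"
proof -
  obtain f where f: "f \<in> L2_space Q" "\<And>i. L2_inner Q f (basis i) = coord z i"
      "(\<lambda>n. L2_norm Q (\<lambda>x. (\<Sum>i\<in>index_below n. coord z i *\<^sub>R basis i x) - f x)) \<longlonglongrightarrow> 0"
    using Riesz_Fischer[OF orthonormal_basis] by blast
  then have "coef f = z"
    by (intro ell2_eqI) (simp add: coord_coef)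
  with f that show thesis
    by blast
qed

lemma synth_L2: "synth z \<in> L2_space Q" and coef_synth: "coef (synth z) = z"
proof -
  have "\<exists>f. f \<in> L2_space Q \<and> coef f = z"
    using synth_exists by blast
  from someI_ex[OF this] show "synth z \<in> L2_space Q" "coef (synth z) = z"
    by (auto simp: synth_def)
qed

lemma synth_AE: "f \<in> L2_space Q \<Longrightarrow> AE x in M. synth (coef f) x = f x"
  by (rule coef_eq_imp_AE) (auto simp: synth_L2 coef_synth)

text \<open>Parseval's identity: the Riesz-Fischer function with the same coefficients has the right
  norm, and completeness identifies it with \<open>f\<close> almost everywhere.\<close>

lemma norm_coef:
  assumes "f \<in> L2_space Q"
  shows "norm (coef f) = L2_norm Q f"
proof -
  obtain f' where f': "f' \<in> L2_space Q" "coef f' = coef f"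
    "(\<lambda>n. L2_norm Q (\<lambda>x. (\<Sum>i\<in>index_below n. coord (coef f) i *\<^sub>R basis i x) - f' x)) \<longlonglongrightarrow> 0"
    using synth_exists by blast
  have "L2_norm Q f' = norm (coef f)"
    by (rule partial_sums_norm[OF orthonormal_basis f'(1,3)])
  moreover have "L2_norm Q f' = L2_norm Q f"
    by (intro L2_norm_cong_AE coef_eq_imp_AE f' assms)
  ultimately show ?thesis
    by simp
qed

text \<open>Polarization of the identity for norms.\<close>

lemma inner_coef:
  assumes "f \<in> L2_space Q" "g \<in> L2_space Q"
  shows "inner (coef f) (coef g) = L2_inner Q f g"
proof -
  have "(norm (coef f + coef g))\<^sup>2 = (L2_norm Q (\<lambda>x. f x + g x))\<^sup>2"
    by (simp add: coef_add[OF assms, symmetric] norm_coef L2_add assms)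
  moreover have "(norm (coef f + coef g))\<^sup>2 = (norm (coef f))\<^sup>2 + 2 * inner (coef f) (coef g) + (norm (coef g))\<^sup>2"
    by (simp add: power2_norm_eq_inner inner_add_left inner_add_right inner_commute)
  ultimately show ?thesis
    by (simp add: L2_norm_sq_add assms norm_coef)
qed

lemma inv_\<omega>: "\<bar>1 / \<omega> j\<bar> \<le> 1 / \<omega>0"
  using \<omega>_ge[of j] \<omega>0_pos by (simp add: frac_le)

abbreviation D :: "('n \<Rightarrow> nat) ell2 \<Rightarrow> ('n \<Rightarrow> nat) ell2" where
  "D \<equiv> diag (\<lambda>j. 1 / \<omega> j)"

lemmas coord_D' = coord_diag[where m = "\<lambda>j. 1 / \<omega> j", OF inv_\<omega>]
  and bounded_linear_D = bounded_linear_diag[where m = "\<lambda>j. 1 / \<omega> j", OF inv_\<omega>]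

text \<open>The coordinates in which the norm of the gradient becomes the norm of
  \<open>\<ell>\<^sub>2\<close>; this is the variable of the abstract equation.\<close>

definition gcoef :: "(real^'n \<Rightarrow> real) \<Rightarrow> ('n \<Rightarrow> nat) ell2" where
  "gcoef f = coefs_of_grad (weak_grad Q f)"

lemma coord_gcoef:
  assumes "f \<in> H10_space Q"
  shows "coord (gcoef f) j = \<omega> j * coord (coef f) j"
  using H10_grad_gbasis[OF H10_imp_H10_grad[OF assms]] H10_grad_L2[OF H10_imp_H10_grad[OF assms]]
  by (simp add: gcoef_def coord_coefs_of_grad coord_coef)

lemma coef_eq_D_gcoef:
  assumes "f \<in> H10_space Q"
  shows "coef f = D (gcoef f)"
  using \<omega>_pos by (intro ell2_eqI) (simp add: coord_D' coord_gcoef[OF assms] less_imp_neq[THEN not_sym])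

lemma gcoef_eqI:
  assumes "f \<in> H10_space Q" "coef f = D z"
  shows "gcoef f = z"
  using \<omega>_pos by (intro ell2_eqI) (simp add: coord_D' coord_gcoef[OF assms(1)] assms(2) less_imp_neq[THEN not_sym])

lemma H10_L2: "f \<in> H10_space Q \<Longrightarrow> f \<in> L2_space Q"
  by (simp add: H10_space_def H1_space_def)

lemma weak_grad_L2: "f \<in> H10_space Q \<Longrightarrow> weak_grad Q f \<in> L2_space Q"
  using H10_grad_L2(2)[OF H10_imp_H10_grad] .

lemma H10_diff:
  assumes "f \<in> H10_space Q" "g \<in> H10_space Q"
  shows "(\<lambda>x. f x - g x) \<in> H10_space Q"
  using H10_grad_imp_H10[OF H10_grad_add[OF H10_imp_H10_grad[OF assms(1)]
      H10_grad_scaleR[OF H10_imp_H10_grad[OF assms(2)], of "-1"]]] by simp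

lemma H10_add:
  assumes "f \<in> H10_space Q" "g \<in> H10_space Q"
  shows "(\<lambda>x. f x + g x) \<in> H10_space Q"
  using H10_grad_imp_H10[OF H10_grad_add[OF H10_imp_H10_grad[OF assms(1)] H10_imp_H10_grad[OF assms(2)]]] .

lemma H10_scaleR:
  assumes "f \<in> H10_space Q"
  shows "(\<lambda>x. r * f x) \<in> H10_space Q"
  using H10_grad_imp_H10[OF H10_grad_scaleR[OF H10_imp_H10_grad[OF assms]]] .

text \<open>Function and gradient are summed in parallel, each by Riesz-Fischer. The norm of the
  gradient is thus obtained as an equality, where Bessel's inequality for \<open>gbasis\<close>
  would give one direction only.\<close>

lemma synth_D_H10_grad: "\<exists>g. H10_grad (synth (D z)) g \<and> L2_norm Q g = norm z"
proof -
  obtain f where f: "f \<in> L2_space Q" "coef f = D z"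
    "(\<lambda>n. L2_norm Q (\<lambda>x. (\<Sum>i\<in>index_below n. coord (D z) i *\<^sub>R basis i x) - f x)) \<longlonglongrightarrow> 0"
    using synth_exists by blast
  obtain g where g: "g \<in> L2_space Q" "\<And>i. L2_inner Q g (gbasis i) = coord z i"
      "(\<lambda>n. L2_norm Q (\<lambda>x. (\<Sum>i\<in>index_below n. coord z i *\<^sub>R gbasis i x) - g x)) \<longlonglongrightarrow> 0"
    using Riesz_Fischer[OF orthonormal_gbasis] by blast
  have "H10_grad (\<lambda>x. \<Sum>i\<in>index_below n. coord (D z) i * basis i x) (\<lambda>x. \<Sum>i\<in>index_below n. coord (D z) i *\<^sub>R (\<omega> i *\<^sub>R gbasis i x))" for n
    by (intro H10_grad_sum finite_index_below H10_grad_basis)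
  moreover have "coord (D z) i *\<^sub>R (\<omega> i *\<^sub>R gbasis i x) = coord z i *\<^sub>R gbasis i x" for i x
    using \<omega>_pos[of i] by (simp add: coord_D')
  ultimately have "H10_grad (\<lambda>x. \<Sum>i\<in>index_below n. coord (D z) i *\<^sub>R basis i x) (\<lambda>x. \<Sum>i\<in>index_below n. coord z i *\<^sub>R gbasis i x)" for n
    by (simp only: real_scaleR_def)
  from H10_grad_limit[OF this f(1) g(1) f(3) g(3)] have "H10_grad f g" .
  then have "H10_grad (synth (D z)) g"
    by (rule H10_grad_cong_AE) (use f synth_L2 g(1) synth_AE[OF f(1)] in auto)
  moreover have "L2_norm Q g = norm z"
    by (rule partial_sums_norm[OF orthonormal_gbasis g(1,3)])
  ultimately show ?thesis
    by blast
qed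

lemma synth_D_H10: "synth (D z) \<in> H10_space Q"
  using synth_D_H10_grad H10_grad_imp_H10 by blast

lemma gcoef_synth_D: "gcoef (synth (D z)) = z"
  by (intro gcoef_eqI synth_D_H10 coef_synth)

lemma norm_gcoef:
  assumes "f \<in> H10_space Q"
  shows "norm (gcoef f) = L2_norm Q (weak_grad Q f)"
proof -
  obtain g where g: "H10_grad (synth (D (gcoef f))) g" "L2_norm Q g = norm (gcoef f)"
    using synth_D_H10_grad by blast
  have "H10_grad f g"
    by (rule H10_grad_cong_AE[OF g(1)])
      (use H10_grad_L2[OF g(1)] H10_L2[OF assms] synth_AE[OF H10_L2[OF assms]] coef_eq_D_gcoef[OF assms] in auto)
  from L2_norm_weak_grad[OF H10_grad_L2(2)[OF this] H10_grad_weak[OF this]] g(2) show ?thesis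
    by simp
qed

lemma gcoef_add:
  assumes "f \<in> H10_space Q" "g \<in> H10_space Q"
  shows "gcoef (\<lambda>x. f x + g x) = gcoef f + gcoef g"
  by (rule ell2_eqI) (simp add: coord_gcoef H10_add assms coef_add H10_L2 distrib_left)

lemma gcoef_diff:
  assumes "f \<in> H10_space Q" "g \<in> H10_space Q"
  shows "gcoef (\<lambda>x. f x - g x) = gcoef f - gcoef g"
  by (rule ell2_eqI) (simp add: coord_gcoef H10_diff assms coef_diff H10_L2 right_diff_distrib)

lemma gcoef_scaleR:
  assumes "f \<in> H10_space Q"
  shows "gcoef (\<lambda>x. r * f x) = r *\<^sub>R gcoef f"
  by (rule ell2_eqI) (simp add: coord_gcoef H10_scaleR assms coef_scaleR H10_L2)

lemma inner_gcoef:
  assumes "f \<in> H10_space Q" "g \<in> H10_space Q"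
  shows "inner (gcoef f) (gcoef g) = L2_inner Q (weak_grad Q f) (weak_grad Q g)"
proof -
  have "AE x in M. weak_grad Q (\<lambda>x. f x + g x) x = weak_grad Q f x + weak_grad Q g x"
    by (intro H10_grad_unique[OF H10_imp_H10_grad H10_grad_add] H10_add H10_imp_H10_grad assms)
  then have "L2_norm Q (weak_grad Q (\<lambda>x. f x + g x)) = L2_norm Q (\<lambda>x. weak_grad Q f x + weak_grad Q g x)"
    by (intro L2_norm_cong_AE weak_grad_L2 H10_add L2_add assms)
  then have "(norm (gcoef f + gcoef g))\<^sup>2 = (L2_norm Q (\<lambda>x. weak_grad Q f x + weak_grad Q g x))\<^sup>2"
    by (simp add: gcoef_add[OF assms, symmetric] norm_gcoef H10_add assms)
  moreover have "(norm (gcoef f + gcoef g))\<^sup>2 = (norm (gcoef f))\<^sup>2 + 2 * inner (gcoef f) (gcoef g) + (norm (gcoef g))\<^sup>2"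
    by (simp add: power2_norm_eq_inner inner_add_left inner_add_right inner_commute)
  ultimately show ?thesis
    by (simp add: L2_norm_sq_add assms norm_gcoef weak_grad_L2)
qed

lemma H1_norm_coef:
  assumes "f \<in> H10_space Q"
  shows "H1_norm Q f = sqrt ((norm (coef f))\<^sup>2 + (norm (gcoef f))\<^sup>2)"
  by (simp add: H1_norm_def norm_coef norm_gcoef H10_L2 assms)

lemma gcoef_zero_imp_AE:
  assumes "f \<in> H10_space Q" "gcoef f = 0"
  shows "AE x in M. f x = 0"
proof -
  have "norm (coef f) = 0"
    using coef_eq_D_gcoef[OF assms(1)] assms(2) linear_simps(3)[OF bounded_linear_D] by simp
  then show ?thesis
    using H10_L2[OF assms(1)] by (simp add: norm_coef L2_norm_eq_0_iff)
qed

end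

section \<open>The cubic nonlinearity\<close>

lemma arith_geo_mean_3:
  fixes a b c :: real
  assumes "a \<ge> 0" "b \<ge> 0" "c \<ge> 0"
  shows "3 * (a * b * c) \<le> a ^ 3 + b ^ 3 + c ^ 3"
proof -
  have "a ^ 3 + b ^ 3 + c ^ 3 - 3 * (a * b * c) = (a + b + c) * ((a - b)\<^sup>2 + (b - c)\<^sup>2 + (c - a)\<^sup>2) / 2"
    by (simp add: power2_eq_square power3_eq_cube algebra_simps)
  also have "\<dots> \<ge> 0"
    using assms by simp
  finally show ?thesis
    by simp
qed

locale sobolev_box = box_domain l for l :: "real^'n::finite" +
  fixes K :: real
  assumes K_nonneg: "K \<ge> 0"
    and sobolev: "\<And>\<phi>. \<phi> \<in> test_functions Q \<Longrightarrow> L2_norm Q (\<lambda>x. \<phi> x ^ 3) \<le> K * L2_norm Q (grad \<phi>) ^ 3"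
begin

text \<open>The inequality is extended from test functions by density. Convergence of the cubes in
  norm is not known, so an almost everywhere convergent subsequence and Fatou's lemma are
  used.\<close>

lemma H10_cube:
  assumes f: "f \<in> H10_space Q"
  shows "(\<lambda>x. f x ^ 3) \<in> L2_space Q" "L2_norm Q (\<lambda>x. f x ^ 3) \<le> K * norm (gcoef f) ^ 3"
proof -
  define G where "G = norm (gcoef f)"
  obtain \<phi> where \<phi>: "\<And>n. \<phi> n \<in> test_functions Q" "(\<lambda>n. L2_norm Q (\<lambda>x. \<phi> n x - f x)) \<longlonglongrightarrow> 0"
        "(\<lambda>n. L2_norm Q (\<lambda>x. grad (\<phi> n) x - weak_grad Q f x)) \<longlonglongrightarrow> 0"
    using H10_imp_H10_grad[OF f] unfolding H10_grad_def by blast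
  have fL2: "f \<in> L2_space Q"
    by (rule H10_L2[OF f])
  have Cauchy: "\<exists>N. \<forall>m\<ge>N. \<forall>n\<ge>N. L2_norm Q (\<lambda>x. \<phi> m x - \<phi> n x) < e" if "e > 0" for e
  proof -
    obtain N where N: "\<And>n. n \<ge> N \<Longrightarrow> L2_norm Q (\<lambda>x. \<phi> n x - f x) < e / 2"
      using order_tendstoD(2)[OF \<phi>(2) half_gt_zero[OF \<open>e > 0\<close>]] unfolding eventually_sequentially by blast
    have "L2_norm Q (\<lambda>x. \<phi> m x - \<phi> n x) < e" if "m \<ge> N" "n \<ge> N" for m n
      using L2_norm_triangle_diff[OF test_L2[OF \<phi>(1)] fL2 test_L2[OF \<phi>(1)], of m n] N[OF that(1)] N[OF that(2)]
        L2_norm_minus_commute[of Q f "\<phi> n"] by linarith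
    then show ?thesis
      by blast
  qed
  obtain f' r where f': "f' \<in> L2_space Q" "(\<lambda>n. L2_norm Q (\<lambda>x. \<phi> n x - f' x)) \<longlonglongrightarrow> 0"
    "strict_mono r" "AE x in M. (\<lambda>k. \<phi> (r k) x) \<longlonglongrightarrow> f' x"
    by (rule L2_complete[OF test_L2[OF \<phi>(1)] Cauchy])
  have "L2_norm Q (\<lambda>x. f x - f' x) = 0"
  proof (rule LIMSEQ_unique)
    show "(\<lambda>n. L2_norm Q (\<lambda>x. f x - f' x)) \<longlonglongrightarrow> L2_norm Q (\<lambda>x. f x - f' x)"
      by simp
    show "(\<lambda>n. L2_norm Q (\<lambda>x. f x - f' x)) \<longlonglongrightarrow> 0"
    proof (rule L2_norm_tendsto_0_mono)
      show "(\<lambda>n. L2_norm Q (\<lambda>x. \<phi> n x - f x) + L2_norm Q (\<lambda>x. \<phi> n x - f' x)) \<longlonglongrightarrow> 0"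
        using tendsto_add[OF \<phi>(2) f'(2)] by simp
      show "L2_norm Q (\<lambda>x. f x - f' x) \<le> L2_norm Q (\<lambda>x. \<phi> n x - f x) + L2_norm Q (\<lambda>x. \<phi> n x - f' x)" for n
        using L2_norm_triangle_diff[OF fL2 test_L2[OF \<phi>(1)] f'(1), of n] L2_norm_minus_commute[of Q f "\<phi> n"] by linarith
    qed
  qed
  then have "AE x in M. f x - f' x = 0"
    using L2_norm_eq_0_iff[OF L2_diff[OF fL2 f'(1)]] by simp
  with f'(4) have lim: "AE x in M. (\<lambda>k. \<phi> (r k) x) \<longlonglongrightarrow> f x"
    by eventually_elim simp
  have grad_lim: "(\<lambda>n. L2_norm Q (grad (\<phi> n))) \<longlonglongrightarrow> G"
    unfolding G_def norm_gcoef[OF f] by (intro L2_norm_tendsto grad_test_L2 weak_grad_L2 \<phi> f)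
  have meas: "(\<lambda>x. f x ^ 3) \<in> borel_measurable M"
    using L2_measurable[OF fL2] by simp
  \<comment> \<open>The gradient norms of the approximants converge to \<open>G\<close> but may
    exceed it; the slack \<delta> is sent to 0 at the end.\<close>
  have est: "(\<lambda>x. f x ^ 3) \<in> L2_space Q \<and> L2_norm Q (\<lambda>x. f x ^ 3) \<le> K * (G + \<delta>) ^ 3" if "\<delta> > 0" for \<delta>
  proof -
    have "G < G + \<delta>"
      using that by simp
    then obtain N where N: "\<And>n. n \<ge> N \<Longrightarrow> L2_norm Q (grad (\<phi> n)) < G + \<delta>"
      using order_tendstoD(2)[OF grad_lim] unfolding eventually_sequentially by blast
    have "L2_norm Q (\<lambda>x. \<phi> (r (k + N)) x ^ 3) \<le> K * (G + \<delta>) ^ 3" for k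
    proof -
      have "N \<le> r (k + N)"
        using strict_mono_imp_increasing[OF f'(3), of "k + N"] by simp
      then have "L2_norm Q (grad (\<phi> (r (k + N)))) ^ 3 \<le> (G + \<delta>) ^ 3"
        using N by (intro power_mono) (auto simp: L2_norm_nonneg less_imp_le)
      then show ?thesis
        using sobolev[OF \<phi>(1), of "r (k + N)"] K_nonneg by (meson mult_left_mono order_trans)
    qed
    moreover have "AE x in M. (\<lambda>k. \<phi> (r (k + N)) x ^ 3) \<longlonglongrightarrow> f x ^ 3"
      using lim
    proof eventually_elim
      fix x assume "(\<lambda>k. \<phi> (r k) x) \<longlonglongrightarrow> f x"
      then show "(\<lambda>k. \<phi> (r (k + N)) x ^ 3) \<longlonglongrightarrow> f x ^ 3"
        by (intro tendsto_power LIMSEQ_ignore_initial_segment[of "\<lambda>k. \<phi> (r k) x"])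
    qed
    moreover have "(\<lambda>x. \<phi> (r (k + N)) x ^ 3) \<in> L2_space Q" for k
      by (intro L2_continuous continuous_on_power C_k_continuous[of 0] test_C_k \<phi>)
    ultimately show ?thesis
      using L2_Fatou[of "\<lambda>k x. \<phi> (r (k + N)) x ^ 3" Q "\<lambda>x. f x ^ 3" "K * (G + \<delta>) ^ 3"] meas by blast
  qed
  show "(\<lambda>x. f x ^ 3) \<in> L2_space Q"
    using est[of 1] by simp
  have "(\<lambda>n. K * (G + 1 / real (Suc n)) ^ 3) \<longlonglongrightarrow> K * (G + 0) ^ 3"
    by (intro tendsto_intros LIMSEQ_inverse_real_of_nat[unfolded inverse_eq_divide])
  then have "L2_norm Q (\<lambda>x. f x ^ 3) \<le> K * (G + 0) ^ 3"
    by (rule LIMSEQ_le_const) (use est in auto)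
  then show "L2_norm Q (\<lambda>x. f x ^ 3) \<le> K * norm (gcoef f) ^ 3"
    by (simp add: G_def)
qed

text \<open>The inequality of arithmetic and geometric means for the squares of the three values,
  integrated.\<close>

lemma H10_triple_L2:
  assumes f: "f \<in> H10_space Q" and g: "g \<in> H10_space Q" and h: "h \<in> H10_space Q"
  shows "(\<lambda>x. f x * g x * h x) \<in> L2_space Q"
    and "3 * (L2_norm Q (\<lambda>x. f x * g x * h x))\<^sup>2 \<le>
      (L2_norm Q (\<lambda>x. f x ^ 3))\<^sup>2 + (L2_norm Q (\<lambda>x. g x ^ 3))\<^sup>2 + (L2_norm Q (\<lambda>x. h x ^ 3))\<^sup>2"
proof -
  have [measurable]: "f \<in> borel_measurable M" "g \<in> borel_measurable M" "h \<in> borel_measurable M"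
    using H10_L2[OF f] H10_L2[OF g] H10_L2[OF h] by (auto intro: L2_measurable)
  have int: "integrable M (\<lambda>x. (norm (f x ^ 3))\<^sup>2)" "integrable M (\<lambda>x. (norm (g x ^ 3))\<^sup>2)" "integrable M (\<lambda>x. (norm (h x ^ 3))\<^sup>2)"
    using L2_integrable_sq[OF H10_cube(1)[OF f]] L2_integrable_sq[OF H10_cube(1)[OF g]] L2_integrable_sq[OF H10_cube(1)[OF h]] by auto
  have le: "3 * (norm (f x * g x * h x))\<^sup>2 \<le> (norm (f x ^ 3))\<^sup>2 + (norm (g x ^ 3))\<^sup>2 + (norm (h x ^ 3))\<^sup>2" for x
    using arith_geo_mean_3[of "(f x)\<^sup>2" "(g x)\<^sup>2" "(h x)\<^sup>2"]
    by (simp add: power_mult_distrib power_mult[symmetric] mult.commute)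
  have int': "integrable M (\<lambda>x. (norm (f x * g x * h x))\<^sup>2)"
  proof (rule Bochner_Integration.integrable_bound)
    show "integrable M (\<lambda>x. (norm (f x ^ 3))\<^sup>2 + (norm (g x ^ 3))\<^sup>2 + (norm (h x ^ 3))\<^sup>2)"
      using int by (intro Bochner_Integration.integrable_add)
    show "AE x in M. norm ((norm (f x * g x * h x))\<^sup>2) \<le> norm ((norm (f x ^ 3))\<^sup>2 + (norm (g x ^ 3))\<^sup>2 + (norm (h x ^ 3))\<^sup>2)"
    proof (intro AE_I2)
      fix x
      have "(norm (f x * g x * h x))\<^sup>2 \<le> 3 * (norm (f x * g x * h x))\<^sup>2"
        by simp
      also note le
      finally show "norm ((norm (f x * g x * h x))\<^sup>2) \<le> norm ((norm (f x ^ 3))\<^sup>2 + (norm (g x ^ 3))\<^sup>2 + (norm (h x ^ 3))\<^sup>2)"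
        unfolding real_norm_def by (simp only: abs_of_nonneg zero_le_power2 add_nonneg_nonneg)
    qed
  qed measurable
  then show "(\<lambda>x. f x * g x * h x) \<in> L2_space Q"
    by (simp add: L2_space_def)
  have "(LINT x|M. 3 * (norm (f x * g x * h x))\<^sup>2) \<le> (LINT x|M. (norm (f x ^ 3))\<^sup>2 + (norm (g x ^ 3))\<^sup>2 + (norm (h x ^ 3))\<^sup>2)"
    using int int' le by (intro integral_mono Bochner_Integration.integrable_add integrable_mult_right)
  then show "3 * (L2_norm Q (\<lambda>x. f x * g x * h x))\<^sup>2 \<le>
      (L2_norm Q (\<lambda>x. f x ^ 3))\<^sup>2 + (L2_norm Q (\<lambda>x. g x ^ 3))\<^sup>2 + (L2_norm Q (\<lambda>x. h x ^ 3))\<^sup>2"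
    using int int' unfolding L2_norm_def
    by (simp add: Bochner_Integration.integral_nonneg)
qed

text \<open>A substitute for the three-factor inequality of Hoelder: after scaling each factor to
  gradient norm 1 the bound by the three cubes is already \<open>K\<close>, and homogeneity restores
  the norms. A factor with vanishing gradient is zero almost everywhere.\<close>

lemma H10_triple_bound:
  assumes f: "f \<in> H10_space Q" and g: "g \<in> H10_space Q" and h: "h \<in> H10_space Q"
  shows "L2_norm Q (\<lambda>x. f x * g x * h x) \<le> K * norm (gcoef f) * norm (gcoef g) * norm (gcoef h)"
proof (cases "gcoef f = 0 \<or> gcoef g = 0 \<or> gcoef h = 0")
  case True
  then have "(AE x in M. f x = 0) \<or> (AE x in M. g x = 0) \<or> (AE x in M. h x = 0)"
    using gcoef_zero_imp_AE f g h by blast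
  then have "AE x in M. f x * g x * h x = 0"
    by (auto elim: eventually_mono)
  then have "L2_norm Q (\<lambda>x. f x * g x * h x) = 0"
    by (simp add: L2_norm_eq_0_iff[OF H10_triple_L2(1)[OF assms]])
  then show ?thesis
    using K_nonneg by simp
next
  case False
  define \<alpha> \<beta> \<gamma> where "\<alpha> = norm (gcoef f)" and "\<beta> = norm (gcoef g)" and "\<gamma> = norm (gcoef h)"
  have pos: "\<alpha> > 0" "\<beta> > 0" "\<gamma> > 0"
    using False by (auto simp: \<alpha>_def \<beta>_def \<gamma>_def)
  have cube: "(L2_norm Q (\<lambda>x. (inverse (norm (gcoef w)) * w x) ^ 3))\<^sup>2 \<le> K\<^sup>2" if "w \<in> H10_space Q" "gcoef w \<noteq> 0" for w
  proof -
    have "norm (gcoef (\<lambda>x. inverse (norm (gcoef w)) * w x)) = 1"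
      using that by (simp add: gcoef_scaleR)
    then have "L2_norm Q (\<lambda>x. (inverse (norm (gcoef w)) * w x) ^ 3) \<le> K"
      using H10_cube(2)[OF H10_scaleR[OF that(1)], of "inverse (norm (gcoef w))"] by simp
    then show ?thesis
      by (intro power_mono) (auto simp: L2_norm_nonneg)
  qed
  define N where "N = L2_norm Q (\<lambda>x. (inverse \<alpha> * f x) * (inverse \<beta> * g x) * (inverse \<gamma> * h x))"
  have "3 * N\<^sup>2 \<le> K\<^sup>2 + K\<^sup>2 + K\<^sup>2"
    unfolding N_def using False
    by (intro order_trans[OF H10_triple_L2(2)[OF H10_scaleR[OF f] H10_scaleR[OF g] H10_scaleR[OF h]]] add_mono)
      (auto simp: \<alpha>_def \<beta>_def \<gamma>_def intro: cube f g h)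
  then have "N\<^sup>2 \<le> K\<^sup>2"
    by simp
  then have "N \<le> K"
    using K_nonneg by (rule power2_le_imp_le)
  moreover have "N = inverse (\<alpha> * \<beta> * \<gamma>) * L2_norm Q (\<lambda>x. f x * g x * h x)"
  proof -
    have "N = L2_norm Q (\<lambda>x. inverse (\<alpha> * \<beta> * \<gamma>) *\<^sub>R (f x * g x * h x))"
      by (simp add: N_def mult_ac)
    then show ?thesis
      using pos unfolding L2_norm_scaleR by (simp add: abs_of_pos)
  qed
  ultimately have "L2_norm Q (\<lambda>x. f x * g x * h x) \<le> K * (\<alpha> * \<beta> * \<gamma>)"
    using pos by (simp add: field_simps)
  then show ?thesis
    by (simp add: \<alpha>_def \<beta>_def \<gamma>_def mult_ac)
qed

definition T :: "('n \<Rightarrow> nat) ell2 \<Rightarrow> ('n \<Rightarrow> nat) ell2 \<Rightarrow> ('n \<Rightarrow> nat) ell2 \<Rightarrow> ('n \<Rightarrow> nat) ell2" where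
  "T a b c = coef (\<lambda>x. synth (D a) x * synth (D b) x * synth (D c) x)"

lemma synth_diff_AE: "AE x in M. synth (D (a - b)) x = synth (D a) x - synth (D b) x"
proof (rule coef_eq_imp_AE)
  show "coef (synth (D (a - b))) = coef (\<lambda>x. synth (D a) x - synth (D b) x)"
    by (simp add: coef_diff synth_L2 coef_synth linear_simps(2)[OF bounded_linear_D])
qed (intro synth_L2 L2_diff)+

sublocale tri: trilinear_ell2 \<omega> \<omega>0 K T
proof
  note triple_L2 = H10_triple_L2(1)[OF synth_D_H10 synth_D_H10 synth_D_H10]
  show "T (x - y) b c = T x b c - T y b c" for x y b c
  proof -
    have "coef (\<lambda>x. synth (D x') x * synth (D b) x * synth (D c) x - synth (D y) x * synth (D b) x * synth (D c) x) = T x' b c - T y b c" for x'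
      unfolding T_def by (intro coef_diff triple_L2)
    moreover have "T (x - y) b c = coef (\<lambda>t. synth (D x) t * synth (D b) t * synth (D c) t - synth (D y) t * synth (D b) t * synth (D c) t)"
      unfolding T_def
      by (intro coef_cong_AE triple_L2 L2_diff eventually_mono[OF synth_diff_AE[of x y]]) (simp add: left_diff_distrib)
    ultimately show ?thesis
      by simp
  qed
  show "T a b c = T b a c" "T a b c = T a c b" for a b c
    by (simp_all add: T_def mult_ac)
  show "norm (T a b c) \<le> K * norm a * norm b * norm c" for a b c
    using H10_triple_bound[OF synth_D_H10 synth_D_H10 synth_D_H10, of a b c]
    by (simp add: T_def norm_coef[OF triple_L2] gcoef_synth_D)
  show "inner (T a b c) (D d) = inner (T d b c) (D a)" for a b c d
  proof -
    have "inner (T a b c) (D d) = L2_inner Q (\<lambda>x. synth (D a) x * synth (D b) x * synth (D c) x) (synth (D d))" for a d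
      using inner_coef[OF triple_L2 synth_L2, of a b c "D d"] by (simp add: T_def coef_synth)
    then show ?thesis
      by (simp add: L2_inner_def mult_ac)
  qed
qed (use \<omega>0_pos \<omega>_ge K_nonneg in auto)

lemma cube_eq: "tri.cube z = coef (\<lambda>x. synth (D z) x ^ 3)"
  by (simp add: tri.cube_def T_def power3_eq_cube)

section \<open>From coefficients back to solutions of the wave equation\<close>

lemma wave_solution_synth:
  fixes w q :: "real \<Rightarrow> ('n \<Rightarrow> nat) ell2"
  assumes u0: "u0 \<in> H10_space Q" and v0: "v0 \<in> L2_space Q"
    and init: "w 0 = gcoef u0" "q 0 = coef v0"
    and cont: "continuous_on {0..t1} w" "continuous_on {0..t1} q"
    and dw: "\<And>t. t \<in> {0..t1} \<Longrightarrow> ((\<lambda>s. D (w s)) has_vector_derivative q t) (at t within {0..t1})"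
    and dq: "\<And>t. t \<in> {0..t1} \<Longrightarrow> ((\<lambda>s. D (q s)) has_vector_derivative
      - (c (\<epsilon> * t))\<^sup>2 *\<^sub>R w t + a (\<epsilon> * t) *\<^sub>R D (tri.cube (w t))) (at t within {0..t1})"
  shows "wave_solution Q c a \<epsilon> t1 u0 v0 (\<lambda>t. synth (D (w t))) (\<lambda>t. synth (q t))"
  unfolding wave_solution_def
proof (intro conjI ballI)
  show "AE x in M. synth (D (w 0)) x = u0 x"
    using synth_AE[OF H10_L2[OF u0]] by (simp add: init coef_eq_D_gcoef[OF u0])
  show "AE x in M. synth (q 0) x = v0 x"
    using synth_AE[OF v0] by (simp add: init)
next
  fix t assume t: "t \<in> {0..t1}"
  let ?F = "at t within {0..t1}"
  show "synth (D (w t)) \<in> H10_space Q" "synth (q t) \<in> L2_space Q" "(\<lambda>x. synth (D (w t)) x ^ 3) \<in> L2_space Q"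
    by (rule synth_D_H10 synth_L2 H10_cube(1)[OF synth_D_H10])+
  have w_lim: "(w \<longlongrightarrow> w t) ?F" and q_lim: "(q \<longlongrightarrow> q t) ?F"
    using cont t by (auto simp: continuous_on_def)
  have "((\<lambda>s. sqrt ((norm (D (w s) - D (w t)))\<^sup>2 + (norm (w s - w t))\<^sup>2)) \<longlongrightarrow>
      sqrt ((norm (D (w t) - D (w t)))\<^sup>2 + (norm (w t - w t))\<^sup>2)) ?F"
    by (intro tendsto_intros bounded_linear.tendsto[OF bounded_linear_D] w_lim)
  moreover have "H1_norm Q (\<lambda>x. synth (D (w s)) x - synth (D (w t)) x) =
      sqrt ((norm (D (w s) - D (w t)))\<^sup>2 + (norm (w s - w t))\<^sup>2)" for s
    by (simp add: H1_norm_coef H10_diff synth_D_H10 coef_diff synth_L2 gcoef_diff coef_synth gcoef_synth_D)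
  ultimately show "((\<lambda>s. H1_norm Q (\<lambda>x. synth (D (w s)) x - synth (D (w t)) x)) \<longlongrightarrow> 0) ?F"
    by simp
  have "((\<lambda>s. norm (q s - q t)) \<longlongrightarrow> norm (q t - q t)) ?F"
    by (intro tendsto_intros q_lim)
  moreover have "L2_norm Q (\<lambda>x. synth (q s) x - synth (q t) x) = norm (q s - q t)" for s
    by (simp add: norm_coef[symmetric] L2_diff coef_diff synth_L2 coef_synth)
  ultimately show "((\<lambda>s. L2_norm Q (\<lambda>x. synth (q s) x - synth (q t) x)) \<longlongrightarrow> 0) ?F"
    by simp
  have "((\<lambda>s. norm ((D (w s) - D (w t)) /\<^sub>R (s - t) - q t)) \<longlongrightarrow> norm (q t - q t)) ?F"
    using dw[OF t] unfolding has_vector_derivative_quotient by (intro tendsto_norm tendsto_diff tendsto_const)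
  moreover have "L2_norm Q (\<lambda>x. (synth (D (w s)) x - synth (D (w t)) x) / (s - t) - synth (q t) x) =
      norm ((D (w s) - D (w t)) /\<^sub>R (s - t) - q t)" for s
  proof -
    have L2: "(\<lambda>x. synth (D (w s)) x - synth (D (w t)) x) \<in> L2_space Q"
      by (intro L2_diff synth_L2)
    then have L2': "(\<lambda>x. inverse (s - t) * (synth (D (w s)) x - synth (D (w t)) x)) \<in> L2_space Q"
      using L2_scaleR[OF L2, of "inverse (s - t)"] by simp
    have "norm (coef (\<lambda>x. inverse (s - t) * (synth (D (w s)) x - synth (D (w t)) x) - synth (q t) x)) =
        norm ((D (w s) - D (w t)) /\<^sub>R (s - t) - q t)"
      by (simp only: coef_diff[OF L2' synth_L2] coef_scaleR[OF L2] coef_diff[OF synth_L2 synth_L2] coef_synth)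
    then show ?thesis
      using norm_coef[OF L2_diff[OF L2' synth_L2[of "q t"]]] by (simp only: divide_inverse mult.commute)
  qed
  ultimately show "((\<lambda>s. L2_norm Q (\<lambda>x. (synth (D (w s)) x - synth (D (w t)) x) / (s - t) - synth (q t) x)) \<longlongrightarrow> 0) ?F"
    by simp
  fix \<phi> assume \<phi>: "\<phi> \<in> H10_space Q"
  \<comment> \<open>Since a test function has coefficients \<open>D \<psi>\<close>, pairing with it
    amounts to pairing \<open>D\<close> of the coefficients with \<psi>. Hence the derivative of
    \<open>D q\<close> is just what the weak formulation asks for.\<close>
  define \<psi> where "\<psi> = gcoef \<phi>"
  have coef_\<phi>: "coef \<phi> = D \<psi>"
    by (simp add: \<psi>_def coef_eq_D_gcoef[OF \<phi>])
  have pair: "L2_inner Q f \<phi> = inner (D (coef f)) \<psi>" if "f \<in> L2_space Q" for f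
    using inner_coef[OF that H10_L2[OF \<phi>]] by (simp add: coef_\<phi> tri.inner_D_commute)
  have "((\<lambda>s. inner (D (q s)) \<psi>) has_vector_derivative
      inner (- (c (\<epsilon> * t))\<^sup>2 *\<^sub>R w t + a (\<epsilon> * t) *\<^sub>R D (tri.cube (w t))) \<psi>) ?F"
    by (rule bounded_linear.has_vector_derivative[OF bounded_linear_inner_left dq[OF t]])
  moreover have "L2_inner Q (synth (q s)) \<phi> = inner (D (q s)) \<psi>" for s
    by (simp add: pair synth_L2 coef_synth)
  moreover have "inner (D (tri.cube (w t))) \<psi> = L2_inner Q (\<lambda>x. synth (D (w t)) x ^ 3) \<phi>"
    by (simp add: pair H10_cube(1)[OF synth_D_H10] cube_eq)
  moreover have "inner (w t) \<psi> = L2_inner Q (weak_grad Q (synth (D (w t)))) (weak_grad Q \<phi>)"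
    using inner_gcoef[OF synth_D_H10 \<phi>, of "w t"] by (simp add: \<psi>_def gcoef_synth_D)
  ultimately show "((\<lambda>s. L2_inner Q (synth (q s)) \<phi>) has_real_derivative
      - (c (\<epsilon> * t))\<^sup>2 * L2_inner Q (weak_grad Q (synth (D (w t)))) (weak_grad Q \<phi>) +
        a (\<epsilon> * t) * L2_inner Q (\<lambda>x. synth (D (w t)) x ^ 3) \<phi>) ?F"
    by (simp add: has_real_derivative_iff_has_vector_derivative inner_diff_left)
qed

lemma adiabatic_invariant_synth:
  "adiabatic_invariant Q c \<epsilon> (\<lambda>t. synth (D (w t))) (\<lambda>t. synth (q t)) t =
    ((norm (q t))\<^sup>2 + (c (\<epsilon> * t))\<^sup>2 * (norm (w t))\<^sup>2) / (2 * c (\<epsilon> * t))"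
proof -
  have "L2_norm Q (weak_grad Q (synth (D (w t)))) = norm (w t)"
    using norm_gcoef[OF synth_D_H10, of "w t"] by (simp add: gcoef_synth_D)
  moreover have "L2_norm Q (synth (q t)) = norm (q t)"
    using norm_coef[OF synth_L2, of "q t"] by (simp add: coef_synth)
  ultimately show ?thesis
    by (simp add: adiabatic_invariant_def)
qed

lemma long_time_solutions:
  assumes sw: "slow_wave \<omega> \<omega>0 K T c c1 c2 c3 a a1 c0"
  obtains \<epsilon>0 \<kappa> C C' where "\<epsilon>0 > 0" "\<kappa> > 0" "C \<ge> 0" "C' \<ge> 0" "\<epsilon>0 \<le> 1"
    "\<And>\<epsilon> u0 v0 t1. \<lbrakk>0 < \<epsilon>; \<epsilon> \<le> \<epsilon>0; u0 \<in> H10_space Q; v0 \<in> L2_space Q;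
        L2_norm Q (weak_grad Q u0) \<le> C0 * \<epsilon>; L2_norm Q v0 \<le> C0 * \<epsilon>; t1 * \<epsilon> ^ 3 \<le> \<kappa>\<rbrakk> \<Longrightarrow>
      \<exists>u v. wave_solution Q c a \<epsilon> t1 u0 v0 u v \<and>
        (\<forall>t\<in>{0..t1}. \<bar>adiabatic_invariant Q c \<epsilon> u v t - adiabatic_invariant Q c \<epsilon> u v 0\<bar> \<le> C * \<epsilon> ^ 3 + C' * t * \<epsilon> ^ 5)"
proof -
  interpret sw: slow_wave \<omega> \<omega>0 K T c c1 c2 c3 a a1 c0
    by (rule sw)
  define P where "P C C' \<epsilon> w0 v0 t1 \<longleftrightarrow> (\<exists>p q. p 0 = c 0 *\<^sub>R w0 \<and> q 0 = v0 \<and> continuous_on {0..} p \<and> continuous_on {0..} q \<and>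
     (\<forall>t\<in>{0..t1}.
       ((\<lambda>s. D (p s) /\<^sub>R c (\<epsilon> * s)) has_vector_derivative q t) (at t within {0..}) \<and>
       ((\<lambda>s. D (q s)) has_vector_derivative
          - c (\<epsilon> * t) *\<^sub>R p t + a (\<epsilon> * t) *\<^sub>R D (tri.cube (p t /\<^sub>R c (\<epsilon> * t)))) (at t within {0..}) \<and>
       \<bar>sw.invariant \<epsilon> p q t - sw.invariant \<epsilon> p q 0\<bar> \<le> C * \<epsilon> ^ 3 + C' * t * \<epsilon> ^ 5))" for C C' \<epsilon> w0 v0 t1
  have "\<exists>\<epsilon>0>0. \<exists>\<kappa>>0. \<exists>C\<ge>0. \<exists>C'\<ge>0. \<epsilon>0 \<le> 1 \<and> (\<forall>\<epsilon> w0 v0 t1. 0 < \<epsilon> \<and> \<epsilon> \<le> \<epsilon>0 \<and>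
     norm w0 \<le> C0 * \<epsilon> \<and> norm v0 \<le> C0 * \<epsilon> \<and> t1 * \<epsilon> ^ 3 \<le> \<kappa> \<longrightarrow> P C C' \<epsilon> w0 v0 t1)"
    unfolding P_def by (rule sw.long_time_invariant)
  then obtain \<epsilon>0 \<kappa> C C' where pos: "\<epsilon>0 > 0" "\<kappa> > 0" "C \<ge> 0" "C' \<ge> 0" "\<epsilon>0 \<le> 1"
    and sol: "\<forall>\<epsilon> w0 v0 t1. 0 < \<epsilon> \<and> \<epsilon> \<le> \<epsilon>0 \<and> norm w0 \<le> C0 * \<epsilon> \<and> norm v0 \<le> C0 * \<epsilon> \<and> t1 * \<epsilon> ^ 3 \<le> \<kappa> \<longrightarrow> P C C' \<epsilon> w0 v0 t1"
    by (elim exE conjE) (rule that)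
  show thesis
  proof (rule that[OF pos])
    fix \<epsilon> t1 :: real and u0 v0 :: "real^'n \<Rightarrow> real"
    assume \<epsilon>: "0 < \<epsilon>" "\<epsilon> \<le> \<epsilon>0" and data: "u0 \<in> H10_space Q" "v0 \<in> L2_space Q"
      and small: "L2_norm Q (weak_grad Q u0) \<le> C0 * \<epsilon>" "L2_norm Q v0 \<le> C0 * \<epsilon>" "t1 * \<epsilon> ^ 3 \<le> \<kappa>"
    have "P C C' \<epsilon> (gcoef u0) (coef v0) t1"
      by (rule sol[rule_format]) (use \<epsilon> small norm_gcoef[OF data(1)] norm_coef[OF data(2)] in auto)
    then obtain p q where init: "p 0 = c 0 *\<^sub>R gcoef u0" "q 0 = coef v0"
      and cont: "continuous_on {0..} p" "continuous_on {0..} q"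
      and dp: "\<And>t. t \<in> {0..t1} \<Longrightarrow> ((\<lambda>s. D (p s) /\<^sub>R c (\<epsilon> * s)) has_vector_derivative q t) (at t within {0..})"
      and dq: "\<And>t. t \<in> {0..t1} \<Longrightarrow> ((\<lambda>s. D (q s)) has_vector_derivative
            - c (\<epsilon> * t) *\<^sub>R p t + a (\<epsilon> * t) *\<^sub>R D (tri.cube (p t /\<^sub>R c (\<epsilon> * t)))) (at t within {0..})"
      and inv: "\<And>t. t \<in> {0..t1} \<Longrightarrow> \<bar>sw.invariant \<epsilon> p q t - sw.invariant \<epsilon> p q 0\<bar> \<le> C * \<epsilon> ^ 3 + C' * t * \<epsilon> ^ 5"
      unfolding P_def ball_conj_distrib by (elim exE conjE) (rule that; (assumption | erule (1) bspec))
    \<comment> \<open>The gradient coefficients of the solution itself; \<open>p\<close> carries the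
      additional factor \<open>c\<close>.\<close>
    define w where "w s = p s /\<^sub>R c (\<epsilon> * s)" for s
    have c_pos: "c (\<epsilon> * t) > 0" if "t \<ge> 0" for t
      using sw.c_pos[of "\<epsilon> * t"] that \<epsilon>(1) by simp
    have p_eq: "p t = c (\<epsilon> * t) *\<^sub>R w t" if "t \<ge> 0" for t
      using c_pos[OF that] by (simp add: w_def)
    have D_w: "D (w s) = D (p s) /\<^sub>R c (\<epsilon> * s)" for s
      unfolding w_def by (rule linear_simps(5)[OF bounded_linear_D])
    have "wave_solution Q c a \<epsilon> t1 u0 v0 (\<lambda>t. synth (D (w t))) (\<lambda>t. synth (q t))"
    proof (rule wave_solution_synth[OF data])
      show "w 0 = gcoef u0"
        using c_pos[of 0] by (simp add: w_def init)
      show "continuous_on {0..t1} w"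
      proof (rule continuous_on_subset)
        show "continuous_on {0..} w"
          unfolding w_def using c_pos
          by (intro continuous_intros cont sw.continuous_on_scaled sw.continuous_coeffs \<epsilon>) (auto simp: less_imp_neq[THEN not_sym])
      qed auto
      show "continuous_on {0..t1} q"
        by (rule continuous_on_subset[OF cont(2)]) auto
      fix t assume t: "t \<in> {0..t1}"
      show "((\<lambda>s. D (w s)) has_vector_derivative q t) (at t within {0..t1})"
        unfolding D_w by (rule has_vector_derivative_within_subset[OF dp[OF t]]) auto
      have "- c (\<epsilon> * t) *\<^sub>R p t = - (c (\<epsilon> * t))\<^sup>2 *\<^sub>R w t"
        using p_eq[of t] t by (simp add: power2_eq_square)
      then show "((\<lambda>s. D (q s)) has_vector_derivative
          - (c (\<epsilon> * t))\<^sup>2 *\<^sub>R w t + a (\<epsilon> * t) *\<^sub>R D (tri.cube (w t))) (at t within {0..t1})"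
        using has_vector_derivative_within_subset[OF dq[OF t], of "{0..t1}"] unfolding w_def by auto
    qed (rule init)
    moreover have "adiabatic_invariant Q c \<epsilon> (\<lambda>t. synth (D (w t))) (\<lambda>t. synth (q t)) t = sw.invariant \<epsilon> p q t" if "t \<ge> 0" for t
      using p_eq[OF that] c_pos[OF that]
      by (simp add: adiabatic_invariant_synth sw.invariant_def power_mult_distrib add.commute)
    ultimately show "\<exists>u v. wave_solution Q c a \<epsilon> t1 u0 v0 u v \<and>
        (\<forall>t\<in>{0..t1}. \<bar>adiabatic_invariant Q c \<epsilon> u v t - adiabatic_invariant Q c \<epsilon> u v 0\<bar> \<le> C * \<epsilon> ^ 3 + C' * t * \<epsilon> ^ 5)"
      using inv by (intro exI[of _ "\<lambda>t. synth (D (w t))"] exI[of _ "\<lambda>t. synth (q t)"]) auto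
  qed
qed

end

section \<open>The estimate on the stated time scale\<close>

lemma smooth_bounded_halfline_derivs:
  assumes "smooth_bounded_halfline f"
  obtains f1 f2 f3 where
    "\<And>\<tau>. \<tau> \<ge> 0 \<Longrightarrow> (f has_real_derivative f1 \<tau>) (at \<tau> within {0..})"
    "\<And>\<tau>. \<tau> \<ge> 0 \<Longrightarrow> (f1 has_real_derivative f2 \<tau>) (at \<tau> within {0..})"
    "\<And>\<tau>. \<tau> \<ge> 0 \<Longrightarrow> (f2 has_real_derivative f3 \<tau>) (at \<tau> within {0..})"
    "bounded (f ` {0..})" "bounded (f1 ` {0..})" "bounded (f2 ` {0..})" "bounded (f3 ` {0..})"
proof -
  obtain D where D0: "\<And>\<tau>. \<tau> \<ge> 0 \<Longrightarrow> D 0 \<tau> = f \<tau>"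
    and D: "\<And>k \<tau>. \<tau> \<ge> 0 \<Longrightarrow> (D k has_real_derivative D (Suc k) \<tau>) (at \<tau> within {0..})"
    and B: "\<And>k. bounded (D k ` {0::real..})"
    using assms unfolding smooth_bounded_halfline_def by blast
  show thesis
  proof (rule that[of "D (Suc 0)" "D (Suc (Suc 0))" "D (Suc (Suc (Suc 0)))"])
    show "(f has_real_derivative D (Suc 0) \<tau>) (at \<tau> within {0..})" if "\<tau> \<ge> 0" for \<tau>
      by (rule has_field_derivative_transform_within[OF D[OF that, of 0] zero_less_one]) (use that in \<open>auto simp: D0\<close>)
    have "f ` {0..} = D 0 ` {0..}"
      using D0 by (auto simp: image_iff)
    then show "bounded (f ` {0..})"
      using B by simp
  qed (use D B in auto)
qed

theorem theorem2:
  fixes l :: "real^'n" and c a :: "real \<Rightarrow> real" and c0 C0 :: real and N :: nat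
  assumes "CARD('n) = 2 \<or> CARD('n) = 3"
    and "\<And>i. l $ i > 0"
    and "smooth_bounded_halfline c" and "smooth_bounded_halfline a"
    and "c0 > 0" and "\<And>\<tau>. \<tau> \<ge> 0 \<Longrightarrow> c \<tau> \<ge> c0"
    and "N \<ge> 1"
  shows "\<exists>\<epsilon>\<^sub>N>0. \<exists>\<kappa>\<^sub>N>0. \<exists>C\<^sub>N C\<^sub>N'. \<forall>\<epsilon>. 0 < \<epsilon> \<and> \<epsilon> \<le> \<epsilon>\<^sub>N \<longrightarrow>
    (\<forall>u0\<in>H10_space (box 0 l). \<forall>v0\<in>L2_space (box 0 l).
       L2_norm (box 0 l) (weak_grad (box 0 l) u0) \<le> C0 * \<epsilon> \<and>
       L2_norm (box 0 l) v0 \<le> C0 * \<epsilon> \<longrightarrow>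
       (\<exists>u v. wave_solution (box 0 l) c a \<epsilon> (\<kappa>\<^sub>N * \<epsilon> powr (-3 + 1 / real N)) u0 v0 u v \<and>
          (\<forall>t. 0 \<le> t \<and> t \<le> \<kappa>\<^sub>N * \<epsilon> powr (-3 + 1 / real N) \<longrightarrow>
             \<bar>adiabatic_invariant (box 0 l) c \<epsilon> u v t - adiabatic_invariant (box 0 l) c \<epsilon> u v 0\<bar>
               \<le> C\<^sub>N * \<epsilon> ^ 3 + C\<^sub>N' * t * \<epsilon> powr (5 - 1 / real N))))"
proof -
  interpret box_domain l
    by unfold_locales (rule assms(2))
  obtain K where K: "K \<ge> 0" "\<And>\<phi>. \<phi> \<in> test_functions Q \<Longrightarrow> L2_norm Q (\<lambda>x. \<phi> x ^ 3) \<le> K * L2_norm Q (grad \<phi>) ^ 3"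
    using sobolev_test[OF assms(1)] by blast
  interpret sobolev_box l K
    by unfold_locales (use K in auto)
  obtain c1 c2 c3 where c: "\<And>\<tau>. \<tau> \<ge> 0 \<Longrightarrow> (c has_real_derivative c1 \<tau>) (at \<tau> within {0..})"
    "\<And>\<tau>. \<tau> \<ge> 0 \<Longrightarrow> (c1 has_real_derivative c2 \<tau>) (at \<tau> within {0..})"
    "\<And>\<tau>. \<tau> \<ge> 0 \<Longrightarrow> (c2 has_real_derivative c3 \<tau>) (at \<tau> within {0..})"
    "bounded (c ` {0..})" "bounded (c1 ` {0..})" "bounded (c2 ` {0..})" "bounded (c3 ` {0..})"
    by (rule smooth_bounded_halfline_derivs[OF assms(3)]) (rule that; assumption)
  obtain a1 a2 a3 where a: "\<And>\<tau>. \<tau> \<ge> 0 \<Longrightarrow> (a has_real_derivative a1 \<tau>) (at \<tau> within {0..})"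
    "\<And>\<tau>. \<tau> \<ge> 0 \<Longrightarrow> (a1 has_real_derivative a2 \<tau>) (at \<tau> within {0..})"
    "\<And>\<tau>. \<tau> \<ge> 0 \<Longrightarrow> (a2 has_real_derivative a3 \<tau>) (at \<tau> within {0..})"
    "bounded (a ` {0..})" "bounded (a1 ` {0..})" "bounded (a2 ` {0..})" "bounded (a3 ` {0..})"
    by (rule smooth_bounded_halfline_derivs[OF assms(4)]) (rule that; assumption)
  have "slow_wave \<omega> \<omega>0 K T c c1 c2 c3 a a1 c0"
    by unfold_locales (use c a assms(5,6) in auto)
  then obtain \<epsilon>0 \<kappa> C C' where pos: "\<epsilon>0 > 0" "\<kappa> > 0" "C \<ge> 0" "C' \<ge> 0" "\<epsilon>0 \<le> 1"
    and sol: "\<And>\<epsilon> u0 v0 t1. \<lbrakk>0 < \<epsilon>; \<epsilon> \<le> \<epsilon>0; u0 \<in> H10_space Q; v0 \<in> L2_space Q;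
        L2_norm Q (weak_grad Q u0) \<le> C0 * \<epsilon>; L2_norm Q v0 \<le> C0 * \<epsilon>; t1 * \<epsilon> ^ 3 \<le> \<kappa>\<rbrakk> \<Longrightarrow>
      \<exists>u v. wave_solution Q c a \<epsilon> t1 u0 v0 u v \<and>
        (\<forall>t\<in>{0..t1}. \<bar>adiabatic_invariant Q c \<epsilon> u v t - adiabatic_invariant Q c \<epsilon> u v 0\<bar> \<le> C * \<epsilon> ^ 3 + C' * t * \<epsilon> ^ 5)"
    by (rule long_time_solutions[where ?C0.0 = C0]) (rule that; assumption)
  \<comment> \<open>The requested time is shorter than the available one, of order - 3 in
    \<epsilon>, by the factor \<open>\<epsilon> powr (1 / real N)\<close>. One choice of constants
    therefore serves every \<open>N\<close>.\<close>
  have time: "\<kappa> * \<epsilon> powr (-3 + 1 / real N) * \<epsilon> ^ 3 \<le> \<kappa>" if "0 < \<epsilon>" "\<epsilon> \<le> \<epsilon>0" for \<epsilon>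
  proof -
    have "\<epsilon> powr (-3 + 1 / real N) * \<epsilon> ^ 3 = \<epsilon> powr (-3 + 1 / real N) * \<epsilon> powr 3"
      using powr_realpow[OF that(1), of 3] by simp
    also have "\<dots> = \<epsilon> powr (1 / real N)"
      unfolding powr_add[symmetric] by simp
    also have "\<dots> \<le> 1"
      using that pos(5) by (intro powr_le1) auto
    finally show ?thesis
      using pos(2) by (simp add: mult.assoc mult_left_le)
  qed
  \<comment> \<open>For \<epsilon> at most 1, lowering the exponent from 5 to
    \<open>5 - 1 / real N\<close> enlarges the bound.\<close>
  have weaker: "C * \<epsilon> ^ 3 + C' * t * \<epsilon> ^ 5 \<le> C * \<epsilon> ^ 3 + C' * t * \<epsilon> powr (5 - 1 / real N)"
    if "0 < \<epsilon>" "\<epsilon> \<le> \<epsilon>0" "t \<ge> 0" for \<epsilon> t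
  proof -
    have "\<epsilon> ^ 5 = \<epsilon> powr 5"
      using powr_realpow[OF that(1), of 5] by simp
    also have "\<dots> \<le> \<epsilon> powr (5 - 1 / real N)"
      using that pos(5) by (intro powr_mono') auto
    finally show ?thesis
      using that(3) pos(4) by (intro add_left_mono mult_left_mono) auto
  qed
  show ?thesis
  proof (rule exI[of _ \<epsilon>0], rule conjI[OF pos(1)], rule exI[of _ \<kappa>], rule conjI[OF pos(2)],
      rule exI[of _ C], rule exI[of _ C'], intro allI impI ballI, elim conjE)
    fix \<epsilon> :: real and u0 v0 :: "real^'n \<Rightarrow> real"
    assume \<epsilon>: "0 < \<epsilon>" "\<epsilon> \<le> \<epsilon>0" and data: "u0 \<in> H10_space Q" "v0 \<in> L2_space Q"
      "L2_norm Q (weak_grad Q u0) \<le> C0 * \<epsilon>" "L2_norm Q v0 \<le> C0 * \<epsilon>"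
    obtain u v where uv: "wave_solution Q c a \<epsilon> (\<kappa> * \<epsilon> powr (-3 + 1 / real N)) u0 v0 u v"
      "\<forall>t\<in>{0..\<kappa> * \<epsilon> powr (-3 + 1 / real N)}.
        \<bar>adiabatic_invariant Q c \<epsilon> u v t - adiabatic_invariant Q c \<epsilon> u v 0\<bar> \<le> C * \<epsilon> ^ 3 + C' * t * \<epsilon> ^ 5"
      using sol[OF \<epsilon> data time[OF \<epsilon>]] by (elim exE conjE) (rule that)
    show "\<exists>u v. wave_solution Q c a \<epsilon> (\<kappa> * \<epsilon> powr (-3 + 1 / real N)) u0 v0 u v \<and>
        (\<forall>t. 0 \<le> t \<and> t \<le> \<kappa> * \<epsilon> powr (-3 + 1 / real N) \<longrightarrow>
          \<bar>adiabatic_invariant Q c \<epsilon> u v t - adiabatic_invariant Q c \<epsilon> u v 0\<bar>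
            \<le> C * \<epsilon> ^ 3 + C' * t * \<epsilon> powr (5 - 1 / real N))"
    proof (rule exI[of _ u], rule exI[of _ v], intro conjI allI impI uv(1))
      fix t assume t: "0 \<le> t \<and> t \<le> \<kappa> * \<epsilon> powr (-3 + 1 / real N)"
      then have "\<bar>adiabatic_invariant Q c \<epsilon> u v t - adiabatic_invariant Q c \<epsilon> u v 0\<bar> \<le> C * \<epsilon> ^ 3 + C' * t * \<epsilon> ^ 5"
        by (intro bspec[OF uv(2)]) auto
      also have "\<dots> \<le> C * \<epsilon> ^ 3 + C' * t * \<epsilon> powr (5 - 1 / real N)"
        using weaker[OF \<epsilon>, of t] t by simp
      finally show "\<bar>adiabatic_invariant Q c \<epsilon> u v t - adiabatic_invariant Q c \<epsilon> u v 0\<bar>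
            \<le> C * \<epsilon> ^ 3 + C' * t * \<epsilon> powr (5 - 1 / real N)" .
    qed
  qed
qed

end
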